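(* Let $\beta>0$ and suppose: (1) for every $N\in\mathbb N$ and $x_1,\dots,x_N\in\mathbb R^d$, $\mu\mapsto c(\mu,\rho)$ is continuous on $\mathcal P(\{x_1,\dots,x_N\})$ uniformly in $\rho\in\mathbb H$; (2) for every $x\in\mathbb R^d$, the set $\{\rho(x)-\rho(0):\rho\in\mathbb H\}$ is a bounded subset of $\mathbb R$. Let $u,w\in C(\mathcal P_p)$ be, respectively, a viscosity subsolution and a viscosity supersolution of $\beta u(\mu)+\sup_{\rho\in\mathbb H}\{-c(\mu,\rho)-Lu(\mu,\rho)\}=0$, $\mu\in\mathcal P_p$, for some $q\in[1,p]\cup\{0\}$. Then $u\le w$ on $\mathcal P_p$.
   Context: Fix $d\in\mathbb N$. $\mathcal P$: Borel probability measures on $\mathbb R^d$ (weak topology); for $r\in[1,\infty)$, $\mathcal P_r$: those with finite $r$-th moment, with Wasserstein-$r$ metric; $\mathcal P_0:=\mathcal P$; $|x|^0:=1$; $\mathcal P(\{x_1,\dots,x_N\})$ denotes probability measures supported in $\{x_1,\dots,x_N\}$; $\mu(\varphi)=\int\varphi\,d\mu$. Fix $p\in[1,\infty)\cup\{0\}$, a Polish space $\mathbb H$ of measurable real functions on $\mathbb R^d$, a measurable $c:\mathcal P_p\times\mathbb H\to\mathbb R\cup\{+\infty\}$ and $\beta\ge0$. $C^2(\mathcal P_q)$: functions $f:\mathcal P_q\to\mathbb R$ with continuous $\frac{\partial f}{\partial\mu}$ on $\mathbb R^d\times\mathcal P_q$ and continuous $\frac{\partial^2 f}{\partial\mu^2}$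 on $\mathbb R^d\times\mathbb R^d\times\mathcal P_q$ (symmetric in $x,y$), with $|\frac{\partial f}{\partial\mu}(x,\mu)|\le c_K(1+|x|^q)$, $|\frac{\partial^2 f}{\partial\mu^2}(x,y,\mu)|\le c_K(1+|x|^q+|y|^q)$ for $\mu$ in any compact $K\subset\mathcal P_q$, and for all $\mu,\nu\in\mathcal P_q$: $f(\nu)-f(\mu)=\int_0^1\int\frac{\partial f}{\partial\mu}(x,t\nu+(1-t)\mu)(\nu-\mu)(dx)dt$, $f(\nu)-f(\mu)-\int\frac{\partial f}{\partial\mu}(x,\mu)(\nu-\mu)(dx)=\int_0^1\int_0^t\iint\frac{\partial^2f}{\partial\mu^2}(x,y,s\nu+(1-s)\mu)(\nu-\mu)^{\otimes2}(dx,dy)ds\,dt$. For $\mu\in\mathcal P_p$, $\rho\in\mathbb H$: $Lf(\mu,\rho)=\frac12\iint\frac{\partial^2f}{\partial\mu^2}(x,y,\mu)\sigma(dx)\sigma(dy)$, $\sigma(dx)=(\rho(x)-\mu(\rho))\mu(dx)$, when $\rho\in L^1(\mu)$ and the integrand lies in $L^1(|\sigma|\otimes|\sigma|)$, else $+\infty$. $H(\mu;f)=\beta f(\mu)+\sup_{\rho\in\mathbb H}\{-c(\mu,\rho)-Lf(\mu,\rho)\}$. $\mu\preceq\nu$ iff $\operatorname{supp}\mu\subseteq\operatorname{supp}\nu$; $D_{\bar\mu}=\{\mu\in\mathcal P_p:\mu\preceq\bar\mu\}$; limits in $\mathcal P_p$. $u:\mathcal P_p\to\overline{\mathbb R}$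 is a viscosity subsolution if $\liminf_{\mu\to\bar\mu,\mu\preceq\bar\mu}H(\mu;f)\le0$ for all $\bar\mu\in\mathcal P_p$, $f\in C^2(\mathcal P_q)$ with $f(\bar\mu)=\limsup_{\mu\to\bar\mu,\mu\preceq\bar\mu}u(\mu)$ and $f\ge u$ on $D_{\bar\mu}$; a viscosity supersolution if $\limsup_{\mu\to\bar\mu,\mu\preceq\bar\mu}H(\mu;f)\ge0$ for all $\bar\mu$, $f$ with $f(\bar\mu)=\liminf_{\mu\to\bar\mu,\mu\preceq\bar\mu}u(\mu)$ and $f\le u$ on $D_{\bar\mu}$. *)

theory Defs
  imports "HOL-Probability.Probability"
begin

definition Prob :: "'a::euclidean_space measure set" where
  "Prob = {\<mu>. prob_space \<mu> \<and> sets \<mu> = sets borel}"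

text \<open>The convention |x|^0 = 1 (note: in Isabelle 0 powr 0 = 0, so we make it explicit).\<close>
definition pw :: "'a::euclidean_space \<Rightarrow> real \<Rightarrow> real" where
  "pw x r = (if r = 0 then 1 else norm x powr r)"

definition Pp :: "real \<Rightarrow> 'a::euclidean_space measure set" where
  "Pp r = {\<mu>\<in>Prob. r = 0 \<or> (\<integral>\<^sup>+ x. ennreal (norm x powr r) \<partial>\<mu>) < \<infinity>}"

definition couplings :: "'a::euclidean_space measure \<Rightarrow> 'a measure \<Rightarrow> ('a \<times> 'a) measure set" where
  "couplings \<mu> \<nu> = {\<pi>. prob_space \<pi> \<and> sets \<pi> = sets (borel \<Otimes>\<^sub>M borel)
      \<and> distr \<pi> borel fst = \<mu> \<and> distr \<pi> borel snd = \<nu>}"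

definition Wass :: "real \<Rightarrow> 'a::euclidean_space measure \<Rightarrow> 'a measure \<Rightarrow> real" where
  "Wass r \<mu> \<nu> = enn2real (INF \<pi>\<in>couplings \<mu> \<nu>. \<integral>\<^sup>+ z. ennreal (dist (fst z) (snd z) powr r) \<partial>\<pi>)
                  powr (1 / r)"

definition convP :: "real \<Rightarrow> (nat \<Rightarrow> 'a::euclidean_space measure) \<Rightarrow> 'a measure \<Rightarrow> bool" where
  "convP p \<mu>s \<mu> \<longleftrightarrow>
     (if p = 0 then
        (\<forall>f::'a \<Rightarrow> real. continuous_on UNIV f \<and> bounded (range f) \<longrightarrow>
            (\<lambda>n. \<integral>x. f x \<partial>(\<mu>s n)) \<longlonglongrightarrow> (\<integral>x. f x \<partial>\<mu>))
      else (\<lambda>n. Wass p (\<mu>s n) \<mu>) \<longlonglongrightarrow> 0)"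

text \<open>The topology of P_p (both topologies are metrizable, so they are determined by
  their convergent sequences: open = sequentially open).\<close>
definition TP :: "real \<Rightarrow> 'a::euclidean_space measure topology" where
  "TP p = topology (\<lambda>U. U \<subseteq> Pp p \<and>
      (\<forall>\<mu>s \<mu>. \<mu> \<in> U \<and> range \<mu>s \<subseteq> Pp p \<and> convP p \<mu>s \<mu> \<longrightarrow> (\<forall>\<^sub>F n in sequentially. \<mu>s n \<in> U)))"

definition borel_of :: "'b topology \<Rightarrow> 'b measure" where
  "borel_of T = sigma (topspace T) {U. openin T U}"

definition Polish :: "'b topology \<Rightarrow> bool" where
  "Polish T \<longleftrightarrow> completely_metrizable_space T \<and> separable_space T"

definition supp :: "'a::euclidean_space measure \<Rightarrow> 'a set" where
  "supp \<mu> = {x. \<forall>e>0. emeasure \<mu> (ball x e) > 0}"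

definition Dset :: "real \<Rightarrow> 'a::euclidean_space measure \<Rightarrow> 'a measure set" where
  "Dset p \<mu>b = {\<mu>\<in>Pp p. supp \<mu> \<subseteq> supp \<mu>b}"

definition ulimsup :: "real \<Rightarrow> 'a::euclidean_space measure set \<Rightarrow> ('a measure \<Rightarrow> ereal) \<Rightarrow> 'a measure \<Rightarrow> ereal" where
  "ulimsup p D g \<mu>b = (INF U\<in>{U. openin (TP p) U \<and> \<mu>b \<in> U}. SUP \<mu>\<in>U \<inter> D. g \<mu>)"

definition uliminf :: "real \<Rightarrow> 'a::euclidean_space measure set \<Rightarrow> ('a measure \<Rightarrow> ereal) \<Rightarrow> 'a measure \<Rightarrow> ereal" where
  "uliminf p D g \<mu>b = (SUP U\<in>{U. openin (TP p) U \<and> \<mu>b \<in> U}. INF \<mu>\<in>U \<inter> D. g \<mu>)"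

definition mixm :: "real \<Rightarrow> 'a::euclidean_space measure \<Rightarrow> 'a measure \<Rightarrow> 'a measure" where
  "mixm t \<nu> \<mu> = measure_of UNIV (sets borel)
      (\<lambda>A. ennreal t * emeasure \<nu> A + ennreal (1 - t) * emeasure \<mu> A)"

definition sint :: "'a::euclidean_space measure \<Rightarrow> 'a measure \<Rightarrow> ('a \<Rightarrow> real) \<Rightarrow> real" where
  "sint \<mu> \<nu> \<phi> = (\<integral>x. \<phi> x \<partial>\<nu>) - (\<integral>x. \<phi> x \<partial>\<mu>)"

text \<open>C2 q f Df D2f: f is in C^2(P_q) with first and second linear functional
  derivatives Df and D2f.\<close>
definition C2 :: "real \<Rightarrow> ('a::euclidean_space measure \<Rightarrow> real) \<Rightarrow> ('a \<Rightarrow> 'a measure \<Rightarrow> real)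
    \<Rightarrow> ('a \<Rightarrow> 'a \<Rightarrow> 'a measure \<Rightarrow> real) \<Rightarrow> bool" where
  "C2 q f Df D2f \<longleftrightarrow>
     continuous_map (prod_topology euclidean (TP q)) euclideanreal (\<lambda>(x, \<mu>). Df x \<mu>) \<and>
     continuous_map (prod_topology (prod_topology euclidean euclidean) (TP q)) euclideanreal
        (\<lambda>((x, y), \<mu>). D2f x y \<mu>) \<and>
     (\<forall>\<mu>\<in>Pp q. \<forall>x y. D2f x y \<mu> = D2f y x \<mu>) \<and>
     (\<forall>K. compactin (TP q) K \<longrightarrow>
        (\<exists>C. \<forall>\<mu>\<in>K. \<forall>x. \<bar>Df x \<mu>\<bar> \<le> C * (1 + pw x q)) \<and>
        (\<exists>C. \<forall>\<mu>\<in>K. \<forall>x y. \<bar>D2f x y \<mu>\<bar> \<le> C * (1 + pw x q + pw y q))) \<and>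
     (\<forall>\<mu>\<in>Pp q. \<forall>\<nu>\<in>Pp q.
        f \<nu> - f \<mu> = integral {0..1} (\<lambda>t. sint \<mu> \<nu> (\<lambda>x. Df x (mixm t \<nu> \<mu>))) \<and>
        f \<nu> - f \<mu> - sint \<mu> \<nu> (\<lambda>x. Df x \<mu>) =
          integral {0..1} (\<lambda>t. integral {0..t} (\<lambda>s.
             sint \<mu> \<nu> (\<lambda>x. sint \<mu> \<nu> (\<lambda>y. D2f x y (mixm s \<nu> \<mu>))))))"

text \<open>Lf(mu, rho), with sigma(dx) = (rho x - mu(rho)) mu(dx); +\<infinity> if not well defined.\<close>
definition Lop :: "('a::euclidean_space \<Rightarrow> 'a \<Rightarrow> 'a measure \<Rightarrow> real) \<Rightarrow> 'a measure \<Rightarrow> ('a \<Rightarrow> real) \<Rightarrow> ereal" where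
  "Lop D2f \<mu> \<rho> =
     (let m = (\<integral>x. \<rho> x \<partial>\<mu>);
          g = (\<lambda>(x, y). D2f x y \<mu> * (\<rho> x - m) * (\<rho> y - m))
      in if integrable \<mu> \<rho> \<and> integrable (\<mu> \<Otimes>\<^sub>M \<mu>) g
         then ereal (1 / 2 * (\<integral>z. g z \<partial>(\<mu> \<Otimes>\<^sub>M \<mu>))) else \<infinity>)"

definition Ham :: "('a::euclidean_space measure \<Rightarrow> ('a \<Rightarrow> real) \<Rightarrow> ereal) \<Rightarrow> ('a \<Rightarrow> real) set \<Rightarrow> real
    \<Rightarrow> ('a measure \<Rightarrow> real) \<Rightarrow> ('a \<Rightarrow> 'a \<Rightarrow> 'a measure \<Rightarrow> real) \<Rightarrow> 'a measure \<Rightarrow> ereal" where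
  "Ham c Hs \<beta> f D2f \<mu> = ereal (\<beta> * f \<mu>) + (SUP \<rho>\<in>Hs. - c \<mu> \<rho> - Lop D2f \<mu> \<rho>)"

definition visc_sub :: "real \<Rightarrow> real \<Rightarrow> ('a::euclidean_space measure \<Rightarrow> ('a \<Rightarrow> real) \<Rightarrow> ereal)
    \<Rightarrow> ('a \<Rightarrow> real) set \<Rightarrow> real \<Rightarrow> ('a measure \<Rightarrow> ereal) \<Rightarrow> bool" where
  "visc_sub p q c Hs \<beta> u \<longleftrightarrow>
     (\<forall>\<mu>b\<in>Pp p. \<forall>f Df D2f.
        C2 q f Df D2f \<and> ereal (f \<mu>b) = ulimsup p (Dset p \<mu>b) u \<mu>b \<and>
        (\<forall>\<mu>\<in>Dset p \<mu>b. u \<mu> \<le> ereal (f \<mu>))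
        \<longrightarrow> uliminf p (Dset p \<mu>b) (Ham c Hs \<beta> f D2f) \<mu>b \<le> 0)"

definition visc_super :: "real \<Rightarrow> real \<Rightarrow> ('a::euclidean_space measure \<Rightarrow> ('a \<Rightarrow> real) \<Rightarrow> ereal)
    \<Rightarrow> ('a \<Rightarrow> real) set \<Rightarrow> real \<Rightarrow> ('a measure \<Rightarrow> ereal) \<Rightarrow> bool" where
  "visc_super p q c Hs \<beta> u \<longleftrightarrow>
     (\<forall>\<mu>b\<in>Pp p. \<forall>f Df D2f.
        C2 q f Df D2f \<and> ereal (f \<mu>b) = uliminf p (Dset p \<mu>b) u \<mu>b \<and>
        (\<forall>\<mu>\<in>Dset p \<mu>b. ereal (f \<mu>) \<le> u \<mu>)
        \<longrightarrow> ulimsup p (Dset p \<mu>b) (Ham c Hs \<beta> f D2f) \<mu>b \<ge> 0)"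

definition PX :: "'a::euclidean_space set \<Rightarrow> 'a measure set" where
  "PX X = {\<mu>\<in>Prob. emeasure \<mu> (UNIV - X) = 0}"

end

theory Submission
  imports Defs "HOL-Library.Function_Algebras" "HOL-Real_Asymp.Real_Asymp"
begin

text \<open>
  Finitely supported measures are dense in every \<open>P_p\<close>, so it is enough to compare u and w on the
  simplex over a finite set X. Maximise u - w there and shrink X to the support of the maximiser,
  which then is an interior point. Write the weights as \<open>m i = exp (z i) / N z\<close> with \<open>N z\<close> the sum
  of the \<open>exp (z i)\<close>, and replace u by its lift \<open>U z = N z * u m\<close>. In these coordinates the operator
  \<open>L(\<cdot>, \<rho>)\<close> acts on U with constant coefficients: it is the generator A of a random walk with step
  \<open>\<plusminus> h * \<rho> - h\<^sup>2 * \<rho>\<^sup>2 / 2\<close>, and A N = 0. The maximum principle, applied step by step along the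
  walk, turns the viscosity inequality \<open>A U \<ge> - K * N\<close> into a mean value inequality, which survives
  translation invariant averaging; hence mollified lifts are classical subsolutions, with N only
  multiplied by a constant. A smooth function touching w from below near the maximiser then gives
  the comparison directly, and no Crandall-Ishii lemma is needed.
\<close>

section \<open>Uniformly differentiable functions of finitely many coordinates\<close>

text \<open>Functions on the type of all maps are compared only through the coordinates in the finite set
  X; the norm and the filter below see just these, so no topology on the function type is involved.\<close>

definition l1_norm :: "'i set \<Rightarrow> ('i \<Rightarrow> real) \<Rightarrow> real" where
  "l1_norm X \<zeta> = (\<Sum>i\<in>X. \<bar>\<zeta> i\<bar>)"

definition at_origin :: "'i set \<Rightarrow> ('i \<Rightarrow> real) filter" where
  "at_origin X = filtercomap (l1_norm X) (nhds 0)"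

definition coord_vec :: "'i \<Rightarrow> real \<Rightarrow> 'i \<Rightarrow> real" where
  "coord_vec i s = (\<lambda>j. if j = i then s else 0)"

definition lin_form :: "'i set \<Rightarrow> ('i \<Rightarrow> real) \<Rightarrow> ('i \<Rightarrow> real) \<Rightarrow> real" where
  "lin_form X p x = (\<Sum>i\<in>X. x i * p i)"

definition quad_form :: "'i set \<Rightarrow> ('i \<Rightarrow> 'i \<Rightarrow> real) \<Rightarrow> ('i \<Rightarrow> real) \<Rightarrow> real" where
  "quad_form X Q x = (\<Sum>i\<in>X. \<Sum>j\<in>X. x i * x j * Q i j)"

definition bdd_ucont :: "'i set \<Rightarrow> (('i \<Rightarrow> real) \<Rightarrow> real) \<Rightarrow> bool" where
  "bdd_ucont X F \<longleftrightarrow> bounded (range F) \<and> uniform_limit UNIV (\<lambda>\<zeta> z. F (z + \<zeta>)) F (at_origin X)"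

text \<open>Differentiability is uniform in the base point and restricted to increments in the directions
  I: a Steklov average in direction i adds i to this set.\<close>

definition unif_diff ::
    "'i set \<Rightarrow> 'i set \<Rightarrow> (('i \<Rightarrow> real) \<Rightarrow> real) \<Rightarrow> ('i \<Rightarrow> ('i \<Rightarrow> real) \<Rightarrow> real) \<Rightarrow> bool" where
  "unif_diff X I F G \<longleftrightarrow> (\<forall>e>0. \<forall>\<^sub>F \<zeta> in at_origin X. (\<forall>i\<in>X - I. \<zeta> i = 0) \<longrightarrow>
     (\<forall>z. \<bar>F (z + \<zeta>) - F z - lin_form I (\<lambda>i. G i z) \<zeta>\<bar> \<le> e * l1_norm X \<zeta>))"

primrec Ck :: "'i set \<Rightarrow> nat \<Rightarrow> (('i \<Rightarrow> real) \<Rightarrow> real) \<Rightarrow> bool" where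
  "Ck X 0 F = bdd_ucont X F"
| "Ck X (Suc k) F = (bdd_ucont X F \<and> (\<exists>G. unif_diff X X F G \<and> (\<forall>i\<in>X. Ck X k (G i))))"

definition unif_C2 :: "'i set \<Rightarrow> (('i \<Rightarrow> real) \<Rightarrow> real) \<Rightarrow> ('i \<Rightarrow> ('i \<Rightarrow> real) \<Rightarrow> real) \<Rightarrow>
    ('i \<Rightarrow> 'i \<Rightarrow> ('i \<Rightarrow> real) \<Rightarrow> real) \<Rightarrow> bool" where
  "unif_C2 X F G H \<longleftrightarrow> bdd_ucont X F \<and> unif_diff X X F G \<and>
     (\<forall>i\<in>X. bdd_ucont X (G i) \<and> unif_diff X X (G i) (H i) \<and> (\<forall>j\<in>X. bdd_ucont X (H i j)))"

lemma l1_norm_nonneg [simp]: "0 \<le> l1_norm X \<zeta>"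
  by (simp add: l1_norm_def sum_nonneg)

lemma abs_le_l1_norm: "finite X \<Longrightarrow> i \<in> X \<Longrightarrow> \<bar>\<zeta> i\<bar> \<le> l1_norm X \<zeta>"
  unfolding l1_norm_def by (rule member_le_sum) auto

lemma l1_norm_scale: "l1_norm X (\<lambda>i. t * \<zeta> i) = \<bar>t\<bar> * l1_norm X \<zeta>"
  by (simp add: l1_norm_def abs_mult sum_distrib_left)

lemma l1_norm_coord_vec: "finite X \<Longrightarrow> i \<in> X \<Longrightarrow> l1_norm X (coord_vec i s) = \<bar>s\<bar>"
  by (simp add: l1_norm_def coord_vec_def if_distrib[of abs] cong: if_cong)

lemma l1_norm_split: "finite X \<Longrightarrow> i \<in> X \<Longrightarrow> l1_norm X \<zeta> = \<bar>\<zeta> i\<bar> + l1_norm X (\<zeta>(i := 0))"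
  by (simp add: l1_norm_def sum.remove[of X i])

lemma l1_norm_le_card: "finite X \<Longrightarrow> (\<And>i. i \<in> X \<Longrightarrow> \<bar>\<zeta> i\<bar> \<le> r) \<Longrightarrow> l1_norm X \<zeta> \<le> real (card X) * r"
  unfolding l1_norm_def using sum_bounded_above[of X "\<lambda>i. \<bar>\<zeta> i\<bar>" r] by simp

lemma coord_vec_add: "coord_vec i s + coord_vec i t = coord_vec i (s + t)"
  by (auto simp: coord_vec_def)

lemma coord_vec_0 [simp]: "coord_vec i 0 = 0"
  by (auto simp: coord_vec_def)

lemma lin_form_lincomb: "lin_form X (\<lambda>i. a * p i + b * q i) x
    = a * lin_form X p x + b * lin_form X q x"
  unfolding lin_form_def sum_distrib_left sum.distrib[symmetric]
  by (rule sum.cong) (simp_all add: algebra_simps)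

lemma lin_form_scale: "lin_form X p (\<lambda>i. t * x i) = t * lin_form X p x"
  by (simp add: lin_form_def sum_distrib_left mult.assoc)

lemma abs_lin_form_le:
  assumes "\<And>i. i \<in> X \<Longrightarrow> \<bar>p i\<bar> \<le> B"
  shows "\<bar>lin_form X p x\<bar> \<le> B * l1_norm X x"
proof -
  have "\<bar>lin_form X p x\<bar> \<le> (\<Sum>i\<in>X. \<bar>x i\<bar> * B)"
    unfolding lin_form_def using assms
    by (intro order_trans[OF sum_abs] sum_mono) (simp add: abs_mult mult_left_mono)
  then show ?thesis by (simp add: l1_norm_def sum_distrib_left mult.commute)
qed

lemma quad_form_eq_lin_form: "quad_form X Q x = lin_form X (\<lambda>i. lin_form X (Q i) x) x"
  by (simp add: quad_form_def lin_form_def sum_distrib_left mult.assoc)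

lemma quad_form_lincomb:
  "quad_form X (\<lambda>i j. a * P i j + b * Q i j) x = a * quad_form X P x + b * quad_form X Q x"
  by (simp add: quad_form_eq_lin_form lin_form_lincomb)

lemma quad_form_diag: "finite X \<Longrightarrow>
    quad_form X (\<lambda>i j. if i = j then b i else 0) x = lin_form X b (\<lambda>i. (x i)\<^sup>2)"
  by (simp add: quad_form_def lin_form_def if_distrib[of "\<lambda>y. _ * y"] power2_eq_square
      cong: if_cong)

lemma eventually_at_origin:
  "eventually P (at_origin X) \<longleftrightarrow> (\<exists>d>0. \<forall>\<zeta>. l1_norm X \<zeta> < d \<longrightarrow> P \<zeta>)"
proof
  assume "eventually P (at_origin X)"
  then obtain Q where Q: "eventually Q (nhds (0::real))" "\<And>\<zeta>. Q (l1_norm X \<zeta>) \<Longrightarrow> P \<zeta>"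
    unfolding at_origin_def eventually_filtercomap by blast
  then obtain d where "d > 0" "\<And>x. dist x 0 < d \<Longrightarrow> Q x" unfolding eventually_nhds_metric by blast
  then show "\<exists>d>0. \<forall>\<zeta>. l1_norm X \<zeta> < d \<longrightarrow> P \<zeta>" using Q(2) by (auto simp: dist_real_def)
next
  assume "\<exists>d>0. \<forall>\<zeta>. l1_norm X \<zeta> < d \<longrightarrow> P \<zeta>"
  then obtain d where d: "d > 0" "\<And>\<zeta>. l1_norm X \<zeta> < d \<Longrightarrow> P \<zeta>" by blast
  have "eventually (\<lambda>x. x < d) (nhds (0::real))"
    using d(1) by (rule eventually_nhds_in_open[of "{..<d}", simplified])
  then show "eventually P (at_origin X)"
    unfolding at_origin_def eventually_filtercomap using d(2) by blast
qed

lemma filterlim_at_origin: "filterlim f (at_origin X) F \<longleftrightarrow> ((\<lambda>x. l1_norm X (f x)) \<longlongrightarrow> 0) F"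
  unfolding at_origin_def filterlim_filtercomap_iff by (simp add: o_def)

lemma l1_norm_tendsto_at_origin: "(l1_norm X \<longlongrightarrow> 0) (at_origin X)"
  unfolding at_origin_def by (rule filterlim_filtercomap)

lemma coord_tendsto_at_origin: "finite X \<Longrightarrow> i \<in> X \<Longrightarrow> ((\<lambda>\<zeta>. \<zeta> i) \<longlongrightarrow> 0) (at_origin X)"
  by (rule Lim_null_comparison[OF _ l1_norm_tendsto_at_origin]) (simp add: abs_le_l1_norm)

lemma coord_bigo_at_origin: "finite X \<Longrightarrow> i \<in> X \<Longrightarrow> (\<lambda>\<zeta>. \<zeta> i) \<in> O[at_origin X](l1_norm X)"
  by (rule bigoI[of _ 1]) (simp add: abs_le_l1_norm)

subsection \<open>Bounded uniformly continuous functions\<close>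

lemma bdd_ucont_bound: "bdd_ucont X F \<Longrightarrow> \<exists>B>0. \<forall>z. \<bar>F z\<bar> \<le> B"
  unfolding bdd_ucont_def bounded_pos by auto

lemma bdd_ucont_eventually:
  assumes "bdd_ucont X F" "0 < e"
  shows "\<forall>\<^sub>F \<zeta> in at_origin X. \<forall>z. \<bar>F (z + \<zeta>) - F z\<bar> \<le> e"
proof -
  have "\<forall>\<^sub>F \<zeta> in at_origin X. \<forall>z. dist (F (z + \<zeta>)) (F z) < e"
    using assms by (simp add: bdd_ucont_def uniform_limit_iff)
  then show ?thesis by (rule eventually_mono) (simp add: dist_real_def less_imp_le)
qed

lemma bdd_ucont_modulus:
  assumes "bdd_ucont X F" "0 < e"
  obtains d where "d > 0" "\<And>z \<zeta>. l1_norm X \<zeta> < d \<Longrightarrow> \<bar>F (z + \<zeta>) - F z\<bar> \<le> e"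
  using bdd_ucont_eventually[OF assms] unfolding eventually_at_origin by blast

lemma bdd_ucontI:
  assumes "\<And>z. \<bar>F z\<bar> \<le> B" "\<And>e. 0 < e \<Longrightarrow> \<forall>\<^sub>F \<zeta> in at_origin X. \<forall>z. \<bar>F (z + \<zeta>) - F z\<bar> \<le> e"
  shows "bdd_ucont X F"
  unfolding bdd_ucont_def
proof
  show "bounded (range F)" using assms(1) by (auto simp: bounded_iff)
  show "uniform_limit UNIV (\<lambda>\<zeta> z. F (z + \<zeta>)) F (at_origin X)"
  proof (rule uniform_limitI)
    fix e :: real assume "0 < e"
    then have "\<forall>\<^sub>F \<zeta> in at_origin X. \<forall>z. \<bar>F (z + \<zeta>) - F z\<bar> \<le> e / 2" by (intro assms(2)) simp
    then show "\<forall>\<^sub>F \<zeta> in at_origin X. \<forall>z\<in>UNIV. dist (F (z + \<zeta>)) (F z) < e"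
    proof (rule eventually_mono, intro ballI)
      fix \<zeta> z assume "\<forall>z. \<bar>F (z + \<zeta>) - F z\<bar> \<le> e / 2"
      then have "\<bar>F (z + \<zeta>) - F z\<bar> \<le> e / 2" by blast
      then show "dist (F (z + \<zeta>)) (F z) < e" using \<open>0 < e\<close> unfolding dist_real_def by linarith
    qed
  qed
qed

lemma bdd_ucont_const [simp]: "bdd_ucont X (\<lambda>z. c)"
  by (rule bdd_ucontI[of _ "\<bar>c\<bar>"]) simp_all

lemma bdd_ucont_add: "bdd_ucont X F \<Longrightarrow> bdd_ucont X G \<Longrightarrow> bdd_ucont X (\<lambda>z. F z + G z)"
  unfolding bdd_ucont_def by (intro conjI bounded_plus_comp uniform_limit_add) auto

lemma bdd_ucont_scale: "bdd_ucont X F \<Longrightarrow> bdd_ucont X (\<lambda>z. a * F z)"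
  unfolding bdd_ucont_def
  using bounded_scaleR_comp[of F UNIV a]
    bounded_linear.uniform_limit[OF bounded_linear_mult_right, where l = F]
  by auto

lemma bdd_ucont_diff: "bdd_ucont X F \<Longrightarrow> bdd_ucont X G \<Longrightarrow> bdd_ucont X (\<lambda>z. F z - G z)"
  unfolding bdd_ucont_def by (intro conjI bounded_minus_comp uniform_limit_minus) auto

lemma bdd_ucont_sum: "(\<And>i. i \<in> I \<Longrightarrow> bdd_ucont X (F i)) \<Longrightarrow> bdd_ucont X (\<lambda>z. \<Sum>i\<in>I. F i z)"
  by (induction I rule: infinite_finite_induct) (auto intro: bdd_ucont_add)

lemma bdd_ucont_lin_form:
  "(\<And>i. i \<in> I \<Longrightarrow> bdd_ucont X (G i)) \<Longrightarrow> bdd_ucont X (\<lambda>z. lin_form I (\<lambda>i. G i z) x)"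
  unfolding lin_form_def by (intro bdd_ucont_sum bdd_ucont_scale)

lemma bdd_ucont_quad_form:
  "(\<And>i j. i \<in> I \<Longrightarrow> j \<in> I \<Longrightarrow> bdd_ucont X (H i j)) \<Longrightarrow> bdd_ucont X (\<lambda>z. quad_form I (\<lambda>i j. H i j z) x)"
  unfolding quad_form_def by (intro bdd_ucont_sum bdd_ucont_scale)

lemma bdd_ucont_translate:
  assumes "bdd_ucont X F"
  shows "bdd_ucont X (\<lambda>z. F (z + v))"
proof -
  obtain B where "\<And>z. \<bar>F z\<bar> \<le> B" using bdd_ucont_bound[OF assms] by blast
  then show ?thesis
  proof (rule bdd_ucontI)
    fix e :: real assume "0 < e"
    from bdd_ucont_eventually[OF assms this]
    show "\<forall>\<^sub>F \<zeta> in at_origin X. \<forall>z. \<bar>F (z + \<zeta> + v) - F (z + v)\<bar> \<le> e"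
      by (rule eventually_mono) (simp add: add.assoc add.commute[of _ v] flip: add.assoc)
  qed
qed

lemma bdd_ucont_cong:
  assumes "bdd_ucont X F" "\<And>i. i \<in> X \<Longrightarrow> z i = z' i"
  shows "F z = F z'"
proof -
  have "l1_norm X (z' - z) = 0" unfolding l1_norm_def using assms(2) by simp
  then have "\<bar>F (z + (z' - z)) - F z\<bar> \<le> 0 + e" if "0 < e" for e
    using bdd_ucont_modulus[OF assms(1) that] by (metis add_0)
  then show ?thesis using field_le_epsilon[of "\<bar>F (z + (z' - z)) - F z\<bar>" 0] by simp
qed

lemma bdd_ucont_modulus_line:
  assumes "finite X" "i \<in> X" "bdd_ucont X F" "0 < e"
  obtains d where "d > 0"
    "\<And>z s t. \<bar>s - t\<bar> < d \<Longrightarrow> \<bar>F (z + coord_vec i s) - F (z + coord_vec i t)\<bar> \<le> e"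
proof -
  obtain d where d: "d > 0" "\<And>z \<zeta>. l1_norm X \<zeta> < d \<Longrightarrow> \<bar>F (z + \<zeta>) - F z\<bar> \<le> e"
    using bdd_ucont_modulus[OF assms(3,4)] by blast
  have "\<bar>F (z + coord_vec i s) - F (z + coord_vec i t)\<bar> \<le> e" if "\<bar>s - t\<bar> < d" for z s t
    using d(2)[of "coord_vec i (s - t)" "z + coord_vec i t"] that assms(1,2)
    by (simp add: l1_norm_coord_vec add.assoc coord_vec_add)
  then show ?thesis using d(1) that by blast
qed

lemma bdd_ucont_continuous_on_line:
  assumes "finite X" "i \<in> X" "bdd_ucont X F"
  shows "continuous_on A (\<lambda>s. F (z + coord_vec i s))"
  unfolding continuous_on_iff
proof (intro ballI allI impI)
  fix s e :: real assume "e > 0"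
  then obtain d where d: "d > 0"
      "\<And>z s t. \<bar>s - t\<bar> < d \<Longrightarrow> \<bar>F (z + coord_vec i s) - F (z + coord_vec i t)\<bar> \<le> e / 2"
    using bdd_ucont_modulus_line[OF assms, of "e / 2"] by auto
  have "dist (F (z + coord_vec i t)) (F (z + coord_vec i s)) < e" if "dist t s < d" for t
    using that d(2) \<open>e > 0\<close> unfolding dist_real_def by (intro le_less_trans[OF d(2)]) auto
  then show "\<exists>d>0. \<forall>t\<in>A. dist t s < d \<longrightarrow> dist (F (z + coord_vec i t)) (F (z + coord_vec i s)) < e"
    using d(1) by (intro exI[of _ d]) simp
qed

subsection \<open>Uniform differentiability\<close>

lemma unif_diffD:
  assumes "unif_diff X I F G" "0 < e"
  obtains d where "d > 0" "\<And>z \<zeta>. l1_norm X \<zeta> < d \<Longrightarrow> (\<And>i. i \<in> X - I \<Longrightarrow> \<zeta> i = 0) \<Longrightarrow>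
    \<bar>F (z + \<zeta>) - F z - lin_form I (\<lambda>i. G i z) \<zeta>\<bar> \<le> e * l1_norm X \<zeta>"
  using assms unfolding unif_diff_def eventually_at_origin by metis

lemma unif_diff_empty: "bdd_ucont X F \<Longrightarrow> unif_diff X {} F G"
  using bdd_ucont_cong[of X F "z + \<zeta>" z for z \<zeta>] by (force simp: unif_diff_def lin_form_def)

lemma unif_diff_const: "unif_diff X I (\<lambda>z. c) (\<lambda>i z. 0)"
  by (simp add: unif_diff_def lin_form_def)

lemma unif_diff_lincomb:
  assumes F: "unif_diff X I F F'" and G: "unif_diff X I G G'"
  shows "unif_diff X I (\<lambda>z. a * F z + b * G z) (\<lambda>i z. a * F' i z + b * G' i z)"
  unfolding unif_diff_def
proof (intro allI impI)
  fix e :: real assume e: "e > 0"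
  define e' where "e' = e / (\<bar>a\<bar> + \<bar>b\<bar> + 1)"
  have e': "e' > 0" "(\<bar>a\<bar> + \<bar>b\<bar>) * e' \<le> e"
    using e by (simp_all add: e'_def field_simps add_pos_nonneg)
  have "\<forall>\<^sub>F \<zeta> in at_origin X. (\<forall>i\<in>X - I. \<zeta> i = 0) \<longrightarrow>
      (\<forall>z. \<bar>F (z + \<zeta>) - F z - lin_form I (\<lambda>i. F' i z) \<zeta>\<bar> \<le> e' * l1_norm X \<zeta>)"
    "\<forall>\<^sub>F \<zeta> in at_origin X. (\<forall>i\<in>X - I. \<zeta> i = 0) \<longrightarrow>
      (\<forall>z. \<bar>G (z + \<zeta>) - G z - lin_form I (\<lambda>i. G' i z) \<zeta>\<bar> \<le> e' * l1_norm X \<zeta>)"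
    using F G e'(1) by (simp_all add: unif_diff_def)
  then have "\<forall>\<^sub>F \<zeta> in at_origin X. (\<forall>i\<in>X - I. \<zeta> i = 0) \<longrightarrow>
      (\<forall>z. \<bar>F (z + \<zeta>) - F z - lin_form I (\<lambda>i. F' i z) \<zeta>\<bar> \<le> e' * l1_norm X \<zeta>) \<and>
      (\<forall>z. \<bar>G (z + \<zeta>) - G z - lin_form I (\<lambda>i. G' i z) \<zeta>\<bar> \<le> e' * l1_norm X \<zeta>)"
    by eventually_elim blast
  then show "\<forall>\<^sub>F \<zeta> in at_origin X. (\<forall>i\<in>X - I. \<zeta> i = 0) \<longrightarrow>
      (\<forall>z. \<bar>a * F (z + \<zeta>) + b * G (z + \<zeta>) - (a * F z + b * G z)
        - lin_form I (\<lambda>i. a * F' i z + b * G' i z) \<zeta>\<bar> \<le> e * l1_norm X \<zeta>)"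
  proof (rule eventually_mono, intro impI allI)
    fix \<zeta> z
    let ?RF = "F (z + \<zeta>) - F z - lin_form I (\<lambda>i. F' i z) \<zeta>"
    let ?RG = "G (z + \<zeta>) - G z - lin_form I (\<lambda>i. G' i z) \<zeta>"
    assume "(\<forall>i\<in>X - I. \<zeta> i = 0) \<longrightarrow>
      (\<forall>z. \<bar>F (z + \<zeta>) - F z - lin_form I (\<lambda>i. F' i z) \<zeta>\<bar> \<le> e' * l1_norm X \<zeta>) \<and>
      (\<forall>z. \<bar>G (z + \<zeta>) - G z - lin_form I (\<lambda>i. G' i z) \<zeta>\<bar> \<le> e' * l1_norm X \<zeta>)" "\<forall>i\<in>X - I. \<zeta> i = 0"
    then have "\<bar>?RF\<bar> \<le> e' * l1_norm X \<zeta>" "\<bar>?RG\<bar> \<le> e' * l1_norm X \<zeta>" by auto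
    then have "\<bar>a\<bar> * \<bar>?RF\<bar> + \<bar>b\<bar> * \<bar>?RG\<bar> \<le> \<bar>a\<bar> * (e' * l1_norm X \<zeta>) + \<bar>b\<bar> * (e' * l1_norm X \<zeta>)"
      by (intro add_mono mult_left_mono) auto
    also have "\<dots> \<le> e * l1_norm X \<zeta>"
      using mult_right_mono[OF e'(2), of "l1_norm X \<zeta>"] by (simp add: algebra_simps)
    finally have "\<bar>a * ?RF + b * ?RG\<bar> \<le> e * l1_norm X \<zeta>"
      using abs_triangle_ineq[of "a * ?RF" "b * ?RG"] by (simp add: abs_mult)
    then show "\<bar>a * F (z + \<zeta>) + b * G (z + \<zeta>) - (a * F z + b * G z)
        - lin_form I (\<lambda>i. a * F' i z + b * G' i z) \<zeta>\<bar> \<le> e * l1_norm X \<zeta>"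
      by (simp add: lin_form_lincomb algebra_simps)
  qed
qed

lemma increment_insert_le:
  fixes j :: 'i and \<zeta> :: "'i \<Rightarrow> real"
  defines "\<eta> \<equiv> coord_vec j (\<zeta> j)" and "\<xi> \<equiv> \<zeta>(j := 0)"
  assumes X: "finite X" "I \<subseteq> X" "j \<in> X" "j \<notin> I" and e: "0 \<le> e"
    and along_I: "\<bar>F (z + \<eta> + \<xi>) - F (z + \<eta>) - lin_form I (\<lambda>i. G i (z + \<eta>)) \<xi>\<bar> \<le> e * l1_norm X \<xi>"
    and along_j: "\<bar>F (z + \<eta>) - F z - lin_form {j} (\<lambda>i. D z) \<eta>\<bar> \<le> e * l1_norm X \<eta>"
    and G_close: "\<And>i. i \<in> I \<Longrightarrow> \<bar>G i (z + \<eta>) - G i z\<bar> \<le> e"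
  shows "\<bar>F (z + \<zeta>) - F z - lin_form (insert j I) (\<lambda>i. (G(j := D)) i z) \<zeta>\<bar> \<le> 2 * e * l1_norm X \<zeta>"
proof -
  have split: "\<zeta> = \<eta> + \<xi>" by (simp add: fun_eq_iff \<eta>_def \<xi>_def coord_vec_def)
  have norm: "l1_norm X \<zeta> = l1_norm X \<eta> + l1_norm X \<xi>"
    using l1_norm_split[OF X(1,3), of \<zeta>] X by (simp add: \<eta>_def \<xi>_def l1_norm_coord_vec)
  have "\<bar>lin_form I (\<lambda>i. G i (z + \<eta>) - G i z) \<xi>\<bar> \<le> e * l1_norm I \<xi>"
    by (intro abs_lin_form_le G_close)
  also have "\<dots> \<le> e * l1_norm X \<xi>"
    unfolding l1_norm_def using X e by (intro mult_left_mono sum_mono2) auto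
  finally have drift: "\<bar>lin_form I (\<lambda>i. G i (z + \<eta>)) \<xi> - lin_form I (\<lambda>i. G i z) \<xi>\<bar>
      \<le> e * l1_norm X \<xi>"
    by (simp add: lin_form_def right_diff_distrib sum_subtractf)
  have "lin_form (insert j I) (\<lambda>i. (G(j := D)) i z) \<zeta>
      = lin_form {j} (\<lambda>i. D z) \<eta> + lin_form I (\<lambda>i. G i z) \<xi>"
    unfolding lin_form_def using finite_subset[OF X(2,1)] X(4)
    by (auto simp: \<eta>_def \<xi>_def coord_vec_def intro!: sum.cong)
  moreover have "2 * e * l1_norm X \<zeta>
      = e * l1_norm X \<xi> + e * l1_norm X \<xi> + e * l1_norm X \<eta> + e * l1_norm X \<eta>"
    unfolding norm by (simp add: algebra_simps)
  moreover have "0 \<le> e * l1_norm X \<eta>" using e by simp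
  moreover have "F (z + \<zeta>) = F (z + \<eta> + \<xi>)" by (simp only: split add.assoc)
  ultimately show ?thesis
    using along_I along_j drift unfolding abs_le_iff by (intro conjI; linarith)
qed

lemma unif_diff_insert:
  assumes X: "finite X" "I \<subseteq> X" "j \<in> X" "j \<notin> I"
    and F: "unif_diff X I F G" "unif_diff X {j} F (\<lambda>_. D)" and G: "\<And>i. i \<in> I \<Longrightarrow> bdd_ucont X (G i)"
  shows "unif_diff X (insert j I) F (G(j := D))"
  unfolding unif_diff_def
proof (intro allI impI)
  fix e :: real assume "e > 0"
  then have e2: "e / 2 > 0" by simp
  obtain d1 where d1: "d1 > 0" "\<And>z \<zeta>. l1_norm X \<zeta> < d1 \<Longrightarrow> (\<And>i. i \<in> X - I \<Longrightarrow> \<zeta> i = 0) \<Longrightarrow>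
      \<bar>F (z + \<zeta>) - F z - lin_form I (\<lambda>i. G i z) \<zeta>\<bar> \<le> e / 2 * l1_norm X \<zeta>"
    using unif_diffD[OF F(1) e2] by blast
  obtain d2 where d2: "d2 > 0" "\<And>z \<zeta>. l1_norm X \<zeta> < d2 \<Longrightarrow> (\<And>i. i \<in> X - {j} \<Longrightarrow> \<zeta> i = 0) \<Longrightarrow>
      \<bar>F (z + \<zeta>) - F z - lin_form {j} (\<lambda>i. D z) \<zeta>\<bar> \<le> e / 2 * l1_norm X \<zeta>"
    using unif_diffD[OF F(2) e2] by blast
  have "\<forall>\<^sub>F \<zeta> in at_origin X. \<forall>i\<in>I. \<forall>z. \<bar>G i (z + \<zeta>) - G i z\<bar> \<le> e / 2"
    using G e2 by (intro eventually_ball_finite[OF finite_subset[OF X(2,1)]] ballI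
      bdd_ucont_eventually)
  then obtain d3 where d3: "d3 > 0"
    "\<And>i z \<zeta>. l1_norm X \<zeta> < d3 \<Longrightarrow> i \<in> I \<Longrightarrow> \<bar>G i (z + \<zeta>) - G i z\<bar> \<le> e / 2"
    unfolding eventually_at_origin by blast
  have "\<bar>F (z + \<zeta>) - F z - lin_form (insert j I) (\<lambda>i. (G(j := D)) i z) \<zeta>\<bar>
      \<le> 2 * (e / 2) * l1_norm X \<zeta>"
    if small: "l1_norm X \<zeta> < min d1 (min d2 d3)" and supp: "\<forall>i\<in>X - insert j I. \<zeta> i = 0" for z \<zeta>
  proof (rule increment_insert_le[OF X less_imp_le[OF e2]])
    let ?\<eta> = "coord_vec j (\<zeta> j)" and ?\<xi> = "\<zeta>(j := 0)"
    have "l1_norm X \<zeta> = l1_norm X ?\<eta> + l1_norm X ?\<xi>"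
      using l1_norm_split[OF X(1,3), of \<zeta>] X by (simp add: l1_norm_coord_vec)
    then have small': "l1_norm X ?\<xi> < d1" "l1_norm X ?\<eta> < d2" "l1_norm X ?\<eta> < d3"
      using small l1_norm_nonneg[of X ?\<xi>] l1_norm_nonneg[of X ?\<eta>] by linarith+
    show "\<bar>F (z + ?\<eta> + ?\<xi>) - F (z + ?\<eta>) - lin_form I (\<lambda>i. G i (z + ?\<eta>)) ?\<xi>\<bar> \<le> e / 2 * l1_norm X ?\<xi>"
      using supp by (intro d1(2) small') simp
    show "\<bar>F (z + ?\<eta>) - F z - lin_form {j} (\<lambda>i. D z) ?\<eta>\<bar> \<le> e / 2 * l1_norm X ?\<eta>"
      by (intro d2(2) small') (simp add: coord_vec_def)
    show "\<bar>G i (z + ?\<eta>) - G i z\<bar> \<le> e / 2" if "i \<in> I" for i by (intro d3(2) small' that)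
  qed
  then show "\<forall>\<^sub>F \<zeta> in at_origin X. (\<forall>i\<in>X - insert j I. \<zeta> i = 0) \<longrightarrow>
      (\<forall>z. \<bar>F (z + \<zeta>) - F z - lin_form (insert j I) (\<lambda>i. (G(j := D)) i z) \<zeta>\<bar> \<le> e * l1_norm X \<zeta>)"
    using d1(1) d2(1) d3(1) unfolding eventually_at_origin
    by (intro exI[of _ "min d1 (min d2 d3)"]) auto
qed

lemma unif_diff_DERIV:
  assumes "unif_diff X X F G"
  shows "((\<lambda>t. F (z + (\<lambda>i. t * \<zeta> i))) has_real_derivative
      lin_form X (\<lambda>i. G i (z + (\<lambda>i. t * \<zeta> i))) \<zeta>) (at t)"
  unfolding DERIV_def LIM_eq
proof (intro allI impI)
  fix r :: real assume r: "r > 0"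
  define l where "l = l1_norm X \<zeta> + 1"
  have l: "l > 0" "l1_norm X \<zeta> < l" using l1_norm_nonneg[of X \<zeta>] unfolding l_def by linarith+
  let ?w = "z + (\<lambda>i. t * \<zeta> i)" and ?D = "lin_form X (\<lambda>i. G i (z + (\<lambda>i. t * \<zeta> i))) \<zeta>"
  obtain d where d: "d > 0" "\<And>z \<xi>. l1_norm X \<xi> < d \<Longrightarrow>
      \<bar>F (z + \<xi>) - F z - lin_form X (\<lambda>i. G i z) \<xi>\<bar> \<le> r / l * l1_norm X \<xi>"
    using unif_diffD[OF assms, of "r / l"] r l by auto
  have "\<bar>(F (z + (\<lambda>i. (t + k) * \<zeta> i)) - F ?w) / k - ?D\<bar> < r" if k: "k \<noteq> 0" "\<bar>k\<bar> < d / l" for k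
  proof -
    have "\<bar>k\<bar> * l1_norm X \<zeta> \<le> \<bar>k\<bar> * l" using l(2) by (intro mult_left_mono) auto
    also have "\<dots> < d" using k(2) l(1) by (simp add: field_simps)
    finally have "\<bar>F (?w + (\<lambda>i. k * \<zeta> i)) - F ?w - k * ?D\<bar> \<le> r / l * (\<bar>k\<bar> * l1_norm X \<zeta>)"
      using d(2)[of "\<lambda>i. k * \<zeta> i" ?w] by (simp add: l1_norm_scale lin_form_scale)
    also have "\<dots> < r * \<bar>k\<bar>" using k(1) r l by (simp add: field_simps mult_strict_left_mono)
    finally have "\<bar>F (?w + (\<lambda>i. k * \<zeta> i)) - F ?w - k * ?D\<bar> / \<bar>k\<bar> < r"
      using k(1) by (simp add: divide_less_eq)
    then have "\<bar>(F (?w + (\<lambda>i. k * \<zeta> i)) - F ?w) / k - ?D\<bar> < r"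
      using k(1) by (simp only: flip: abs_divide) (simp add: diff_divide_distrib)
    moreover have "z + (\<lambda>i. (t + k) * \<zeta> i) = ?w + (\<lambda>i. k * \<zeta> i)" by (auto simp: algebra_simps)
    ultimately show ?thesis by (simp only:)
  qed
  then show "\<exists>s>0. \<forall>k. k \<noteq> 0 \<and> norm (k - 0) < s \<longrightarrow>
      norm ((F (z + (\<lambda>i. (t + k) * \<zeta> i)) - F ?w) / k - ?D) < r"
    using d(1) l by (intro exI[of _ "d / l"]) auto
qed

lemma unif_C2_remainder_le:
  assumes F: "unif_C2 X F G H" and e: "0 \<le> e"
    and G: "\<And>i \<xi>. i \<in> X \<Longrightarrow> l1_norm X \<xi> \<le> l1_norm X \<zeta> \<Longrightarrow>
      \<bar>G i (z + \<xi>) - G i z - lin_form X (\<lambda>j. H i j z) \<xi>\<bar> \<le> e * l1_norm X \<xi>"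
  shows "\<bar>F (z + \<zeta>) - F z - lin_form X (\<lambda>i. G i z) \<zeta> - quad_form X (\<lambda>i j. H i j z) \<zeta> / 2\<bar>
    \<le> e * (l1_norm X \<zeta>)\<^sup>2"
proof -
  have dF: "unif_diff X X F G" using F by (simp add: unif_C2_def)
  define a where "a = lin_form X (\<lambda>i. G i z) \<zeta>"
  define b where "b = quad_form X (\<lambda>i j. H i j z) \<zeta>"
  define \<phi> where "\<phi> t = F (z + (\<lambda>i. t * \<zeta> i)) - t * a - t\<^sup>2 / 2 * b" for t
  define \<phi>' where "\<phi>' t = lin_form X (\<lambda>i. G i (z + (\<lambda>i. t * \<zeta> i))) \<zeta> - a - t * b" for t
  have "(\<phi> has_real_derivative \<phi>' t) (at t)" for t
    unfolding \<phi>_def \<phi>'_def by (auto intro!: derivative_eq_intros unif_diff_DERIV[OF dF])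
  then obtain t where t: "0 < t" "t < 1" "\<phi> 1 - \<phi> 0 = (1 - 0) * \<phi>' t"
    using MVT2[of 0 1 \<phi> \<phi>'] by auto
  have scaled: "l1_norm X (\<lambda>i. t * \<zeta> i) \<le> l1_norm X \<zeta>"
    unfolding l1_norm_scale using t l1_norm_nonneg[of X \<zeta>] mult_right_mono[of t 1 "l1_norm X \<zeta>"]
    by simp
  have "\<phi>' t = lin_form X (\<lambda>i. G i (z + (\<lambda>i. t * \<zeta> i)) - G i z
      - lin_form X (\<lambda>j. H i j z) (\<lambda>i. t * \<zeta> i)) \<zeta>"
    unfolding \<phi>'_def a_def b_def quad_form_eq_lin_form
    by (simp add: lin_form_def right_diff_distrib sum_subtractf sum_distrib_left ac_simps)
  also have "\<bar>\<dots>\<bar> \<le> (e * l1_norm X \<zeta>) * l1_norm X \<zeta>"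
  proof (rule abs_lin_form_le)
    fix i assume "i \<in> X"
    from G[OF this scaled] mult_left_mono[OF scaled e]
    show "\<bar>G i (z + (\<lambda>i. t * \<zeta> i)) - G i z - lin_form X (\<lambda>j. H i j z) (\<lambda>i. t * \<zeta> i)\<bar>
        \<le> e * l1_norm X \<zeta>" by linarith
  qed
  finally have "\<bar>\<phi> 1 - \<phi> 0\<bar> \<le> e * (l1_norm X \<zeta>)\<^sup>2"
    using t(3) by (simp add: power2_eq_square mult.assoc)
  moreover have "\<phi> 1 - \<phi> 0 = F (z + \<zeta>) - F z - a - b / 2"
    by (simp add: \<phi>_def zero_fun_def[symmetric])
  ultimately show ?thesis unfolding a_def b_def by simp
qed

lemma unif_C2_taylor:
  assumes X: "finite X" and F: "unif_C2 X F G H" and e: "0 < e"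
  shows "\<forall>\<^sub>F \<zeta> in at_origin X. \<forall>z. \<bar>F (z + \<zeta>) - F z - lin_form X (\<lambda>i. G i z) \<zeta>
     - quad_form X (\<lambda>i j. H i j z) \<zeta> / 2\<bar> \<le> e * (l1_norm X \<zeta>)\<^sup>2"
proof -
  have "\<And>i. i \<in> X \<Longrightarrow> unif_diff X X (G i) (H i)" using F by (simp add: unif_C2_def)
  then have "\<forall>\<^sub>F \<zeta> in at_origin X. \<forall>i\<in>X. \<forall>z. \<bar>G i (z + \<zeta>) - G i z
      - lin_form X (\<lambda>j. H i j z) \<zeta>\<bar> \<le> e * l1_norm X \<zeta>"
    using e by (intro eventually_ball_finite[OF X] ballI) (simp add: unif_diff_def)
  then obtain d where d: "d > 0" "\<And>i z \<zeta>. l1_norm X \<zeta> < d \<Longrightarrow> i \<in> X \<Longrightarrow>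
      \<bar>G i (z + \<zeta>) - G i z - lin_form X (\<lambda>j. H i j z) \<zeta>\<bar> \<le> e * l1_norm X \<zeta>"
    unfolding eventually_at_origin by blast
  have "\<bar>F (z + \<zeta>) - F z - lin_form X (\<lambda>i. G i z) \<zeta> - quad_form X (\<lambda>i j. H i j z) \<zeta> / 2\<bar>
      \<le> e * (l1_norm X \<zeta>)\<^sup>2" if "l1_norm X \<zeta> < d" for z \<zeta>
    using that e by (intro unif_C2_remainder_le[OF F] d(2)) auto
  then show ?thesis using d(1) unfolding eventually_at_origin by blast
qed

lemma Ck_bdd_ucont: "Ck X k F \<Longrightarrow> bdd_ucont X F"
  by (cases k) auto

lemma Ck_Suc: "Ck X (Suc k) F \<Longrightarrow> Ck X k F"
  by (induction k arbitrary: F) auto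

lemma Ck_lincomb: "Ck X k F \<Longrightarrow> Ck X k G \<Longrightarrow> Ck X k (\<lambda>z. a * F z + b * G z)"
proof (induction k arbitrary: F G)
  case 0
  then show ?case by (simp add: bdd_ucont_add bdd_ucont_scale)
next
  case (Suc k)
  then obtain F' G' where "unif_diff X X F F'" "\<forall>i\<in>X. Ck X k (F' i)" "unif_diff X X G G'"
    "\<forall>i\<in>X. Ck X k (G' i)"
     "bdd_ucont X F" "bdd_ucont X G"
    by auto
  then have "bdd_ucont X (\<lambda>z. a * F z + b * G z)" "\<forall>i\<in>X. Ck X k (\<lambda>z. a * F' i z + b * G' i z)"
      "unif_diff X X (\<lambda>z. a * F z + b * G z) (\<lambda>i z. a * F' i z + b * G' i z)"
    using Suc.IH by (auto intro: bdd_ucont_add bdd_ucont_scale unif_diff_lincomb)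
  then show ?case unfolding Ck.simps by (intro conjI exI[of _ "\<lambda>i z. a * F' i z + b * G' i z"])
qed

lemma Ck_const: "Ck X k (\<lambda>z. c)"
proof (induction k arbitrary: c)
  case (Suc k)
  then show ?case
    unfolding Ck.simps using unif_diff_const[of X X c] by (intro conjI exI[of _ "\<lambda>i z. 0"]) auto
qed simp

lemma Ck_scale: "Ck X k F \<Longrightarrow> Ck X k (\<lambda>z. a * F z)"
  using Ck_lincomb[of X k F F a 0] by simp

lemma Ck_sum: "(\<And>i. i \<in> I \<Longrightarrow> Ck X k (F i)) \<Longrightarrow> Ck X k (\<lambda>z. \<Sum>i\<in>I. F i z)"
proof (induction I rule: infinite_finite_induct)
  case (insert i I)
  then show ?case using Ck_lincomb[of X k "F i" "\<lambda>z. \<Sum>i\<in>I. F i z" 1 1] by simp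
qed (simp_all add: Ck_const)

lemma Ck_unif_C2:
  assumes "Ck X (Suc (Suc k)) F"
  obtains G H where "unif_C2 X F G H" "\<forall>i\<in>X. Ck X k (G i)" "\<forall>i\<in>X. \<forall>j\<in>X. Ck X k (H i j)"
proof -
  obtain G where G: "bdd_ucont X F" "unif_diff X X F G" "\<forall>i\<in>X. Ck X (Suc k) (G i)"
    using assms by auto
  then have "\<forall>i\<in>X. \<exists>H. unif_diff X X (G i) H \<and> (\<forall>j\<in>X. Ck X k (H j))" by auto
  then obtain H where H: "\<forall>i\<in>X. unif_diff X X (G i) (H i) \<and> (\<forall>j\<in>X. Ck X k (H i j))" by metis
  show ?thesis
  proof (rule that)
    show "unif_C2 X F G H" using G H Ck_bdd_ucont unfolding unif_C2_def by blast
  qed (use G(3) H Ck_Suc in blast)+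
qed

section \<open>Local averages\<close>

text \<open>Shifts, random walk steps and mollifiers are all translation invariant averages over a cube of
  radius r, hence they commute with one another and with differentiation.\<close>

locale local_avg =
  fixes X :: "'i set" and r :: real and E :: "(('i \<Rightarrow> real) \<Rightarrow> real) \<Rightarrow> ('i \<Rightarrow> real) \<Rightarrow> real"
  assumes lincomb: "bdd_ucont X F \<Longrightarrow> bdd_ucont X G \<Longrightarrow>
      E (\<lambda>z. a * F z + b * G z) = (\<lambda>z. a * E F z + b * E G z)"
    and const: "E (\<lambda>z. c) = (\<lambda>z. c)"
    and translate: "bdd_ucont X F \<Longrightarrow> E (\<lambda>z. F (z + v)) = (\<lambda>z. E F (z + v))"
    and mono: "bdd_ucont X F \<Longrightarrow> bdd_ucont X G \<Longrightarrow>
      (\<And>v. (\<And>i. i \<in> X \<Longrightarrow> \<bar>v i\<bar> \<le> r) \<Longrightarrow> F (z + v) \<le> G (z + v)) \<Longrightarrow> E F z \<le> E G z"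
begin

lemma scale: "bdd_ucont X F \<Longrightarrow> E (\<lambda>z. a * F z) = (\<lambda>z. a * E F z)"
  using lincomb[of F F a 0] by simp

lemma add: "bdd_ucont X F \<Longrightarrow> bdd_ucont X G \<Longrightarrow> E (\<lambda>z. F z + G z) = (\<lambda>z. E F z + E G z)"
  using lincomb[of F G 1 1] by simp

lemma diff: "bdd_ucont X F \<Longrightarrow> bdd_ucont X G \<Longrightarrow> E (\<lambda>z. F z - G z) = (\<lambda>z. E F z - E G z)"
  using lincomb[of F G 1 "-1"] by simp

lemma sum_avg:
  "(\<And>i. i \<in> I \<Longrightarrow> bdd_ucont X (F i)) \<Longrightarrow> E (\<lambda>z. \<Sum>i\<in>I. F i z) = (\<lambda>z. \<Sum>i\<in>I. E (F i) z)"
proof (induction I rule: infinite_finite_induct)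
  case (insert i I)
  then show ?case using add[of "F i" "\<lambda>z. \<Sum>i\<in>I. F i z"] by (simp add: bdd_ucont_sum)
qed (simp_all add: const)

lemma lin_form:
  "(\<And>i. i \<in> I \<Longrightarrow> bdd_ucont X (G i)) \<Longrightarrow>
    E (\<lambda>z. lin_form I (\<lambda>i. G i z) x) = (\<lambda>z. lin_form I (\<lambda>i. E (G i) z) x)"
  unfolding lin_form_def by (simp add: sum_avg scale bdd_ucont_scale)

lemma quad_form:
  "(\<And>i j. i \<in> I \<Longrightarrow> j \<in> I \<Longrightarrow> bdd_ucont X (H i j)) \<Longrightarrow>
    E (\<lambda>z. quad_form I (\<lambda>i j. H i j z) x) = (\<lambda>z. quad_form I (\<lambda>i j. E (H i j) z) x)"
  unfolding quad_form_def by (simp add: sum_avg scale bdd_ucont_scale bdd_ucont_sum)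

lemma abs_le:
  assumes "bdd_ucont X F" "\<And>v. (\<And>i. i \<in> X \<Longrightarrow> \<bar>v i\<bar> \<le> r) \<Longrightarrow> \<bar>F (z + v)\<bar> \<le> B"
  shows "\<bar>E F z\<bar> \<le> B"
proof -
  have "E F z \<le> E (\<lambda>z. B) z" "E (\<lambda>z. - B) z \<le> E F z"
    using assms by (auto intro!: mono simp: abs_le_iff minus_le_iff)
  then show ?thesis by (simp add: const)
qed

lemma local_eq:
  assumes "bdd_ucont X F" "bdd_ucont X G" "\<And>v. (\<And>i. i \<in> X \<Longrightarrow> \<bar>v i\<bar> \<le> r) \<Longrightarrow> F (z + v) = G (z + v)"
  shows "E F z = E G z"
  using assms by (intro order_antisym mono) auto

lemma abs_diff_le:
  assumes "bdd_ucont X F" "\<And>v. (\<And>i. i \<in> X \<Longrightarrow> \<bar>v i\<bar> \<le> r) \<Longrightarrow> \<bar>F (z + v) - F z\<bar> \<le> e"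
  shows "\<bar>E F z - F z\<bar> \<le> e"
proof -
  have "\<bar>E (\<lambda>w. F w - F z) z\<bar> \<le> e" using assms by (intro abs_le bdd_ucont_diff) auto
  then show ?thesis by (simp add: diff[OF assms(1)] const)
qed

lemma le_add_const:
  assumes "bdd_ucont X F" "bdd_ucont X G" "\<And>z. F z \<le> G z + c"
  shows "E F z \<le> E G z + c"
proof -
  have "E F z \<le> E (\<lambda>z. G z + c) z" using assms by (intro mono bdd_ucont_add bdd_ucont_const)
  then show ?thesis by (simp add: add[OF assms(2) bdd_ucont_const] const)
qed

lemma bdd_ucont_avg:
  assumes F: "bdd_ucont X F"
  shows "bdd_ucont X (E F)"
proof -
  obtain B where "\<And>z. \<bar>F z\<bar> \<le> B" using bdd_ucont_bound[OF F] by blast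
  then have "\<bar>E F z\<bar> \<le> B" for z by (intro abs_le F)
  then show ?thesis
  proof (rule bdd_ucontI)
    fix e :: real assume "e > 0"
    from bdd_ucont_eventually[OF F this]
    show "\<forall>\<^sub>F \<zeta> in at_origin X. \<forall>z. \<bar>E F (z + \<zeta>) - E F z\<bar> \<le> e"
    proof (rule eventually_mono, intro allI)
      fix \<zeta> z assume "\<forall>z. \<bar>F (z + \<zeta>) - F z\<bar> \<le> e"
      then have "\<bar>E (\<lambda>z. F (z + \<zeta>) - F z) z\<bar> \<le> e"
        using F by (intro abs_le bdd_ucont_diff bdd_ucont_translate) auto
      then show "\<bar>E F (z + \<zeta>) - E F z\<bar> \<le> e"
        using F by (simp add: diff translate bdd_ucont_translate)
    qed
  qed
qed

lemma unif_diff_avg: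
  assumes F: "bdd_ucont X F" "unif_diff X I F G" and G: "\<And>i. i \<in> I \<Longrightarrow> bdd_ucont X (G i)"
  shows "unif_diff X I (E F) (\<lambda>i. E (G i))"
  unfolding unif_diff_def
proof (intro allI impI)
  fix e :: real assume "e > 0"
  then have "\<forall>\<^sub>F \<zeta> in at_origin X. (\<forall>i\<in>X - I. \<zeta> i = 0) \<longrightarrow>
      (\<forall>z. \<bar>F (z + \<zeta>) - F z - lin_form I (\<lambda>i. G i z) \<zeta>\<bar> \<le> e * l1_norm X \<zeta>)"
    using F(2) by (simp add: unif_diff_def)
  then show "\<forall>\<^sub>F \<zeta> in at_origin X. (\<forall>i\<in>X - I. \<zeta> i = 0) \<longrightarrow>
      (\<forall>z. \<bar>E F (z + \<zeta>) - E F z - lin_form I (\<lambda>i. E (G i) z) \<zeta>\<bar> \<le> e * l1_norm X \<zeta>)"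
  proof (rule eventually_mono, intro allI impI)
    fix \<zeta> z
    assume "(\<forall>i\<in>X - I. \<zeta> i = 0) \<longrightarrow>
        (\<forall>z. \<bar>F (z + \<zeta>) - F z - lin_form I (\<lambda>i. G i z) \<zeta>\<bar> \<le> e * l1_norm X \<zeta>)"
      "\<forall>i\<in>X - I. \<zeta> i = 0"
    then have "\<bar>E (\<lambda>z. F (z + \<zeta>) - F z - lin_form I (\<lambda>i. G i z) \<zeta>) z\<bar> \<le> e * l1_norm X \<zeta>"
      using F G by (intro abs_le bdd_ucont_diff bdd_ucont_translate bdd_ucont_lin_form) auto
    then show "\<bar>E F (z + \<zeta>) - E F z - lin_form I (\<lambda>i. E (G i) z) \<zeta>\<bar> \<le> e * l1_norm X \<zeta>"
      using F G by (simp add: diff translate lin_form bdd_ucont_diff bdd_ucont_translate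
        bdd_ucont_lin_form)
  qed
qed

lemma unif_C2_avg: "unif_C2 X F G H \<Longrightarrow> unif_C2 X (E F) (\<lambda>i. E (G i)) (\<lambda>i j. E (H i j))"
  by (simp add: unif_C2_def bdd_ucont_avg unif_diff_avg)

lemma Ck_avg: "Ck X k F \<Longrightarrow> Ck X k (E F)"
proof (induction k arbitrary: F)
  case 0
  then show ?case by (simp add: bdd_ucont_avg)
next
  case (Suc k)
  then obtain G where G: "bdd_ucont X F" "unif_diff X X F G" "\<forall>i\<in>X. Ck X k (G i)" by auto
  then have "unif_diff X X (E F) (\<lambda>i. E (G i))" using Ck_bdd_ucont by (intro unif_diff_avg) auto
  then show ?case
    using Suc.IH G bdd_ucont_avg unfolding Ck.simps by (intro conjI exI[of _ "\<lambda>i. E (G i)"]) auto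
qed

end

lemma local_avg_id: "0 \<le> r \<Longrightarrow> local_avg X r (\<lambda>F. F)"
proof
  fix F G :: "('a \<Rightarrow> real) \<Rightarrow> real" and z
  assume "0 \<le> r" "\<And>v. (\<And>i. i \<in> X \<Longrightarrow> \<bar>v i\<bar> \<le> r) \<Longrightarrow> F (z + v) \<le> G (z + v)"
  from this(2)[of 0] \<open>0 \<le> r\<close> show "F z \<le> G z" by simp
qed simp_all

lemma local_avg_shift: "local_avg X \<bar>s\<bar> (\<lambda>F z. F (z + coord_vec i s))"
  by unfold_locales (simp_all add: ac_simps coord_vec_def)

lemma local_avg_comp:
  assumes "local_avg X r E" "local_avg X s E'" "0 \<le> r" "0 \<le> s"
  shows "local_avg X (r + s) (\<lambda>F. E (E' F))"
proof -
  interpret E: local_avg X r E by fact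
  interpret E': local_avg X s E' by fact
  show ?thesis
  proof
    fix F G :: "('a \<Rightarrow> real) \<Rightarrow> real" and z
    assume FG: "bdd_ucont X F" "bdd_ucont X G"
      and le: "\<And>v. (\<And>i. i \<in> X \<Longrightarrow> \<bar>v i\<bar> \<le> r + s) \<Longrightarrow> F (z + v) \<le> G (z + v)"
    show "E (E' F) z \<le> E (E' G) z"
    proof (intro E.mono E'.bdd_ucont_avg FG)
      fix v assume v: "\<And>i. i \<in> X \<Longrightarrow> \<bar>v i\<bar> \<le> r"
      show "E' F (z + v) \<le> E' G (z + v)"
      proof (intro E'.mono FG)
        fix v' assume v': "\<And>i. i \<in> X \<Longrightarrow> \<bar>v' i\<bar> \<le> s"
        have "\<bar>(v + v') i\<bar> \<le> r + s" if "i \<in> X" for i using v[OF that] v'[OF that] by simp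
        then show "F (z + v + v') \<le> G (z + v + v')" using le[of "v + v'"] by (simp add: ac_simps)
      qed
    qed
  qed (simp_all add: E.lincomb E'.lincomb E.const E'.const E.translate E'.translate
      E'.bdd_ucont_avg)
qed

lemma local_avg_funpow:
  assumes "local_avg X r E" "0 \<le> r"
  shows "local_avg X (real n * r) (E ^^ n)"
proof (induction n)
  case 0
  show ?case using local_avg_id[of 0] by (simp add: id_def)
next
  case (Suc n)
  show ?case using local_avg_comp[OF assms(1) Suc assms(2)] assms(2)
    by (simp add: o_def algebra_simps)
qed

subsection \<open>Steklov averages\<close>

definition steklov :: "real \<Rightarrow> 'i \<Rightarrow> (('i \<Rightarrow> real) \<Rightarrow> real) \<Rightarrow> ('i \<Rightarrow> real) \<Rightarrow> real" where
  "steklov \<epsilon> i F z = integral {0..1} (\<lambda>s. F (z + coord_vec i (\<epsilon> * s)))"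

definition steklov_list :: "real \<Rightarrow> 'i list \<Rightarrow> (('i \<Rightarrow> real) \<Rightarrow> real) \<Rightarrow> ('i \<Rightarrow> real) \<Rightarrow> real" where
  "steklov_list \<epsilon> xs = foldr (steklov \<epsilon>) xs"

lemma steklov_integrable:
  assumes "finite X" "i \<in> X" "bdd_ucont X F"
  shows "(\<lambda>s. F (z + coord_vec i (\<epsilon> * s))) integrable_on {0..1}"
proof -
  have "continuous_on {0..1} ((\<lambda>s. F (z + coord_vec i s)) \<circ> (\<lambda>s. \<epsilon> * s))"
    by (intro continuous_on_compose continuous_intros bdd_ucont_continuous_on_line[OF assms])
  then show ?thesis unfolding o_def by (rule integrable_continuous_real)
qed

lemma local_avg_steklov:
  assumes "finite X" "i \<in> X" "0 \<le> \<epsilon>"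
  shows "local_avg X \<epsilon> (steklov \<epsilon> i)"
proof
  fix F G :: "('a \<Rightarrow> real) \<Rightarrow> real" and a b
  assume "bdd_ucont X F" "bdd_ucont X G"
  then show "steklov \<epsilon> i (\<lambda>z. a * F z + b * G z) = (\<lambda>z. a * steklov \<epsilon> i F z + b * steklov \<epsilon> i G z)"
    using steklov_integrable[OF assms(1,2)]
    by (simp add: steklov_def fun_eq_iff integral_add integrable_on_mult_right)
next
  fix F G :: "('a \<Rightarrow> real) \<Rightarrow> real" and z
  assume FG: "bdd_ucont X F" "bdd_ucont X G"
    and le: "\<And>v. (\<And>i. i \<in> X \<Longrightarrow> \<bar>v i\<bar> \<le> \<epsilon>) \<Longrightarrow> F (z + v) \<le> G (z + v)"
  have "F (z + coord_vec i (\<epsilon> * s)) \<le> G (z + coord_vec i (\<epsilon> * s))" if "s \<in> {0..1}" for s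
    using that assms(3) by (intro le) (auto simp: coord_vec_def abs_mult intro: mult_left_le)
  then show "steklov \<epsilon> i F z \<le> steklov \<epsilon> i G z"
    unfolding steklov_def using FG by (intro integral_le steklov_integrable[OF assms(1,2)])
qed (simp_all add: steklov_def fun_eq_iff ac_simps)

lemma MVT_abs:
  fixes f f' :: "real \<Rightarrow> real"
  assumes "\<And>x. (f has_real_derivative f' x) (at x)"
  obtains \<xi> where "\<bar>\<xi> - a\<bar> \<le> \<bar>h\<bar>" "f (a + h) - f a = h * f' \<xi>"
proof -
  consider "h = 0" | "h > 0" | "h < 0" by linarith
  then show ?thesis
  proof cases
    case 2
    then obtain \<xi> where "a < \<xi>" "\<xi> < a + h" "f (a + h) - f a = (a + h - a) * f' \<xi>"
      using MVT2[of a "a + h" f f'] assms by auto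
    then show ?thesis by (intro that[of \<xi>]) auto
  next
    case 3
    then obtain \<xi> where "a + h < \<xi>" "\<xi> < a" "f a - f (a + h) = (a - (a + h)) * f' \<xi>"
      using MVT2[of "a + h" a f f'] assms by auto
    then show ?thesis by (intro that[of \<xi>]) auto
  qed (auto intro: that)
qed

lemma steklov_increment:
  fixes g :: "real \<Rightarrow> real"
  assumes g: "continuous_on UNIV g" and \<epsilon>: "0 < \<epsilon>"
  obtains \<xi> \<xi>' where "\<bar>\<xi>\<bar> \<le> \<bar>h\<bar>" "\<bar>\<xi>' - \<epsilon>\<bar> \<le> \<bar>h\<bar>"
    "integral {0..1} (\<lambda>s. g (h + \<epsilon> * s)) - integral {0..1} (\<lambda>s. g (\<epsilon> * s)) = h * ((g \<xi>' - g \<xi>) / \<epsilon>)"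
proof -
  have "\<exists>P. \<forall>x::real. -\<infinity> < ereal x \<longrightarrow> ereal x < \<infinity> \<longrightarrow> (P has_vector_derivative g x) (at x)"
    using g by (intro einterval_antiderivative) (auto simp: continuous_on_eq_continuous_at)
  then obtain P where P: "\<And>x. (P has_real_derivative g x) (at x)"
    by (auto simp: has_real_derivative_iff_has_vector_derivative)
  have average: "integral {0..1} (\<lambda>s. g (k + \<epsilon> * s)) = (P (k + \<epsilon>) - P k) / \<epsilon>" for k
  proof -
    have "((\<lambda>s. P (k + \<epsilon> * s) / \<epsilon>) has_real_derivative g (k + \<epsilon> * s)) (at s within {0..1})" for s
      using \<epsilon> by (auto intro!: derivative_eq_intros DERIV_chain2[OF P, THEN DERIV_subset])
    then have "((\<lambda>s. g (k + \<epsilon> * s)) has_integral (P (k + \<epsilon> * 1) / \<epsilon> - P (k + \<epsilon> * 0) / \<epsilon>)) {0..1}"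
      by (intro fundamental_theorem_of_calculus)
        (auto simp: has_real_derivative_iff_has_vector_derivative)
    then show ?thesis by (simp add: integral_unique diff_divide_distrib)
  qed
  obtain \<xi> where \<xi>: "\<bar>\<xi> - 0\<bar> \<le> \<bar>h\<bar>" "P (0 + h) - P 0 = h * g \<xi>" using MVT_abs[OF P] .
  obtain \<xi>' where \<xi>': "\<bar>\<xi>' - \<epsilon>\<bar> \<le> \<bar>h\<bar>" "P (\<epsilon> + h) - P \<epsilon> = h * g \<xi>'" using MVT_abs[OF P] .
  have "integral {0..1} (\<lambda>s. g (h + \<epsilon> * s)) - integral {0..1} (\<lambda>s. g (\<epsilon> * s))
      = ((P (\<epsilon> + h) - P \<epsilon>) - (P (0 + h) - P 0)) / \<epsilon>"
    using average[of h] average[of 0] by (simp add: add.commute diff_divide_distrib)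
  also have "\<dots> = h * ((g \<xi>' - g \<xi>) / \<epsilon>)" unfolding \<xi>(2) \<xi>'(2) by (simp add: right_diff_distrib)
  finally show ?thesis using \<xi>(1) \<xi>'(1) by (intro that[of \<xi> \<xi>']) simp_all
qed

lemma steklov_difference_quotient:
  assumes X: "finite X" "j \<in> X" and F: "bdd_ucont X F" and \<epsilon>: "0 < \<epsilon>" and e: "0 < e"
  obtains d where "d > 0" "\<And>z h. \<bar>h\<bar> < d \<Longrightarrow>
    \<bar>steklov \<epsilon> j F (z + coord_vec j h) - steklov \<epsilon> j F z - h * ((F (z + coord_vec j \<epsilon>) - F z) / \<epsilon>)\<bar>
    \<le> e * \<bar>h\<bar>"
proof -
  obtain d where d: "d > 0"
      "\<And>z s t. \<bar>s - t\<bar> < d \<Longrightarrow> \<bar>F (z + coord_vec j s) - F (z + coord_vec j t)\<bar> \<le> e * \<epsilon> / 2"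
    using bdd_ucont_modulus_line[OF X F, of "e * \<epsilon> / 2"] e \<epsilon> by auto
  have "\<bar>steklov \<epsilon> j F (z + coord_vec j h) - steklov \<epsilon> j F z
      - h * ((F (z + coord_vec j \<epsilon>) - F z) / \<epsilon>)\<bar> \<le> e * \<bar>h\<bar>"
    if h: "\<bar>h\<bar> < d" for z h
  proof -
    define g where "g s = F (z + coord_vec j s)" for s
    obtain \<xi> \<xi>' where \<xi>: "\<bar>\<xi>\<bar> \<le> \<bar>h\<bar>" "\<bar>\<xi>' - \<epsilon>\<bar> \<le> \<bar>h\<bar>" and
      eq: "integral {0..1} (\<lambda>s. g (h + \<epsilon> * s)) - integral {0..1} (\<lambda>s. g (\<epsilon> * s))
          = h * ((g \<xi>' - g \<xi>) / \<epsilon>)"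
      using steklov_increment[of g \<epsilon> h] bdd_ucont_continuous_on_line[OF X F] \<epsilon> unfolding g_def
      by blast
    have "\<bar>g \<xi>' - g \<epsilon>\<bar> \<le> e * \<epsilon> / 2" "\<bar>g \<xi> - g 0\<bar> \<le> e * \<epsilon> / 2"
      unfolding g_def using \<xi> h by (intro d(2); simp)+
    then have "\<bar>(g \<xi>' - g \<epsilon>) - (g \<xi> - g 0)\<bar> \<le> e * \<epsilon>" by linarith
    then have "\<bar>((g \<xi>' - g \<epsilon>) - (g \<xi> - g 0)) / \<epsilon>\<bar> \<le> e"
      using \<epsilon> by (simp add: abs_divide divide_le_eq)
    then have "\<bar>h * (((g \<xi>' - g \<epsilon>) - (g \<xi> - g 0)) / \<epsilon>)\<bar> \<le> e * \<bar>h\<bar>"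
      unfolding abs_mult using mult_left_mono by (metis abs_ge_zero mult.commute)
    also have "h * (((g \<xi>' - g \<epsilon>) - (g \<xi> - g 0)) / \<epsilon>)
        = h * ((g \<xi>' - g \<xi>) / \<epsilon>) - h * ((g \<epsilon> - g 0) / \<epsilon>)"
      by (simp add: diff_divide_distrib add_divide_distrib algebra_simps)
    also have "h * ((g \<xi>' - g \<xi>) / \<epsilon>) = steklov \<epsilon> j F (z + coord_vec j h) - steklov \<epsilon> j F z"
      using eq by (simp add: steklov_def g_def add.assoc coord_vec_add)
    finally show ?thesis by (simp add: g_def)
  qed
  then show ?thesis using d(1) that by blast
qed

lemma unif_diff_steklov_same_direction:
  assumes X: "finite X" "j \<in> X" and F: "bdd_ucont X F" and \<epsilon>: "0 < \<epsilon>"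
  shows "unif_diff X {j} (steklov \<epsilon> j F) (\<lambda>_ z. (F (z + coord_vec j \<epsilon>) - F z) / \<epsilon>)"
  unfolding unif_diff_def
proof (intro allI impI)
  fix e :: real assume e: "e > 0"
  obtain d where d: "d > 0" "\<And>z h. \<bar>h\<bar> < d \<Longrightarrow>
      \<bar>steklov \<epsilon> j F (z + coord_vec j h) - steklov \<epsilon> j F z
      - h * ((F (z + coord_vec j \<epsilon>) - F z) / \<epsilon>)\<bar> \<le> e * \<bar>h\<bar>"
    using steklov_difference_quotient[OF X F \<epsilon> e] by blast
  have "\<bar>steklov \<epsilon> j F (z + \<zeta>) - steklov \<epsilon> j F z
      - lin_form {j} (\<lambda>i. (F (z + coord_vec j \<epsilon>) - F z) / \<epsilon>) \<zeta>\<bar>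
      \<le> e * l1_norm X \<zeta>"
    if small: "l1_norm X \<zeta> < d" and supp: "\<forall>i\<in>X - {j}. \<zeta> i = 0" for z \<zeta>
  proof -
    have "bdd_ucont X (steklov \<epsilon> j F)"
      using local_avg.bdd_ucont_avg[OF local_avg_steklov[OF X] F] \<epsilon> by simp
    then have "steklov \<epsilon> j F (z + \<zeta>) = steklov \<epsilon> j F (z + coord_vec j (\<zeta> j))"
      by (rule bdd_ucont_cong) (use supp in \<open>auto simp: coord_vec_def\<close>)
    moreover have "\<bar>\<zeta> j\<bar> < d" "e * \<bar>\<zeta> j\<bar> \<le> e * l1_norm X \<zeta>"
      using abs_le_l1_norm[OF X, of \<zeta>] small e by simp_all
    ultimately show ?thesis using d(2)[of "\<zeta> j" z] by (simp add: lin_form_def)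
  qed
  then show "\<forall>\<^sub>F \<zeta> in at_origin X. (\<forall>i\<in>X - {j}. \<zeta> i = 0) \<longrightarrow>
      (\<forall>z. \<bar>steklov \<epsilon> j F (z + \<zeta>) - steklov \<epsilon> j F z
      - lin_form {j} (\<lambda>i. (F (z + coord_vec j \<epsilon>) - F z) / \<epsilon>) \<zeta>\<bar> \<le> e * l1_norm X \<zeta>)"
    using d(1) unfolding eventually_at_origin by blast
qed

lemma unif_diff_steklov:
  assumes X: "finite X" "I \<subseteq> X" "j \<in> X" "j \<notin> I" and \<epsilon>: "0 < \<epsilon>"
    and F: "bdd_ucont X F" "unif_diff X I F G" and G: "\<And>i. i \<in> I \<Longrightarrow> bdd_ucont X (G i)"
  shows "unif_diff X (insert j I) (steklov \<epsilon> j F)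
    ((\<lambda>i. steklov \<epsilon> j (G i))(j := \<lambda>z. (F (z + coord_vec j \<epsilon>) - F z) / \<epsilon>))"
proof -
  interpret local_avg X \<epsilon> "steklov \<epsilon> j" using local_avg_steklov[OF X(1,3)] \<epsilon> by simp
  show ?thesis
    by (intro unif_diff_insert X unif_diff_avg F G unif_diff_steklov_same_direction \<epsilon> bdd_ucont_avg)
qed

lemma local_avg_steklov_list:
  fixes \<epsilon> :: real
  assumes "finite X" "0 \<le> \<epsilon>"
  shows "set xs \<subseteq> X \<Longrightarrow> local_avg X (\<epsilon> * real (length xs)) (steklov_list \<epsilon> xs)"
proof (induction xs)
  case Nil
  show ?case using local_avg_id[of 0 X] by (simp add: steklov_list_def id_def)
next
  case (Cons x xs)
  then show ?case
    using local_avg_comp[OF local_avg_steklov[OF assms(1) _ assms(2)] Cons.IH, of x] assms(2)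
    by (simp add: steklov_list_def algebra_simps o_def)
qed

lemma steklov_list_unif_diff:
  assumes X: "finite X" and \<epsilon>: "0 < \<epsilon>" and F: "Ck X k F"
  shows "distinct xs \<Longrightarrow> set xs \<subseteq> X \<Longrightarrow>
    \<exists>G. unif_diff X (set xs) (steklov_list \<epsilon> xs F) G \<and> (\<forall>i\<in>set xs. Ck X k (G i))"
proof (induction xs)
  case Nil
  show ?case using unif_diff_empty[OF Ck_bdd_ucont[OF F]] by (auto simp: steklov_list_def)
next
  case (Cons x xs)
  define F' where "F' = steklov_list \<epsilon> xs F"
  from Cons obtain G where G: "unif_diff X (set xs) F' G" "\<forall>i\<in>set xs. Ck X k (G i)"
    unfolding F'_def by auto
  have x: "x \<in> X" "x \<notin> set xs" "set xs \<subseteq> X" using Cons by auto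
  have F': "Ck X k F'"
    unfolding F'_def using local_avg.Ck_avg[OF local_avg_steklov_list[OF X _ x(3)] F] \<epsilon> by simp
  let ?G = "(\<lambda>i. steklov \<epsilon> x (G i))(x := \<lambda>z. (F' (z + coord_vec x \<epsilon>) - F' z) / \<epsilon>)"
  have "unif_diff X (insert x (set xs)) (steklov \<epsilon> x F') ?G"
    using G(2) Ck_bdd_ucont F' by (intro unif_diff_steklov X \<epsilon> x G) blast+
  moreover have "Ck X k (?G i)" if "i \<in> set (x # xs)" for i
  proof (cases "i = x")
    case True
    have "Ck X k (\<lambda>z. 1 / \<epsilon> * F' (z + coord_vec x \<epsilon>) + (- 1 / \<epsilon>) * F' z)"
      by (intro Ck_lincomb local_avg.Ck_avg[OF local_avg_shift] F')
    then show ?thesis using True by (simp add: diff_divide_distrib)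
  next
    case False
    then show ?thesis using that G(2) local_avg.Ck_avg[OF local_avg_steklov[OF X x(1)]] \<epsilon> by simp
  qed
  ultimately show ?case
    by (intro exI[of _ ?G]) (simp add: steklov_list_def F'_def del: fun_upd_apply)
qed

text \<open>Every round of Steklov averages in all directions gains one derivative.\<close>

lemma steklov_list_Ck:
  assumes "finite X" "0 < \<epsilon>" "Ck X k F" "distinct xs" "set xs = X"
  shows "Ck X (Suc k) (steklov_list \<epsilon> xs F)"
proof -
  have "bdd_ucont X (steklov_list \<epsilon> xs F)"
    using local_avg.bdd_ucont_avg[OF local_avg_steklov_list] assms Ck_bdd_ucont
    by (metis less_imp_le order_refl)
  then show ?thesis using steklov_list_unif_diff[OF assms(1-3), of xs] assms by auto
qed

lemma steklov_list_funpow_Ck: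
  assumes "finite X" "0 < \<epsilon>" "bdd_ucont X F" "distinct xs" "set xs = X"
  shows "Ck X n ((steklov_list \<epsilon> xs ^^ n) F)"
  using assms by (induction n) (simp_all add: steklov_list_Ck del: Ck.simps(2))

lemma local_avg_steklov_list_funpow:
  assumes "finite X" "0 \<le> \<epsilon>" "set xs \<subseteq> X"
  shows "local_avg X (real n * (\<epsilon> * real (length xs))) (steklov_list \<epsilon> xs ^^ n)"
  using assms by (intro local_avg_funpow local_avg_steklov_list) auto

section \<open>The random walk\<close>

definition walk_step :: "('i \<Rightarrow> real) \<Rightarrow> real \<Rightarrow> 'i \<Rightarrow> real" where
  "walk_step \<rho> h = (\<lambda>i. h * \<rho> i - h\<^sup>2 / 2 * (\<rho> i)\<^sup>2)"

definition walk :: "('i \<Rightarrow> real) \<Rightarrow> real \<Rightarrow> (('i \<Rightarrow> real) \<Rightarrow> real) \<Rightarrow> ('i \<Rightarrow> real) \<Rightarrow> real" where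
  "walk \<rho> h F z = (F (z + walk_step \<rho> h) + F (z + walk_step \<rho> (- h))) / 2"

definition walk_radius :: "'i set \<Rightarrow> ('i \<Rightarrow> real) \<Rightarrow> real \<Rightarrow> real" where
  "walk_radius X \<rho> h = l1_norm X (walk_step \<rho> h) + l1_norm X (walk_step \<rho> (- h))"

text \<open>Because of the drift of the steps, the generator annihilates every exponential \<open>exp (z i)\<close>.\<close>

definition walk_gen :: "'i set \<Rightarrow> ('i \<Rightarrow> real) \<Rightarrow> ('i \<Rightarrow> real) \<Rightarrow> ('i \<Rightarrow> 'i \<Rightarrow> real) \<Rightarrow> real" where
  "walk_gen X \<rho> p Q = quad_form X Q \<rho> / 2 - lin_form X p (\<lambda>i. (\<rho> i)\<^sup>2) / 2"

definition walk_gen_fun :: "'i set \<Rightarrow> ('i \<Rightarrow> real) \<Rightarrow> ('i \<Rightarrow> ('i \<Rightarrow> real) \<Rightarrow> real) \<Rightarrow>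
    ('i \<Rightarrow> 'i \<Rightarrow> ('i \<Rightarrow> real) \<Rightarrow> real) \<Rightarrow> ('i \<Rightarrow> real) \<Rightarrow> real" where
  "walk_gen_fun X \<rho> G H = (\<lambda>z. walk_gen X \<rho> (\<lambda>i. G i z) (\<lambda>i j. H i j z))"

lemma walk_step_tendsto: "filterlim (walk_step \<rho>) (at_origin X) (nhds 0)"
  unfolding filterlim_at_origin l1_norm_def walk_step_def
proof (rule tendsto_null_sum)
  fix i
  have "((\<lambda>h. \<bar>h * \<rho> i - h\<^sup>2 / 2 * (\<rho> i)\<^sup>2\<bar>) \<longlongrightarrow> \<bar>0 * \<rho> i - 0\<^sup>2 / 2 * (\<rho> i)\<^sup>2\<bar>) (nhds 0)"
    by (intro tendsto_intros filterlim_ident) simp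
  then show "((\<lambda>h. \<bar>h * \<rho> i - h\<^sup>2 / 2 * (\<rho> i)\<^sup>2\<bar>) \<longlongrightarrow> 0) (nhds 0)" by simp
qed

lemma walk_step_tendsto_right:
  "filterlim (walk_step \<rho>) (at_origin X) (at_right 0)"
  "filterlim (\<lambda>h. walk_step \<rho> (- h)) (at_origin X) (at_right 0)"
proof -
  show "filterlim (walk_step \<rho>) (at_origin X) (at_right 0)"
    by (rule filterlim_mono[OF walk_step_tendsto order_refl]) (simp add: at_within_le_nhds)
  have "((\<lambda>h::real. - h) \<longlongrightarrow> 0) (at_right 0)" by (auto intro!: tendsto_eq_intros)
  then show "filterlim (\<lambda>h. walk_step \<rho> (- h)) (at_origin X) (at_right 0)"
    by (rule filterlim_compose[OF walk_step_tendsto])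
qed

lemma l1_norm_walk_step:
  assumes "\<bar>h\<bar> \<le> 1"
  shows "l1_norm X (walk_step \<rho> h) \<le> \<bar>h\<bar> * (\<Sum>i\<in>X. \<bar>\<rho> i\<bar> + (\<rho> i)\<^sup>2)"
  unfolding l1_norm_def walk_step_def sum_distrib_left
proof (rule sum_mono)
  fix i
  have "h\<^sup>2 / 2 \<le> \<bar>h\<bar>" using mult_left_mono[OF assms, of "\<bar>h\<bar>"] by (simp add: power2_eq_square)
  then have "h\<^sup>2 / 2 * (\<rho> i)\<^sup>2 \<le> \<bar>h\<bar> * (\<rho> i)\<^sup>2" by (rule mult_right_mono) simp
  moreover have "\<bar>h * \<rho> i - h\<^sup>2 / 2 * (\<rho> i)\<^sup>2\<bar> \<le> \<bar>h * \<rho> i\<bar> + \<bar>h\<^sup>2 / 2 * (\<rho> i)\<^sup>2\<bar>"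
    by (rule abs_triangle_ineq4)
  ultimately show "\<bar>h * \<rho> i - h\<^sup>2 / 2 * (\<rho> i)\<^sup>2\<bar> \<le> \<bar>h\<bar> * (\<bar>\<rho> i\<bar> + (\<rho> i)\<^sup>2)"
    by (simp add: abs_mult distrib_left)
qed

lemma walk_radius_nonneg: "0 \<le> walk_radius X \<rho> h"
  by (simp add: walk_radius_def)

lemma local_avg_walk:
  assumes "finite X"
  shows "local_avg X (walk_radius X \<rho> h) (walk \<rho> h)"
proof
  fix F G :: "('a \<Rightarrow> real) \<Rightarrow> real" and z
  assume le: "\<And>v. (\<And>i. i \<in> X \<Longrightarrow> \<bar>v i\<bar> \<le> walk_radius X \<rho> h) \<Longrightarrow> F (z + v) \<le> G (z + v)"
  have "F (z + walk_step \<rho> k) \<le> G (z + walk_step \<rho> k)" if "k = h \<or> k = - h" for k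
  proof (rule le)
    fix i assume "i \<in> X"
    then have "\<bar>walk_step \<rho> k i\<bar> \<le> l1_norm X (walk_step \<rho> k)" by (rule abs_le_l1_norm[OF assms])
    also have "\<dots> \<le> walk_radius X \<rho> h" using that by (auto simp: walk_radius_def)
    finally show "\<bar>walk_step \<rho> k i\<bar> \<le> walk_radius X \<rho> h" .
  qed
  then show "walk \<rho> h F z \<le> walk \<rho> h G z" by (simp add: walk_def add_mono)
qed (simp_all add: walk_def fun_eq_iff ac_simps field_simps)

lemma local_avg_walk_funpow: "finite X \<Longrightarrow> local_avg X (real n * walk_radius X \<rho> h) (walk \<rho> h ^^ n)"
  by (intro local_avg_funpow local_avg_walk walk_radius_nonneg)

lemma (in local_avg) walk_commute:
  assumes "finite X" "bdd_ucont X F"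
  shows "E ((walk \<rho> h ^^ n) F) = (walk \<rho> h ^^ n) (E F)"
proof (induction n)
  case (Suc n)
  define F' where "F' = (walk \<rho> h ^^ n) F"
  have F': "bdd_ucont X F'"
    unfolding F'_def
    by (rule local_avg.bdd_ucont_avg[OF local_avg_walk_funpow[OF assms(1)] assms(2)])
  have "walk \<rho> h F' = (\<lambda>z. 1 / 2 * F' (z + walk_step \<rho> h) + 1 / 2 * F' (z + walk_step \<rho> (- h)))"
    by (simp add: walk_def fun_eq_iff add_divide_distrib)
  then have "E (walk \<rho> h F') = (\<lambda>z. 1 / 2 * E F' (z + walk_step \<rho> h)
      + 1 / 2 * E F' (z + walk_step \<rho> (- h)))"
    by (simp only: lincomb[OF bdd_ucont_translate[OF F'] bdd_ucont_translate[OF F']]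
      translate[OF F'])
  also have "\<dots> = walk \<rho> h (E F')" by (simp add: walk_def fun_eq_iff add_divide_distrib)
  finally show ?case using Suc unfolding F'_def by simp
qed simp

lemma walk_gen_fun_lincomb:
  "walk_gen_fun X \<rho> G H z = 1 / 2 * quad_form X (\<lambda>i j. H i j z) \<rho>
      + (- 1 / 2) * lin_form X (\<lambda>i. G i z) (\<lambda>i. (\<rho> i)\<^sup>2)"
  by (simp add: walk_gen_fun_def walk_gen_def)

lemma bdd_ucont_walk_gen_fun:
  "(\<And>i. i \<in> X \<Longrightarrow> bdd_ucont X (G i)) \<Longrightarrow> (\<And>i j. i \<in> X \<Longrightarrow> j \<in> X \<Longrightarrow> bdd_ucont X (H i j)) \<Longrightarrow>
    bdd_ucont X (walk_gen_fun X \<rho> G H)"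
  unfolding walk_gen_fun_lincomb[abs_def]
  by (intro bdd_ucont_add bdd_ucont_scale bdd_ucont_lin_form bdd_ucont_quad_form)

lemma Ck_walk_gen_fun:
  "\<forall>i\<in>X. Ck X k (G i) \<Longrightarrow> \<forall>i\<in>X. \<forall>j\<in>X. Ck X k (H i j) \<Longrightarrow> Ck X k (walk_gen_fun X \<rho> G H)"
  unfolding walk_gen_fun_lincomb[abs_def] lin_form_def quad_form_def
  by (intro Ck_lincomb Ck_sum Ck_scale) auto

lemma (in local_avg) walk_gen_fun:
  assumes "\<And>i. i \<in> X \<Longrightarrow> bdd_ucont X (G i)" "\<And>i j. i \<in> X \<Longrightarrow> j \<in> X \<Longrightarrow> bdd_ucont X (H i j)"
  shows "E (walk_gen_fun X \<rho> G H) = walk_gen_fun X \<rho> (\<lambda>i. E (G i)) (\<lambda>i j. E (H i j))"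
  unfolding walk_gen_fun_lincomb[abs_def] using assms
  by (subst lincomb) (simp_all add: lin_form quad_form bdd_ucont_lin_form bdd_ucont_quad_form)

lemma walk_quadratic:
  "(lin_form X p (walk_step \<rho> h) + quad_form X Q (walk_step \<rho> h) / 2
     + (lin_form X p (walk_step \<rho> (- h)) + quad_form X Q (walk_step \<rho> (- h)) / 2)) / 2
   = h\<^sup>2 * walk_gen X \<rho> p Q + h ^ 4 / 8 * quad_form X Q (\<lambda>i. (\<rho> i)\<^sup>2)"
proof -
  have "lin_form X p (walk_step \<rho> h) + lin_form X p (walk_step \<rho> (- h))
      = - h\<^sup>2 * lin_form X p (\<lambda>i. (\<rho> i)\<^sup>2)"
    unfolding lin_form_def sum.distrib[symmetric] sum_distrib_left
    by (intro sum.cong refl) (simp add: walk_step_def field_simps)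
  moreover have "quad_form X Q (walk_step \<rho> h) + quad_form X Q (walk_step \<rho> (- h))
     = 2 * h\<^sup>2 * quad_form X Q \<rho> + h ^ 4 / 2 * quad_form X Q (\<lambda>i. (\<rho> i)\<^sup>2)"
    unfolding quad_form_def sum.distrib[symmetric] sum_distrib_left
    by (intro sum.cong refl) (simp add: walk_step_def field_simps power2_eq_square power4_eq_xxxx)
  ultimately show ?thesis unfolding walk_gen_def by (simp add: field_simps)
qed

lemma walk_step_remainder:
  assumes X: "finite X" and F: "unif_C2 X F G H" and e: "0 < e"
  shows "\<forall>\<^sub>F h in at_right 0. \<forall>z. \<forall>k\<in>{h, - h}. \<bar>F (z + walk_step \<rho> k) - F z
      - lin_form X (\<lambda>i. G i z) (walk_step \<rho> k)
    - quad_form X (\<lambda>i j. H i j z) (walk_step \<rho> k) / 2\<bar> \<le> e * h\<^sup>2"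
proof -
  define c where "c = (\<Sum>i\<in>X. \<bar>\<rho> i\<bar> + (\<rho> i)\<^sup>2) + 1"
  have "0 \<le> (\<Sum>i\<in>X. \<bar>\<rho> i\<bar> + (\<rho> i)\<^sup>2)" by (intro sum_nonneg) auto
  then have c: "0 < c" "(\<Sum>i\<in>X. \<bar>\<rho> i\<bar> + (\<rho> i)\<^sup>2) \<le> c" by (auto simp: c_def)
  from e c(1) have "0 < e / c\<^sup>2" by simp
  note taylor = unif_C2_taylor[OF X F this]
  have "\<forall>\<^sub>F h::real in at_right 0. h \<in> {0<..<1}" by (rule eventually_at_right_real) simp
  from this taylor[THEN eventually_compose_filterlim, OF walk_step_tendsto_right(1)[of \<rho>]]
    taylor[THEN eventually_compose_filterlim, OF walk_step_tendsto_right(2)[of \<rho>]]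
  show ?thesis
  proof eventually_elim
    case (elim h)
    show ?case
    proof (intro allI ballI)
      fix z k assume k: "k \<in> {h, - h}"
      then have "\<bar>F (z + walk_step \<rho> k) - F z - lin_form X (\<lambda>i. G i z) (walk_step \<rho> k)
          - quad_form X (\<lambda>i j. H i j z) (walk_step \<rho> k) / 2\<bar>
          \<le> e / c\<^sup>2 * (l1_norm X (walk_step \<rho> k))\<^sup>2"
        using elim(2,3) by blast
      also have "\<dots> \<le> e / c\<^sup>2 * (h * c)\<^sup>2"
      proof (intro mult_left_mono power_mono)
        have "l1_norm X (walk_step \<rho> k) \<le> h * (\<Sum>i\<in>X. \<bar>\<rho> i\<bar> + (\<rho> i)\<^sup>2)"
          using l1_norm_walk_step[of k X \<rho>] elim(1) k by auto
        also have "\<dots> \<le> h * c" using c(2) elim(1) by (intro mult_left_mono) auto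
        finally show "l1_norm X (walk_step \<rho> k) \<le> h * c" .
      qed (use e in auto)
      also have "\<dots> = e * h\<^sup>2" using c(1) by (simp add: power_mult_distrib)
      finally show "\<bar>F (z + walk_step \<rho> k) - F z - lin_form X (\<lambda>i. G i z) (walk_step \<rho> k)
          - quad_form X (\<lambda>i j. H i j z) (walk_step \<rho> k) / 2\<bar> \<le> e * h\<^sup>2" .
    qed
  qed
qed

lemma walk_expand:
  assumes X: "finite X" and F: "unif_C2 X F G H" and e: "0 < e"
  shows "\<forall>\<^sub>F h in at_right 0. \<forall>z. \<bar>walk \<rho> h F z - F z - h\<^sup>2 * walk_gen_fun X \<rho> G H z\<bar> \<le> e * h\<^sup>2"
proof -
  have "bdd_ucont X (\<lambda>z. quad_form X (\<lambda>i j. H i j z) (\<lambda>i. (\<rho> i)\<^sup>2))"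
    using F by (intro bdd_ucont_quad_form) (auto simp: unif_C2_def)
  then obtain B where B: "\<And>z. \<bar>quad_form X (\<lambda>i j. H i j z) (\<lambda>i. (\<rho> i)\<^sup>2)\<bar> \<le> B"
    using bdd_ucont_bound by blast
  have "((\<lambda>h. h\<^sup>2 / 8 * B) \<longlongrightarrow> 0) (at_right 0)" by (auto intro!: tendsto_eq_intros)
  then have "\<forall>\<^sub>F h in at_right 0. h\<^sup>2 / 8 * B < e / 2" using e by (intro order_tendstoD(2)) auto
  moreover have "\<forall>\<^sub>F h in at_right 0. \<forall>z. \<forall>k\<in>{h, - h}. \<bar>F (z + walk_step \<rho> k) - F z
      - lin_form X (\<lambda>i. G i z) (walk_step \<rho> k) - quad_form X (\<lambda>i j. H i j z) (walk_step \<rho> k) / 2\<bar>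
      \<le> e / 2 * h\<^sup>2"
    using e by (intro walk_step_remainder[OF X F]) simp
  ultimately show ?thesis
  proof (eventually_elim, intro allI)
    fix h z
    define R where "R k = F (z + walk_step \<rho> k) - F z
      - lin_form X (\<lambda>i. G i z) (walk_step \<rho> k) - quad_form X (\<lambda>i j. H i j z) (walk_step \<rho> k) / 2"
        for k
    define q where "q = quad_form X (\<lambda>i j. H i j z) (\<lambda>i. (\<rho> i)\<^sup>2)"
    assume small: "h\<^sup>2 / 8 * B < e / 2"
      and "\<forall>z. \<forall>k\<in>{h, - h}. \<bar>F (z + walk_step \<rho> k) - F z
      - lin_form X (\<lambda>i. G i z) (walk_step \<rho> k) - quad_form X (\<lambda>i j. H i j z) (walk_step \<rho> k) / 2\<bar>
      \<le> e / 2 * h\<^sup>2"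
    then have R: "\<bar>R h\<bar> \<le> e / 2 * h\<^sup>2" "\<bar>R (- h)\<bar> \<le> e / 2 * h\<^sup>2" by (auto simp: R_def)
    have "h\<^sup>2 / 8 * \<bar>q\<bar> \<le> h\<^sup>2 / 8 * B" using B[of z] by (intro mult_left_mono) (simp_all add: q_def)
    then have "h\<^sup>2 / 8 * \<bar>q\<bar> \<le> e / 2" using small by linarith
    then have "h\<^sup>2 * (h\<^sup>2 / 8 * \<bar>q\<bar>) \<le> h\<^sup>2 * (e / 2)" by (rule mult_left_mono) simp
    then have "\<bar>h ^ 4 / 8 * q\<bar> \<le> e / 2 * h\<^sup>2"
      by (simp add: abs_mult power4_eq_xxxx power2_eq_square ac_simps)
    moreover have "walk \<rho> h F z - F z - h\<^sup>2 * walk_gen_fun X \<rho> G H z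
        = (R h + R (- h)) / 2 + h ^ 4 / 8 * q"
      using walk_quadratic[of X "\<lambda>i. G i z" \<rho> h "\<lambda>i j. H i j z"]
      unfolding R_def walk_def q_def walk_gen_fun_def by (simp add: field_simps)
    ultimately show "\<bar>walk \<rho> h F z - F z - h\<^sup>2 * walk_gen_fun X \<rho> G H z\<bar> \<le> e * h\<^sup>2"
      using R by argo
  qed
qed

lemma walk_funpow_increment:
  assumes X: "finite X" and F: "unif_C2 X F G H" and e: "0 < e"
  shows "\<forall>\<^sub>F h in at_right 0. \<forall>k z.
    \<bar>(walk \<rho> h ^^ Suc k) F z - (walk \<rho> h ^^ k) F z - h\<^sup>2 * (walk \<rho> h ^^ k) (walk_gen_fun X \<rho> G H) z\<bar>
    \<le> e * h\<^sup>2"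
  using walk_expand[OF X F e, of \<rho>]
proof (rule eventually_mono, intro allI)
  fix h k z
  let ?g = "walk_gen_fun X \<rho> G H"
  assume bound: "\<forall>z. \<bar>walk \<rho> h F z - F z - h\<^sup>2 * ?g z\<bar> \<le> e * h\<^sup>2"
  interpret P: local_avg X "real k * walk_radius X \<rho> h" "walk \<rho> h ^^ k"
    by (rule local_avg_walk_funpow[OF X])
  have u: "bdd_ucont X F" "bdd_ucont X (walk \<rho> h F)" "bdd_ucont X ?g"
    using F local_avg.bdd_ucont_avg[OF local_avg_walk[OF X]] bdd_ucont_walk_gen_fun[of X G H]
    by (auto simp: unif_C2_def)
  have "\<bar>(walk \<rho> h ^^ k) (\<lambda>z. walk \<rho> h F z - F z - h\<^sup>2 * ?g z) z\<bar> \<le> e * h\<^sup>2"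
    using bound u by (intro P.abs_le bdd_ucont_diff bdd_ucont_scale) auto
  then show "\<bar>(walk \<rho> h ^^ Suc k) F z - (walk \<rho> h ^^ k) F z - h\<^sup>2 * (walk \<rho> h ^^ k) ?g z\<bar> \<le> e * h\<^sup>2"
    using u by (simp add: P.diff P.scale bdd_ucont_diff bdd_ucont_scale funpow_swap1)
qed

lemma walk_funpow_close:
  assumes X: "finite X" and g: "bdd_ucont X g" and e: "0 < e"
  shows "\<forall>\<^sub>F h in at_right 0. \<forall>k z. \<bar>(walk \<rho> h ^^ Suc k) g z - (walk \<rho> h ^^ k) g z\<bar> \<le> e"
proof -
  note modulus = bdd_ucont_eventually[OF g e]
  from modulus[THEN eventually_compose_filterlim, OF walk_step_tendsto_right(1)[of \<rho>]]
    modulus[THEN eventually_compose_filterlim, OF walk_step_tendsto_right(2)[of \<rho>]]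
  show ?thesis
  proof (eventually_elim, intro allI)
    fix h k z
    assume steps: "\<forall>z. \<bar>g (z + walk_step \<rho> h) - g z\<bar> \<le> e"
      "\<forall>z. \<bar>g (z + walk_step \<rho> (- h)) - g z\<bar> \<le> e"
    have close: "\<bar>walk \<rho> h g z - g z\<bar> \<le> e" for z
      using steps[THEN spec, of z] unfolding walk_def by argo
    interpret P: local_avg X "real k * walk_radius X \<rho> h" "walk \<rho> h ^^ k"
      by (rule local_avg_walk_funpow[OF X])
    have u: "bdd_ucont X (walk \<rho> h g)" by (rule local_avg.bdd_ucont_avg[OF local_avg_walk[OF X] g])
    have "\<bar>(walk \<rho> h ^^ k) (\<lambda>z. walk \<rho> h g z - g z) z\<bar> \<le> e"
      using close u g by (intro P.abs_le bdd_ucont_diff) auto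
    then show "\<bar>(walk \<rho> h ^^ Suc k) g z - (walk \<rho> h ^^ k) g z\<bar> \<le> e"
      using u g by (simp add: P.diff funpow_swap1)
  qed
qed

lemma walk_funpow_increment_ge:
  assumes X: "finite X" and F: "unif_C2 X F G H" and e: "0 < e"
  shows "\<forall>\<^sub>F h in at_right 0. \<forall>k z. h\<^sup>2 * (walk \<rho> h ^^ Suc k) (walk_gen_fun X \<rho> G H) z - 2 * e * h\<^sup>2
    \<le> (walk \<rho> h ^^ Suc k) F z - (walk \<rho> h ^^ k) F z"
proof -
  define g where "g = walk_gen_fun X \<rho> G H"
  have "bdd_ucont X g"
    unfolding g_def using F by (intro bdd_ucont_walk_gen_fun) (auto simp: unif_C2_def)
  from walk_funpow_increment[OF X F e, of \<rho>, folded g_def] walk_funpow_close[OF X this e, of \<rho>]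
  show ?thesis
    unfolding g_def[symmetric]
  proof (eventually_elim, intro allI)
    fix h k z
    assume "\<forall>k z. \<bar>(walk \<rho> h ^^ Suc k) F z - (walk \<rho> h ^^ k) F z - h\<^sup>2 * (walk \<rho> h ^^ k) g z\<bar>
        \<le> e * h\<^sup>2"
      and "\<forall>k z. \<bar>(walk \<rho> h ^^ Suc k) g z - (walk \<rho> h ^^ k) g z\<bar> \<le> e"
    then have incr: "\<bar>(walk \<rho> h ^^ Suc k) F z - (walk \<rho> h ^^ k) F z - h\<^sup>2 * (walk \<rho> h ^^ k) g z\<bar>
        \<le> e * h\<^sup>2"
      and "\<bar>(walk \<rho> h ^^ Suc k) g z - (walk \<rho> h ^^ k) g z\<bar> \<le> e" by blast+
    then have "(walk \<rho> h ^^ Suc k) g z \<le> (walk \<rho> h ^^ k) g z + e" by linarith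
    then have "h\<^sup>2 * (walk \<rho> h ^^ Suc k) g z \<le> h\<^sup>2 * ((walk \<rho> h ^^ k) g z + e)"
      by (rule mult_left_mono) simp
    then show "h\<^sup>2 * (walk \<rho> h ^^ Suc k) g z - 2 * e * h\<^sup>2
        \<le> (walk \<rho> h ^^ Suc k) F z - (walk \<rho> h ^^ k) F z"
      using incr by (simp only: distrib_left) (simp add: algebra_simps abs_le_iff)
  qed
qed

lemma abs_telescope_le:
  fixes a :: "nat \<Rightarrow> real"
  assumes "\<And>k. k < n \<Longrightarrow> \<bar>a (Suc k) - a k - b\<bar> \<le> c"
  shows "\<bar>a n - a 0 - real n * b\<bar> \<le> real n * c"
  using assms
proof (induction n)
  case (Suc n)
  have "\<bar>a n - a 0 - real n * b\<bar> \<le> real n * c" "\<bar>a (Suc n) - a n - b\<bar> \<le> c" using Suc by auto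
  then show ?case by (simp add: distrib_right abs_le_iff)
qed simp

lemma walk_funpow_drift:
  assumes X: "finite X" and F: "unif_C2 X F G H"
  obtains C where "C > 0" "\<forall>\<^sub>F h in at_right 0. \<forall>n z. \<bar>(walk \<rho> h ^^ n) F z - F z\<bar>
      \<le> C * (real n * h\<^sup>2)"
proof -
  define g where "g = walk_gen_fun X \<rho> G H"
  have g: "bdd_ucont X g"
    unfolding g_def using F by (intro bdd_ucont_walk_gen_fun) (auto simp: unif_C2_def)
  obtain B where B: "B > 0" "\<And>z. \<bar>g z\<bar> \<le> B" using bdd_ucont_bound[OF g] by blast
  have "\<forall>\<^sub>F h in at_right 0. \<forall>n z. \<bar>(walk \<rho> h ^^ n) F z - F z\<bar> \<le> (1 + B) * (real n * h\<^sup>2)"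
    using walk_funpow_increment[OF X F, of 1 \<rho>, folded g_def, OF zero_less_one]
  proof (rule eventually_mono, intro allI)
    fix h n z
    assume incr: "\<forall>k z. \<bar>(walk \<rho> h ^^ Suc k) F z - (walk \<rho> h ^^ k) F z - h\<^sup>2 * (walk \<rho> h ^^ k) g z\<bar>
        \<le> 1 * h\<^sup>2"
    have "\<bar>(walk \<rho> h ^^ Suc k) F z - (walk \<rho> h ^^ k) F z - 0\<bar> \<le> (1 + B) * h\<^sup>2" for k
    proof -
      have "\<bar>(walk \<rho> h ^^ k) g z\<bar> \<le> B"
        using B(2) by (intro local_avg.abs_le[OF local_avg_walk_funpow[OF X] g])
      then have "\<bar>h\<^sup>2 * (walk \<rho> h ^^ k) g z\<bar> \<le> B * h\<^sup>2"
        by (simp add: abs_mult mult.commute[of B] mult_left_mono)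
      moreover have "(1 + B) * h\<^sup>2 = 1 * h\<^sup>2 + B * h\<^sup>2" by (rule distrib_right)
      ultimately show ?thesis
        using incr[rule_format, of k z] unfolding abs_le_iff by (intro conjI; linarith)
    qed
    from abs_telescope_le[where a = "\<lambda>k. (walk \<rho> h ^^ k) F z", OF this, of n]
    show "\<bar>(walk \<rho> h ^^ n) F z - F z\<bar> \<le> (1 + B) * (real n * h\<^sup>2)" by (simp add: ac_simps)
  qed
  then show ?thesis using B(1) by (intro that[of "1 + B"]) auto
qed

lemma walk_funpow_expand:
  assumes X: "finite X" and F: "unif_C2 X F G H" and g: "Ck X 2 (walk_gen_fun X \<rho> G H)"
    and e: "0 < e"
  obtains T where "T > 0" "\<forall>\<^sub>F h in at_right 0. \<forall>n z. real n * h\<^sup>2 \<le> T \<longrightarrow>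
    \<bar>(walk \<rho> h ^^ n) F z - F z - real n * h\<^sup>2 * walk_gen_fun X \<rho> G H z\<bar> \<le> e * (real n * h\<^sup>2)"
proof -
  define g where "g = walk_gen_fun X \<rho> G H"
  obtain G' H' where C2: "unif_C2 X g G' H'"
    using g unfolding g_def numeral_2_eq_2 by (rule Ck_unif_C2)
  obtain C where C: "C > 0" "\<forall>\<^sub>F h in at_right 0. \<forall>n z. \<bar>(walk \<rho> h ^^ n) g z - g z\<bar>
      \<le> C * (real n * h\<^sup>2)"
    by (rule walk_funpow_drift[OF X C2])
  define T where "T = e / (2 * C)"
  have T: "T > 0" "C * T = e / 2" using e C(1) by (auto simp: T_def)
  have "\<forall>\<^sub>F h in at_right 0. \<forall>k z.
      \<bar>(walk \<rho> h ^^ Suc k) F z - (walk \<rho> h ^^ k) F z - h\<^sup>2 * (walk \<rho> h ^^ k) g z\<bar> \<le> e / 2 * h\<^sup>2"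
    unfolding g_def using e by (intro walk_funpow_increment[OF X F]) simp
  with C(2) have "\<forall>\<^sub>F h in at_right 0. \<forall>n z. real n * h\<^sup>2 \<le> T \<longrightarrow>
      \<bar>(walk \<rho> h ^^ n) F z - F z - real n * h\<^sup>2 * g z\<bar> \<le> e * (real n * h\<^sup>2)"
  proof (eventually_elim, intro allI impI)
    fix h n z
    assume drift: "\<forall>n z. \<bar>(walk \<rho> h ^^ n) g z - g z\<bar> \<le> C * (real n * h\<^sup>2)" and n: "real n * h\<^sup>2 \<le> T"
      and incr: "\<forall>k z. \<bar>(walk \<rho> h ^^ Suc k) F z - (walk \<rho> h ^^ k) F z - h\<^sup>2 * (walk \<rho> h ^^ k) g z\<bar>
          \<le> e / 2 * h\<^sup>2"
    have "\<bar>(walk \<rho> h ^^ Suc k) F z - (walk \<rho> h ^^ k) F z - h\<^sup>2 * g z\<bar> \<le> e * h\<^sup>2" if "k < n" for k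
    proof -
      have "real k * h\<^sup>2 \<le> real n * h\<^sup>2" using that by (intro mult_right_mono) auto
      then have "C * (real k * h\<^sup>2) \<le> e / 2"
        using n C(1) unfolding T(2)[symmetric] by (intro mult_left_mono) auto
      then have "\<bar>(walk \<rho> h ^^ k) g z - g z\<bar> \<le> e / 2" using drift[rule_format, of k z] by linarith
      then have "\<bar>h\<^sup>2 * ((walk \<rho> h ^^ k) g z - g z)\<bar> \<le> e / 2 * h\<^sup>2"
        by (simp add: abs_mult mult.commute[of _ "h\<^sup>2"] mult_left_mono del: times_divide_eq_left
          times_divide_eq_right)
      then show ?thesis using incr[rule_format, of k z] unfolding abs_le_iff right_diff_distrib
        by (intro conjI; linarith)
    qed
    from abs_telescope_le[where a = "\<lambda>k. (walk \<rho> h ^^ k) F z", OF this]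
    show "\<bar>(walk \<rho> h ^^ n) F z - F z - real n * h\<^sup>2 * g z\<bar> \<le> e * (real n * h\<^sup>2)"
      by (simp add: ac_simps)
  qed
  then show ?thesis using T(1) that unfolding g_def by blast
qed

lemma exists_walk_scale:
  assumes "0 < T" "\<forall>\<^sub>F h in at_right 0. P h"
  obtains h n where "0 < h" "P h" "real n * h\<^sup>2 = T"
proof -
  have "filterlim (\<lambda>n. sqrt (T / real (Suc n))) (at_right 0) sequentially"
    using assms(1) by real_asymp
  from eventually_compose_filterlim[OF assms(2) this]
  obtain n where "P (sqrt (T / real (Suc n)))" by (auto simp: eventually_sequentially)
  then show ?thesis using assms(1) by (intro that[of "sqrt (T / real (Suc n))" "Suc n"]) simp_all
qed

section \<open>Second order jets and viscosity subsolutions\<close>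

definition has_jet2 ::
    "'i set \<Rightarrow> (('i \<Rightarrow> real) \<Rightarrow> real) \<Rightarrow> ('i \<Rightarrow> real) \<Rightarrow> ('i \<Rightarrow> real) \<Rightarrow> ('i \<Rightarrow> 'i \<Rightarrow> real) \<Rightarrow> bool" where
  "has_jet2 X \<phi> z p Q \<longleftrightarrow>
     (\<lambda>\<zeta>. \<phi> (z + \<zeta>) - \<phi> z - lin_form X p \<zeta>
     - quad_form X Q \<zeta> / 2) \<in> o[at_origin X](\<lambda>\<zeta>. (l1_norm X \<zeta>)\<^sup>2)"

lemma has_jet2_taylor:
  assumes "finite X" "unif_C2 X F G H"
  shows "has_jet2 X F z (\<lambda>i. G i z) (\<lambda>i j. H i j z)"
  unfolding has_jet2_def
proof (rule landau_o.smallI)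
  fix e :: real assume "e > 0"
  from unif_C2_taylor[OF assms this]
  show "\<forall>\<^sub>F \<zeta> in at_origin X. norm (F (z + \<zeta>) - F z - lin_form X (\<lambda>i. G i z) \<zeta>
      - quad_form X (\<lambda>i j. H i j z) \<zeta> / 2) \<le> e * norm ((l1_norm X \<zeta>)\<^sup>2)"
    by (rule eventually_mono) simp
qed

lemma has_jet2_lincomb:
  assumes "has_jet2 X \<phi> z p Q" "has_jet2 X \<psi> z p' Q'"
  shows "has_jet2 X (\<lambda>z. a * \<phi> z + b * \<psi> z) z (\<lambda>i. a * p i + b * p' i) (\<lambda>i j. a * Q i j
      + b * Q' i j)"
proof -
  have cmult: "(\<lambda>\<zeta>. c * f \<zeta>) \<in> o[at_origin X](\<lambda>\<zeta>. (l1_norm X \<zeta>)\<^sup>2)"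
    if "f \<in> o[at_origin X](\<lambda>\<zeta>. (l1_norm X \<zeta>)\<^sup>2)" for c :: real and f
    using that by (cases "c = 0") auto
  show ?thesis
    using sum_in_smallo(1)[OF cmult[of _ a, OF assms(1)[unfolded has_jet2_def]]
      cmult[of _ b, OF assms(2)[unfolded has_jet2_def]]]
    unfolding has_jet2_def lin_form_lincomb quad_form_lincomb
    by (simp add: algebra_simps add_divide_distrib)
qed

lemma has_jet2_separable:
  assumes X: "finite X" and \<psi>: "\<And>i. i \<in> X \<Longrightarrow>
    (\<lambda>t. \<psi> i (z i + t) - \<psi> i (z i) - t * a i - t\<^sup>2 * b i / 2) \<in> o[nhds 0](\<lambda>t::real. t\<^sup>2)"
  shows "has_jet2 X (\<lambda>z. \<Sum>i\<in>X. \<psi> i (z i)) z a (\<lambda>i j. if i = j then b i else 0)"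
proof -
  have "(\<lambda>\<zeta>. \<Sum>i\<in>X. \<psi> i (z i + \<zeta> i) - \<psi> i (z i) - \<zeta> i * a i - (\<zeta> i)\<^sup>2 * b i / 2)
      \<in> o[at_origin X](\<lambda>\<zeta>. (l1_norm X \<zeta>)\<^sup>2)"
  proof (rule big_sum_in_smallo)
    fix i assume i: "i \<in> X"
    have "(\<lambda>\<zeta>. \<psi> i (z i + \<zeta> i) - \<psi> i (z i) - \<zeta> i * a i
        - (\<zeta> i)\<^sup>2 * b i / 2) \<in> o[at_origin X](\<lambda>\<zeta>. (\<zeta> i)\<^sup>2)"
      using landau_o.small.compose[OF \<psi>[OF i] coord_tendsto_at_origin[OF X i]] .
    also have "(\<lambda>\<zeta>. (\<zeta> i)\<^sup>2) \<in> O[at_origin X](\<lambda>\<zeta>. (l1_norm X \<zeta>)\<^sup>2)"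
      using coord_bigo_at_origin[OF X i] by (rule landau_o.big_power)
    finally show "(\<lambda>\<zeta>. \<psi> i (z i + \<zeta> i) - \<psi> i (z i) - \<zeta> i * a i - (\<zeta> i)\<^sup>2 * b i / 2)
        \<in> o[at_origin X](\<lambda>\<zeta>. (l1_norm X \<zeta>)\<^sup>2)" .
  qed
  then show ?thesis
    unfolding has_jet2_def quad_form_diag[OF X]
    by (simp add: lin_form_def sum_subtractf sum_divide_distrib)
qed

lemma walk_gen_lincomb:
  "walk_gen X \<rho> (\<lambda>i. a * p i + b * p' i) (\<lambda>i j. a * Q i j + b * Q' i j)
      = a * walk_gen X \<rho> p Q + b * walk_gen X \<rho> p' Q'"
  by (simp add: walk_gen_def lin_form_lincomb quad_form_lincomb field_simps)

lemma walk_gen_diag: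
  "finite X \<Longrightarrow> walk_gen X \<rho> a (\<lambda>i j. if i = j then b i else 0) = (\<Sum>i\<in>X. (\<rho> i)\<^sup>2 * (b i - a i)) / 2"
  by (simp add: walk_gen_def quad_form_diag lin_form_def right_diff_distrib sum_subtractf
    diff_divide_distrib)

lemma smallo_at_imp_nhds:
  fixes f g :: "real \<Rightarrow> real"
  shows "f \<in> o[at a](g) \<Longrightarrow> f a = 0 \<Longrightarrow> f \<in> o[nhds a](g)"
  unfolding smallo_def eventually_nhds_conv_at by simp

subsection \<open>The sum of exponentials and the barrier\<close>

definition expsum :: "'i set \<Rightarrow> ('i \<Rightarrow> real) \<Rightarrow> real" where
  "expsum X z = (\<Sum>i\<in>X. exp (z i))"

lemma expsum_nonneg: "0 \<le> expsum X z"
  by (simp add: expsum_def sum_nonneg)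

lemma expsum_pos: "finite X \<Longrightarrow> X \<noteq> {} \<Longrightarrow> 0 < expsum X z"
  unfolding expsum_def by (intro sum_pos) auto

lemma has_jet2_expsum:
  assumes X: "finite X"
  shows "has_jet2 X (expsum X) z (\<lambda>i. exp (z i)) (\<lambda>i j. if i = j then exp (z i) else 0)"
  unfolding expsum_def[abs_def]
proof (rule has_jet2_separable[OF X])
  fix i
  have "(\<lambda>t::real. exp t - 1 - t - t\<^sup>2 / 2) \<in> o[at 0](\<lambda>t. t\<^sup>2)" by real_asymp
  then have "(\<lambda>t. exp (z i) * (exp t - 1 - t - t\<^sup>2 / 2)) \<in> o[nhds 0](\<lambda>t. t\<^sup>2)"
    by (simp add: smallo_at_imp_nhds)
  then show "(\<lambda>t. exp (z i + t) - exp (z i) - t * exp (z i)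
      - t\<^sup>2 * exp (z i) / 2) \<in> o[nhds 0](\<lambda>t. t\<^sup>2)"
    by (simp add: exp_add algebra_simps)
qed

lemma walk_gen_expsum:
  "finite X \<Longrightarrow> walk_gen X \<rho> (\<lambda>i. exp (z i)) (\<lambda>i j. if i = j then exp (z i) else 0) = 0"
  by (simp add: walk_gen_diag)

text \<open>The barrier forces the maximum of a comparison function into the interior of a cube; for
  \<open>s = \<Sum> (\<rho> i)\<^sup>2\<close> its time dependent part compensates what the generator does to the quartic.\<close>

definition barrier :: "'i set \<Rightarrow> real \<Rightarrow> real \<Rightarrow> ('i \<Rightarrow> real) \<Rightarrow> real" where
  "barrier X s t \<zeta> = (\<Sum>i\<in>X. (\<zeta> i) ^ 4) + 8 * s * t * (\<Sum>i\<in>X. (\<zeta> i)\<^sup>2) + 8 * s\<^sup>2 * t\<^sup>2"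

definition barrier_grad :: "real \<Rightarrow> real \<Rightarrow> ('i \<Rightarrow> real) \<Rightarrow> 'i \<Rightarrow> real" where
  "barrier_grad s t \<zeta> i = 4 * (\<zeta> i) ^ 3 + 16 * s * t * \<zeta> i"

definition barrier_hess :: "real \<Rightarrow> real \<Rightarrow> ('i \<Rightarrow> real) \<Rightarrow> 'i \<Rightarrow> 'i \<Rightarrow> real" where
  "barrier_hess s t \<zeta> i j = (if i = j then 12 * (\<zeta> i)\<^sup>2 + 16 * s * t else 0)"

lemma barrier_nonneg: "0 \<le> s \<Longrightarrow> 0 \<le> t \<Longrightarrow> 0 \<le> barrier X s t \<zeta>"
  unfolding barrier_def by (intro add_nonneg_nonneg mult_nonneg_nonneg sum_nonneg) auto

lemma barrier_ge_power4:
  assumes "finite X" "i \<in> X" "0 \<le> s" "0 \<le> t"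
  shows "(\<zeta> i) ^ 4 \<le> barrier X s t \<zeta>"
proof -
  have "(\<zeta> i) ^ 4 \<le> (\<Sum>i\<in>X. (\<zeta> i) ^ 4)" using assms by (intro member_le_sum) auto
  moreover have "0 \<le> 8 * s * t * (\<Sum>i\<in>X. (\<zeta> i)\<^sup>2)" "0 \<le> 8 * s\<^sup>2 * t\<^sup>2"
    using assms by (auto intro!: mult_nonneg_nonneg sum_nonneg)
  ultimately show ?thesis unfolding barrier_def by linarith
qed

lemma barrier_decrement:
  "barrier X s t \<zeta> - barrier X s (t - k) \<zeta>
      = k * (8 * s * (\<Sum>i\<in>X. (\<zeta> i)\<^sup>2) + 16 * s\<^sup>2 * t) - 8 * s\<^sup>2 * k\<^sup>2"
  by (simp add: barrier_def algebra_simps power2_eq_square)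

lemma quartic_jet:
  "(\<lambda>t. ((s + t) ^ 4 + \<beta> * (s + t)\<^sup>2) - (s ^ 4 + \<beta> * s\<^sup>2) - t * (4 * s ^ 3 + 2 * \<beta> * s)
      - t\<^sup>2 * (12 * s\<^sup>2 + 2 * \<beta>) / 2)
    \<in> o[nhds 0](\<lambda>t::real. t\<^sup>2)"
proof (rule smallo_at_imp_nhds)
  have "(\<lambda>t::real. t ^ 3) \<in> o[at 0](\<lambda>t. t\<^sup>2)" "(\<lambda>t::real. t ^ 4) \<in> o[at 0](\<lambda>t. t\<^sup>2)" by real_asymp+
  then have "(\<lambda>t. 4 * s * t ^ 3 + t ^ 4) \<in> o[at 0](\<lambda>t. t\<^sup>2)" by (intro sum_in_smallo) auto
  moreover have "((s + t) ^ 4 + \<beta> * (s + t)\<^sup>2) - (s ^ 4 + \<beta> * s\<^sup>2) - t * (4 * s ^ 3 + 2 * \<beta> * s)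
      - t\<^sup>2 * (12 * s\<^sup>2 + 2 * \<beta>) / 2 = 4 * s * t ^ 3 + t ^ 4" for t
    by (simp add: power4_eq_xxxx power3_eq_cube power2_eq_square field_simps)
  ultimately show "(\<lambda>t. ((s + t) ^ 4 + \<beta> * (s + t)\<^sup>2) - (s ^ 4 + \<beta> * s\<^sup>2)
      - t * (4 * s ^ 3 + 2 * \<beta> * s)
      - t\<^sup>2 * (12 * s\<^sup>2 + 2 * \<beta>) / 2) \<in> o[at 0](\<lambda>t. t\<^sup>2)" by simp
qed simp

lemma has_jet2_barrier:
  assumes X: "finite X"
  shows "has_jet2 X (\<lambda>z. barrier X s t (z - z0)) z
    (barrier_grad s t (z - z0)) (barrier_hess s t (z - z0))"
proof -
  have "has_jet2 X (\<lambda>z. \<Sum>i\<in>X. (z i - z0 i) ^ 4 + 8 * s * t * (z i - z0 i)\<^sup>2) z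
      (barrier_grad s t (z - z0)) (\<lambda>i j. if i = j then 12 * ((z - z0) i)\<^sup>2 + 16 * s * t else 0)"
  proof (rule has_jet2_separable[OF X])
    fix i
    show "(\<lambda>h. (z i + h - z0 i) ^ 4 + 8 * s * t * (z i + h - z0 i)\<^sup>2
        - ((z i - z0 i) ^ 4 + 8 * s * t * (z i - z0 i)\<^sup>2)
        - h * barrier_grad s t (z - z0) i
        - h\<^sup>2 * (12 * ((z - z0) i)\<^sup>2 + 16 * s * t) / 2) \<in> o[nhds 0](\<lambda>h. h\<^sup>2)"
      using quartic_jet[of "z i - z0 i" "8 * s * t"] by (simp add: barrier_grad_def algebra_simps)
  qed
  moreover have "barrier X s t (z - z0)
      = (\<Sum>i\<in>X. (z i - z0 i) ^ 4 + 8 * s * t * (z i - z0 i)\<^sup>2) + 8 * s\<^sup>2 * t\<^sup>2" for z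
    by (simp add: barrier_def sum.distrib sum_distrib_left)
  ultimately show ?thesis by (simp add: has_jet2_def barrier_hess_def[abs_def])
qed

lemma walk_gen_barrier_le:
  assumes X: "finite X" and \<zeta>: "\<And>i. i \<in> X \<Longrightarrow> \<bar>\<zeta> i\<bar> \<le> 1" and t: "0 \<le> t" and s: "s = (\<Sum>i\<in>X. (\<rho> i)\<^sup>2)"
  shows "walk_gen X \<rho> (barrier_grad s t \<zeta>) (barrier_hess s t \<zeta>)
      \<le> 8 * s * (\<Sum>i\<in>X. (\<zeta> i)\<^sup>2) + 16 * s\<^sup>2 * t"
proof -
  have s0: "0 \<le> s" unfolding s by (intro sum_nonneg) auto
  have "walk_gen X \<rho> (barrier_grad s t \<zeta>) (barrier_hess s t \<zeta>)
      = (\<Sum>i\<in>X. (\<rho> i)\<^sup>2 * ((12 * (\<zeta> i)\<^sup>2 + 16 * s * t - (4 * (\<zeta> i) ^ 3 + 16 * s * t * \<zeta> i)) / 2))"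
    unfolding barrier_hess_def[abs_def] barrier_grad_def[abs_def] walk_gen_diag[OF X]
    by (simp add: sum_divide_distrib)
  also have "\<dots> \<le> (\<Sum>i\<in>X. (\<rho> i)\<^sup>2 * (8 * (\<zeta> i)\<^sup>2 + 16 * s * t))"
  proof (intro sum_mono mult_left_mono)
    fix i assume "i \<in> X"
    then have le: "- \<zeta> i \<le> 1" using \<zeta> by force
    have "(\<zeta> i)\<^sup>2 * (- \<zeta> i) \<le> (\<zeta> i)\<^sup>2 * 1" "16 * s * t * (- \<zeta> i) \<le> 16 * s * t * 1"
      using le s0 t by (intro mult_left_mono; simp)+
    then show "(12 * (\<zeta> i)\<^sup>2 + 16 * s * t - (4 * (\<zeta> i) ^ 3 + 16 * s * t * \<zeta> i)) / 2
        \<le> 8 * (\<zeta> i)\<^sup>2 + 16 * s * t"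
      by (simp add: power2_eq_square power3_eq_cube)
  qed simp
  also have "\<dots> = (\<Sum>i\<in>X. (\<rho> i)\<^sup>2 * (8 * (\<zeta> i)\<^sup>2)) + (\<Sum>i\<in>X. (\<rho> i)\<^sup>2) * (16 * s * t)"
    by (simp add: distrib_left sum.distrib sum_distrib_right)
  also have "\<dots> \<le> (\<Sum>i\<in>X. s * (8 * (\<zeta> i)\<^sup>2)) + s * (16 * s * t)"
    using X unfolding s by (intro add_mono sum_mono mult_right_mono order_refl member_le_sum) auto
  finally show ?thesis by (simp add: power2_eq_square sum_distrib_left ac_simps)
qed

subsection \<open>Sequential compactness\<close>

definition seq_compact_on :: "'i set \<Rightarrow> ('i \<Rightarrow> real) set \<Rightarrow> bool" where
  "seq_compact_on X B \<longleftrightarrow> (\<forall>s::nat \<Rightarrow> 'i \<Rightarrow> real. range s \<subseteq> B \<longrightarrow>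
     (\<exists>r. \<exists>l\<in>B. strict_mono r \<and> (\<forall>i\<in>X. (\<lambda>n. s (r n) i) \<longlonglongrightarrow> l i)))"

definition seq_cont_on :: "'i set \<Rightarrow> ('i \<Rightarrow> real) set \<Rightarrow> (('i \<Rightarrow> real) \<Rightarrow> real) \<Rightarrow> bool" where
  "seq_cont_on X B f \<longleftrightarrow> (\<forall>s l. range s \<subseteq> B \<longrightarrow> l \<in> B \<longrightarrow> (\<forall>i\<in>X. (\<lambda>n. s n i) \<longlonglongrightarrow> l i) \<longrightarrow>
     (\<lambda>n. f (s n)) \<longlonglongrightarrow> f l)"

definition cube :: "'i set \<Rightarrow> ('i \<Rightarrow> real) \<Rightarrow> real \<Rightarrow> ('i \<Rightarrow> real) set" where
  "cube X z r = {y. \<forall>i\<in>X. \<bar>y i - z i\<bar> \<le> r}"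

lemma seq_compact_onE:
  fixes s :: "nat \<Rightarrow> 'i \<Rightarrow> real"
  assumes "seq_compact_on X B" "\<And>n. s n \<in> B"
  obtains r l where "strict_mono r" "l \<in> B" "\<And>i. i \<in> X \<Longrightarrow> (\<lambda>n. s (r n) i) \<longlonglongrightarrow> l i"
proof -
  have "range s \<subseteq> B" using assms(2) by blast
  from assms(1)[unfolded seq_compact_on_def, rule_format, OF this] show ?thesis
    by (auto intro: that)
qed

lemma seq_cont_onD:
  fixes s :: "nat \<Rightarrow> 'i \<Rightarrow> real"
  shows "seq_cont_on X B f \<Longrightarrow> (\<And>n. s n \<in> B) \<Longrightarrow> l \<in> B \<Longrightarrow> (\<And>i. i \<in> X \<Longrightarrow> (\<lambda>n. s n i) \<longlonglongrightarrow> l i) \<Longrightarrow>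
      (\<lambda>n. f (s n)) \<longlonglongrightarrow> f l"
  unfolding seq_cont_on_def by blast

lemma seq_cont_on_diff: "seq_cont_on X B f \<Longrightarrow> seq_cont_on X B g \<Longrightarrow> seq_cont_on X B (\<lambda>z. f z - g z)"
  unfolding seq_cont_on_def by (intro allI impI tendsto_diff) simp_all

lemma seq_cont_on_add: "seq_cont_on X B f \<Longrightarrow> seq_cont_on X B g \<Longrightarrow> seq_cont_on X B (\<lambda>z. f z + g z)"
  unfolding seq_cont_on_def by (intro allI impI tendsto_add) simp_all

lemma seq_cont_on_cmult: "seq_cont_on X B f \<Longrightarrow> seq_cont_on X B (\<lambda>z. c * f z)"
  unfolding seq_cont_on_def by (intro allI impI tendsto_mult_left) simp_all

lemma seq_cont_on_subset: "seq_cont_on X B f \<Longrightarrow> A \<subseteq> B \<Longrightarrow> seq_cont_on X A f"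
  unfolding seq_cont_on_def by blast

lemma seq_cont_on_cong:
  assumes "seq_cont_on X B f" "z \<in> B" "z' \<in> B" "\<And>i. i \<in> X \<Longrightarrow> z i = z' i"
  shows "f z = f z'"
  using seq_cont_onD[OF assms(1), of "\<lambda>_. z" z'] assms by (simp add: LIMSEQ_const_iff)

lemma seq_cont_on_separable:
  assumes "\<And>i x. i \<in> X \<Longrightarrow> isCont (\<psi> i) x"
  shows "seq_cont_on X B (\<lambda>z. \<Sum>i\<in>X. \<psi> i (z i))"
  unfolding seq_cont_on_def using assms
  by (intro allI impI tendsto_sum) (rule isCont_tendsto_compose, simp_all)

lemma l1_norm_diff_tendsto:
  assumes "\<And>i. i \<in> X \<Longrightarrow> (\<lambda>n. s n i) \<longlonglongrightarrow> l i"
  shows "filterlim (\<lambda>n. s n - l) (at_origin X) sequentially"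
  unfolding filterlim_at_origin l1_norm_def
proof (rule tendsto_null_sum)
  fix i assume "i \<in> X"
  then have "(\<lambda>n. \<bar>s n i - l i\<bar>) \<longlonglongrightarrow> \<bar>l i - l i\<bar>" using assms by (intro tendsto_intros)
  then show "(\<lambda>n. \<bar>(s n - l) i\<bar>) \<longlonglongrightarrow> 0" by simp
qed

lemma seq_cont_on_bdd_ucont:
  assumes F: "bdd_ucont X F"
  shows "seq_cont_on X B F"
  unfolding seq_cont_on_def
proof (intro allI impI)
  fix s :: "nat \<Rightarrow> 'a \<Rightarrow> real" and l assume "\<forall>i\<in>X. (\<lambda>n. s n i) \<longlonglongrightarrow> l i"
  then have lim: "filterlim (\<lambda>n. s n - l) (at_origin X) sequentially"
    by (intro l1_norm_diff_tendsto) simp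
  have "((\<lambda>\<zeta>. F (l + \<zeta>)) \<longlongrightarrow> F l) (at_origin X)"
    by (rule tendsto_uniform_limitI[OF conjunct2[OF F[unfolded bdd_ucont_def]] UNIV_I])
  from filterlim_compose[OF this lim] show "(\<lambda>n. F (s n)) \<longlonglongrightarrow> F l" by simp
qed

lemma compact_image_seq_cont_on:
  assumes "seq_compact_on X B" "seq_cont_on X B f"
  shows "compact (f ` B)"
  unfolding compact_eq_seq_compact_metric seq_compact_def
proof (intro allI impI)
  fix y :: "nat \<Rightarrow> real" assume "\<forall>n. y n \<in> f ` B"
  then obtain s where s: "\<And>n. s n \<in> B" "\<And>n. y n = f (s n)" unfolding image_iff by metis
  obtain r l where r: "strict_mono r" "l \<in> B" "\<And>i. i \<in> X \<Longrightarrow> (\<lambda>n. s (r n) i) \<longlonglongrightarrow> l i"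
    using seq_compact_onE[OF assms(1), of s] s(1) by blast
  then have "(\<lambda>n. f (s (r n))) \<longlonglongrightarrow> f l"
    using s(1) by (intro seq_cont_onD[OF assms(2), where s = "\<lambda>n. s (r n)"])
  then show "\<exists>l\<in>f ` B. \<exists>r. strict_mono r \<and> (y \<circ> r) \<longlonglongrightarrow> l" using r(1,2) s(2) by (auto simp: o_def)
qed

lemma seq_cont_on_bounded:
  assumes "seq_compact_on X B" "seq_cont_on X B f"
  obtains M where "\<And>z. z \<in> B \<Longrightarrow> \<bar>f z\<bar> \<le> M"
  using compact_imp_bounded[OF compact_image_seq_cont_on[OF assms]] that by (auto simp: bounded_iff)

lemma seq_cont_on_attains_sup:
  assumes "seq_compact_on X B" "B \<noteq> {}" "seq_cont_on X B f"
  obtains z where "z \<in> B" "\<And>y. y \<in> B \<Longrightarrow> f y \<le> f z"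
  using compact_attains_sup[OF compact_image_seq_cont_on[OF assms(1,3)]] assms(2) that by blast

lemma seq_cont_on_uniform:
  assumes B: "seq_compact_on X B" and f: "seq_cont_on X B f" and e: "0 < e"
  obtains d where "d > 0" "\<And>y z. y \<in> B \<Longrightarrow> z \<in> B \<Longrightarrow> (\<And>i. i \<in> X \<Longrightarrow> \<bar>y i - z i\<bar> < d) \<Longrightarrow> \<bar>f y - f z\<bar> < e"
proof (rule ccontr)
  assume "\<not> thesis"
  have "\<exists>y z. y \<in> B \<and> z \<in> B \<and> (\<forall>i\<in>X. \<bar>y i - z i\<bar> < 1 / real (Suc n)) \<and> e \<le> \<bar>f y - f z\<bar>" for n
  proof (rule ccontr)
    assume "\<nexists>y z. y \<in> B \<and> z \<in> B \<and> (\<forall>i\<in>X. \<bar>y i - z i\<bar> < 1 / real (Suc n)) \<and> e \<le> \<bar>f y - f z\<bar>"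
    then have "thesis" by (intro that[of "1 / real (Suc n)"]) (simp, meson not_le)
    with \<open>\<not> thesis\<close> show False ..
  qed
  then have "\<forall>n. \<exists>y z. y \<in> B \<and> z \<in> B \<and> (\<forall>i\<in>X. \<bar>y i - z i\<bar> < 1 / real (Suc n)) \<and> e \<le> \<bar>f y - f z\<bar>"
    by blast
  then obtain y z where "\<forall>n. y n \<in> B \<and> z n \<in> B \<and> (\<forall>i\<in>X. \<bar>y n i - z n i\<bar> < 1 / real (Suc n)) \<and>
      e \<le> \<bar>f (y n) - f (z n)\<bar>" by metis
  then have y: "\<And>n. y n \<in> B" and z: "\<And>n. z n \<in> B" and far: "\<And>n. e \<le> \<bar>f (y n) - f (z n)\<bar>"
    and close: "\<And>n i. i \<in> X \<Longrightarrow> \<bar>y n i - z n i\<bar> < 1 / real (Suc n)" by blast+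
  obtain r l where r: "strict_mono r" "l \<in> B" and lim: "\<And>i. i \<in> X \<Longrightarrow> (\<lambda>n. z (r n) i) \<longlonglongrightarrow> l i"
    using seq_compact_onE[OF B, of z] z by blast
  have "(\<lambda>n. y (r n) i) \<longlonglongrightarrow> l i" if "i \<in> X" for i
  proof -
    have "(\<lambda>n. 1 / real (Suc (r n))) \<longlonglongrightarrow> 0"
      using LIMSEQ_subseq_LIMSEQ[OF LIMSEQ_inverse_real_of_nat r(1)]
      by (simp add: o_def inverse_eq_divide)
    then have "(\<lambda>n. y (r n) i - z (r n) i) \<longlonglongrightarrow> 0"
      by (rule Lim_null_comparison[rotated]) (use close[OF that] in \<open>simp add: less_imp_le\<close>)
    from tendsto_add[OF this lim[OF that]] show ?thesis by simp
  qed
  then have "(\<lambda>n. \<bar>f (y (r n)) - f (z (r n))\<bar>) \<longlonglongrightarrow> \<bar>f l - f l\<bar>"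
    using y z r(2) lim
    by (intro tendsto_intros seq_cont_onD[OF f, where s = "\<lambda>n. y (r n)"]
      seq_cont_onD[OF f, where s = "\<lambda>n. z (r n)"])
  then have "e \<le> \<bar>f l - f l\<bar>" using far by (intro LIMSEQ_le_const) auto
  then show False using e by simp
qed

lemma bounded_coords_convergent_subsequence:
  fixes s :: "nat \<Rightarrow> 'i \<Rightarrow> real"
  assumes "finite X" "\<And>i. i \<in> X \<Longrightarrow> bounded (range (\<lambda>n. s n i))"
  obtains r l where "strict_mono r" "\<And>i. i \<in> X \<Longrightarrow> (\<lambda>n. s (r n) i) \<longlonglongrightarrow> l i"
proof -
  have "\<forall>\<delta>\<subseteq>X. \<exists>l r. strict_mono r \<and> (\<forall>\<epsilon>>0. \<forall>\<^sub>F n in sequentially. \<forall>i\<in>\<delta>. dist (s (r n) i) (l i) < \<epsilon>)"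
    using assms by (intro compact_lemma_general[where unproj = "\<lambda>e. e"]) (auto simp: image_image)
  then obtain l r where r: "strict_mono r"
    "\<And>\<epsilon>. \<epsilon> > 0 \<Longrightarrow> \<forall>\<^sub>F n in sequentially. \<forall>i\<in>X. dist (s (r n) i) (l i) < \<epsilon>"
    by blast
  have "(\<lambda>n. s (r n) i) \<longlonglongrightarrow> l i" if "i \<in> X" for i
    using that by (intro tendstoI eventually_mono[OF r(2)]) auto
  then show ?thesis by (rule that[OF r(1)])
qed

lemma seq_compact_on_cube:
  assumes "finite X"
  shows "seq_compact_on X (cube X z r)"
  unfolding seq_compact_on_def
proof (intro allI impI)
  fix s :: "nat \<Rightarrow> 'a \<Rightarrow> real" assume s: "range s \<subseteq> cube X z r"
  have in_cube: "\<bar>s n i - z i\<bar> \<le> r" if "i \<in> X" for n i using s that by (auto simp: cube_def)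
  have bdd: "bounded (range (\<lambda>n. s n i))" if "i \<in> X" for i
  proof -
    have "\<bar>s n i\<bar> \<le> r + \<bar>z i\<bar>" for n using in_cube[OF that, of n] by linarith
    then show ?thesis by (auto simp: bounded_iff)
  qed
  obtain q l where q: "strict_mono q" "\<And>i. i \<in> X \<Longrightarrow> (\<lambda>n. s (q n) i) \<longlonglongrightarrow> l i"
    using bounded_coords_convergent_subsequence[where s = s, OF assms bdd] by blast
  have "\<bar>l i - z i\<bar> \<le> r" if "i \<in> X" for i
  proof (rule LIMSEQ_le_const2)
    show "(\<lambda>n. \<bar>s (q n) i - z i\<bar>) \<longlonglongrightarrow> \<bar>l i - z i\<bar>" using q(2)[OF that] by (intro tendsto_intros)
  qed (use in_cube[OF that] in auto)
  then show "\<exists>r'. \<exists>l\<in>cube X z r. strict_mono r' \<and> (\<forall>i\<in>X. (\<lambda>n. s (r' n) i) \<longlonglongrightarrow> l i)"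
    using q by (intro exI[of _ q] bexI[of _ l]) (auto simp: cube_def)
qed

lemma cube_mono: "z \<in> cube X zb r \<Longrightarrow> r \<le> t \<Longrightarrow> z \<in> cube X zb t"
  unfolding cube_def by force

lemma cube_shift:
  assumes "z \<in> cube X zb r" "\<And>i. i \<in> X \<Longrightarrow> \<bar>v i\<bar> \<le> s" "r + s \<le> t"
  shows "z + v \<in> cube X zb t"
  unfolding cube_def
proof (intro CollectI ballI)
  fix i assume "i \<in> X"
  then have "\<bar>z i - zb i\<bar> \<le> r" "\<bar>v i\<bar> \<le> s" using assms by (auto simp: cube_def)
  then show "\<bar>(z + v) i - zb i\<bar> \<le> t" using assms(3) by simp
qed

lemma eventually_in_cube:
  assumes X: "finite X" and z: "\<And>i. i \<in> X \<Longrightarrow> \<bar>z i - z0 i\<bar> < r"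
  shows "\<forall>\<^sub>F \<zeta> in at_origin X. \<forall>i\<in>X. \<bar>(z + \<zeta>) i - z0 i\<bar> < r"
proof (intro eventually_ball_finite[OF X] ballI)
  fix i assume i: "i \<in> X"
  have "((\<lambda>\<zeta>. \<bar>z i + \<zeta> i - z0 i\<bar>) \<longlongrightarrow> \<bar>z i + 0 - z0 i\<bar>) (at_origin X)"
    by (intro tendsto_intros coord_tendsto_at_origin X i)
  then show "\<forall>\<^sub>F \<zeta> in at_origin X. \<bar>(z + \<zeta>) i - z0 i\<bar> < r"
    using z[OF i] by (auto dest: order_tendstoD(2))
qed

subsection \<open>The mean value inequality\<close>

definition local_subsolution ::
    "'i set \<Rightarrow> ('i \<Rightarrow> real) \<Rightarrow> real \<Rightarrow> ('i \<Rightarrow> real) \<Rightarrow> real \<Rightarrow> (('i \<Rightarrow> real) \<Rightarrow> real) \<Rightarrow> bool" where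
  "local_subsolution X zb R \<rho> K V \<longleftrightarrow> (\<forall>z \<phi> p Q. (\<forall>i\<in>X. \<bar>z i - zb i\<bar> < R) \<longrightarrow> has_jet2 X \<phi> z p Q \<longrightarrow>
     (\<forall>\<^sub>F \<zeta> in at_origin X. V (z + \<zeta>) - V z \<le> \<phi> (z + \<zeta>) - \<phi> z) \<longrightarrow>
     - K * expsum X z \<le> walk_gen X \<rho> p Q)"

lemma local_subsolution_interior_max:
  assumes X: "finite X" and sub: "local_subsolution X zb R \<rho> K V"
    and z: "\<And>i. i \<in> X \<Longrightarrow> \<bar>z i - zb i\<bar> < R"
    and jet: "has_jet2 X \<Phi> z p Q" and interior: "\<And>i. i \<in> X \<Longrightarrow> \<bar>z i - z0 i\<bar> < r"
    and max: "\<And>y. y \<in> cube X z0 r \<Longrightarrow> V y - \<Phi> y \<le> V z - \<Phi> z"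
  shows "- K * expsum X z \<le> walk_gen X \<rho> p Q"
proof -
  have "\<forall>\<^sub>F \<zeta> in at_origin X. V (z + \<zeta>) - V z \<le> \<Phi> (z + \<zeta>) - \<Phi> z"
    using eventually_in_cube[OF X interior]
  proof (rule eventually_mono)
    fix \<zeta> assume "\<forall>i\<in>X. \<bar>(z + \<zeta>) i - z0 i\<bar> < r"
    then have "z + \<zeta> \<in> cube X z0 r" by (auto simp: cube_def intro: less_imp_le)
    from max[OF this] show "V (z + \<zeta>) - V z \<le> \<Phi> (z + \<zeta>) - \<Phi> z" by linarith
  qed
  then show ?thesis using sub jet z unfolding local_subsolution_def by blast
qed

lemma seq_cont_on_comparison:
  assumes "bdd_ucont X V" "bdd_ucont X \<Psi>"
  shows "seq_cont_on X B (\<lambda>z. V z - (\<Psi> z + c * expsum X z + C * barrier X s t (z - z0)))"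
proof -
  have eq: "(\<lambda>z. V z - (\<Psi> z + c * expsum X z + C * barrier X s t (z - z0))) =
      (\<lambda>z. V z - (\<Psi> z +
        (\<Sum>i\<in>X. c * exp (z i) + C * ((z i - z0 i) ^ 4 + 8 * s * t * (z i - z0 i)\<^sup>2)) +
        C * (8 * s\<^sup>2 * t\<^sup>2)))"
    by (simp add: fun_eq_iff expsum_def barrier_def sum.distrib sum_distrib_left distrib_left)
  show ?thesis
    unfolding eq
    by (intro seq_cont_on_diff[OF seq_cont_on_bdd_ucont[OF assms(1)]] seq_cont_on_add
      seq_cont_on_separable
        seq_cont_on_bdd_ucont[OF assms(2)] seq_cont_on_bdd_ucont[OF bdd_ucont_const]
            continuous_intros)
qed

text \<open>One step of the maximum principle, with the walk acting on a test function; this replaces the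
  doubling of variables.\<close>

lemma cube_interior_of_barrier_less:
  assumes X: "finite X" and st: "0 \<le> s" "0 \<le> t"
    and y: "y \<in> cube X z0 r" "barrier X s t (y - z0) < r ^ 4" and i: "i \<in> X"
  shows "\<bar>y i - z0 i\<bar> < r"
proof (rule ccontr)
  assume "\<not> ?thesis"
  then have "r = \<bar>(y - z0) i\<bar>" using y(1) i by (force simp: cube_def)
  then show False using barrier_ge_power4[OF X i st, of "y - z0"] y(2) by simp
qed

lemma comparison_step:
  assumes X: "finite X" and sub: "local_subsolution X zb R \<rho> K V" and V: "bdd_ucont X V"
    and \<Psi>': "unif_C2 X \<Psi>' G H" and r: "0 < r" "r \<le> 1"
    and inside: "\<And>z i. z \<in> cube X z0 r \<Longrightarrow> i \<in> X \<Longrightarrow> \<bar>z i - zb i\<bar> < R"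
    and crude: "\<And>z. z \<in> cube X z0 r \<Longrightarrow> V z - \<Psi>' z - K * t * expsum X z \<le> C * r ^ 4"
    and s: "s = (\<Sum>i\<in>X. (\<rho> i)\<^sup>2)" and C: "0 \<le> C" and \<omega>: "0 \<le> \<omega>" and \<theta>: "0 \<le> \<theta>" "3 * e \<le> \<theta>"
    and h: "h\<^sup>2 \<le> t" "C * (8 * s\<^sup>2) * h\<^sup>2 \<le> e"
    and prev: "\<And>z. z \<in> cube X z0 r \<Longrightarrow>
      V z - \<Psi> z - K * (t - h\<^sup>2) * expsum X z - \<theta> * (t - h\<^sup>2) - C * barrier X s (t - h\<^sup>2) (z - z0)
      \<le> \<omega>"
    and step: "\<And>z. h\<^sup>2 * walk_gen_fun X \<rho> G H z - 2 * e * h\<^sup>2 \<le> \<Psi>' z - \<Psi> z"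
    and z: "z \<in> cube X z0 r"
  shows "V z - \<Psi>' z - K * t * expsum X z - \<theta> * t - C * barrier X s t (z - z0) \<le> \<omega>"
proof (rule ccontr)
  assume neg: "\<not> ?thesis"
  define \<Phi> where "\<Phi> z = \<Psi>' z + K * t * expsum X z + C * barrier X s t (z - z0)" for z
  have "bdd_ucont X \<Psi>'" using \<Psi>' by (simp add: unif_C2_def)
  then have "seq_cont_on X (cube X z0 r) (\<lambda>z. V z - \<Phi> z)"
    unfolding \<Phi>_def by (rule seq_cont_on_comparison[OF V])
  from seq_cont_on_attains_sup[OF seq_compact_on_cube[OF X] _ this] z
  obtain y where y: "y \<in> cube X z0 r" "\<And>z. z \<in> cube X z0 r \<Longrightarrow> V z - \<Phi> z \<le> V y - \<Phi> y" by blast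
  have above: "\<omega> < V y - \<Psi>' y - K * t * expsum X y - \<theta> * t - C * barrier X s t (y - z0)"
    using neg y(2)[OF z] unfolding \<Phi>_def by linarith
  have t: "0 \<le> t" using h(1) zero_le_power2[of h] by linarith
  have s0: "0 \<le> s" unfolding s by (intro sum_nonneg) auto
  have "C * barrier X s t (y - z0) < C * r ^ 4"
    using above crude[OF y(1)] \<omega> mult_nonneg_nonneg[OF \<theta>(1) t] by linarith
  then have "barrier X s t (y - z0) < r ^ 4" using C by (rule mult_left_less_imp_less)
  note interior = cube_interior_of_barrier_less[OF X s0 t y(1) this]
  define gb where "gb = walk_gen X \<rho> (barrier_grad s t (y - z0)) (barrier_hess s t (y - z0))"
  define b' where "b' = 8 * s * (\<Sum>i\<in>X. ((y - z0) i)\<^sup>2) + 16 * s\<^sup>2 * t"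
  define g where "g = walk_gen_fun X \<rho> G H y"
  have gb: "gb \<le> b'" unfolding gb_def b'_def
  proof (rule walk_gen_barrier_le[OF X _ t s])
    show "\<bar>(y - z0) i\<bar> \<le> 1" if "i \<in> X" for i using interior[OF that] r(2) by simp
  qed
  note jet = has_jet2_lincomb[OF has_jet2_lincomb[OF has_jet2_taylor[OF X \<Psi>', of y]
      has_jet2_expsum[OF X], of 1 "K * t"]
      has_jet2_barrier[OF X, of s t z0], of 1 C]
  have \<Phi>: "\<Phi> = (\<lambda>z. 1 * (1 * \<Psi>' z + K * t * expsum X z) + C * barrier X s t (z - z0))"
    by (simp add: fun_eq_iff \<Phi>_def)
  from local_subsolution_interior_max[OF X sub inside[OF y(1)] jet[folded \<Phi>] interior y(2)]
  have "- K * expsum X y \<le> g + C * gb"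
    unfolding walk_gen_lincomb walk_gen_expsum[OF X] g_def gb_def walk_gen_fun_def by simp
  also have "\<dots> \<le> g + C * b'" using gb C by (simp add: mult_left_mono)
  finally have "h\<^sup>2 * (- K * expsum X y) \<le> h\<^sup>2 * (g + C * b')" by (rule mult_left_mono) simp
  moreover have "C * barrier X s t (y - z0) - C * barrier X s (t - h\<^sup>2) (y - z0)
      = C * (h\<^sup>2 * b' - 8 * s\<^sup>2 * (h\<^sup>2)\<^sup>2)"
    unfolding right_diff_distrib[symmetric] barrier_decrement b'_def ..
  moreover have "C * (h\<^sup>2 * b' - 8 * s\<^sup>2 * (h\<^sup>2)\<^sup>2) = h\<^sup>2 * (C * b') - h\<^sup>2 * (C * (8 * s\<^sup>2) * h\<^sup>2)"
    by (simp add: right_diff_distrib power2_eq_square[of "h\<^sup>2"])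
  moreover have "h\<^sup>2 * (C * (8 * s\<^sup>2) * h\<^sup>2) \<le> h\<^sup>2 * e" using h(2) by (rule mult_left_mono) simp
  moreover have "3 * e * h\<^sup>2 \<le> \<theta> * h\<^sup>2" using \<theta>(2) by (rule mult_right_mono) simp
  ultimately show False
    using above prev[OF y(1)] step[of y] unfolding g_def[symmetric] by (simp add: algebra_simps)
qed

lemma walk_comparison:
  assumes X: "finite X" and sub: "local_subsolution X zb R \<rho> K V" and V: "bdd_ucont X V"
    and \<Psi>: "unif_C2 X \<Psi> G H" "\<And>z. V z - \<Psi> z \<le> \<omega>" and r: "0 < r" "r \<le> 1"
    and inside: "\<And>z i. z \<in> cube X z0 r \<Longrightarrow> i \<in> X \<Longrightarrow> \<bar>z i - zb i\<bar> < R"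
    and crude: "\<And>z k. z \<in> cube X z0 r \<Longrightarrow> k \<le> n \<Longrightarrow>
      V z - (walk \<rho> h ^^ k) \<Psi> z - K * (real k * h\<^sup>2) * expsum X z \<le> C * r ^ 4"
    and s: "s = (\<Sum>i\<in>X. (\<rho> i)\<^sup>2)" and C: "0 \<le> C" and \<omega>: "0 \<le> \<omega>" and \<theta>: "0 \<le> \<theta>" "3 * e \<le> \<theta>"
    and h: "C * (8 * s\<^sup>2) * h\<^sup>2 \<le> e"
    and incr: "\<And>k z. h\<^sup>2 * (walk \<rho> h ^^ Suc k) (walk_gen_fun X \<rho> G H) z - 2 * e * h\<^sup>2
      \<le> (walk \<rho> h ^^ Suc k) \<Psi> z - (walk \<rho> h ^^ k) \<Psi> z"
  shows "k \<le> n \<Longrightarrow> z \<in> cube X z0 r \<Longrightarrow> V z - (walk \<rho> h ^^ k) \<Psi> z - K * (real k * h\<^sup>2) * expsum X z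
    - \<theta> * (real k * h\<^sup>2) - C * barrier X s (real k * h\<^sup>2) (z - z0) \<le> \<omega>"
proof (induction k arbitrary: z)
  case 0
  have "0 \<le> s" unfolding s by (intro sum_nonneg) auto
  then have "0 \<le> C * barrier X s 0 (z - z0)"
    using C by (intro mult_nonneg_nonneg barrier_nonneg) auto
  then have "V z - \<Psi> z - 0 - 0 - C * barrier X s 0 (z - z0) \<le> \<omega>" using \<Psi>(2)[of z] by linarith
  then show ?case by (simp only: funpow_0 of_nat_0 mult_zero_left mult_zero_right)
next
  case (Suc k)
  interpret P: local_avg X "real (Suc k) * walk_radius X \<rho> h" "walk \<rho> h ^^ Suc k"
    by (rule local_avg_walk_funpow[OF X])
  have t: "real (Suc k) * h\<^sup>2 - h\<^sup>2 = real k * h\<^sup>2" by (simp add: distrib_right)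
  have gen: "walk_gen_fun X \<rho> (\<lambda>i. (walk \<rho> h ^^ Suc k) (G i)) (\<lambda>i j. (walk \<rho> h ^^ Suc k) (H i j))
      = (walk \<rho> h ^^ Suc k) (walk_gen_fun X \<rho> G H)"
    using \<Psi>(1) by (intro P.walk_gen_fun[symmetric]) (auto simp: unif_C2_def)
  show ?case
  proof (rule comparison_step[where R = R and zb = zb and r = r and e = e and h = h and \<Psi> =
      "(walk \<rho> h ^^ k) \<Psi>",
        OF X sub V P.unif_C2_avg[OF \<Psi>(1)]])
    show "h\<^sup>2 \<le> real (Suc k) * h\<^sup>2" by (simp add: distrib_right)
    show "V z - (walk \<rho> h ^^ k) \<Psi> z - K * (real (Suc k) * h\<^sup>2 - h\<^sup>2) * expsum X z
        - \<theta> * (real (Suc k) * h\<^sup>2 - h\<^sup>2)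
        - C * barrier X s (real (Suc k) * h\<^sup>2 - h\<^sup>2) (z - z0) \<le> \<omega>" if "z \<in> cube X z0 r" for z
      unfolding t using Suc.prems(1) that by (intro Suc.IH) simp_all
  qed (simp_all only: r inside s C \<omega> \<theta> h[unfolded s] gen incr crude Suc.prems)
qed

lemma steklov_list_funpow_close:
  assumes X: "finite X" and V: "bdd_ucont X V" and \<eta>: "0 < \<eta>" and xs: "set xs \<subseteq> X"
  shows "\<forall>\<^sub>F \<epsilon> in at_right 0. \<forall>z. \<bar>(steklov_list \<epsilon> xs ^^ n) V z - V z\<bar> \<le> \<eta>"
proof -
  obtain d where d: "d > 0" "\<And>z \<zeta>. l1_norm X \<zeta> < d \<Longrightarrow> \<bar>V (z + \<zeta>) - V z\<bar> \<le> \<eta>"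
    using bdd_ucont_modulus[OF V \<eta>] by blast
  have "((\<lambda>\<epsilon>. real (card X) * (real n * (\<epsilon> * real (length xs)))) \<longlongrightarrow> 0) (at_right 0)"
    by (auto intro!: tendsto_eq_intros)
  from order_tendstoD(2)[OF this d(1)] eventually_at_right_less[of 0]
  show ?thesis
  proof (eventually_elim, intro allI)
    fix \<epsilon> :: real and z assume small: "real (card X) * (real n * (\<epsilon> * real (length xs))) < d"
      and "0 < \<epsilon>"
    interpret local_avg X "real n * (\<epsilon> * real (length xs))" "steklov_list \<epsilon> xs ^^ n"
      using \<open>0 < \<epsilon>\<close> by (intro local_avg_steklov_list_funpow X xs) simp
    show "\<bar>(steklov_list \<epsilon> xs ^^ n) V z - V z\<bar> \<le> \<eta>"
      using le_less_trans[OF l1_norm_le_card[OF X] small] by (intro abs_diff_le V d(2)) simp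
  qed
qed

lemma bdd_ucont_C2_approx:
  assumes X: "finite X" and V: "bdd_ucont X V" and \<eta>: "0 < \<eta>"
  obtains \<Psi> G H where "unif_C2 X \<Psi> G H" "\<And>z. \<bar>\<Psi> z - V z\<bar> \<le> \<eta>" "\<And>S z. (\<And>z. \<bar>V z\<bar> \<le> S) \<Longrightarrow> \<bar>\<Psi> z\<bar> \<le> S"
proof -
  obtain xs where xs: "distinct xs" "set xs = X" using finite_distinct_list[OF X] by blast
  have "\<forall>\<^sub>F \<epsilon> in at_right 0. 0 < \<epsilon> \<and> (\<forall>z. \<bar>(steklov_list \<epsilon> xs ^^ 2) V z - V z\<bar> \<le> \<eta>)"
    using steklov_list_funpow_close[OF X V \<eta>] xs(2)
    by (intro eventually_conj eventually_at_right_less) simp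
  then obtain \<epsilon> where \<epsilon>: "0 < \<epsilon>" "\<And>z. \<bar>(steklov_list \<epsilon> xs ^^ 2) V z - V z\<bar> \<le> \<eta>"
    using eventually_happens[of _ "at_right (0::real)"] by auto
  define \<Psi> where "\<Psi> = (steklov_list \<epsilon> xs ^^ 2) V"
  have "Ck X (Suc (Suc 0)) \<Psi>"
    using steklov_list_funpow_Ck[OF X \<epsilon>(1) V xs, of 2] unfolding \<Psi>_def by (simp add: numeral_2_eq_2)
  then obtain G H where GH: "unif_C2 X \<Psi> G H" by (rule Ck_unif_C2)
  interpret local_avg X "real 2 * (\<epsilon> * real (length xs))" "steklov_list \<epsilon> xs ^^ 2"
    using \<epsilon>(1) xs(2) by (intro local_avg_steklov_list_funpow X) auto
  show ?thesis using GH \<epsilon>(2) abs_le[OF V] unfolding \<Psi>_def by (rule that)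
qed

lemma walk_mean_value:
  assumes X: "finite X" and sub: "local_subsolution X zb R \<rho> K V" and V: "bdd_ucont X V"
    and \<Psi>: "unif_C2 X \<Psi> G H" "\<And>z. \<bar>\<Psi> z - V z\<bar> \<le> \<omega>" and S: "\<And>z. \<bar>V z\<bar> \<le> S" "\<And>z. \<bar>\<Psi> z\<bar> \<le> S"
    and N: "\<And>z. (\<And>i. i \<in> X \<Longrightarrow> \<bar>z i - zb i\<bar> < R) \<Longrightarrow> expsum X z \<le> N"
    and r: "0 < r" "r \<le> 1" "r < R / 2" and z0: "z0 \<in> cube X zb (R / 2)"
    and C: "0 \<le> C" "C * r ^ 4 = 2 * S + \<bar>K\<bar> * N" and s: "s = (\<Sum>i\<in>X. (\<rho> i)\<^sup>2)"
    and \<omega>: "0 \<le> \<omega>" "3 * e \<le> \<omega>" and h: "C * (8 * s\<^sup>2) * h\<^sup>2 \<le> e" and n: "real n * h\<^sup>2 \<le> 1"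
    and incr: "\<And>k z. h\<^sup>2 * (walk \<rho> h ^^ Suc k) (walk_gen_fun X \<rho> G H) z - 2 * e * h\<^sup>2
      \<le> (walk \<rho> h ^^ Suc k) \<Psi> z - (walk \<rho> h ^^ k) \<Psi> z"
  shows "V z0 \<le> (walk \<rho> h ^^ n) V z0 + K * (real n * h\<^sup>2) * expsum X z0 + 3 * \<omega>
      + C * (8 * s\<^sup>2) * (real n * h\<^sup>2)\<^sup>2"
proof -
  have u: "bdd_ucont X \<Psi>" using \<Psi>(1) by (simp add: unif_C2_def)
  have inside: "\<bar>z i - zb i\<bar> < R" if "z \<in> cube X z0 r" "i \<in> X" for z i
  proof -
    have "\<bar>z i - z0 i\<bar> \<le> r" "\<bar>z0 i - zb i\<bar> \<le> R / 2" using that z0 by (auto simp: cube_def)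
    then show ?thesis using r(3) by linarith
  qed
  have crude: "V z - (walk \<rho> h ^^ k) \<Psi> z - K * (real k * h\<^sup>2) * expsum X z \<le> C * r ^ 4"
    if "z \<in> cube X z0 r" "k \<le> n" for z k
  proof -
    have "real k * h\<^sup>2 \<le> real n * h\<^sup>2" using that(2) by (intro mult_right_mono) auto
    then have "\<bar>real k * h\<^sup>2\<bar> * \<bar>expsum X z\<bar> \<le> 1 * N"
      using n N[OF inside[OF that(1)]] expsum_nonneg[of X z] by (intro mult_mono) auto
    then have "\<bar>K * (real k * h\<^sup>2 * expsum X z)\<bar> \<le> \<bar>K\<bar> * N" by (simp add: abs_mult mult_left_mono)
    moreover have "\<bar>(walk \<rho> h ^^ k) \<Psi> z\<bar> \<le> S"
      using S(2) by (intro local_avg.abs_le[OF local_avg_walk_funpow[OF X] u])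
    ultimately show ?thesis unfolding C(2) mult.assoc using S(1)[of z] by linarith
  qed
  have "V z0 - (walk \<rho> h ^^ n) \<Psi> z0 - K * (real n * h\<^sup>2) * expsum X z0 - \<omega> * (real n * h\<^sup>2)
      - C * barrier X s (real n * h\<^sup>2) (z0 - z0) \<le> \<omega>"
  proof (rule walk_comparison[where n = n and R = R and zb = zb and r = r and G = G and H = H, OF X
      sub V \<Psi>(1)])
    show "V z - \<Psi> z \<le> \<omega>" for z using \<Psi>(2)[of z] by (simp add: abs_le_iff)
    show "z0 \<in> cube X z0 r" using r(1) by (simp add: cube_def)
  qed ((rule r inside crude s C(1) \<omega> h incr order_refl | assumption)+)
  moreover have "\<omega> * (real n * h\<^sup>2) \<le> \<omega> * 1" using n \<omega>(1) by (rule mult_left_mono)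
  moreover have "C * barrier X s (real n * h\<^sup>2) (z0 - z0) = C * (8 * s\<^sup>2) * (real n * h\<^sup>2)\<^sup>2"
    by (simp add: barrier_def)
  moreover have "(walk \<rho> h ^^ n) \<Psi> z0 \<le> (walk \<rho> h ^^ n) V z0 + \<omega>"
  proof (rule local_avg.le_add_const[OF local_avg_walk_funpow[OF X] u V])
    show "\<Psi> z \<le> V z + \<omega>" for z using \<Psi>(2)[of z] by (simp add: abs_le_iff)
  qed
  ultimately show ?thesis by linarith
qed

lemma mean_value_inequality:
  assumes X: "finite X" and sub: "local_subsolution X zb R \<rho> K V" and V: "bdd_ucont X V"
    and R: "0 < R"
  obtains C where "\<forall>T \<theta>. 0 < T \<longrightarrow> T \<le> 1 \<longrightarrow> 0 < \<theta> \<longrightarrow> (\<forall>\<^sub>F h in at_right 0. \<forall>n z0. real n * h\<^sup>2 \<le> T \<longrightarrow>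
    z0 \<in> cube X zb (R / 2) \<longrightarrow>
    V z0 \<le> (walk \<rho> h ^^ n) V z0 + K * (real n * h\<^sup>2) * expsum X z0 + \<theta> + C * T\<^sup>2)"
proof -
  obtain S where S: "S > 0" "\<And>z. \<bar>V z\<bar> \<le> S" using bdd_ucont_bound[OF V] by blast
  define r where "r = min 1 (R / 4)"
  have r: "0 < r" "r \<le> 1" "r < R / 2" using R by (auto simp: r_def)
  define N where "N = (\<Sum>i\<in>X. exp (zb i + R))"
  have N: "expsum X z \<le> N" if "\<And>i. i \<in> X \<Longrightarrow> \<bar>z i - zb i\<bar> < R" for z
    unfolding expsum_def N_def using that by (intro sum_mono) force
  define s where "s = (\<Sum>i\<in>X. (\<rho> i)\<^sup>2)"
  define C where "C = (2 * S + \<bar>K\<bar> * N) / r ^ 4"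
  have "0 \<le> N" unfolding N_def by (intro sum_nonneg) auto
  then have C: "0 \<le> C" "C * r ^ 4 = 2 * S + \<bar>K\<bar> * N" using r S(1) by (auto simp: C_def)
  have "\<forall>\<^sub>F h in at_right 0. \<forall>n z0. real n * h\<^sup>2 \<le> T \<longrightarrow> z0 \<in> cube X zb (R / 2) \<longrightarrow>
      V z0 \<le> (walk \<rho> h ^^ n) V z0 + K * (real n * h\<^sup>2) * expsum X z0 + \<theta> + C * (8 * s\<^sup>2) * T\<^sup>2"
    if T: "0 < T" "T \<le> 1" and \<theta>: "0 < \<theta>" for T \<theta>
  proof -
    define \<omega> where "\<omega> = \<theta> / 3"
    define e where "e = \<omega> / 3"
    have pos: "0 < \<omega>" "0 < e" "3 * e \<le> \<omega>" using \<theta> by (auto simp: \<omega>_def e_def)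
    obtain \<Psi> G H where \<Psi>: "unif_C2 X \<Psi> G H" "\<And>z. \<bar>\<Psi> z - V z\<bar> \<le> \<omega>" "\<And>z. \<bar>\<Psi> z\<bar> \<le> S"
      using bdd_ucont_C2_approx[OF X V pos(1)] S(2) by metis
    have "((\<lambda>h. C * (8 * s\<^sup>2) * h\<^sup>2) \<longlongrightarrow> 0) (at_right 0)" by (auto intro!: tendsto_eq_intros)
    from order_tendstoD(2)[OF this pos(2)] walk_funpow_increment_ge[OF X \<Psi>(1) pos(2), of \<rho>]
    show ?thesis
    proof (eventually_elim, intro allI impI)
      fix h n z0
      assume h: "C * (8 * s\<^sup>2) * h\<^sup>2 < e" and n: "real n * h\<^sup>2 \<le> T" and z0: "z0 \<in> cube X zb (R / 2)"
        and incr: "\<forall>k z. h\<^sup>2 * (walk \<rho> h ^^ Suc k) (walk_gen_fun X \<rho> G H) z - 2 * e * h\<^sup>2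
          \<le> (walk \<rho> h ^^ Suc k) \<Psi> z - (walk \<rho> h ^^ k) \<Psi> z"
      have "(real n * h\<^sup>2)\<^sup>2 \<le> T\<^sup>2" using n by (intro power_mono) auto
      then have "C * (8 * s\<^sup>2) * (real n * h\<^sup>2)\<^sup>2 \<le> C * (8 * s\<^sup>2) * T\<^sup>2"
        using C(1) by (intro mult_left_mono) auto
      moreover have "V z0 \<le> (walk \<rho> h ^^ n) V z0 + K * (real n * h\<^sup>2) * expsum X z0 + 3 * \<omega>
          + C * (8 * s\<^sup>2) * (real n * h\<^sup>2)\<^sup>2"
        by (rule walk_mean_value[OF X sub V \<Psi>(1,2) S(2) \<Psi>(3) N r z0 C s_def less_imp_le[OF pos(1)]
              pos(3) less_imp_le[OF h] order_trans[OF n T(2)] incr[rule_format]])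
      moreover have "3 * \<omega> = \<theta>" by (simp add: \<omega>_def)
      ultimately show "V z0 \<le> (walk \<rho> h ^^ n) V z0 + K * (real n * h\<^sup>2) * expsum X z0 + \<theta>
          + C * (8 * s\<^sup>2) * T\<^sup>2"
        by linarith
    qed
  qed
  then show ?thesis by (intro that) blast
qed

section \<open>Mollified subsolutions\<close>

text \<open>Clamping to a cube makes the exponentials bounded and uniformly continuous and changes nothing
  inside the cube.\<close>

definition clamp_cube :: "('i \<Rightarrow> real) \<Rightarrow> real \<Rightarrow> ('i \<Rightarrow> real) \<Rightarrow> 'i \<Rightarrow> real" where
  "clamp_cube zb R z = (\<lambda>i. max (zb i - R) (min (zb i + R) (z i)))"

definition clamped_expsum :: "'i set \<Rightarrow> ('i \<Rightarrow> real) \<Rightarrow> real \<Rightarrow> ('i \<Rightarrow> real) \<Rightarrow> ('i \<Rightarrow> real) \<Rightarrow> real" where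
  "clamped_expsum X zb R c z = (\<Sum>i\<in>X. c i * exp (clamp_cube zb R z i))"

lemma clamp_cube_eq: "z \<in> cube X zb R \<Longrightarrow> i \<in> X \<Longrightarrow> clamp_cube zb R z i = z i"
  by (fastforce simp: cube_def clamp_cube_def abs_le_iff)

lemma clamp_cube_in_cube: "0 \<le> R \<Longrightarrow> clamp_cube zb R z \<in> cube X zb R"
  by (auto simp: cube_def clamp_cube_def)

lemma abs_clamp_cube_diff_le: "\<bar>clamp_cube zb R y i - clamp_cube zb R z i\<bar> \<le> \<bar>y i - z i\<bar>"
  by (simp add: clamp_cube_def max_def min_def)

lemma bdd_ucont_clamped:
  assumes X: "finite X" and R: "0 \<le> R" and U: "seq_cont_on X (cube X zb R) U"
  shows "bdd_ucont X (\<lambda>z. U (clamp_cube zb R z))"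
proof -
  note cube = clamp_cube_in_cube[OF R, of zb _ X]
  obtain M where "\<And>z. z \<in> cube X zb R \<Longrightarrow> \<bar>U z\<bar> \<le> M"
    using seq_cont_on_bounded[OF seq_compact_on_cube[OF X] U] by blast
  then have "\<bar>U (clamp_cube zb R z)\<bar> \<le> M" for z using cube by blast
  then show ?thesis
  proof (rule bdd_ucontI)
    fix e :: real assume "0 < e"
    from seq_cont_on_uniform[OF seq_compact_on_cube[OF X] U this]
    obtain d where d: "d > 0" "\<And>y z. y \<in> cube X zb R \<Longrightarrow> z \<in> cube X zb R \<Longrightarrow>
        (\<And>i. i \<in> X \<Longrightarrow> \<bar>y i - z i\<bar> < d) \<Longrightarrow> \<bar>U y - U z\<bar> < e" by blast
    have "\<bar>U (clamp_cube zb R (z + \<zeta>)) - U (clamp_cube zb R z)\<bar> < e" if "l1_norm X \<zeta> < d" for z \<zeta>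
    proof (intro d(2) cube)
      fix i assume "i \<in> X"
      have "\<bar>clamp_cube zb R (z + \<zeta>) i - clamp_cube zb R z i\<bar> \<le> \<bar>\<zeta> i\<bar>"
        using abs_clamp_cube_diff_le[of zb R "z + \<zeta>" i z] by simp
      also have "\<dots> < d" using abs_le_l1_norm[OF X \<open>i \<in> X\<close>, of \<zeta>] that by linarith
      finally show "\<bar>clamp_cube zb R (z + \<zeta>) i - clamp_cube zb R z i\<bar> < d" .
    qed
    then show "\<forall>\<^sub>F \<zeta> in at_origin X. \<forall>z. \<bar>U (clamp_cube zb R (z + \<zeta>)) - U (clamp_cube zb R z)\<bar> \<le> e"
      using d(1) unfolding eventually_at_origin by (intro exI[of _ d]) (simp add: less_imp_le)
  qed
qed

lemma bdd_ucont_clamped_expsum: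
  assumes "finite X" "0 \<le> R"
  shows "bdd_ucont X (clamped_expsum X zb R c)"
  unfolding clamped_expsum_def[abs_def]
  using seq_cont_on_separable[of X "\<lambda>i x. c i * exp x"] by (intro bdd_ucont_clamped assms) simp

lemma clamped_expsum_eq: "z \<in> cube X zb R \<Longrightarrow> clamped_expsum X zb R c z = (\<Sum>i\<in>X. c i * exp (z i))"
  unfolding clamped_expsum_def by (intro sum.cong refl) (simp add: clamp_cube_eq)

lemma clamped_expsum_1: "z \<in> cube X zb R \<Longrightarrow> clamped_expsum X zb R (\<lambda>i. 1) z = expsum X z"
  by (simp add: clamped_expsum_eq expsum_def)

text \<open>A Steklov average multiplies \<open>exp (z i)\<close> by \<open>exp_mean \<epsilon>\<close>, so it preserves the right-hand side
  of the viscosity inequality up to a factor tending to 1.\<close>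

definition exp_mean :: "real \<Rightarrow> real" where
  "exp_mean \<epsilon> = (exp \<epsilon> - 1) / \<epsilon>"

lemma exp_mean_ge_1: "0 < \<epsilon> \<Longrightarrow> 1 \<le> exp_mean \<epsilon>"
  unfolding exp_mean_def using exp_ge_add_one_self[of \<epsilon>] by (simp add: field_simps)

lemma exp_mean_tendsto: "(exp_mean \<longlongrightarrow> 1) (at_right 0)"
  unfolding exp_mean_def[abs_def] by real_asymp

lemma has_integral_exp_mean:
  assumes "0 < \<epsilon>"
  shows "((\<lambda>s. exp (\<epsilon> * s)) has_integral exp_mean \<epsilon>) {0..1}"
proof -
  have "((\<lambda>s. exp (\<epsilon> * s) / \<epsilon>) has_real_derivative exp (\<epsilon> * s)) (at s within {0..1})" for s
    using assms by (auto intro!: derivative_eq_intros)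
  then have "((\<lambda>s. exp (\<epsilon> * s)) has_integral (exp (\<epsilon> * 1) / \<epsilon> - exp (\<epsilon> * 0) / \<epsilon>)) {0..1}"
    by (intro fundamental_theorem_of_calculus)
      (auto simp: has_real_derivative_iff_has_vector_derivative)
  then show ?thesis by (simp add: exp_mean_def diff_divide_distrib)
qed

lemma steklov_clamped_expsum:
  assumes X: "finite X" "i \<in> X" and \<epsilon>: "0 < \<epsilon>" and z: "z \<in> cube X zb (R - \<epsilon>)"
  shows "steklov \<epsilon> i (clamped_expsum X zb R c) z
      = clamped_expsum X zb R (c(i := c i * exp_mean \<epsilon>)) z"
proof -
  define A where "A = (\<Sum>j\<in>X - {i}. c j * exp (z j))"
  have "A + c i * exp (z i) * exp (\<epsilon> * s) = clamped_expsum X zb R c (z + coord_vec i (\<epsilon> * s))"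
    if "s \<in> {0..1}" for s
  proof -
    have "\<bar>coord_vec i (\<epsilon> * s) j\<bar> \<le> \<epsilon>" for j
      using that \<epsilon> by (auto simp: coord_vec_def abs_mult intro: mult_left_le)
    then have "z + coord_vec i (\<epsilon> * s) \<in> cube X zb R" by (intro cube_shift[OF z]) auto
    then have "clamped_expsum X zb R c (z + coord_vec i (\<epsilon> * s))
        = (\<Sum>j\<in>X. c j * exp ((z + coord_vec i (\<epsilon> * s)) j))"
      by (rule clamped_expsum_eq)
    also have "\<dots> = c i * exp (z i + \<epsilon> * s) + A"
      unfolding sum.remove[OF X] A_def by (simp add: coord_vec_def)
    finally show ?thesis by (simp add: exp_add)
  qed
  moreover have "((\<lambda>s. A + c i * exp (z i) * exp (\<epsilon> * s)) has_integral
      (A * (1 - 0) + c i * exp (z i) * exp_mean \<epsilon>)) {0..1}"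
    using has_integral_const_real[of A 0 1]
    by (intro has_integral_add has_integral_mult_right has_integral_exp_mean[OF \<epsilon>])
      (simp add: mult.commute)
  ultimately have "((\<lambda>s. clamped_expsum X zb R c (z + coord_vec i (\<epsilon> * s))) has_integral
      (A * (1 - 0) + c i * exp (z i) * exp_mean \<epsilon>)) {0..1}"
    by (rule has_integral_eq)
  then have "steklov \<epsilon> i (clamped_expsum X zb R c) z = A + c i * exp (z i) * exp_mean \<epsilon>"
    unfolding steklov_def by (simp add: integral_unique)
  also have "\<dots> = (\<Sum>j\<in>X. (c(i := c i * exp_mean \<epsilon>)) j * exp (z j))"
    unfolding sum.remove[OF X] A_def by simp
  also have "\<dots> = clamped_expsum X zb R (c(i := c i * exp_mean \<epsilon>)) z"
    using cube_mono[OF z, of R] \<epsilon> by (simp add: clamped_expsum_eq)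
  finally show ?thesis .
qed

lemma steklov_list_clamped_expsum:
  assumes X: "finite X" and \<epsilon>: "0 < \<epsilon>" and R: "0 \<le> R"
  shows "distinct xs \<Longrightarrow> set xs \<subseteq> X \<Longrightarrow> z \<in> cube X zb (R - \<epsilon> * real (length xs)) \<Longrightarrow>
    steklov_list \<epsilon> xs (clamped_expsum X zb R c) z
      = clamped_expsum X zb R (\<lambda>i. if i \<in> set xs then c i * exp_mean \<epsilon> else c i) z"
proof (induction xs arbitrary: z)
  case Nil
  then show ?case by (simp add: steklov_list_def)
next
  case (Cons x xs)
  let ?c = "\<lambda>i. if i \<in> set xs then c i * exp_mean \<epsilon> else c i"
  have x: "x \<in> X" "x \<notin> set xs" "distinct xs" "set xs \<subseteq> X" using Cons.prems by auto
  have z: "z \<in> cube X zb (R - \<epsilon> * real (length xs) - \<epsilon>)"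
    using Cons.prems(3) by (simp add: algebra_simps)
  interpret S: local_avg X \<epsilon> "steklov \<epsilon> x" using local_avg_steklov[OF X x(1)] \<epsilon> by simp
  have "steklov_list \<epsilon> (x # xs) (clamped_expsum X zb R c) z
      = steklov \<epsilon> x (steklov_list \<epsilon> xs (clamped_expsum X zb R c)) z"
    by (simp add: steklov_list_def)
  also have "\<dots> = steklov \<epsilon> x (clamped_expsum X zb R ?c) z"
  proof (rule S.local_eq)
    show "bdd_ucont X (steklov_list \<epsilon> xs (clamped_expsum X zb R c))"
      using local_avg.bdd_ucont_avg[OF local_avg_steklov_list[OF X _ x(4)]
        bdd_ucont_clamped_expsum[OF X R]] \<epsilon> by simp
    fix v assume "\<And>i. i \<in> X \<Longrightarrow> \<bar>v i\<bar> \<le> \<epsilon>"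
    then have "z + v \<in> cube X zb (R - \<epsilon> * real (length xs))" by (intro cube_shift[OF z]) auto
    then show "steklov_list \<epsilon> xs (clamped_expsum X zb R c) (z + v)
        = clamped_expsum X zb R ?c (z + v)"
      by (rule Cons.IH[OF x(3,4)])
  qed (rule bdd_ucont_clamped_expsum[OF X R])
  also have "\<dots> = clamped_expsum X zb R (?c(x := ?c x * exp_mean \<epsilon>)) z"
  proof (rule steklov_clamped_expsum[OF X x(1) \<epsilon>])
    have "0 \<le> \<epsilon> * real (length xs)" using \<epsilon> by simp
    then show "z \<in> cube X zb (R - \<epsilon>)" using cube_mono[OF z, of "R - \<epsilon>"] by simp
  qed
  also have "\<dots> = clamped_expsum X zb R (\<lambda>i. if i \<in> set (x # xs) then c i * exp_mean \<epsilon> else c i) z"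
    unfolding clamped_expsum_def using x(2) by (intro sum.cong) auto
  finally show ?case .
qed

lemma steklov_list_funpow_clamped_expsum:
  assumes X: "finite X" and \<epsilon>: "0 < \<epsilon>" and R: "0 \<le> R" and xs: "distinct xs" "set xs = X"
  shows "z \<in> cube X zb (R - real n * (\<epsilon> * real (length xs))) \<Longrightarrow>
    (steklov_list \<epsilon> xs ^^ n) (clamped_expsum X zb R (\<lambda>i. 1)) z = exp_mean \<epsilon> ^ n * expsum X z"
proof (induction n arbitrary: z)
  case 0
  then show ?case by (simp add: clamped_expsum_1)
next
  case (Suc n)
  define r where "r = \<epsilon> * real (length xs)"
  have r: "0 \<le> r" "0 \<le> real n * r" using \<epsilon> by (auto simp: r_def)
  have z: "z \<in> cube X zb (R - real n * r - r)" using Suc.prems by (simp add: r_def algebra_simps)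
  note N = bdd_ucont_clamped_expsum[OF X R, of zb]
  interpret S: local_avg X r "steklov_list \<epsilon> xs"
    unfolding r_def using local_avg_steklov_list[OF X, of \<epsilon> xs] \<epsilon> xs by simp
  have "(steklov_list \<epsilon> xs ^^ Suc n) (clamped_expsum X zb R (\<lambda>i. 1)) z
      = steklov_list \<epsilon> xs ((steklov_list \<epsilon> xs ^^ n) (clamped_expsum X zb R (\<lambda>i. 1))) z" by simp
  also have "\<dots> = steklov_list \<epsilon> xs (\<lambda>z. exp_mean \<epsilon> ^ n * clamped_expsum X zb R (\<lambda>i. 1) z) z"
  proof (intro S.local_eq bdd_ucont_scale N)
    show "bdd_ucont X ((steklov_list \<epsilon> xs ^^ n) (clamped_expsum X zb R (\<lambda>i. 1)))"
      using local_avg.bdd_ucont_avg[OF local_avg_steklov_list_funpow[OF X] N] \<epsilon> xs by simp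
    fix v assume "\<And>i. i \<in> X \<Longrightarrow> \<bar>v i\<bar> \<le> r"
    then have zv: "z + v \<in> cube X zb (R - real n * r)" by (intro cube_shift[OF z]) auto
    then have "z + v \<in> cube X zb R" using r by (intro cube_mono[OF zv]) simp
    then show "(steklov_list \<epsilon> xs ^^ n) (clamped_expsum X zb R (\<lambda>i. 1)) (z + v)
        = exp_mean \<epsilon> ^ n * clamped_expsum X zb R (\<lambda>i. 1) (z + v)"
      by (simp only: clamped_expsum_1 Suc.IH[OF zv[unfolded r_def]])
  qed
  also have "\<dots> = exp_mean \<epsilon> ^ n * steklov_list \<epsilon> xs (clamped_expsum X zb R (\<lambda>i. 1)) z"
    by (simp add: S.scale[OF N])
  also have "steklov_list \<epsilon> xs (clamped_expsum X zb R (\<lambda>i. 1)) z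
      = clamped_expsum X zb R (\<lambda>i. if i \<in> set xs then 1 * exp_mean \<epsilon> else 1) z"
    using r xs cube_mono[OF z, of "R - r"]
    by (intro steklov_list_clamped_expsum[OF X \<epsilon> R]) (simp_all add: r_def)
  also have "\<dots> = exp_mean \<epsilon> * expsum X z"
    using cube_mono[OF z, of R] r xs by (simp add: clamped_expsum_eq expsum_def sum_distrib_left)
  finally show ?case by simp
qed

lemma mollified_mean_value:
  assumes X: "finite X" and V: "bdd_ucont X V" and R: "0 < R" and xs: "distinct xs" "set xs = X"
    and \<epsilon>: "0 < \<epsilon>" "real n * (\<epsilon> * real (length xs)) \<le> R / 4"
    and mean: "\<And>y. y \<in> cube X zb (R / 2) \<Longrightarrow> V y \<le> (walk \<rho> h ^^ m) V y + c * expsum X y + \<delta>"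
    and z: "z \<in> cube X zb (R / 4)"
  shows "(steklov_list \<epsilon> xs ^^ n) V z \<le> (walk \<rho> h ^^ m) ((steklov_list \<epsilon> xs ^^ n) V) z
    + c * (exp_mean \<epsilon> ^ n * expsum X z) + \<delta>"
proof -
  define E where "E = steklov_list \<epsilon> xs ^^ n"
  define M where "M = walk \<rho> h ^^ m"
  define N where "N = clamped_expsum X zb (R / 2) (\<lambda>i. 1)"
  interpret E: local_avg X "real n * (\<epsilon> * real (length xs))" E
    unfolding E_def using X \<epsilon>(1) xs by (intro local_avg_steklov_list_funpow) auto
  have MV: "bdd_ucont X (M V)"
    unfolding M_def by (rule local_avg.bdd_ucont_avg[OF local_avg_walk_funpow[OF X] V])
  have N: "bdd_ucont X N" unfolding N_def using R by (intro bdd_ucont_clamped_expsum X) simp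
  have "E V z \<le> E (\<lambda>z. (M V z + c * N z) + \<delta>) z"
  proof (intro E.mono V bdd_ucont_add bdd_ucont_scale MV N bdd_ucont_const)
    fix v assume "\<And>i. i \<in> X \<Longrightarrow> \<bar>v i\<bar> \<le> real n * (\<epsilon> * real (length xs))"
    then have "z + v \<in> cube X zb (R / 2)" using \<epsilon>(2) by (intro cube_shift[OF z]) auto
    then show "V (z + v) \<le> (M V (z + v) + c * N (z + v)) + \<delta>"
      using mean unfolding N_def M_def by (simp add: clamped_expsum_1)
  qed
  also have "\<dots> = E (M V) z + c * E N z + \<delta>"
    by (simp add: E.add E.scale E.const bdd_ucont_add bdd_ucont_scale MV N)
  also have "E N z = exp_mean \<epsilon> ^ n * expsum X z"
    unfolding E_def N_def
  proof (rule steklov_list_funpow_clamped_expsum[OF X \<epsilon>(1) _ xs])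
    show "z \<in> cube X zb (R / 2 - real n * (\<epsilon> * real (length xs)))"
      using \<epsilon>(2) by (intro cube_mono[OF z]) simp
  qed (use R in simp)
  also have "E (M V) z = M (E V) z" unfolding M_def E.walk_commute[OF X V] ..
  finally show ?thesis unfolding E_def M_def .
qed

lemma mollified_subsolution:
  assumes X: "finite X" and sub: "local_subsolution X zb R \<rho> K V" and V: "bdd_ucont X V"
    and R: "0 < R"
    and xs: "distinct xs" "set xs = X" and \<epsilon>: "0 < \<epsilon>" "real n * (\<epsilon> * real (length xs)) \<le> R / 4"
    and F: "unif_C2 X ((steklov_list \<epsilon> xs ^^ n) V) G H" and g: "Ck X 2 (walk_gen_fun X \<rho> G H)"
    and z: "z \<in> cube X zb (R / 4)"
  shows "- K * (exp_mean \<epsilon> ^ n * expsum X z) \<le> walk_gen_fun X \<rho> G H z"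
proof (rule field_le_epsilon)
  fix e :: real assume "e > 0"
  define e' where "e' = e / 3"
  have e': "e' > 0" using \<open>e > 0\<close> by (simp add: e'_def)
  define F where "F = (steklov_list \<epsilon> xs ^^ n) V"
  define g where "g = walk_gen_fun X \<rho> G H z"
  define N where "N = exp_mean \<epsilon> ^ n * expsum X z"
  obtain C where C: "\<forall>T \<theta>. 0 < T \<longrightarrow> T \<le> 1 \<longrightarrow> 0 < \<theta> \<longrightarrow> (\<forall>\<^sub>F h in at_right 0. \<forall>n z0. real n * h\<^sup>2 \<le> T \<longrightarrow>
     z0 \<in> cube X zb (R / 2) \<longrightarrow>
     V z0 \<le> (walk \<rho> h ^^ n) V z0 + K * (real n * h\<^sup>2) * expsum X z0 + \<theta> + C * T\<^sup>2)"
    by (rule mean_value_inequality[OF X sub V R])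
  obtain T0 where T0: "T0 > 0" and expand: "\<forall>\<^sub>F h in at_right 0. \<forall>n z. real n * h\<^sup>2 \<le> T0 \<longrightarrow>
      \<bar>(walk \<rho> h ^^ n) F z - F z - real n * h\<^sup>2 * walk_gen_fun X \<rho> G H z\<bar> \<le> e' * (real n * h\<^sup>2)"
    using walk_funpow_expand[OF X F g e'] unfolding F_def by blast
  define T where "T = Min {1, T0, e' / (\<bar>C\<bar> + 1)}"
  have T: "0 < T" "T \<le> 1" "T \<le> T0" "T \<le> e' / (\<bar>C\<bar> + 1)" using T0 e' by (auto simp: T_def)
  have "C * T \<le> (\<bar>C\<bar> + 1) * T" using T(1) by (intro mult_right_mono) auto
  also have "\<dots> \<le> e'" using T(4) by (simp add: field_simps)
  finally have CT: "C * T \<le> e'" .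
  have "0 < e' * T" using e' T by simp
  obtain h m where m: "real m * h\<^sup>2 = T"
    and mean: "\<forall>n z0. real n * h\<^sup>2 \<le> T \<longrightarrow> z0 \<in> cube X zb (R / 2) \<longrightarrow>
      V z0 \<le> (walk \<rho> h ^^ n) V z0 + K * (real n * h\<^sup>2) * expsum X z0 + e' * T + C * T\<^sup>2"
    and expand': "\<forall>n z. real n * h\<^sup>2 \<le> T0 \<longrightarrow>
      \<bar>(walk \<rho> h ^^ n) F z - F z - real n * h\<^sup>2 * walk_gen_fun X \<rho> G H z\<bar> \<le> e' * (real n * h\<^sup>2)"
    using exists_walk_scale[OF T(1)
      eventually_conj[OF C[rule_format, OF T(1,2) \<open>0 < e' * T\<close>] expand]] by metis
  have "V y \<le> (walk \<rho> h ^^ m) V y + K * T * expsum X y + (e' * T + C * T\<^sup>2)"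
    if "y \<in> cube X zb (R / 2)" for y
    using mean that m by force
  from mollified_mean_value[OF X V R xs \<epsilon> this z]
  have "F z \<le> (walk \<rho> h ^^ m) F z + K * T * N + (e' * T + C * T\<^sup>2)" unfolding F_def N_def by simp
  moreover have "(walk \<rho> h ^^ m) F z - F z \<le> T * g + e' * T"
    using expand'[rule_format, of m z] T(3) unfolding m g_def by (simp add: abs_le_iff)
  ultimately have "0 \<le> T * (g + e' + K * N + e' + C * T)"
    by (simp add: algebra_simps power2_eq_square)
  then have "0 \<le> g + e' + K * N + e' + C * T" using T(1) by (simp add: zero_le_mult_iff)
  then show "- K * (exp_mean \<epsilon> ^ n * expsum X z) \<le> walk_gen_fun X \<rho> G H z + e"
    using CT by (simp add: e'_def g_def N_def)
qed

lemma mollified_approx: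
  assumes X: "finite X" and V: "bdd_ucont X V" and xs: "set xs \<subseteq> X" and \<eta>: "0 < \<eta>"
  shows "\<forall>\<^sub>F \<epsilon> in at_right 0. \<forall>z. \<bar>(steklov_list \<epsilon> xs ^^ n) V z / exp_mean \<epsilon> ^ n - V z\<bar> \<le> \<eta>"
proof -
  obtain S where S: "S > 0" "\<And>z. \<bar>V z\<bar> \<le> S" using bdd_ucont_bound[OF V] by blast
  have "((\<lambda>\<epsilon>. 1 - 1 / exp_mean \<epsilon> ^ n) \<longlongrightarrow> 1 - 1 / 1 ^ n) (at_right 0)"
    by (intro tendsto_intros exp_mean_tendsto) auto
  then have "\<forall>\<^sub>F \<epsilon> in at_right 0. 1 - 1 / exp_mean \<epsilon> ^ n < \<eta> / 2 / S"
    using \<eta> S(1) by (intro order_tendstoD(2)) auto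
  moreover have "\<forall>\<^sub>F \<epsilon> in at_right 0. \<forall>z. \<bar>(steklov_list \<epsilon> xs ^^ n) V z - V z\<bar> \<le> \<eta> / 2"
    using \<eta> by (intro steklov_list_funpow_close[OF X V _ xs]) simp
  ultimately show ?thesis using eventually_at_right_less[of "0 :: real"]
  proof (eventually_elim, intro allI)
    fix \<epsilon> :: real and z
    define k where "k = exp_mean \<epsilon> ^ n"
    define F where "F = (steklov_list \<epsilon> xs ^^ n) V z"
    assume \<epsilon>: "1 - 1 / exp_mean \<epsilon> ^ n < \<eta> / 2 / S" "0 < \<epsilon>"
      and "\<forall>z. \<bar>(steklov_list \<epsilon> xs ^^ n) V z - V z\<bar> \<le> \<eta> / 2"
    then have close: "\<bar>F - V z\<bar> \<le> \<eta> / 2" by (simp add: F_def)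
    have k: "1 \<le> k" unfolding k_def using exp_mean_ge_1[OF \<epsilon>(2)] by (rule one_le_power)
    have "\<bar>(F - V z) / k\<bar> \<le> \<bar>F - V z\<bar> / 1"
      unfolding abs_divide using k by (intro divide_left_mono) auto
    moreover have "\<bar>(1 - 1 / k) * V z\<bar> \<le> \<eta> / 2 / S * S"
      unfolding abs_mult using S \<epsilon>(1) k \<eta> by (intro mult_mono) (auto simp: k_def)
    moreover have "F / k - V z = (F - V z) / k - (1 - 1 / k) * V z"
      using k by (simp add: field_simps)
    ultimately have "\<bar>F / k - V z\<bar> \<le> \<bar>F - V z\<bar> / 1 + \<eta> / 2 / S * S"
      using abs_triangle_ineq4[of "(F - V z) / k" "(1 - 1 / k) * V z"] by linarith
    then have "\<bar>F / k - V z\<bar> \<le> \<eta>" using close S(1) by simp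
    then show "\<bar>(steklov_list \<epsilon> xs ^^ n) V z / exp_mean \<epsilon> ^ n - V z\<bar> \<le> \<eta>" by (simp add: F_def k_def)
  qed
qed

section \<open>Logarithmic coordinates on the simplex\<close>

definition prob_simplex :: "'i set \<Rightarrow> ('i \<Rightarrow> real) set" where
  "prob_simplex X = {m. (\<forall>i\<in>X. 0 \<le> m i) \<and> (\<Sum>i\<in>X. m i) = 1}"

text \<open>Superjets relative to the simplex, in the coordinates x of the perturbation \<open>m (1 + x)\<close>.\<close>

definition simplex_superjet ::
    "'i set \<Rightarrow> (('i \<Rightarrow> real) \<Rightarrow> real) \<Rightarrow> ('i \<Rightarrow> real) \<Rightarrow> ('i \<Rightarrow> real) \<Rightarrow> ('i \<Rightarrow> 'i \<Rightarrow> real) \<Rightarrow> bool" where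
  "simplex_superjet X u m p P \<longleftrightarrow> (\<exists>r. r \<in> o[at_origin X](\<lambda>x. (l1_norm X x)\<^sup>2) \<and>
     (\<forall>\<^sub>F x in at_origin X. lin_form X m x = 0 \<longrightarrow>
        u (\<lambda>i. m i * (1 + x i)) \<le> u m + lin_form X p x + quad_form X P x / 2 + r x))"

definition centred_gen :: "'i set \<Rightarrow> ('i \<Rightarrow> real) \<Rightarrow> ('i \<Rightarrow> 'i \<Rightarrow> real) \<Rightarrow> ('i \<Rightarrow> real) \<Rightarrow> real" where
  "centred_gen X m P \<rho> = quad_form X P (\<lambda>i. \<rho> i - lin_form X \<rho> m) / 2"

definition softmax :: "'i set \<Rightarrow> ('i \<Rightarrow> real) \<Rightarrow> 'i \<Rightarrow> real" where
  "softmax X z = (\<lambda>i. exp (z i) / expsum X z)"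

definition homog_lift :: "'i set \<Rightarrow> (('i \<Rightarrow> real) \<Rightarrow> real) \<Rightarrow> ('i \<Rightarrow> real) \<Rightarrow> real" where
  "homog_lift X u z = expsum X z * u (softmax X z)"

definition ln1p :: "('i \<Rightarrow> real) \<Rightarrow> 'i \<Rightarrow> real" where
  "ln1p y = (\<lambda>i. ln (1 + y i))"

definition log_hess :: "('i \<Rightarrow> real) \<Rightarrow> ('i \<Rightarrow> 'i \<Rightarrow> real) \<Rightarrow> 'i \<Rightarrow> 'i \<Rightarrow> real" where
  "log_hess p Q i j = Q i j - (if i = j then p i else 0)"

lemma prob_simplex_sum: "m \<in> prob_simplex X \<Longrightarrow> (\<Sum>i\<in>X. m i) = 1"
  by (simp add: prob_simplex_def)

lemma prob_simplex_nonneg: "m \<in> prob_simplex X \<Longrightarrow> i \<in> X \<Longrightarrow> 0 \<le> m i"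
  by (simp add: prob_simplex_def)

lemma prob_simplex_le_1: "finite X \<Longrightarrow> m \<in> prob_simplex X \<Longrightarrow> i \<in> X \<Longrightarrow> m i \<le> 1"
  unfolding prob_simplex_def using member_le_sum[of i X m] by auto

lemma softmax_pos: "finite X \<Longrightarrow> X \<noteq> {} \<Longrightarrow> 0 < softmax X z i"
  using expsum_pos[of X z] by (simp add: softmax_def)

lemma softmax_in_simplex:
  assumes "finite X" "X \<noteq> {}"
  shows "softmax X z \<in> prob_simplex X"
proof -
  have "(\<Sum>i\<in>X. softmax X z i) = expsum X z / expsum X z"
    unfolding softmax_def sum_divide_distrib[symmetric] expsum_def[symmetric] ..
  then show ?thesis using expsum_pos[OF assms, of z] softmax_pos[OF assms]
    by (simp add: prob_simplex_def less_imp_le)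
qed

lemma expsum_ln:
  assumes "m \<in> prob_simplex X" "\<And>i. i \<in> X \<Longrightarrow> 0 < m i"
  shows "expsum X (\<lambda>i. ln (m i)) = 1"
  using assms by (simp add: expsum_def prob_simplex_def)

lemma softmax_ln: "m \<in> prob_simplex X \<Longrightarrow> (\<And>i. i \<in> X \<Longrightarrow> 0 < m i) \<Longrightarrow> i \<in> X \<Longrightarrow>
    softmax X (\<lambda>i. ln (m i)) i = m i"
  by (simp add: softmax_def expsum_ln)

lemma seq_cont_on_expsum: "seq_cont_on X B (expsum X)"
  unfolding expsum_def[abs_def] by (intro seq_cont_on_separable continuous_intros)

lemma seq_cont_on_softmax:
  assumes X: "finite X" "X \<noteq> {}" and i: "i \<in> X"
  shows "seq_cont_on X B (\<lambda>z. softmax X z i)"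
  unfolding seq_cont_on_def softmax_def
proof (intro allI impI)
  fix s l assume "range s \<subseteq> B" "l \<in> B" and lim: "\<forall>i\<in>X. (\<lambda>n. s n i) \<longlonglongrightarrow> l i"
  then have "(\<lambda>n. expsum X (s n)) \<longlonglongrightarrow> expsum X l" by (intro seq_cont_onD[OF seq_cont_on_expsum]) auto
  then show "(\<lambda>n. exp (s n i) / expsum X (s n)) \<longlonglongrightarrow> exp (l i) / expsum X l"
    using lim i expsum_pos[OF X, of l] by (intro tendsto_intros) auto
qed

lemma seq_cont_on_homog_lift:
  assumes X: "finite X" "X \<noteq> {}" and u: "seq_cont_on X (prob_simplex X) u"
  shows "seq_cont_on X B (homog_lift X u)"
  unfolding seq_cont_on_def homog_lift_def
proof (intro allI impI tendsto_mult)
  fix s l assume s: "range s \<subseteq> B" "l \<in> B" "\<forall>i\<in>X. (\<lambda>n. s n i) \<longlonglongrightarrow> l i"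
  then show "(\<lambda>n. expsum X (s n)) \<longlonglongrightarrow> expsum X l" by (intro seq_cont_onD[OF seq_cont_on_expsum]) auto
  have "(\<lambda>n. softmax X (s n) i) \<longlonglongrightarrow> softmax X l i" if "i \<in> X" for i
    using s by (intro seq_cont_onD[OF seq_cont_on_softmax[OF X that]]) auto
  then show "(\<lambda>n. u (softmax X (s n))) \<longlonglongrightarrow> u (softmax X l)"
    by (intro seq_cont_onD[OF u] softmax_in_simplex[OF X])
qed

lemma homog_lift_ln:
  assumes X: "finite X" "X \<noteq> {}" and u: "seq_cont_on X (prob_simplex X) u"
    and m: "m \<in> prob_simplex X" "\<And>i. i \<in> X \<Longrightarrow> 0 < m i"
  shows "homog_lift X u (\<lambda>i. ln (m i)) = u m"
  using seq_cont_on_cong[OF u softmax_in_simplex[OF X] m(1) softmax_ln[OF m]]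
  by (simp add: homog_lift_def expsum_ln[OF m])

lemma softmax_near:
  assumes X: "finite X" "X \<noteq> {}" and d: "0 < d"
  obtains R where "R > 0" "\<And>z i. z \<in> cube X zb R \<Longrightarrow> i \<in> X \<Longrightarrow> \<bar>softmax X z i - softmax X zb i\<bar> < d"
proof -
  have "\<exists>r>0. \<forall>z. (\<forall>j\<in>X. \<bar>z j - zb j\<bar> < r) \<longrightarrow> \<bar>softmax X z i - softmax X zb i\<bar> < d" if i: "i \<in> X"
    for i
  proof -
    obtain r where r: "r > 0" "\<And>y z. y \<in> cube X zb 1 \<Longrightarrow> z \<in> cube X zb 1 \<Longrightarrow>
        (\<And>j. j \<in> X \<Longrightarrow> \<bar>y j - z j\<bar> < r) \<Longrightarrow> \<bar>softmax X y i - softmax X z i\<bar> < d"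
      using seq_cont_on_uniform[OF seq_compact_on_cube[OF X(1)] seq_cont_on_softmax[OF X i] d]
      by blast
    then show ?thesis by (intro exI[of _ "min 1 r"]) (auto simp: cube_def less_imp_le)
  qed
  then obtain r where r: "\<And>i. i \<in> X \<Longrightarrow> r i > 0"
      "\<And>i z. i \<in> X \<Longrightarrow> (\<And>j. j \<in> X \<Longrightarrow> \<bar>z j - zb j\<bar> < r i) \<Longrightarrow> \<bar>softmax X z i - softmax X zb i\<bar> < d"
    by metis
  define R where "R = Min (r ` X) / 2"
  have "0 < Min (r ` X)" using X r(1) by simp
  then have R: "0 < R" "R < Min (r ` X)" by (auto simp: R_def)
  have "\<bar>softmax X z i - softmax X zb i\<bar> < d" if z: "z \<in> cube X zb R" and i: "i \<in> X" for z i
  proof (rule r(2)[OF i])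
    fix j assume "j \<in> X"
    then have "\<bar>z j - zb j\<bar> \<le> R" using z by (simp add: cube_def)
    also have "R < r i" using R(2) X(1) i by (meson Min_le finite_imageI imageI less_le_trans)
    finally show "\<bar>z j - zb j\<bar> < r i" .
  qed
  then show ?thesis using R(1) that by blast
qed

subsection \<open>Jets under a logarithmic change of coordinates\<close>

lemma walk_gen_eq_quad_form: "finite X \<Longrightarrow> walk_gen X \<rho> p Q = quad_form X (log_hess p Q) \<rho> / 2"
  using quad_form_lincomb[of X 1 Q "-1" "\<lambda>i j. if i = j then p i else 0" \<rho>]
  by (simp add: walk_gen_def log_hess_def[abs_def] quad_form_diag diff_divide_distrib)

lemma smallo_1_iff: "f \<in> o[F](\<lambda>x. 1 :: real) \<longleftrightarrow> (f \<longlongrightarrow> 0) F" for f :: "_ \<Rightarrow> real"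
  using smalloI_tendsto[of f "\<lambda>x. 1" F] smalloD_tendsto[of f F "\<lambda>x. 1"] by auto

lemma tendsto_imp_bigo_1: "(f \<longlongrightarrow> c) F \<Longrightarrow> f \<in> O[F](\<lambda>x. 1 :: real)" for f :: "_ \<Rightarrow> real"
  by (rule bigoI_tendsto[of f "\<lambda>x. 1" c]) auto

lemma lin_form_smallo:
  assumes "\<And>i. i \<in> X \<Longrightarrow> (\<lambda>x. f x i) \<in> o[F](g)"
  shows "(\<lambda>x. lin_form X p (f x)) \<in> o[F](g)"
  unfolding lin_form_def
proof (rule big_sum_in_smallo)
  fix i assume "i \<in> X"
  then show "(\<lambda>x. f x i * p i) \<in> o[F](g)" using assms by (cases "p i = 0") auto
qed

lemma lin_form_bigo:
  assumes "\<And>i. i \<in> X \<Longrightarrow> (\<lambda>x. f x i) \<in> O[F](g)"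
  shows "(\<lambda>x. lin_form X p (f x)) \<in> O[F](g)"
  unfolding lin_form_def
proof (rule big_sum_in_bigo)
  fix i assume "i \<in> X"
  then show "(\<lambda>x. f x i * p i) \<in> O[F](g)" using assms by (cases "p i = 0") auto
qed

lemma quad_form_bigo:
  assumes "\<And>i. i \<in> X \<Longrightarrow> (\<lambda>x. f x i) \<in> O[F](g)"
  shows "(\<lambda>x. quad_form X Q (f x)) \<in> O[F](\<lambda>x. (g x)\<^sup>2)"
  unfolding quad_form_def
proof (intro big_sum_in_bigo)
  fix i j assume "i \<in> X" "j \<in> X"
  then have "(\<lambda>x. f x i * f x j) \<in> O[F](\<lambda>x. g x * g x)" by (intro landau_o.big.mult assms)
  then show "(\<lambda>x. f x i * f x j * Q i j) \<in> O[F](\<lambda>x. (g x)\<^sup>2)"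
    by (cases "Q i j = 0") (auto simp: power2_eq_square)
qed

lemma quad_form_diff_smallo:
  assumes f: "\<And>i. i \<in> X \<Longrightarrow> (\<lambda>x. f x i) \<in> O[F](h)" and g: "\<And>i. i \<in> X \<Longrightarrow> (\<lambda>x. g x i) \<in> O[F](h)"
    and fg: "\<And>i. i \<in> X \<Longrightarrow> (\<lambda>x. f x i - g x i) \<in> o[F](h)"
  shows "(\<lambda>x. quad_form X Q (f x) - quad_form X Q (g x)) \<in> o[F](\<lambda>x. (h x)\<^sup>2)"
proof -
  have "(\<lambda>x. \<Sum>i\<in>X. \<Sum>j\<in>X. Q i j * (f x i * f x j - g x i * g x j)) \<in> o[F](\<lambda>x. (h x)\<^sup>2)"
  proof (intro big_sum_in_smallo)
    fix i j assume "i \<in> X" "j \<in> X"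
    then have "(\<lambda>x. (f x i - g x i) * f x j + g x i * (f x j - g x j)) \<in> o[F](\<lambda>x. h x * h x)"
      by (intro sum_in_smallo landau_o.small_big_mult landau_o.big_small_mult f g fg)
    then have "(\<lambda>x. f x i * f x j - g x i * g x j) \<in> o[F](\<lambda>x. (h x)\<^sup>2)"
      by (simp add: algebra_simps power2_eq_square)
    then show "(\<lambda>x. Q i j * (f x i * f x j - g x i * g x j)) \<in> o[F](\<lambda>x. (h x)\<^sup>2)"
      by (cases "Q i j = 0") auto
  qed
  then show ?thesis by (simp add: quad_form_def sum_subtractf right_diff_distrib mult.commute)
qed

lemma l1_norm_bigo:
  assumes "\<And>i. i \<in> X \<Longrightarrow> (\<lambda>x. f x i) \<in> O[F](g)"
  shows "(\<lambda>x. l1_norm X (f x)) \<in> O[F](g)"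
  unfolding l1_norm_def using assms by (intro big_sum_in_bigo) simp

lemma filterlim_at_origin_bigo:
  assumes "\<And>i. i \<in> X \<Longrightarrow> (\<lambda>x. f x i) \<in> O[at_origin X](l1_norm X)"
  shows "filterlim f (at_origin X) (at_origin X)"
proof -
  have "l1_norm X \<in> o[at_origin X](\<lambda>x. 1)"
    using l1_norm_tendsto_at_origin by (simp add: smallo_1_iff)
  from landau_o.big_small_trans[OF l1_norm_bigo[OF assms] this]
  show ?thesis unfolding filterlim_at_origin by (simp add: smallo_1_iff)
qed

lemma ln_taylor1: "(\<lambda>t::real. ln (1 + t) - t) \<in> o[nhds 0](\<lambda>t. t)"
  by (rule smallo_at_imp_nhds) (real_asymp, simp)

lemma ln_taylor2: "(\<lambda>t::real. ln (1 + t) - t + t\<^sup>2 / 2) \<in> o[nhds 0](\<lambda>t. t\<^sup>2)"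
  by (rule smallo_at_imp_nhds) (real_asymp, simp)

lemma ln1p_smallo:
  assumes "finite X" "i \<in> X"
  shows "(\<lambda>y. ln1p y i - y i) \<in> o[at_origin X](l1_norm X)"
    and "(\<lambda>y. ln1p y i - y i + (y i)\<^sup>2 / 2) \<in> o[at_origin X](\<lambda>y. (l1_norm X y)\<^sup>2)"
  unfolding ln1p_def
  using landau_o.small_big_trans[OF
    landau_o.small.compose[OF ln_taylor1 coord_tendsto_at_origin[OF assms]]
      coord_bigo_at_origin[OF assms]]
    landau_o.small_big_trans[OF landau_o.small.compose[OF ln_taylor2
        coord_tendsto_at_origin[OF assms]]
      landau_o.big_power[OF coord_bigo_at_origin[OF assms]]]
  by auto

lemma ln1p_bigo:
  assumes "finite X" "i \<in> X"
  shows "(\<lambda>y. ln1p y i) \<in> O[at_origin X](l1_norm X)"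
  using sum_in_bigo(1)[OF landau_o.small_imp_big[OF ln1p_smallo(1)[OF assms]]
    coord_bigo_at_origin[OF assms]] by simp

lemma filterlim_ln1p: "finite X \<Longrightarrow> filterlim ln1p (at_origin X) (at_origin X)"
  by (rule filterlim_at_origin_bigo) (rule ln1p_bigo)

lemma log_jet:
  assumes X: "finite X" and jet: "has_jet2 X \<phi> z p Q"
  shows "(\<lambda>y. \<phi> (z + ln1p y) - \<phi> z - lin_form X p y - quad_form X (log_hess p Q) y / 2)
    \<in> o[at_origin X](\<lambda>y. (l1_norm X y)\<^sup>2)"
proof -
  have "(\<lambda>y. \<phi> (z + ln1p y) - \<phi> z - lin_form X p (ln1p y) - quad_form X Q (ln1p y) / 2)
      \<in> o[at_origin X](\<lambda>y. (l1_norm X (ln1p y))\<^sup>2)"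
    using jet unfolding has_jet2_def by (rule landau_o.small.compose[OF _ filterlim_ln1p[OF X]])
  then have remainder: "(\<lambda>y. \<phi> (z + ln1p y) - \<phi> z - lin_form X p (ln1p y)
      - quad_form X Q (ln1p y) / 2)
      \<in> o[at_origin X](\<lambda>y. (l1_norm X y)\<^sup>2)"
    by (rule landau_o.small_big_trans) (intro landau_o.big_power l1_norm_bigo ln1p_bigo[OF X])
  have lin: "(\<lambda>y. lin_form X p (\<lambda>i. ln1p y i - y i + (y i)\<^sup>2 / 2))
      \<in> o[at_origin X](\<lambda>y. (l1_norm X y)\<^sup>2)"
    by (intro lin_form_smallo ln1p_smallo(2)[OF X])
  have "(\<lambda>y. (quad_form X Q (ln1p y) - quad_form X Q y) / 2) \<in> o[at_origin X](\<lambda>y. (l1_norm X y)\<^sup>2)"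
    using quad_form_diff_smallo[OF ln1p_bigo[OF X] coord_bigo_at_origin[OF X] ln1p_smallo(1)[OF X]]
    by simp
  note small = sum_in_smallo(1)[OF sum_in_smallo(1)[OF remainder lin] this]
  have "(\<phi> (z + ln1p y) - \<phi> z - lin_form X p (ln1p y) - quad_form X Q (ln1p y) / 2)
      + lin_form X p (\<lambda>i. ln1p y i - y i + (y i)\<^sup>2 / 2)
      + (quad_form X Q (ln1p y) - quad_form X Q y) / 2
      = \<phi> (z + ln1p y) - \<phi> z - lin_form X p y - quad_form X (log_hess p Q) y / 2" for y
  proof -
    have "lin_form X p (\<lambda>i. ln1p y i - y i + (y i)\<^sup>2 / 2)
        = lin_form X p (ln1p y) - lin_form X p y + lin_form X p (\<lambda>i. (y i)\<^sup>2) / 2"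
      by (simp add: lin_form_def distrib_right left_diff_distrib sum.distrib sum_subtractf
        sum_divide_distrib)
    moreover have "quad_form X (log_hess p Q) y = quad_form X Q y - lin_form X p (\<lambda>i. (y i)\<^sup>2)"
      using walk_gen_eq_quad_form[OF X, of y p Q] by (simp add: walk_gen_def)
    ultimately show ?thesis by (simp add: diff_divide_distrib)
  qed
  with small show ?thesis by (simp only:)
qed

text \<open>In these terms \<open>m (1 + x) / (1 - s x)\<close> has logarithmic coordinates
  \<open>ln m + ln1p (dilate X l x)\<close>, where \<open>s = lin_form X l\<close>; the dilation leaves \<open>softmax\<close> alone and
  multiplies \<open>expsum\<close> by \<open>1 / (1 - s x)\<close>.\<close>

definition shear :: "'i set \<Rightarrow> ('i \<Rightarrow> real) \<Rightarrow> ('i \<Rightarrow> real) \<Rightarrow> 'i \<Rightarrow> real" where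
  "shear X l x = (\<lambda>i. x i + lin_form X l x)"

definition dilate :: "'i set \<Rightarrow> ('i \<Rightarrow> real) \<Rightarrow> ('i \<Rightarrow> real) \<Rightarrow> 'i \<Rightarrow> real" where
  "dilate X l x = (\<lambda>i. shear X l x i / (1 - lin_form X l x))"

lemma lin_form_tendsto: "finite X \<Longrightarrow> (lin_form X l \<longlongrightarrow> 0) (at_origin X)"
  unfolding lin_form_def[abs_def]
  by (intro tendsto_null_sum tendsto_mult_left_zero coord_tendsto_at_origin)

lemma eventually_lin_form_less_1: "finite X \<Longrightarrow> \<forall>\<^sub>F x in at_origin X. lin_form X l x < 1"
  by (rule order_tendstoD(2)[OF lin_form_tendsto]) simp_all

lemma eventually_coords_gt_minus_1: "finite X \<Longrightarrow> \<forall>\<^sub>F x in at_origin X. \<forall>i\<in>X. -1 < x i"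
  by (intro eventually_ball_finite ballI order_tendstoD(1)[OF coord_tendsto_at_origin]) auto

lemma shear_bigo: "finite X \<Longrightarrow> i \<in> X \<Longrightarrow> (\<lambda>x. shear X l x i) \<in> O[at_origin X](l1_norm X)"
  unfolding shear_def by (intro sum_in_bigo lin_form_bigo coord_bigo_at_origin)

lemma dilation_factor_tendsto: "finite X \<Longrightarrow> ((\<lambda>x. 1 / (1 - lin_form X l x)) \<longlongrightarrow> 1) (at_origin X)"
  by (auto intro!: tendsto_eq_intros lin_form_tendsto)

lemma dilate_bigo:
  assumes "finite X" "i \<in> X"
  shows "(\<lambda>x. dilate X l x i) \<in> O[at_origin X](l1_norm X)"
  using landau_o.big.mult[OF shear_bigo[OF assms, of l]
    tendsto_imp_bigo_1[OF dilation_factor_tendsto[OF assms(1), of l]]]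
  by (simp add: dilate_def)

lemma filterlim_dilate: "finite X \<Longrightarrow> filterlim (dilate X l) (at_origin X) (at_origin X)"
  by (rule filterlim_at_origin_bigo) (rule dilate_bigo)

lemma dilation_cancel:
  assumes "lin_form X l x < 1"
  shows "(1 - lin_form X l x) * (D - lin_form X p (dilate X l x) - quad_form X P (dilate X l x) / 2)
      + (1 / (1 - lin_form X l x) - 1) * (quad_form X P (shear X l x) / 2)
    = (1 - lin_form X l x) * D - lin_form X p (shear X l x) - quad_form X P (shear X l x) / 2"
proof -
  define k where "k = 1 - lin_form X l x"
  define v where "v = 1 / k"
  define a where "a = lin_form X p (shear X l x)"
  define b where "b = quad_form X P (shear X l x)"
  have kv: "k * v = 1" using assms by (simp add: k_def v_def)
  have "lin_form X p (dilate X l x) = v * a"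
    using lin_form_scale[of X p v "shear X l x"] by (simp add: dilate_def a_def v_def k_def)
  moreover have "quad_form X P (dilate X l x) = v * (v * b)"
    by (simp add: quad_form_def dilate_def b_def v_def k_def sum_distrib_left)
  moreover have "k * (D - v * a - v * (v * b) / 2) = k * D - (k * v) * a - (k * v) * (v * b) / 2"
    by (simp add: algebra_simps)
  then have "k * (D - v * a - v * (v * b) / 2) + (v - 1) * (b / 2) = k * D - a - b / 2"
    unfolding kv by (simp only:) (simp add: field_simps)
  ultimately show ?thesis by (simp add: a_def b_def v_def k_def)
qed

lemma dilation_jet:
  assumes X: "finite X" and jet: "has_jet2 X \<phi> z p Q"
  shows "(\<lambda>x. (1 - lin_form X l x) * (\<phi> (z + ln1p (dilate X l x)) - \<phi> z)
      - lin_form X p (shear X l x) - quad_form X (log_hess p Q) (shear X l x) / 2)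
      \<in> o[at_origin X](\<lambda>x. (l1_norm X x)\<^sup>2)"
proof -
  define s where "s = lin_form X l"
  define P where "P = log_hess p Q"
  define A where "A x = \<phi> (z + ln1p (dilate X l x)) - \<phi> z - lin_form X p (dilate X l x)
      - quad_form X P (dilate X l x) / 2" for x
  have "A \<in> o[at_origin X](\<lambda>x. (l1_norm X (dilate X l x))\<^sup>2)"
    unfolding A_def P_def
    by (rule landau_o.small.compose[OF log_jet[OF X jet] filterlim_dilate[OF X]])
  then have A: "A \<in> o[at_origin X](\<lambda>x. (l1_norm X x)\<^sup>2)"
    by (rule landau_o.small_big_trans) (intro landau_o.big_power l1_norm_bigo dilate_bigo[OF X])
  have "((\<lambda>x. 1 - s x) \<longlongrightarrow> 1) (at_origin X)"
    unfolding s_def by (auto intro!: tendsto_eq_intros lin_form_tendsto X)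
  from landau_o.big_small_mult[OF tendsto_imp_bigo_1[OF this] A]
  have "(\<lambda>x. (1 - s x) * A x) \<in> o[at_origin X](\<lambda>x. (l1_norm X x)\<^sup>2)" by simp
  moreover have "(\<lambda>x. (1 / (1 - s x) - 1) * (quad_form X P (shear X l x) / 2))
      \<in> o[at_origin X](\<lambda>x. (l1_norm X x)\<^sup>2)"
  proof -
    have "(\<lambda>x. 1 / (1 - s x) - 1) \<in> o[at_origin X](\<lambda>x. 1)"
      unfolding smallo_1_iff s_def
      using tendsto_diff[OF dilation_factor_tendsto[OF X, of l] tendsto_const[of 1]] by simp
    moreover have "(\<lambda>x. quad_form X P (shear X l x) / 2) \<in> O[at_origin X](\<lambda>x. (l1_norm X x)\<^sup>2)"
      using quad_form_bigo[OF shear_bigo[OF X]] by simp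
    ultimately show ?thesis using landau_o.small_big_mult by fastforce
  qed
  ultimately have sum: "(\<lambda>x. (1 - s x) * A x
      + (1 / (1 - s x) - 1) * (quad_form X P (shear X l x) / 2))
      \<in> o[at_origin X](\<lambda>x. (l1_norm X x)\<^sup>2)" by (rule sum_in_smallo(1))
  have "\<forall>\<^sub>F x in at_origin X. (1 - s x) * A x
      + (1 / (1 - s x) - 1) * (quad_form X P (shear X l x) / 2)
      = (1 - s x) * (\<phi> (z + ln1p (dilate X l x)) - \<phi> z) - lin_form X p (shear X l x)
      - quad_form X P (shear X l x) / 2"
    using eventually_lin_form_less_1[OF X, of l]
    by eventually_elim (simp only: A_def s_def dilation_cancel)
  from landau_o.small.in_cong[OF this] sum show ?thesis unfolding s_def P_def by blast
qed

lemma lin_form_shear: "lin_form X p (shear X l x) = lin_form X (\<lambda>k. p k + (\<Sum>i\<in>X. p i) * l k) x"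
proof -
  have "lin_form X p (shear X l x) = lin_form X p x + (\<Sum>i\<in>X. p i) * lin_form X l x"
    unfolding lin_form_def[of X p] shear_def sum_distrib_right sum.distrib[symmetric]
    by (intro sum.cong refl) (simp add: algebra_simps)
  then show ?thesis using lin_form_lincomb[of X 1 p "\<Sum>i\<in>X. p i" l x] by simp
qed

lemma quad_form_linear_image:
  fixes E :: "'i \<Rightarrow> 'i \<Rightarrow> real"
  shows "quad_form X P (\<lambda>i. lin_form X (E i) x)
      = quad_form X (\<lambda>k l. \<Sum>i\<in>X. \<Sum>j\<in>X. E i k * E j l * P i j) x"
proof -
  have "quad_form X P (\<lambda>i. lin_form X (E i) x)
      = (\<Sum>i\<in>X. \<Sum>j\<in>X. \<Sum>k\<in>X. \<Sum>l\<in>X. x k * x l * (E i k * E j l * P i j))"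
    unfolding quad_form_def lin_form_def sum_product
    unfolding sum_distrib_right by (intro sum.cong refl) (simp add: ac_simps)
  also have "\<dots> = (\<Sum>i\<in>X. \<Sum>k\<in>X. \<Sum>j\<in>X. \<Sum>l\<in>X. x k * x l * (E i k * E j l * P i j))"
    by (rule sum.cong[OF refl], rule sum.swap)
  also have "\<dots> = (\<Sum>k\<in>X. \<Sum>i\<in>X. \<Sum>j\<in>X. \<Sum>l\<in>X. x k * x l * (E i k * E j l * P i j))" by (rule sum.swap)
  also have "\<dots> = (\<Sum>k\<in>X. \<Sum>i\<in>X. \<Sum>l\<in>X. \<Sum>j\<in>X. x k * x l * (E i k * E j l * P i j))"
    by (rule sum.cong[OF refl], rule sum.cong[OF refl], rule sum.swap)
  also have "\<dots> = (\<Sum>k\<in>X. \<Sum>l\<in>X. \<Sum>i\<in>X. \<Sum>j\<in>X. x k * x l * (E i k * E j l * P i j))"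
    by (rule sum.cong[OF refl], rule sum.swap)
  finally show ?thesis by (simp add: quad_form_def sum_distrib_left)
qed

lemma quad_form_shear:
  assumes X: "finite X"
  obtains P' where "\<And>x. quad_form X P (shear X l x) = quad_form X P' x"
proof -
  define E where "E i k = (if i = k then 1 else 0) + l k" for i k
  have "shear X l x i = lin_form X (E i) x" if "i \<in> X" for i x
    using X that
    by (simp add: E_def shear_def lin_form_def distrib_left sum.distrib if_distrib[of "\<lambda>a. _ * a"]
      cong: if_cong)
  then have "quad_form X P (shear X l x) = quad_form X P (\<lambda>i. lin_form X (E i) x)" for x
    unfolding quad_form_def by (intro sum.cong refl) simp
  then show ?thesis using quad_form_linear_image[of X P E] by (intro that) simp
qed

lemma homog_lift_dilate:
  assumes X: "finite X" "X \<noteq> {}" and u: "seq_cont_on X (prob_simplex X) u"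
    and s: "lin_form X l x < 1"
    and x: "lin_form X (softmax X z) x = 0" "\<And>i. i \<in> X \<Longrightarrow> -1 < x i"
  shows "homog_lift X u (z + ln1p (dilate X l x))
      = expsum X z / (1 - lin_form X l x) * u (\<lambda>i. softmax X z i * (1 + x i))"
proof -
  define s where "s = lin_form X l x"
  define N where "N = expsum X z"
  define y where "y = z + ln1p (dilate X l x)"
  define m where "m = softmax X z"
  have s1: "s < 1" using s by (simp add: s_def)
  have N: "N > 0" unfolding N_def by (rule expsum_pos[OF X])
  have m: "m \<in> prob_simplex X" "\<And>i. 0 < m i"
    unfolding m_def using softmax_in_simplex[OF X] softmax_pos[OF X] by auto
  have exp_y: "exp (y i) = N / (1 - s) * (m i * (1 + x i))" if "i \<in> X" for i
  proof -
    have "1 + dilate X l x i = (1 + x i) / (1 - s)"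
      using s1 by (simp add: dilate_def shear_def s_def field_simps)
    moreover have "0 < (1 + x i) / (1 - s)" using x(2)[OF that] s1 by simp
    ultimately have "exp (y i) = exp (z i) * ((1 + x i) / (1 - s))"
      by (simp add: y_def ln1p_def exp_add)
    moreover have "exp (z i) = N * m i" using N by (simp add: m_def N_def softmax_def)
    ultimately show ?thesis by simp
  qed
  have "(\<Sum>i\<in>X. m i * (1 + x i)) = (\<Sum>i\<in>X. m i) + lin_form X m x"
    unfolding lin_form_def sum.distrib[symmetric] by (intro sum.cong refl) (simp add: algebra_simps)
  then have mass: "(\<Sum>i\<in>X. m i * (1 + x i)) = 1"
    using x(1) prob_simplex_sum[OF m(1)] by (simp add: m_def)
  have "expsum X y = (\<Sum>i\<in>X. N / (1 - s) * (m i * (1 + x i)))"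
    unfolding expsum_def by (intro sum.cong refl exp_y)
  then have expsum_y: "expsum X y = N / (1 - s)" unfolding sum_distrib_left[symmetric] mass by simp
  have "0 \<le> m i * (1 + x i)" if "i \<in> X" for i using m(2)[of i] x(2)[OF that] by simp
  then have "(\<lambda>i. m i * (1 + x i)) \<in> prob_simplex X" using mass by (simp add: prob_simplex_def)
  then have "u (softmax X y) = u (\<lambda>i. m i * (1 + x i))"
    using N s1 by (intro seq_cont_on_cong[OF u softmax_in_simplex[OF X]])
      (simp_all add: softmax_def[of X y] expsum_y exp_y)
  then show ?thesis
    unfolding homog_lift_def y_def[symmetric] expsum_y by (simp add: N_def s_def m_def)
qed

text \<open>A test function touching the homogeneous lift can be restricted along any dilation of the
  simplex. Choosing l to take the value of the mean on the centred direction turns that direction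
  into \<open>\<rho>\<close>.\<close>

lemma simplex_increment_le_of_homog_lift:
  fixes X :: "'i set" and z l x :: "'i \<Rightarrow> real"
  defines "m \<equiv> softmax X z" and "N \<equiv> expsum X z" and "s \<equiv> lin_form X l x"
  assumes X: "finite X" "X \<noteq> {}" and u: "seq_cont_on X (prob_simplex X) u"
    and x: "s < 1" "\<forall>i\<in>X. -1 < x i" "lin_form X m x = 0"
    and le: "homog_lift X u (z + ln1p (dilate X l x)) - homog_lift X u z \<le> D"
  shows "u (\<lambda>i. m i * (1 + x i)) \<le> u m - u m * s + (1 - s) * D / N"
proof -
  have N: "N > 0" unfolding N_def by (rule expsum_pos[OF X])
  define U where "U = u (\<lambda>i. m i * (1 + x i))"
  have "homog_lift X u (z + ln1p (dilate X l x)) = N / (1 - s) * U"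
    unfolding N_def s_def U_def m_def using x
    by (intro homog_lift_dilate[OF X u]) (auto simp: s_def m_def)
  moreover have "homog_lift X u z = N * u m" by (simp add: homog_lift_def N_def m_def)
  ultimately have "N / (1 - s) * U \<le> N * u m + D" using le by linarith
  then have "(1 - s) * (N / (1 - s) * U) \<le> (1 - s) * (N * u m + D)"
    using x(1) by (intro mult_left_mono) auto
  then have "N * U \<le> (1 - s) * (N * u m + D)" using x(1) by simp
  then have "U \<le> (1 - s) * (N * u m + D) / N" using N by (simp add: pos_le_divide_eq mult.commute)
  also have "\<dots> = u m - u m * s + (1 - s) * D / N" using N by (simp add: field_simps)
  finally show ?thesis unfolding U_def .
qed

lemma homog_lift_superjet:
  assumes X: "finite X" "X \<noteq> {}" and u: "seq_cont_on X (prob_simplex X) u"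
    and jet: "has_jet2 X \<phi> z p Q"
    and touch: "\<forall>\<^sub>F \<zeta> in at_origin X. homog_lift X u (z + \<zeta>) - homog_lift X u z \<le> \<phi> (z + \<zeta>) - \<phi> z"
    and l: "lin_form X l (\<lambda>i. \<rho> i - lin_form X \<rho> (softmax X z)) = lin_form X \<rho> (softmax X z)"
  obtains p' P' where "simplex_superjet X u (softmax X z) p' P'"
    "expsum X z * centred_gen X (softmax X z) P' \<rho> = walk_gen X \<rho> p Q"
proof -
  define N where "N = expsum X z"
  have N: "N > 0" unfolding N_def by (rule expsum_pos[OF X])
  define m where "m = softmax X z"
  define s where "s = lin_form X l"
  obtain P0 where P0: "\<And>x. quad_form X (log_hess p Q) (shear X l x) = quad_form X P0 x"
    using quad_form_shear[OF X(1)] by blast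
  define p0 where "p0 = (\<lambda>k. p k + (\<Sum>i\<in>X. p i) * l k)"
  define D where "D x = \<phi> (z + ln1p (dilate X l x)) - \<phi> z" for x
  define R where "R x = (1 - s x) * D x - lin_form X p0 x - quad_form X P0 x / 2" for x
  have R: "R \<in> o[at_origin X](\<lambda>x. (l1_norm X x)\<^sup>2)"
    using dilation_jet[OF X(1) jet, of l]
    by (simp add: R_def[abs_def] D_def s_def P0 lin_form_shear p0_def)
  define p' where "p' k = (- u m) * l k + 1 / N * p0 k" for k
  define P' where "P' i j = 1 / N * P0 i j" for i j
  have lin: "lin_form X p' x = - u m * s x + 1 / N * lin_form X p0 x" for x
    unfolding p'_def s_def by (rule lin_form_lincomb)
  have quad: "quad_form X P' x = 1 / N * quad_form X P0 x" for x
    using quad_form_lincomb[of X "1 / N" P0 0 P0 x] by (simp add: P'_def[abs_def])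
  have "\<forall>\<^sub>F x in at_origin X. homog_lift X u (z + ln1p (dilate X l x)) - homog_lift X u z \<le> D x"
    unfolding D_def
    using eventually_compose_filterlim[OF touch
      filterlim_compose[OF filterlim_ln1p filterlim_dilate]] X(1) by simp
  with eventually_lin_form_less_1[OF X(1), of l] eventually_coords_gt_minus_1[OF X(1)]
  have "\<forall>\<^sub>F x in at_origin X. lin_form X m x = 0 \<longrightarrow>
      u (\<lambda>i. m i * (1 + x i)) \<le> u m + lin_form X p' x + quad_form X P' x / 2 + 1 / N * R x"
  proof (eventually_elim, intro impI)
    fix x assume x: "lin_form X l x < 1" "\<forall>i\<in>X. -1 < x i" "lin_form X m x = 0"
      and touch_x: "homog_lift X u (z + ln1p (dilate X l x)) - homog_lift X u z \<le> D x"
    have "u (\<lambda>i. m i * (1 + x i)) \<le> u m - u m * s x + (1 - s x) * D x / N"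
      unfolding m_def s_def N_def
      by (rule simplex_increment_le_of_homog_lift[OF X u x(1,2)
        x(3)[unfolded m_def] touch_x])
    also have "\<dots> = u m + lin_form X p' x + quad_form X P' x / 2 + 1 / N * R x"
      unfolding lin quad R_def by (simp add: diff_divide_distrib)
    finally show "u (\<lambda>i. m i * (1 + x i))
        \<le> u m + lin_form X p' x + quad_form X P' x / 2 + 1 / N * R x" .
  qed
  moreover have "(\<lambda>x. 1 / N * R x) \<in> o[at_origin X](\<lambda>x. (l1_norm X x)\<^sup>2)" using R N by simp
  ultimately have "simplex_superjet X u m p' P'" unfolding simplex_superjet_def by blast
  moreover have "N * centred_gen X m P' \<rho> = walk_gen X \<rho> p Q"
  proof -
    have "shear X l (\<lambda>i. \<rho> i - lin_form X \<rho> m) = \<rho>" using l by (simp add: shear_def m_def)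
    then show ?thesis
      using N P0[of "\<lambda>i. \<rho> i - lin_form X \<rho> m"]
      by (simp add: centred_gen_def quad walk_gen_eq_quad_form[OF X(1)])
  qed
  ultimately show ?thesis unfolding m_def N_def by (rule that)
qed

lemma exists_centring_functional:
  assumes X: "finite X" and m: "m \<in> prob_simplex X" "lin_form X \<rho> m = 0"
  obtains l where "lin_form X l (\<lambda>i. \<rho> i - a) = a"
proof (cases "\<forall>i\<in>X. \<rho> i = a")
  case True
  then have "a = 0"
    using m by (simp add: lin_form_def prob_simplex_def sum_distrib_right[symmetric] cong: sum.cong)
  then show ?thesis using True by (intro that[of "\<lambda>_. 0"]) (simp add: lin_form_def)
next
  case False
  define S where "S = (\<Sum>i\<in>X. (\<rho> i - a)\<^sup>2)"
  have "S \<noteq> 0" unfolding S_def using False X by (simp add: sum_nonneg_eq_0_iff)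
  moreover have "lin_form X (\<lambda>i. a / S * (\<rho> i - a)) (\<lambda>i. \<rho> i - a) = a / S * S"
    unfolding lin_form_def S_def sum_distrib_left
    by (intro sum.cong refl) (simp add: power2_eq_square)
  ultimately show ?thesis by (intro that[of "\<lambda>i. a / S * (\<rho> i - a)"]) simp
qed

lemma homog_lift_local_subsolution:
  assumes X: "finite X" "X \<noteq> {}" and u: "seq_cont_on X (prob_simplex X) u"
    and sub: "\<And>z p P. z \<in> cube X zb R \<Longrightarrow> simplex_superjet X u (softmax X z) p P \<Longrightarrow>
        - K \<le> centred_gen X (softmax X z) P \<rho>"
    and m0: "m0 \<in> prob_simplex X" "lin_form X \<rho> m0 = 0"
  shows "local_subsolution X zb R \<rho> K (\<lambda>z. homog_lift X u (clamp_cube zb R z))"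
  unfolding local_subsolution_def
proof (intro allI impI)
  fix z \<phi> p Q
  assume z: "\<forall>i\<in>X. \<bar>z i - zb i\<bar> < R" and jet: "has_jet2 X \<phi> z p Q"
    and ev: "\<forall>\<^sub>F \<zeta> in at_origin X. homog_lift X u (clamp_cube zb R (z + \<zeta>))
        - homog_lift X u (clamp_cube zb R z)
      \<le> \<phi> (z + \<zeta>) - \<phi> z"
  have zc: "z \<in> cube X zb R" using z by (auto simp: cube_def intro: less_imp_le)
  have unclamp: "homog_lift X u (clamp_cube zb R y) = homog_lift X u y" if "y \<in> cube X zb R" for y
    using that by (intro seq_cont_on_cong[OF seq_cont_on_homog_lift[OF X u, of UNIV]])
      (simp_all add: clamp_cube_eq)
  have "\<forall>\<^sub>F \<zeta> in at_origin X. z + \<zeta> \<in> cube X zb R"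
    using eventually_in_cube[OF X(1), of z zb R] z
    by (auto elim!: eventually_mono simp: cube_def intro: less_imp_le)
  with ev have touch: "\<forall>\<^sub>F \<zeta> in at_origin X. homog_lift X u (z + \<zeta>) - homog_lift X u z
      \<le> \<phi> (z + \<zeta>) - \<phi> z"
    by eventually_elim (simp add: unclamp zc)
  obtain l where "lin_form X l (\<lambda>i. \<rho> i - lin_form X \<rho> (softmax X z)) = lin_form X \<rho> (softmax X z)"
    using exists_centring_functional[OF X(1) m0] by blast
  from homog_lift_superjet[OF X u jet touch this] obtain p' P' where
    P': "simplex_superjet X u (softmax X z) p' P'"
      "expsum X z * centred_gen X (softmax X z) P' \<rho> = walk_gen X \<rho> p Q"
    by blast
  have "expsum X z * (- K) \<le> expsum X z * centred_gen X (softmax X z) P' \<rho>"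
    using sub[OF zc P'(1)] expsum_nonneg[of X z] by (rule mult_left_mono)
  then show "- K * expsum X z \<le> walk_gen X \<rho> p Q" unfolding P'(2) by (simp add: mult.commute)
qed

section \<open>Comparison on the simplex\<close>

definition simplex_subsolution :: "'i set \<Rightarrow> 'r set \<Rightarrow> ('r \<Rightarrow> 'i \<Rightarrow> real) \<Rightarrow> (('i \<Rightarrow> real) \<Rightarrow> 'r \<Rightarrow> ereal) \<Rightarrow>
    real \<Rightarrow>
    (('i \<Rightarrow> real) \<Rightarrow> real) \<Rightarrow> bool" where
  "simplex_subsolution X Hs \<rho> c \<beta> u
      \<longleftrightarrow> (\<forall>m p P. m \<in> prob_simplex X \<longrightarrow> (\<forall>i\<in>X. 0 < m i) \<longrightarrow> simplex_superjet X u m p P \<longrightarrow>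
     (\<forall>r\<in>Hs. ereal (\<beta> * u m) \<le> c m r + ereal (centred_gen X m P (\<rho> r))))"

definition simplex_supersolution :: "'i set \<Rightarrow> 'r set \<Rightarrow> ('r \<Rightarrow> 'i \<Rightarrow> real) \<Rightarrow>
    (('i \<Rightarrow> real) \<Rightarrow> 'r \<Rightarrow> ereal) \<Rightarrow> real \<Rightarrow>
    (('i \<Rightarrow> real) \<Rightarrow> real) \<Rightarrow> bool" where
  "simplex_supersolution X Hs \<rho> c \<beta> w \<longleftrightarrow>
     (\<forall>m p P. m \<in> prob_simplex X \<longrightarrow> (\<forall>i\<in>X. 0 < m i) \<longrightarrow> simplex_superjet X (\<lambda>m. - w m) m p P \<longrightarrow>
     (\<forall>e>0. \<exists>r\<in>Hs. c m r - ereal (centred_gen X m P (\<rho> r)) \<le> ereal (\<beta> * w m + e)))"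

definition log_cube :: "'i set \<Rightarrow> ('i \<Rightarrow> real) \<Rightarrow> real \<Rightarrow> ('i \<Rightarrow> real) set" where
  "log_cube X mb R = {m \<in> prob_simplex X. \<forall>i\<in>X. mb i * exp (- R) \<le> m i \<and> m i \<le> mb i * exp R}"

definition sq_dist :: "'i set \<Rightarrow> ('i \<Rightarrow> real) \<Rightarrow> ('i \<Rightarrow> real) \<Rightarrow> real" where
  "sq_dist X y z = (\<Sum>i\<in>X. (y i - z i)\<^sup>2)"

definition penalised_hess :: "real \<Rightarrow> real \<Rightarrow> ('i \<Rightarrow> real) \<Rightarrow> ('i \<Rightarrow> 'i \<Rightarrow> real) \<Rightarrow> ('i \<Rightarrow> real) \<Rightarrow> 'i \<Rightarrow> 'i \<Rightarrow>
    real" where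
  "penalised_hess a e p Q m i j = a * log_hess p Q i j + 2 * e * (if i = j then (m i)\<^sup>2 else 0)"

definition ereal_close :: "real \<Rightarrow> ereal \<Rightarrow> ereal \<Rightarrow> bool" where
  "ereal_close e x y \<longleftrightarrow> x = y \<or> \<bar>x - y\<bar> < ereal e"

lemma abs_ln_diff_le_iff:
  fixes x y :: real
  assumes "0 < y"
  shows "y * exp (- R) \<le> x \<and> x \<le> y * exp R \<longleftrightarrow> 0 < x \<and> \<bar>ln x - ln y\<bar> \<le> R"
proof (cases "0 < x")
  case True
  then have "y * exp (- R) \<le> x \<longleftrightarrow> ln y - R \<le> ln x" "x \<le> y * exp R \<longleftrightarrow> ln x \<le> ln y + R"
    using assms ln_le_cancel_iff[of "y * exp (- R)" x] ln_le_cancel_iff[of x "y * exp R"]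
    by (simp_all add: ln_mult)
  then show ?thesis using True by auto
next
  case False
  have "0 < y * exp (- R)" using assms by simp
  with False show ?thesis by linarith
qed

lemma log_cube_iff:
  assumes "\<And>i. i \<in> X \<Longrightarrow> 0 < mb i"
  shows "m \<in> log_cube X mb R \<longleftrightarrow> m \<in> prob_simplex X \<and> (\<forall>i\<in>X. 0 < m i \<and> \<bar>ln (m i) - ln (mb i)\<bar> \<le> R)"
  using abs_ln_diff_le_iff[OF assms] by (simp add: log_cube_def)

lemma seq_compact_on_simplex_slice:
  assumes X: "finite X"
  shows "seq_compact_on X {m \<in> prob_simplex X. \<forall>i\<in>X. a i \<le> m i \<and> m i \<le> b i}"
  unfolding seq_compact_on_def
proof (intro allI impI)
  let ?K = "{m \<in> prob_simplex X. \<forall>i\<in>X. a i \<le> m i \<and> m i \<le> b i}"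
  fix s :: "nat \<Rightarrow> 'a \<Rightarrow> real" assume "range s \<subseteq> ?K"
  then have s: "s n \<in> prob_simplex X" "i \<in> X \<Longrightarrow> a i \<le> s n i \<and> s n i \<le> b i" for n i by auto
  have bdd: "bounded (range (\<lambda>n. s n i))" if "i \<in> X" for i
    using s(1)[THEN prob_simplex_nonneg[OF _ that]] s(1)[THEN prob_simplex_le_1[OF X _ that]]
    by (auto simp: bounded_iff intro!: exI[of _ 1])
  obtain q l where q: "strict_mono q" and lim: "\<And>i. i \<in> X \<Longrightarrow> (\<lambda>n. s (q n) i) \<longlonglongrightarrow> l i"
    using bounded_coords_convergent_subsequence[where s = s, OF X bdd] by blast
  have "0 \<le> l i \<and> a i \<le> l i \<and> l i \<le> b i" if i: "i \<in> X" for i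
    using s(2)[OF i] prob_simplex_nonneg[OF s(1) i]
    by (intro conjI LIMSEQ_le_const[OF lim[OF i]] LIMSEQ_le_const2[OF lim[OF i]]) auto
  moreover have "(\<Sum>i\<in>X. l i) = 1"
  proof -
    have "(\<lambda>n. \<Sum>i\<in>X. s (q n) i) \<longlonglongrightarrow> (\<Sum>i\<in>X. l i)" using lim by (intro tendsto_sum)
    then show ?thesis using prob_simplex_sum[OF s(1)] by (simp add: LIMSEQ_const_iff)
  qed
  ultimately have "l \<in> ?K" by (simp add: prob_simplex_def)
  then show "\<exists>r. \<exists>l\<in>?K. strict_mono r \<and> (\<forall>i\<in>X. (\<lambda>n. s (r n) i) \<longlonglongrightarrow> l i)" using q lim by blast
qed

lemma seq_compact_on_simplex:
  assumes X: "finite X"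
  shows "seq_compact_on X (prob_simplex X)"
proof -
  have "{m \<in> prob_simplex X. \<forall>i\<in>X. 0 \<le> m i \<and> m i \<le> 1} = prob_simplex X"
    by (auto dest: prob_simplex_le_1[OF X] prob_simplex_nonneg)
  then show ?thesis using seq_compact_on_simplex_slice[OF X, of "\<lambda>_. 0" "\<lambda>_. 1"] by simp
qed

lemma seq_compact_on_log_cube: "finite X \<Longrightarrow> seq_compact_on X (log_cube X mb R)"
  unfolding log_cube_def by (rule seq_compact_on_simplex_slice)

lemma abs_diff_ge_of_ln_diff:
  fixes x y :: real
  assumes "0 < x" "0 < y" and R: "\<bar>ln x - ln y\<bar> = R"
  shows "y * (1 - exp (- R)) \<le> \<bar>x - y\<bar>"
proof -
  have "x = exp (ln y + (ln x - ln y))" using assms(1) by simp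
  then have x: "x = y * exp (ln x - ln y)" using assms(2) by (simp only: exp_add exp_ln)
  consider "ln x - ln y = R" | "ln x - ln y = - R" using R by linarith
  then show ?thesis
  proof cases
    case 1
    have "1 - exp (- R) \<le> exp R - 1"
      using exp_ge_add_one_self[of R] exp_ge_add_one_self[of "- R"] by linarith
    then have "y * (1 - exp (- R)) \<le> y * (exp R - 1)" using assms(2) by (intro mult_left_mono) auto
    also have "\<dots> = x - y" using x unfolding 1 by (simp add: algebra_simps)
    finally show ?thesis by linarith
  next
    case 2
    have "y * (1 - exp (- R)) = y - x" using x unfolding 2 by (simp add: algebra_simps)
    then show ?thesis by linarith
  qed
qed

lemma log_cube_max_interior:
  assumes X: "finite X" and mb: "mb \<in> prob_simplex X" "\<And>i. i \<in> X \<Longrightarrow> 0 < mb i" and R: "0 \<le> R"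
    and e: "0 < e"
    and \<delta>: "0 \<le> \<delta>" "\<And>i. i \<in> X \<Longrightarrow> \<delta> \<le> mb i * (1 - exp (- R))" and \<eta>: "0 < \<eta>" "4 * \<eta> \<le> e * \<delta>\<^sup>2"
    and close: "\<And>m. m \<in> log_cube X mb R \<Longrightarrow> \<bar>f m - v m\<bar> \<le> \<eta>"
    and v_max: "\<And>m. m \<in> prob_simplex X \<Longrightarrow> v m \<le> v mb"
    and m: "m \<in> log_cube X mb R"
      "\<And>y. y \<in> log_cube X mb R \<Longrightarrow> f y - e * sq_dist X y mb \<le> f m - e * sq_dist X m mb"
    and i: "i \<in> X"
  shows "\<bar>ln (m i) - ln (mb i)\<bar> < R"
proof (rule ccontr)
  assume "\<not> ?thesis"
  then have pos: "0 < m i" and "\<bar>ln (m i) - ln (mb i)\<bar> = R"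
    using m(1) i by (auto simp: log_cube_iff[OF mb(2)])
  from abs_diff_ge_of_ln_diff[OF pos mb(2)[OF i] this(2)] have "\<delta> \<le> \<bar>m i - mb i\<bar>"
    using \<delta>(2)[OF i] by linarith
  then have "\<delta>\<^sup>2 \<le> (m i - mb i)\<^sup>2" using power_mono[OF _ \<delta>(1), of "\<bar>m i - mb i\<bar>" 2] by simp
  also have "\<dots> \<le> sq_dist X m mb" unfolding sq_dist_def using X i by (intro member_le_sum) auto
  finally have "e * \<delta>\<^sup>2 \<le> e * sq_dist X m mb" using e by simp
  moreover have mb_mem: "mb \<in> log_cube X mb R" using mb R by (simp add: log_cube_iff[OF mb(2)])
  have "f mb \<le> f m - e * sq_dist X m mb" using m(2)[OF mb_mem] by (simp add: sq_dist_def)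
  moreover have "m \<in> prob_simplex X" using m(1) by (simp add: log_cube_def)
  ultimately show False
    using close[OF mb_mem] close[OF m(1)] v_max[of m] \<eta> by (simp add: abs_le_iff)
qed

lemma sq_dist_perturb:
  "sq_dist X (\<lambda>i. m i * (1 + x i)) mb = sq_dist X m mb
    + 2 * lin_form X (\<lambda>i. m i * (m i - mb i)) x + lin_form X (\<lambda>i. (m i)\<^sup>2) (\<lambda>i. (x i)\<^sup>2)"
  unfolding sq_dist_def lin_form_def sum_distrib_left sum.distrib[symmetric]
  by (intro sum.cong refl) (simp add: power2_eq_square algebra_simps)

lemma eventually_in_log_cube:
  assumes X: "finite X" and mb: "\<And>i. i \<in> X \<Longrightarrow> 0 < mb i"
    and m: "m \<in> prob_simplex X" "\<And>i. i \<in> X \<Longrightarrow> 0 < m i"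
    and interior: "\<And>i. i \<in> X \<Longrightarrow> \<bar>ln (m i) - ln (mb i)\<bar> < R"
  shows "\<forall>\<^sub>F x in at_origin X. (\<forall>i\<in>X. -1 < x i) \<and>
      (lin_form X m x = 0 \<longrightarrow> (\<lambda>i. m i * (1 + x i)) \<in> log_cube X mb R)"
proof -
  have "\<forall>\<^sub>F x in at_origin X. \<forall>i\<in>X. -1 < x i \<and> \<bar>ln (m i * (1 + x i)) - ln (mb i)\<bar> < R"
  proof (intro eventually_ball_finite[OF X] ballI eventually_conj)
    fix i assume i: "i \<in> X"
    show "\<forall>\<^sub>F x in at_origin X. - 1 < x i"
      using coord_tendsto_at_origin[OF X i] by (rule order_tendstoD(1)) simp
    have "((\<lambda>x. \<bar>ln (m i * (1 + x i)) - ln (mb i)\<bar>) \<longlongrightarrow> \<bar>ln (m i * (1 + 0))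
        - ln (mb i)\<bar>) (at_origin X)"
      using m(2)[OF i] by (intro tendsto_intros coord_tendsto_at_origin X i) auto
    then show "\<forall>\<^sub>F x in at_origin X. \<bar>ln (m i * (1 + x i)) - ln (mb i)\<bar> < R"
      using interior[OF i] by (intro order_tendstoD(2)) auto
  qed
  then show ?thesis
  proof (rule eventually_mono, intro conjI impI)
    fix x assume x: "\<forall>i\<in>X. -1 < x i \<and> \<bar>ln (m i * (1 + x i)) - ln (mb i)\<bar> < R"
      and "lin_form X m x = 0"
    then have "(\<Sum>i\<in>X. m i * (1 + x i)) = 1"
      using prob_simplex_sum[OF m(1)]
      by (simp add: lin_form_def distrib_left sum.distrib mult.commute[of "m _"])
    moreover have "0 < m i * (1 + x i)" if "i \<in> X" for i using m(2)[OF that] x that by force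
    ultimately show "(\<lambda>i. m i * (1 + x i)) \<in> log_cube X mb R"
      using x by (auto simp: log_cube_iff[OF mb] prob_simplex_def intro: less_imp_le)
  qed auto
qed

lemma simplex_superjet_of_log_max:
  assumes X: "finite X" and mb: "\<And>i. i \<in> X \<Longrightarrow> 0 < mb i" and F: "unif_C2 X F G H" and k: "0 < k"
    and m: "m \<in> prob_simplex X" "\<And>i. i \<in> X \<Longrightarrow> 0 < m i" "\<And>i. i \<in> X \<Longrightarrow> \<bar>ln (m i) - ln (mb i)\<bar> < R"
    and max: "\<And>y. y \<in> log_cube X mb R \<Longrightarrow> F (\<lambda>i. ln (y i)) / k - w y - e * sq_dist X y mb
      \<le> F (\<lambda>i. ln (m i)) / k - w m - e * sq_dist X m mb"
    and z: "z = (\<lambda>i. ln (m i))"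
  shows "simplex_superjet X (\<lambda>m. - w m) m (\<lambda>i. - 1 / k * G i z + 2 * e * (m i * (m i - mb i)))
    (penalised_hess (- 1 / k) e (\<lambda>i. G i z) (\<lambda>i j. H i j z) m)"
    (is "simplex_superjet X _ m ?p ?P")
proof -
  define P where "P = log_hess (\<lambda>i. G i z) (\<lambda>i j. H i j z)"
  define A where "A x = F (z + ln1p x) - F z - lin_form X (\<lambda>i. G i z) x - quad_form X P x / 2" for x
  have "A \<in> o[at_origin X](\<lambda>x. (l1_norm X x)\<^sup>2)"
    unfolding A_def P_def by (rule log_jet[OF X has_jet2_taylor[OF X F]])
  then have A: "(\<lambda>x. - 1 / k * A x) \<in> o[at_origin X](\<lambda>x. (l1_norm X x)\<^sup>2)" using k by simp
  have uF: "bdd_ucont X F" using F by (simp add: unif_C2_def)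
  have lin: "lin_form X ?p x = - 1 / k * lin_form X (\<lambda>i. G i z) x
      + 2 * e * lin_form X (\<lambda>i. m i * (m i - mb i)) x" for x
    by (rule lin_form_lincomb)
  have quad: "quad_form X ?P x = - 1 / k * quad_form X P x
      + 2 * e * lin_form X (\<lambda>i. (m i)\<^sup>2) (\<lambda>i. (x i)\<^sup>2)" for x
    unfolding penalised_hess_def quad_form_lincomb quad_form_diag[OF X] P_def ..
  have "\<forall>\<^sub>F x in at_origin X. (\<forall>i\<in>X. -1 < x i) \<and>
      (lin_form X m x = 0 \<longrightarrow> (\<lambda>i. m i * (1 + x i)) \<in> log_cube X mb R)"
    by (rule eventually_in_log_cube[OF X mb m])
  then have "\<forall>\<^sub>F x in at_origin X. lin_form X m x = 0 \<longrightarrow>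
      - w (\<lambda>i. m i * (1 + x i)) \<le> - w m + lin_form X ?p x + quad_form X ?P x / 2 + - 1 / k * A x"
  proof (rule eventually_mono, intro impI)
    fix x assume x: "lin_form X m x = 0"
      "(\<forall>i\<in>X. -1 < x i) \<and> (lin_form X m x = 0 \<longrightarrow> (\<lambda>i. m i * (1 + x i)) \<in> log_cube X mb R)"
    let ?m = "\<lambda>i. m i * (1 + x i)"
    have "F (\<lambda>i. ln (?m i)) = F (z + ln1p x)"
    proof (rule bdd_ucont_cong[OF uF])
      fix i assume "i \<in> X"
      then show "ln (?m i) = (z + ln1p x) i" using m(2) x(2) by (force simp: z ln1p_def ln_mult)
    qed
    moreover have "?m \<in> log_cube X mb R" using x by blast
    ultimately have le: "F (z + ln1p x) / k - w ?m - e * sq_dist X ?m mb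
        \<le> F z / k - w m - e * sq_dist X m mb"
      using max[of ?m] by (simp add: z)
    have "F (z + ln1p x) / k = F z / k + A x / k + lin_form X (\<lambda>i. G i z) x / k
        + quad_form X P x / k / 2"
      unfolding A_def by (simp add: diff_divide_distrib)
    then show "- w ?m \<le> - w m + lin_form X ?p x + quad_form X ?P x / 2 + - 1 / k * A x"
      using le unfolding sq_dist_perturb lin quad
      by (simp add: algebra_simps add_divide_distrib diff_divide_distrib)
  qed
  then show ?thesis unfolding simplex_superjet_def using A by blast
qed

lemma small_mollification:
  assumes X: "finite X" and V: "bdd_ucont X V" and R: "0 < R" and \<eta>: "0 < \<eta>"
  obtains \<epsilon> xs where "0 < \<epsilon>" "distinct xs" "set xs = X" "real n * (\<epsilon> * real (length xs)) \<le> R"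
    "\<forall>z. \<bar>(steklov_list \<epsilon> xs ^^ n) V z / exp_mean \<epsilon> ^ n - V z\<bar> \<le> \<eta>"
proof -
  obtain xs where xs: "distinct xs" "set xs = X" using finite_distinct_list[OF X] by blast
  have "((\<lambda>\<epsilon>. real n * (\<epsilon> * real (length xs))) \<longlongrightarrow> 0) (at_right 0)"
    by (auto intro!: tendsto_eq_intros)
  then have "\<forall>\<^sub>F \<epsilon> in at_right 0. real n * (\<epsilon> * real (length xs)) < R"
    using R by (intro order_tendstoD(2)) auto
  moreover have "\<forall>\<^sub>F \<epsilon> in at_right 0. \<forall>z. \<bar>(steklov_list \<epsilon> xs ^^ n) V z / exp_mean \<epsilon> ^ n - V z\<bar> \<le> \<eta>"
    by (rule mollified_approx[OF X V _ \<eta>]) (simp add: xs)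
  ultimately have "\<forall>\<^sub>F \<epsilon> in at_right 0. 0 < \<epsilon> \<and> real n * (\<epsilon> * real (length xs)) < R \<and>
      (\<forall>z. \<bar>(steklov_list \<epsilon> xs ^^ n) V z / exp_mean \<epsilon> ^ n - V z\<bar> \<le> \<eta>)"
    using eventually_at_right_less[of 0] by eventually_elim simp
  then obtain \<epsilon> where "0 < \<epsilon>" "real n * (\<epsilon> * real (length xs)) < R"
      "\<forall>z. \<bar>(steklov_list \<epsilon> xs ^^ n) V z / exp_mean \<epsilon> ^ n - V z\<bar> \<le> \<eta>"
    using eventually_happens[of _ "at_right (0::real)"] by auto
  then show ?thesis using xs by (intro that) auto
qed

lemma clamped_lift_ln:
  assumes X: "finite X" "X \<noteq> {}" and u: "seq_cont_on X (prob_simplex X) u"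
    and mb: "\<And>i. i \<in> X \<Longrightarrow> 0 < mb i"
    and m: "m \<in> log_cube X mb R"
  shows "homog_lift X u (clamp_cube (\<lambda>i. ln (mb i)) R (\<lambda>i. ln (m i))) = u m"
proof -
  have m': "m \<in> prob_simplex X" "\<And>i. i \<in> X \<Longrightarrow> 0 < m i"
    and "(\<lambda>i. ln (m i)) \<in> cube X (\<lambda>i. ln (mb i)) R"
    using m by (auto simp: log_cube_iff[OF mb] cube_def)
  then have "homog_lift X u (clamp_cube (\<lambda>i. ln (mb i)) R (\<lambda>i. ln (m i)))
      = homog_lift X u (\<lambda>i. ln (m i))"
    by (intro seq_cont_on_cong[OF seq_cont_on_homog_lift[OF X u, of UNIV]])
      (simp_all add: clamp_cube_eq)
  then show ?thesis using homog_lift_ln[OF X u m'] by simp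
qed

lemma seq_cont_on_ln_comp:
  assumes F: "bdd_ucont X F" and pos: "\<And>m i. m \<in> K \<Longrightarrow> i \<in> X \<Longrightarrow> 0 < m i"
  shows "seq_cont_on X K (\<lambda>m. F (\<lambda>i. ln (m i)))"
  unfolding seq_cont_on_def
proof (intro allI impI)
  fix s l assume s: "range s \<subseteq> K" "l \<in> K" "\<forall>i\<in>X. (\<lambda>n. s n i) \<longlonglongrightarrow> l i"
  have "(\<lambda>n. ln (s n i)) \<longlonglongrightarrow> ln (l i)" if "i \<in> X" for i
    using s(3) pos[OF s(2) that] that by (intro tendsto_intros) auto
  then show "(\<lambda>n. F (\<lambda>i. ln (s n i))) \<longlonglongrightarrow> F (\<lambda>i. ln (l i))"
    using seq_cont_onD[of X UNIV F "\<lambda>n i. ln (s n i)", OF seq_cont_on_bdd_ucont[OF F]] by simp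
qed

lemma log_cube_penalised_max:
  assumes X: "finite X" "X \<noteq> {}" and mb: "mb \<in> prob_simplex X" "\<And>i. i \<in> X \<Longrightarrow> 0 < mb i" and R: "0 < R"
    and e: "0 < e"
  obtains \<eta> where "0 < \<eta>" "\<forall>f v. seq_cont_on X (log_cube X mb R) f \<longrightarrow>
      (\<forall>m\<in>log_cube X mb R. \<bar>f m - v m\<bar> \<le> \<eta>) \<longrightarrow> (\<forall>m\<in>prob_simplex X. v m \<le> v mb) \<longrightarrow>
      (\<exists>m\<in>log_cube X mb R.
        (\<forall>y\<in>log_cube X mb R. f y - e * sq_dist X y mb \<le> f m - e * sq_dist X m mb) \<and>
        (\<forall>i\<in>X. \<bar>ln (m i) - ln (mb i)\<bar> < R))"
proof -
  define \<delta> where "\<delta> = Min (mb ` X) * (1 - exp (- R))"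
  have "0 < Min (mb ` X)" using X mb(2) by simp
  then have \<delta>: "0 < \<delta>" "\<And>i. i \<in> X \<Longrightarrow> \<delta> \<le> mb i * (1 - exp (- R))"
    using X(1) R unfolding \<delta>_def by (auto intro!: mult_right_mono)
  define \<eta> where "\<eta> = e * \<delta>\<^sup>2 / 4"
  have \<eta>: "0 < \<eta>" "4 * \<eta> \<le> e * \<delta>\<^sup>2" using e \<delta>(1) by (auto simp: \<eta>_def)
  show ?thesis
  proof (rule that[OF \<eta>(1)], intro allI impI)
    fix f v :: "('a \<Rightarrow> real) \<Rightarrow> real"
    assume f: "seq_cont_on X (log_cube X mb R) f" and close: "\<forall>m\<in>log_cube X mb R. \<bar>f m - v m\<bar> \<le> \<eta>"
      and max: "\<forall>m\<in>prob_simplex X. v m \<le> v mb"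
    have "seq_cont_on X (log_cube X mb R) (\<lambda>m. sq_dist X m mb)"
      unfolding sq_dist_def by (intro seq_cont_on_separable continuous_intros)
    then have "seq_cont_on X (log_cube X mb R) (\<lambda>m. f m - e * sq_dist X m mb)"
      using f by (simp add: seq_cont_on_diff seq_cont_on_cmult)
    moreover have "mb \<in> log_cube X mb R" using mb R by (simp add: log_cube_iff[OF mb(2)])
    ultimately obtain m where m: "m \<in> log_cube X mb R"
        "\<And>y. y \<in> log_cube X mb R \<Longrightarrow> f y - e * sq_dist X y mb \<le> f m - e * sq_dist X m mb"
      using seq_cont_on_attains_sup[OF seq_compact_on_log_cube[OF X(1)]] by blast
    have "\<bar>ln (m i) - ln (mb i)\<bar> < R" if "i \<in> X" for i
      using log_cube_max_interior[OF X(1) mb less_imp_le[OF R] e less_imp_le[OF \<delta>(1)] \<delta>(2) \<eta>, of f v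
        m i]
        close max m that by simp
    then show "\<exists>m\<in>log_cube X mb R. (\<forall>y\<in>log_cube X mb R. f y - e * sq_dist X y mb
        \<le> f m - e * sq_dist X m mb) \<and> (\<forall>i\<in>X. \<bar>ln (m i) - ln (mb i)\<bar> < R)"
      using m by blast
  qed
qed

lemma mollified_lift:
  assumes X: "finite X" "X \<noteq> {}" and mb: "\<And>i. i \<in> X \<Longrightarrow> 0 < mb i"
    and u: "seq_cont_on X (prob_simplex X) u" and R: "0 < R" and \<eta>: "0 < \<eta>"
    and V: "V = (\<lambda>z. homog_lift X u (clamp_cube (\<lambda>i. ln (mb i)) R z))"
  obtains \<epsilon> xs G H where "0 < \<epsilon>" "distinct xs" "set xs = X"
    "real 4 * (\<epsilon> * real (length xs)) \<le> R / 4"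
    "unif_C2 X ((steklov_list \<epsilon> xs ^^ 4) V) G H" "\<forall>\<rho>. Ck X 2 (walk_gen_fun X \<rho> G H)"
    "\<forall>m\<in>log_cube X mb R.
      \<bar>(steklov_list \<epsilon> xs ^^ 4) V (\<lambda>i. ln (m i)) / exp_mean \<epsilon> ^ 4 - u m\<bar> \<le> \<eta>"
proof -
  have uV: "bdd_ucont X V"
    unfolding V using R by (intro bdd_ucont_clamped X seq_cont_on_homog_lift u) auto
  have R4: "0 < R / 4" using R by simp
  obtain \<epsilon> xs where \<epsilon>: "0 < \<epsilon>" and xs: "distinct xs" "set xs = X"
    and small: "real 4 * (\<epsilon> * real (length xs)) \<le> R / 4"
    and approx: "\<forall>z. \<bar>(steklov_list \<epsilon> xs ^^ 4) V z / exp_mean \<epsilon> ^ 4 - V z\<bar> \<le> \<eta>"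
    by (rule small_mollification[OF X(1) uV R4 \<eta>])
  have "Ck X (Suc (Suc 2)) ((steklov_list \<epsilon> xs ^^ 4) V)"
    using steklov_list_funpow_Ck[OF X(1) \<epsilon> uV xs, of 4] by (simp del: Ck.simps)
  then obtain G H where GH: "unif_C2 X ((steklov_list \<epsilon> xs ^^ 4) V) G H"
    "\<forall>i\<in>X. Ck X 2 (G i)" "\<forall>i\<in>X. \<forall>j\<in>X. Ck X 2 (H i j)"
    by (rule Ck_unif_C2)
  show ?thesis
  proof (rule that[OF \<epsilon> xs small GH(1)])
    show "\<forall>\<rho>. Ck X 2 (walk_gen_fun X \<rho> G H)" using Ck_walk_gen_fun[OF GH(2,3)] by blast
    show "\<forall>m\<in>log_cube X mb R.
        \<bar>(steklov_list \<epsilon> xs ^^ 4) V (\<lambda>i. ln (m i)) / exp_mean \<epsilon> ^ 4 - u m\<bar> \<le> \<eta>"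
    proof
      fix m assume "m \<in> log_cube X mb R"
      from clamped_lift_ln[OF X u mb this] have "V (\<lambda>i. ln (m i)) = u m" by (simp add: V)
      then show "\<bar>(steklov_list \<epsilon> xs ^^ 4) V (\<lambda>i. ln (m i)) / exp_mean \<epsilon> ^ 4 - u m\<bar> \<le> \<eta>"
        using spec[OF approx, of "\<lambda>i. ln (m i)"] by simp
    qed
  qed
qed

lemma perturbed_maximiser:
  assumes X: "finite X" "X \<noteq> {}" and mb: "mb \<in> prob_simplex X" "\<And>i. i \<in> X \<Longrightarrow> 0 < mb i"
    and u: "seq_cont_on X (prob_simplex X) u" and w: "seq_cont_on X (prob_simplex X) w"
    and max: "\<And>m. m \<in> prob_simplex X \<Longrightarrow> u m - w m \<le> u mb - w mb" and e: "0 < e" and R: "0 < R"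
    and V: "V = (\<lambda>z. homog_lift X u (clamp_cube (\<lambda>i. ln (mb i)) R z))"
  obtains \<epsilon> xs G H m p where "0 < \<epsilon>" "distinct xs" "set xs = X"
    "real 4 * (\<epsilon> * real (length xs)) \<le> R / 4"
    "unif_C2 X ((steklov_list \<epsilon> xs ^^ 4) V) G H" "\<forall>\<rho>. Ck X 2 (walk_gen_fun X \<rho> G H)"
    "m \<in> log_cube X mb (R / 4)"
    "simplex_superjet X (\<lambda>m. - w m) m p (penalised_hess (- 1 / exp_mean \<epsilon> ^ 4) e
      (\<lambda>i. G i (\<lambda>i. ln (m i))) (\<lambda>i j. H i j (\<lambda>i. ln (m i))) m)"
proof -
  have R4: "0 < R / 4" using R by simp
  define K where "K = log_cube X mb (R / 4)"
  have K: "m \<in> prob_simplex X" "\<And>i. i \<in> X \<Longrightarrow> 0 < m i" if "m \<in> K" for m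
    using that by (auto simp: K_def log_cube_iff[OF mb(2)])
  obtain \<eta> where \<eta>: "0 < \<eta>" "\<forall>f v. seq_cont_on X K f \<longrightarrow> (\<forall>m\<in>K. \<bar>f m - v m\<bar> \<le> \<eta>) \<longrightarrow>
      (\<forall>m\<in>prob_simplex X. v m \<le> v mb) \<longrightarrow>
      (\<exists>m\<in>K. (\<forall>y\<in>K. f y - e * sq_dist X y mb \<le> f m - e * sq_dist X m mb) \<and>
        (\<forall>i\<in>X. \<bar>ln (m i) - ln (mb i)\<bar> < R / 4))"
    unfolding K_def by (rule log_cube_penalised_max[OF X mb R4 e])
  obtain \<epsilon> xs G H where \<epsilon>: "0 < \<epsilon>" and xs: "distinct xs" "set xs = X"
    and small: "real 4 * (\<epsilon> * real (length xs)) \<le> R / 4"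
    and C2: "unif_C2 X ((steklov_list \<epsilon> xs ^^ 4) V) G H" "\<forall>\<rho>. Ck X 2 (walk_gen_fun X \<rho> G H)"
    and approx: "\<forall>m\<in>log_cube X mb R.
      \<bar>(steklov_list \<epsilon> xs ^^ 4) V (\<lambda>i. ln (m i)) / exp_mean \<epsilon> ^ 4 - u m\<bar> \<le> \<eta>"
    by (rule mollified_lift[OF X mb(2) u R \<eta>(1) V])
  define k where "k = exp_mean \<epsilon> ^ 4"
  have k: "0 < k" unfolding k_def using exp_mean_ge_1[OF \<epsilon>] by (intro zero_less_power) linarith
  define F where "F = (steklov_list \<epsilon> xs ^^ 4) V"
  have F: "unif_C2 X F G H" unfolding F_def by (rule C2(1))
  define f where "f m = 1 / k * F (\<lambda>i. ln (m i)) - w m" for m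
  have "seq_cont_on X K (\<lambda>m. F (\<lambda>i. ln (m i)))"
    using F K(2) by (intro seq_cont_on_ln_comp) (auto simp: unif_C2_def)
  moreover have "seq_cont_on X K w" using seq_cont_on_subset[OF w] K(1) by blast
  ultimately have "seq_cont_on X K f" unfolding f_def by (intro seq_cont_on_diff seq_cont_on_cmult)
  moreover have "\<bar>f y - (u y - w y)\<bar> \<le> \<eta>" if "y \<in> K" for y
  proof -
    have "y \<in> log_cube X mb R" using that R by (force simp: K_def log_cube_iff[OF mb(2)])
    from bspec[OF approx this] show ?thesis by (simp add: f_def F_def k_def)
  qed
  ultimately obtain m where m: "m \<in> K"
      "\<forall>y\<in>K. f y - e * sq_dist X y mb \<le> f m - e * sq_dist X m mb"
      "\<forall>i\<in>X. \<bar>ln (m i) - ln (mb i)\<bar> < R / 4"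
    using spec[OF spec[OF \<eta>(2), of f], of "\<lambda>m. u m - w m"] max by blast
  note jet = simplex_superjet_of_log_max[OF X(1) mb(2) F k K(1,2)[OF m(1)] bspec[OF m(3)] _
      refl, of w e]
  show ?thesis
    by (rule that[OF \<epsilon> xs small C2 m(1)[unfolded K_def] jet[unfolded k_def]])
      (use m(2) in \<open>auto simp: f_def K_def k_def\<close>)
qed

lemma lin_form_shift: "m \<in> prob_simplex X \<Longrightarrow> lin_form X (\<lambda>i. \<rho> i - a) m = lin_form X \<rho> m - a"
  by (simp add: lin_form_def right_diff_distrib sum_subtractf sum_distrib_right[symmetric]
    prob_simplex_sum)

lemma centred_gen_shift: "m \<in> prob_simplex X \<Longrightarrow>
    centred_gen X m P (\<lambda>i. \<rho> i - a) = centred_gen X m P \<rho>"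
  by (simp add: centred_gen_def lin_form_shift)

lemma abs_lin_form_simplex_le:
  assumes "m \<in> prob_simplex X" "\<And>i. i \<in> X \<Longrightarrow> \<bar>\<rho> i\<bar> \<le> B"
  shows "\<bar>lin_form X \<rho> m\<bar> \<le> B"
proof -
  have "l1_norm X m = 1"
    using assms(1) prob_simplex_nonneg[OF assms(1)] by (simp add: l1_norm_def prob_simplex_sum)
  then show ?thesis using abs_lin_form_le[of X \<rho> B m, OF assms(2)] by simp
qed

lemma centred_square_le:
  assumes X: "finite X" and m: "m \<in> prob_simplex X" and B: "\<And>i. i \<in> X \<Longrightarrow> \<bar>\<rho> i\<bar> \<le> B"
  shows "lin_form X (\<lambda>i. (m i)\<^sup>2) (\<lambda>i. (\<rho> i - lin_form X \<rho> m)\<^sup>2) \<le> 4 * B\<^sup>2"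
proof -
  have "(\<rho> i - lin_form X \<rho> m)\<^sup>2 * (m i)\<^sup>2 \<le> (2 * B)\<^sup>2 * (m i * 1)" if "i \<in> X" for i
  proof (intro mult_mono)
    have "\<bar>\<rho> i - lin_form X \<rho> m\<bar> \<le> 2 * B"
      using B[OF that] abs_lin_form_simplex_le[of m X \<rho> B, OF m B] by linarith
    then show "(\<rho> i - lin_form X \<rho> m)\<^sup>2 \<le> (2 * B)\<^sup>2"
      using power_mono[of "\<bar>\<rho> i - lin_form X \<rho> m\<bar>" "2 * B" 2] by simp
    show "(m i)\<^sup>2 \<le> m i * 1"
      unfolding power2_eq_square using prob_simplex_nonneg[OF m that] prob_simplex_le_1[OF X m that]
      by (intro mult_left_mono)
  qed (use prob_simplex_nonneg[OF m that] in auto)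
  then have "lin_form X (\<lambda>i. (m i)\<^sup>2) (\<lambda>i. (\<rho> i - lin_form X \<rho> m)\<^sup>2)
      \<le> (\<Sum>i\<in>X. (2 * B)\<^sup>2 * (m i * 1))"
    unfolding lin_form_def by (rule sum_mono)
  also have "\<dots> = 4 * B\<^sup>2"
    using prob_simplex_sum[OF m] by (simp add: sum_distrib_left[symmetric] power_mult_distrib)
  finally show ?thesis .
qed

lemma ereal_close_bounds:
  fixes x :: ereal
  assumes "ereal_close e x (ereal b)" "0 < e"
  shows "ereal (b - e) \<le> x" "x \<le> ereal (b + e)"
  using assms by (cases x; auto simp: ereal_close_def abs_real_def split: if_splits)+

lemma ereal_close_real:
  fixes x y :: ereal
  assumes "ereal_close e x y" "x \<noteq> \<infinity>" "y \<noteq> -\<infinity>"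
  obtains b where "y = ereal b"
  using assms by (cases y; cases x) (auto simp: ereal_close_def)

lemma local_subsolution_of_simplex_subsolution:
  assumes X: "finite X" "X \<noteq> {}" and u: "seq_cont_on X (prob_simplex X) u"
    and sub: "simplex_subsolution X Hs \<rho> c \<beta> u" and r: "r \<in> Hs" and \<beta>: "0 \<le> \<beta>"
    and m: "m \<in> prob_simplex X"
    and near: "\<And>z. z \<in> cube X zb R \<Longrightarrow> a \<le> u (softmax X z)"
    "\<And>z. z \<in> cube X zb R \<Longrightarrow> c (softmax X z) r \<le> ereal b"
  shows "local_subsolution X zb R (\<lambda>i. \<rho> r i - lin_form X (\<rho> r) m) (b - \<beta> * a)
    (\<lambda>z. homog_lift X u (clamp_cube zb R z))"
proof (rule homog_lift_local_subsolution[OF X u _ m])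
  show "lin_form X (\<lambda>i. \<rho> r i - lin_form X (\<rho> r) m) m = 0" using lin_form_shift[OF m] by simp
  fix z p P assume z: "z \<in> cube X zb R" and jet: "simplex_superjet X u (softmax X z) p P"
  define y where "y = softmax X z"
  have y: "y \<in> prob_simplex X" "\<And>i. 0 < y i"
    unfolding y_def using softmax_in_simplex[OF X] softmax_pos[OF X] by auto
  have "ereal (\<beta> * u y) \<le> c y r + ereal (centred_gen X y P (\<rho> r))"
    using sub y jet r unfolding simplex_subsolution_def y_def by blast
  also have "\<dots> \<le> ereal b + ereal (centred_gen X y P (\<rho> r))"
    using near(2)[OF z] unfolding y_def by (rule add_right_mono)
  finally have "\<beta> * u y \<le> b + centred_gen X y P (\<rho> r)" by simp
  moreover have "\<beta> * a \<le> \<beta> * u y" using near(1)[OF z] \<beta> unfolding y_def by (rule mult_left_mono)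
  ultimately show "- (b - \<beta> * a) \<le> centred_gen X (softmax X z) P (\<lambda>i. \<rho> r i - lin_form X (\<rho> r) m)"
    unfolding centred_gen_shift[OF y(1)[unfolded y_def]] y_def by linarith
qed

lemma centred_gen_penalised:
  assumes X: "finite X"
  shows "centred_gen X m (penalised_hess a e p Q m) \<rho>
    = a * walk_gen X (\<lambda>i. \<rho> i - lin_form X \<rho> m) p Q
    + e * lin_form X (\<lambda>i. (m i)\<^sup>2) (\<lambda>i. (\<rho> i - lin_form X \<rho> m)\<^sup>2)"
  unfolding centred_gen_def penalised_hess_def quad_form_lincomb quad_form_diag[OF X]
    walk_gen_eq_quad_form[OF X] by (simp add: add_divide_distrib)

lemma near_optimal_control:
  assumes super: "simplex_supersolution X Hs \<rho> c \<beta> w"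
    and m: "m \<in> prob_simplex X" "\<And>i. i \<in> X \<Longrightarrow> 0 < m i"
    and jet: "simplex_superjet X (\<lambda>m. - w m) m p P" and e: "0 < e" and c: "\<And>r. r \<in> Hs \<Longrightarrow> c mb r \<noteq> -\<infinity>"
    and near: "\<And>r. r \<in> Hs \<Longrightarrow> ereal_close e (c m r) (c mb r)"
  obtains r b where "r \<in> Hs" "c mb r = ereal b" "b - centred_gen X m P (\<rho> r) \<le> \<beta> * w m + 2 * e"
proof -
  obtain r where r: "r \<in> Hs" "c m r - ereal (centred_gen X m P (\<rho> r)) \<le> ereal (\<beta> * w m + e)"
    using super m jet e unfolding simplex_supersolution_def by blast
  have "c m r \<noteq> \<infinity>" using r(2) by (cases "c m r") auto
  then obtain b where b: "c mb r = ereal b"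
    using ereal_close_real[OF near[OF r(1)] _ c[OF r(1)]] by blast
  have "ereal (b - e) \<le> c m r" by (rule ereal_close_bounds(1)[OF near[OF r(1), unfolded b] e])
  then have "ereal (b - e) - ereal (centred_gen X m P (\<rho> r)) \<le> ereal (\<beta> * w m + e)"
    by (rule order_trans[OF ereal_minus_mono[OF _ order_refl] r(2)])
  then have "b - centred_gen X m P (\<rho> r) \<le> \<beta> * w m + 2 * e" by simp
  with r(1) b show thesis by (rule that)
qed

lemma mollified_lift_gen_ge:
  assumes X: "finite X" "X \<noteq> {}" and u: "seq_cont_on X (prob_simplex X) u"
    and sub: "simplex_subsolution X Hs \<rho> c \<beta> u" and r: "r \<in> Hs" and \<beta>: "0 \<le> \<beta>"
    and m: "m \<in> prob_simplex X" "\<And>i. i \<in> X \<Longrightarrow> 0 < m i" "(\<lambda>i. ln (m i)) \<in> cube X zb (R / 4)"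
    and R: "0 < R"
    and near: "\<And>z. z \<in> cube X zb R \<Longrightarrow> a \<le> u (softmax X z)"
      "\<And>z. z \<in> cube X zb R \<Longrightarrow> c (softmax X z) r \<le> ereal b"
    and V: "V = (\<lambda>z. homog_lift X u (clamp_cube zb R z))"
    and xs: "distinct xs" "set xs = X" and \<epsilon>: "0 < \<epsilon>" "real n * (\<epsilon> * real (length xs)) \<le> R / 4"
    and F: "unif_C2 X ((steklov_list \<epsilon> xs ^^ n) V) G H" "\<forall>\<rho>. Ck X 2 (walk_gen_fun X \<rho> G H)"
  shows "\<beta> * a - b
    \<le> walk_gen_fun X (\<lambda>i. \<rho> r i - lin_form X (\<rho> r) m) G H (\<lambda>i. ln (m i)) / exp_mean \<epsilon> ^ n"
proof -
  have uV: "bdd_ucont X V"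
    unfolding V using R by (intro bdd_ucont_clamped X seq_cont_on_homog_lift u) auto
  have "local_subsolution X zb R (\<lambda>i. \<rho> r i - lin_form X (\<rho> r) m) (b - \<beta> * a) V"
    unfolding V
    by (rule local_subsolution_of_simplex_subsolution[OF X u sub r \<beta> m(1) near])
  from mollified_subsolution[OF X(1) this uV R xs \<epsilon> F(1) spec[OF F(2)] m(3)]
  have "(\<beta> * a - b) * exp_mean \<epsilon> ^ n
      \<le> walk_gen_fun X (\<lambda>i. \<rho> r i - lin_form X (\<rho> r) m) G H (\<lambda>i. ln (m i))"
    by (simp add: expsum_ln[OF m(1,2)])
  moreover have "0 < exp_mean \<epsilon> ^ n"
    using exp_mean_ge_1[OF \<epsilon>(1)] by (intro zero_less_power) linarith
  ultimately show ?thesis by (simp only: pos_le_divide_eq)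
qed

lemma simplex_comparison_approx:
  assumes X: "finite X" "X \<noteq> {}" and mb: "mb \<in> prob_simplex X" "\<And>i. i \<in> X \<Longrightarrow> 0 < mb i"
    and u: "seq_cont_on X (prob_simplex X) u" and w: "seq_cont_on X (prob_simplex X) w"
    and max: "\<And>m. m \<in> prob_simplex X \<Longrightarrow> u m - w m \<le> u mb - w mb" and \<beta>: "0 < \<beta>"
    and sub: "simplex_subsolution X Hs \<rho> c \<beta> u" and super: "simplex_supersolution X Hs \<rho> c \<beta> w"
    and c: "\<And>r. r \<in> Hs \<Longrightarrow> c mb r \<noteq> -\<infinity>" and B: "\<And>r i. r \<in> Hs \<Longrightarrow> i \<in> X \<Longrightarrow> \<bar>\<rho> r i\<bar> \<le> B"
    and e: "0 < e" and R: "0 < R"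
    and near: "\<And>z. z \<in> cube X (\<lambda>i. ln (mb i)) R \<Longrightarrow> \<bar>u (softmax X z) - u mb\<bar> \<le> e"
      "\<And>z. z \<in> cube X (\<lambda>i. ln (mb i)) R \<Longrightarrow> \<bar>w (softmax X z) - w mb\<bar> \<le> e"
      "\<And>z m r. z \<in> cube X (\<lambda>i. ln (mb i)) R \<Longrightarrow> m \<in> prob_simplex X \<Longrightarrow>
          (\<And>i. i \<in> X \<Longrightarrow> m i = softmax X z i) \<Longrightarrow> r \<in> Hs \<Longrightarrow>
        ereal_close e (c m r) (c mb r)"
  shows "\<beta> * u mb \<le> \<beta> * w mb + (3 + 2 * \<beta> + 4 * B\<^sup>2) * e"
proof -
  define zb where "zb = (\<lambda>i. ln (mb i))"
  define V where "V = (\<lambda>z. homog_lift X u (clamp_cube zb R z))"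
  obtain \<epsilon> xs G H m p where \<epsilon>: "0 < \<epsilon>" "real 4 * (\<epsilon> * real (length xs)) \<le> R / 4"
    and xs: "distinct xs" "set xs = X"
    and F: "unif_C2 X ((steklov_list \<epsilon> xs ^^ 4) V) G H" "\<forall>\<rho>. Ck X 2 (walk_gen_fun X \<rho> G H)"
    and mK: "m \<in> log_cube X mb (R / 4)"
    and jet: "simplex_superjet X (\<lambda>m. - w m) m p (penalised_hess (- 1 / exp_mean \<epsilon> ^ 4) e
      (\<lambda>i. G i (\<lambda>i. ln (m i))) (\<lambda>i j. H i j (\<lambda>i. ln (m i))) m)"
    by (rule perturbed_maximiser[OF X mb u w max e R V_def[unfolded zb_def]])
  define z where "z = (\<lambda>i. ln (m i))"
  define k where "k = exp_mean \<epsilon> ^ 4"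
  have m: "m \<in> prob_simplex X" "\<And>i. i \<in> X \<Longrightarrow> 0 < m i" and z: "z \<in> cube X zb (R / 4)"
    using mK by (auto simp: log_cube_iff[OF mb(2)] z_def zb_def cube_def)
  have zR: "z \<in> cube X zb R" using R by (intro cube_mono[OF z]) simp
  have softmax_z: "softmax X z i = m i" if "i \<in> X" for i
    unfolding z_def by (rule softmax_ln[OF m that])
  have c_m: "ereal_close e (c m r) (c mb r)" if "r \<in> Hs" for r
    using near(3)[OF zR[unfolded zb_def] m(1) _ that] softmax_z by simp
  obtain r b where r: "r \<in> Hs" "c mb r = ereal b" and w_ge: "b - centred_gen X m
      (penalised_hess (- 1 / k) e (\<lambda>i. G i z) (\<lambda>i j. H i j z) m) (\<rho> r) \<le> \<beta> * w m + 2 * e"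
    unfolding k_def z_def by (rule near_optimal_control[where c = c, OF super m jet e c c_m])
  define \<rho>m where "\<rho>m i = \<rho> r i - lin_form X (\<rho> r) m" for i
  define g where "g = walk_gen_fun X \<rho>m G H z"
  have u_le: "\<beta> * (u mb - e) - (b + e) \<le> g / k"
    unfolding g_def \<rho>m_def k_def z_def
  proof (rule mollified_lift_gen_ge[OF X u sub r(1) less_imp_le[OF \<beta>] m z[unfolded z_def] R
        _ _ V_def xs \<epsilon> F])
    fix y assume y: "y \<in> cube X zb R"
    show "u mb - e \<le> u (softmax X y)" using near(1)[OF y[unfolded zb_def]] by linarith
    show "c (softmax X y) r \<le> ereal (b + e)"
      using near(3)[OF y[unfolded zb_def] softmax_in_simplex[OF X] refl r(1)] e unfolding r(2)
      by (rule ereal_close_bounds(2))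
  qed
  have "e * lin_form X (\<lambda>i. (m i)\<^sup>2) (\<lambda>i. (\<rho>m i)\<^sup>2) \<le> e * (4 * B\<^sup>2)"
    unfolding \<rho>m_def using e centred_square_le[OF X(1) m(1) B[OF r(1)]]
    by (intro mult_left_mono) auto
  then have "b + g / k \<le> \<beta> * w m + 2 * e + e * (4 * B\<^sup>2)"
    using w_ge unfolding centred_gen_penalised[OF X(1)] \<rho>m_def[symmetric]
    by (simp add: g_def walk_gen_fun_def)
  moreover have "w (softmax X z) = w m"
    by (rule seq_cont_on_cong[OF w softmax_in_simplex[OF X] m(1) softmax_z])
  then have "\<beta> * w m \<le> \<beta> * (w mb + e)"
    using near(2)[OF zR[unfolded zb_def]] \<beta> by (intro mult_left_mono) auto
  ultimately show ?thesis using u_le by (simp add: algebra_simps)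
qed

lemma simplex_comparison_radius:
  assumes X: "finite X" "X \<noteq> {}" and mb: "mb \<in> prob_simplex X" "\<And>i. i \<in> X \<Longrightarrow> 0 < mb i"
    and u: "seq_cont_on X (prob_simplex X) u" and w: "seq_cont_on X (prob_simplex X) w"
    and c_cont: "\<exists>d>0. \<forall>m\<in>prob_simplex X. (\<forall>i\<in>X. \<bar>m i - mb i\<bar> < d) \<longrightarrow>
        (\<forall>r\<in>Hs. ereal_close e (c m r) (c mb r))"
    and e: "0 < e"
  obtains R where "0 < R" "\<And>z m. z \<in> cube X (\<lambda>i. ln (mb i)) R \<Longrightarrow> m \<in> prob_simplex X \<Longrightarrow>
      (\<And>i. i \<in> X \<Longrightarrow> m i = softmax X z i) \<Longrightarrow>
      \<bar>u m - u mb\<bar> \<le> e \<and> \<bar>w m - w mb\<bar> \<le> e \<and> (\<forall>r\<in>Hs. ereal_close e (c m r) (c mb r))"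
proof -
  have near: "\<exists>d>0. \<forall>m\<in>prob_simplex X. (\<forall>i\<in>X. \<bar>m i - mb i\<bar> < d) \<longrightarrow> \<bar>f m - f mb\<bar> \<le> e"
    if "seq_cont_on X (prob_simplex X) f" for f
    using seq_cont_on_uniform[OF seq_compact_on_simplex[OF X(1)] that e] mb(1)
    by (metis less_imp_le)
  obtain d1 d2 d3 where d: "d1 > 0" "d2 > 0" "d3 > 0"
    "\<forall>m\<in>prob_simplex X. (\<forall>i\<in>X. \<bar>m i - mb i\<bar> < d1) \<longrightarrow> \<bar>u m - u mb\<bar> \<le> e"
    "\<forall>m\<in>prob_simplex X. (\<forall>i\<in>X. \<bar>m i - mb i\<bar> < d2) \<longrightarrow> \<bar>w m - w mb\<bar> \<le> e"
    "\<forall>m\<in>prob_simplex X. (\<forall>i\<in>X. \<bar>m i - mb i\<bar> < d3) \<longrightarrow> (\<forall>r\<in>Hs. ereal_close e (c m r) (c mb r))"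
    using near[OF u] near[OF w] c_cont by metis
  have "0 < min d1 (min d2 d3)" using d by simp
  then obtain R where R: "R > 0" "\<And>z i. z \<in> cube X (\<lambda>i. ln (mb i)) R \<Longrightarrow> i \<in> X \<Longrightarrow>
      \<bar>softmax X z i - softmax X (\<lambda>i. ln (mb i)) i\<bar> < min d1 (min d2 d3)"
    using softmax_near[OF X] by blast
  have close: "\<forall>i\<in>X. \<bar>m i - mb i\<bar> < d1" "\<forall>i\<in>X. \<bar>m i - mb i\<bar> < d2" "\<forall>i\<in>X. \<bar>m i - mb i\<bar> < d3"
    if "z \<in> cube X (\<lambda>i. ln (mb i)) R" "\<And>i. i \<in> X \<Longrightarrow> m i = softmax X z i" for z m
    using R(2)[OF that(1)] that(2) softmax_ln[OF mb] by force+
  show ?thesis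
  proof (rule that[OF R(1)])
    fix z m assume m: "z \<in> cube X (\<lambda>i. ln (mb i)) R" "m \<in> prob_simplex X"
      "\<And>i. i \<in> X \<Longrightarrow> m i = softmax X z i"
    show "\<bar>u m - u mb\<bar> \<le> e \<and> \<bar>w m - w mb\<bar> \<le> e \<and> (\<forall>r\<in>Hs. ereal_close e (c m r) (c mb r))"
      using bspec[OF d(4) m(2)] bspec[OF d(5) m(2)] bspec[OF d(6) m(2)] close[OF m(1,3)]
      by simp
  qed
qed

lemma simplex_comparison:
  assumes X: "finite X" "X \<noteq> {}" and mb: "mb \<in> prob_simplex X" "\<And>i. i \<in> X \<Longrightarrow> 0 < mb i"
    and u: "seq_cont_on X (prob_simplex X) u" and w: "seq_cont_on X (prob_simplex X) w"
    and max: "\<And>m. m \<in> prob_simplex X \<Longrightarrow> u m - w m \<le> u mb - w mb" and \<beta>: "0 < \<beta>"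
    and sub: "simplex_subsolution X Hs \<rho> c \<beta> u" and super: "simplex_supersolution X Hs \<rho> c \<beta> w"
    and c: "\<And>r. r \<in> Hs \<Longrightarrow> c mb r \<noteq> -\<infinity>" and B: "\<And>r i. r \<in> Hs \<Longrightarrow> i \<in> X \<Longrightarrow> \<bar>\<rho> r i\<bar> \<le> B"
    and c_cont: "\<And>e. 0 < e \<Longrightarrow> \<exists>d>0. \<forall>m\<in>prob_simplex X. (\<forall>i\<in>X. \<bar>m i - mb i\<bar> < d) \<longrightarrow>
        (\<forall>r\<in>Hs. ereal_close e (c m r) (c mb r))"
  shows "u mb \<le> w mb"
proof -
  have approx: "\<beta> * u mb \<le> \<beta> * w mb + (3 + 2 * \<beta> + 4 * B\<^sup>2) * e" if e: "0 < e" for e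
  proof -
    obtain R where R: "0 < R" "\<And>z m. z \<in> cube X (\<lambda>i. ln (mb i)) R \<Longrightarrow> m \<in> prob_simplex X \<Longrightarrow>
        (\<And>i. i \<in> X \<Longrightarrow> m i = softmax X z i) \<Longrightarrow>
        \<bar>u m - u mb\<bar> \<le> e \<and> \<bar>w m - w mb\<bar> \<le> e \<and> (\<forall>r\<in>Hs. ereal_close e (c m r) (c mb r))"
      using simplex_comparison_radius[OF X mb u w c_cont[OF e] e] by blast
    show ?thesis
      by (rule simplex_comparison_approx[where c = c and \<rho> = \<rho>,
            OF X mb u w max \<beta> sub super c B e R(1)])
        (use R(2) softmax_in_simplex[OF X] in blast)+
  qed
  define q where "q = 3 + 2 * \<beta> + 4 * B\<^sup>2"
  have q: "q > 0" using \<beta> by (simp add: q_def add_pos_nonneg)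
  have "\<beta> * u mb \<le> \<beta> * w mb"
  proof (rule field_le_epsilon)
    fix e :: real assume "e > 0"
    then show "\<beta> * u mb \<le> \<beta> * w mb + e"
      using approx[of "e / q"] q unfolding q_def[symmetric] by simp
  qed
  then show ?thesis using \<beta> by simp
qed

section \<open>Wasserstein convergence\<close>

lemma openin_TP: "openin (TP p) U \<longleftrightarrow> U \<subseteq> Pp p \<and>
   (\<forall>\<mu>s \<mu>. \<mu> \<in> U \<and> range \<mu>s \<subseteq> Pp p \<and> convP p \<mu>s \<mu> \<longrightarrow> (\<forall>\<^sub>F n in sequentially. \<mu>s n \<in> U))"
proof -
  have "istopology (\<lambda>U. U \<subseteq> Pp p \<and>
      (\<forall>\<mu>s \<mu>. \<mu> \<in> U \<and> range \<mu>s \<subseteq> Pp p \<and> convP p \<mu>s \<mu> \<longrightarrow> (\<forall>\<^sub>F n in sequentially. \<mu>s n \<in> U)))"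
    (is "istopology ?L")
    unfolding istopology_def
  proof (rule conjI; intro allI impI)
    fix S T assume S: "?L S" and T: "?L T"
    have "\<forall>\<^sub>F n in sequentially. \<mu>s n \<in> S \<inter> T"
      if "\<mu> \<in> S \<inter> T" "range \<mu>s \<subseteq> Pp p" "convP p \<mu>s \<mu>" for \<mu>s \<mu>
    proof -
      have "\<forall>\<^sub>F n in sequentially. \<mu>s n \<in> S" "\<forall>\<^sub>F n in sequentially. \<mu>s n \<in> T"
        using S T that by blast+
      then show ?thesis by eventually_elim blast
    qed
    then show "?L (S \<inter> T)" using S by blast
  next
    fix \<K> assume \<K>: "\<forall>S\<in>\<K>. ?L S"
    have "\<forall>\<^sub>F n in sequentially. \<mu>s n \<in> \<Union>\<K>"
      if \<mu>: "\<mu> \<in> \<Union>\<K>" "range \<mu>s \<subseteq> Pp p" "convP p \<mu>s \<mu>" for \<mu>s \<mu>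
    proof -
      obtain S where S: "S \<in> \<K>" "\<mu> \<in> S" using \<mu>(1) by blast
      then have "\<forall>\<^sub>F n in sequentially. \<mu>s n \<in> S" using \<K> \<mu> by blast
      then show ?thesis by (rule eventually_mono) (use S in blast)
    qed
    then show "?L (\<Union>\<K>)" using \<K> by blast
  qed
  from topology_inverse'[OF this] show ?thesis unfolding TP_def by (rule fun_cong)
qed

lemma topspace_TP [simp]: "topspace (TP p) = Pp p"
proof -
  have "openin (TP p) (Pp p)" unfolding openin_TP by (auto intro!: always_eventually)
  then show ?thesis
    using openin_TP[of p "topspace (TP p)"] openin_subset[of "TP p" "Pp p"]
      openin_topspace[of "TP p"] by blast
qed

lemma continuous_map_TP_iff:
  fixes g :: "'a::euclidean_space measure \<Rightarrow> real"
  shows "continuous_map (TP p) euclideanreal g \<longleftrightarrow>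
    (\<forall>\<mu>s \<mu>. \<mu> \<in> Pp p \<longrightarrow> range \<mu>s \<subseteq> Pp p \<longrightarrow> convP p \<mu>s \<mu> \<longrightarrow> (\<lambda>n. g (\<mu>s n)) \<longlonglongrightarrow> g \<mu>)" (is "?lhs \<longleftrightarrow> ?rhs")
proof
  assume g: ?lhs
  show ?rhs
  proof (intro allI impI topological_tendstoI)
    fix \<mu>s \<mu> and S :: "real set"
    assume \<mu>: "\<mu> \<in> Pp p" "range \<mu>s \<subseteq> Pp p" "convP p \<mu>s \<mu>" and S: "open S" "g \<mu> \<in> S"
    have "openin (TP p) {\<nu> \<in> Pp p. g \<nu> \<in> S}" using g S(1) by (auto simp: continuous_map_def)
    then have "\<forall>\<^sub>F n in sequentially. \<mu>s n \<in> {\<nu> \<in> Pp p. g \<nu> \<in> S}"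
      using \<mu> S(2) unfolding openin_TP by blast
    then show "\<forall>\<^sub>F n in sequentially. g (\<mu>s n) \<in> S" by (rule eventually_mono) simp
  qed
next
  assume g: ?rhs
  have "openin (TP p) {\<mu> \<in> Pp p. g \<mu> \<in> S}" if "open S" for S
    unfolding openin_TP
  proof (intro conjI allI impI)
    fix \<mu>s \<mu> assume \<mu>: "\<mu> \<in> {\<mu> \<in> Pp p. g \<mu> \<in> S} \<and> range \<mu>s \<subseteq> Pp p \<and> convP p \<mu>s \<mu>"
    then have "\<forall>\<^sub>F n in sequentially. g (\<mu>s n) \<in> S"
      using g that by (intro topological_tendstoD[of _ "g \<mu>"]) auto
    then show "\<forall>\<^sub>F n in sequentially. \<mu>s n \<in> {\<mu> \<in> Pp p. g \<mu> \<in> S}"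
      by (rule eventually_mono) (use \<mu> in blast)
  qed blast
  then show ?lhs by (simp add: continuous_map_def)
qed

lemma Prob_D: "\<mu> \<in> Prob \<Longrightarrow> prob_space \<mu>" "\<mu> \<in> Prob \<Longrightarrow> sets \<mu> = sets borel" "\<mu> \<in> Prob \<Longrightarrow> space \<mu> = UNIV"
  unfolding Prob_def by (auto dest: sets_eq_imp_space_eq)

lemma Pp_Prob: "\<mu> \<in> Pp p \<Longrightarrow> \<mu> \<in> Prob"
  by (simp add: Pp_def)

lemma measurable_Prob: "\<mu> \<in> Prob \<Longrightarrow> borel_measurable \<mu> = borel_measurable borel"
  using Prob_D(2) by (metis measurable_cong_sets)

lemma integrable_Prob_bounded:
  fixes \<phi> :: "'a::euclidean_space \<Rightarrow> real"
  assumes \<mu>: "\<mu> \<in> Prob" and "\<phi> \<in> borel_measurable borel" "bounded (range \<phi>)"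
  shows "integrable \<mu> \<phi>"
proof -
  interpret prob_space \<mu> by (rule Prob_D[OF \<mu>])
  obtain B where "\<And>x. norm (\<phi> x) \<le> B" using assms(3) by (auto simp: bounded_iff)
  then show ?thesis
    using assms(2) measurable_Prob[OF \<mu>] by (intro integrable_const_bound[of _ B]) auto
qed

lemma couplings_D:
  assumes "\<pi> \<in> couplings \<mu> \<nu>"
  shows "prob_space \<pi>" "fst \<in> \<pi> \<rightarrow>\<^sub>M borel" "snd \<in> \<pi> \<rightarrow>\<^sub>M borel" "distr \<pi> borel fst = \<mu>"
    "distr \<pi> borel snd = \<nu>"
    "borel_measurable \<pi> = borel_measurable (borel \<Otimes>\<^sub>M borel)"
  using assms measurable_cong_sets[of \<pi> "borel \<Otimes>\<^sub>M borel"] unfolding couplings_def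
  by (auto simp: measurable_fst measurable_snd)

lemma integrable_coupling:
  fixes \<phi> :: "'a::euclidean_space \<Rightarrow> real"
  assumes "\<pi> \<in> couplings \<mu> \<nu>" "\<phi> \<in> borel_measurable borel"
  shows "integrable \<pi> (\<lambda>z. \<phi> (fst z)) \<longleftrightarrow> integrable \<mu> \<phi>"
    "integrable \<pi> (\<lambda>z. \<phi> (snd z)) \<longleftrightarrow> integrable \<nu> \<phi>"
  using integrable_distr_eq[OF couplings_D(2)[OF assms(1)] assms(2)]
    integrable_distr_eq[OF couplings_D(3)[OF assms(1)] assms(2)]
  by (simp_all add: couplings_D(4,5)[OF assms(1)])

lemma integral_coupling:
  fixes \<phi> :: "'a::euclidean_space \<Rightarrow> real"
  assumes "\<pi> \<in> couplings \<mu> \<nu>" "\<phi> \<in> borel_measurable borel"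
  shows "(\<integral>z. \<phi> (fst z) \<partial>\<pi>) = (\<integral>x. \<phi> x \<partial>\<mu>)" "(\<integral>z. \<phi> (snd z) \<partial>\<pi>) = (\<integral>x. \<phi> x \<partial>\<nu>)"
  using integral_distr[OF couplings_D(2)[OF assms(1)] assms(2)]
    integral_distr[OF couplings_D(3)[OF assms(1)] assms(2)]
  by (simp_all add: couplings_D(4,5)[OF assms(1)])

lemma integrable_norm_powr_Pp:
  assumes "\<mu> \<in> Pp p" "p \<noteq> 0"
  shows "integrable \<mu> (\<lambda>x. norm x powr p)"
proof (rule integrableI_nonneg)
  show "(\<lambda>x. norm x powr p) \<in> borel_measurable \<mu>"
    unfolding measurable_Prob[OF Pp_Prob[OF assms(1)]] by measurable
qed (use assms in \<open>auto simp: Pp_def\<close>)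

lemma product_coupling:
  assumes "\<mu> \<in> Prob" "\<nu> \<in> Prob"
  shows "\<mu> \<Otimes>\<^sub>M \<nu> \<in> couplings \<mu> \<nu>"
proof -
  interpret M: prob_space \<mu> by (rule Prob_D[OF assms(1)])
  interpret N: prob_space \<nu> by (rule Prob_D[OF assms(2)])
  interpret P: pair_prob_space \<mu> \<nu> ..
  have sets: "sets \<mu> = sets borel" "sets \<nu> = sets borel" using assms Prob_D(2) by auto
  have "distr (\<mu> \<Otimes>\<^sub>M \<nu>) \<mu> fst = \<mu>" by (rule N.distr_pair_fst)
  then have fst: "distr (\<mu> \<Otimes>\<^sub>M \<nu>) borel fst = \<mu>" using distr_cong[OF refl sets(1) refl] by metis
  have "distr (\<mu> \<Otimes>\<^sub>M \<nu>) \<nu> snd = distr (\<nu> \<Otimes>\<^sub>M \<mu>) \<nu> fst"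
    by (subst P.distr_pair_swap, subst distr_distr[OF _ measurable_pair_swap'])
      (auto intro!: distr_cong measurable_snd)
  also have "\<dots> = \<nu>" by (rule M.distr_pair_fst)
  finally have "distr (\<mu> \<Otimes>\<^sub>M \<nu>) borel snd = \<nu>" using distr_cong[OF refl sets(2) refl] by metis
  then show ?thesis
    unfolding couplings_def using fst P.prob_space_axioms sets_pair_measure_cong[OF sets] by simp
qed

definition transport_cost :: "real \<Rightarrow> ('a::euclidean_space \<times> 'a) measure \<Rightarrow> real" where
  "transport_cost p \<pi> = (\<integral>z. dist (fst z) (snd z) powr p \<partial>\<pi>)"

lemma transport_cost_nonneg [simp]: "0 \<le> transport_cost p \<pi>"
  by (simp add: transport_cost_def)

lemma dist_powr_measurable:
  "(\<lambda>z. dist (fst z) (snd z) powr p)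
      \<in> borel_measurable (borel \<Otimes>\<^sub>M (borel :: 'a::euclidean_space measure))"
  by measurable

lemma dist_powr_le:
  fixes x y :: "'a::real_normed_vector"
  assumes "0 \<le> p"
  shows "dist x y powr p \<le> 2 powr p * (norm x powr p + norm y powr p)"
proof -
  have "dist x y \<le> 2 * max (norm x) (norm y)"
    using norm_triangle_ineq4[of x y] by (simp add: dist_norm max_def)
  then have "dist x y powr p \<le> (2 * max (norm x) (norm y)) powr p"
    using assms by (intro powr_mono2) auto
  also have "\<dots> = 2 powr p * (max (norm x) (norm y)) powr p" by (subst powr_mult) auto
  also have "\<dots> \<le> 2 powr p * (norm x powr p + norm y powr p)"
    by (intro mult_left_mono) (auto simp: max_def)
  finally show ?thesis .
qed

lemma integrable_dist_powr_coupling: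
  assumes p: "1 \<le> p" and \<mu>: "\<mu> \<in> Pp p" and \<nu>: "\<nu> \<in> Pp p" and \<pi>: "\<pi> \<in> couplings \<mu> \<nu>"
  shows "integrable \<pi> (\<lambda>z. dist (fst z) (snd z) powr p)"
proof (rule Bochner_Integration.integrable_bound)
  have "(\<lambda>x::'a. norm x powr p) \<in> borel_measurable borel" by measurable
  from integrable_coupling[OF \<pi> this] show "integrable \<pi>
      (\<lambda>z. 2 powr p * (norm (fst z) powr p + norm (snd z) powr p))"
    using p integrable_norm_powr_Pp[OF \<mu>] integrable_norm_powr_Pp[OF \<nu>] by simp
  show "(\<lambda>z. dist (fst z) (snd z) powr p) \<in> borel_measurable \<pi>"
    unfolding couplings_D(6)[OF \<pi>] by (rule dist_powr_measurable)
  show "AE z in \<pi>. norm (dist (fst z) (snd z) powr p)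
      \<le> norm (2 powr p * (norm (fst z) powr p + norm (snd z) powr p))"
    using p dist_powr_le[of p] by (auto intro!: AE_I2 order_trans[OF _ abs_ge_self])
qed

lemma Wass_eq_transport_cost:
  assumes "1 \<le> p" "\<mu> \<in> Pp p" "\<nu> \<in> Pp p"
  shows "Wass p \<mu> \<nu> = enn2real (INF \<pi>\<in>couplings \<mu> \<nu>. ennreal (transport_cost p \<pi>)) powr (1 / p)"
proof -
  have "(\<integral>\<^sup>+ z. ennreal (dist (fst z) (snd z) powr p) \<partial>\<pi>) = ennreal (transport_cost p \<pi>)"
    if "\<pi> \<in> couplings \<mu> \<nu>" for \<pi>
    unfolding transport_cost_def
    by (rule nn_integral_eq_integral[OF integrable_dist_powr_coupling[OF assms that]]) simp
  then show ?thesis by (simp add: Wass_def cong: INF_cong)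
qed

lemma Wass_tendsto_0:
  assumes p: "1 \<le> p" and \<mu>s: "\<And>n. \<mu>s n \<in> Pp p" and \<mu>: "\<mu> \<in> Pp p"
    and \<pi>: "\<And>n. \<pi> n \<in> couplings (\<mu>s n) \<mu>"
    and lim: "(\<lambda>n. transport_cost p (\<pi> n)) \<longlonglongrightarrow> 0"
  shows "(\<lambda>n. Wass p (\<mu>s n) \<mu>) \<longlonglongrightarrow> 0"
proof (rule Lim_null_comparison)
  have "Wass p (\<mu>s n) \<mu> \<le> transport_cost p (\<pi> n) powr (1 / p)" for n
  proof -
    have "(INF \<pi>\<in>couplings (\<mu>s n) \<mu>. ennreal (transport_cost p \<pi>))
        \<le> ennreal (transport_cost p (\<pi> n))"
      by (rule INF_lower[OF \<pi>])
    from enn2real_mono[OF this] show ?thesis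
      unfolding Wass_eq_transport_cost[OF p \<mu>s \<mu>] using p by (intro powr_mono2) auto
  qed
  then show "\<forall>\<^sub>F n in sequentially. norm (Wass p (\<mu>s n) \<mu>) \<le> transport_cost p (\<pi> n) powr (1 / p)"
    by (simp add: Wass_def)
  show "(\<lambda>n. transport_cost p (\<pi> n) powr (1 / p)) \<longlonglongrightarrow> 0"
    using tendsto_powr'[OF lim tendsto_const[of "1 / p"]] p by simp
qed

lemma couplings_of_Wass_tendsto_0:
  assumes p: "1 \<le> p" and \<mu>s: "\<And>n. \<mu>s n \<in> Pp p" and \<mu>: "\<mu> \<in> Pp p"
    and lim: "(\<lambda>n. Wass p (\<mu>s n) \<mu>) \<longlonglongrightarrow> 0"
  obtains \<pi> where "\<forall>n. \<pi> n \<in> couplings (\<mu>s n) \<mu>" "(\<lambda>n. transport_cost p (\<pi> n)) \<longlonglongrightarrow> 0"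
proof -
  define I where "I n = (INF \<pi>\<in>couplings (\<mu>s n) \<mu>. ennreal (transport_cost p \<pi>))" for n
  have "I n < \<infinity>" for n
  proof -
    have "I n \<le> ennreal (transport_cost p (\<mu>s n \<Otimes>\<^sub>M \<mu>))"
      unfolding I_def by (rule INF_lower[OF product_coupling[OF Pp_Prob[OF \<mu>s] Pp_Prob[OF \<mu>]]])
    also have "\<dots> < \<infinity>" by simp
    finally show ?thesis .
  qed
  then have I: "I n = ennreal (Wass p (\<mu>s n) \<mu> powr p)" for n
    using p by (simp add: Wass_eq_transport_cost[OF p \<mu>s \<mu>] I_def[symmetric] powr_powr)
  have "\<exists>\<pi>\<in>couplings (\<mu>s n) \<mu>. ennreal (transport_cost p \<pi>) < I n + ennreal (1 / real (Suc n))"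
    for n
    unfolding I_def[symmetric] INF_less_iff[symmetric] unfolding I
    by (subst ennreal_plus[symmetric])
      (auto intro!: ennreal_lessI add_nonneg_pos simp del: ennreal_plus)
  then obtain \<pi> where \<pi>: "\<And>n. \<pi> n \<in> couplings (\<mu>s n) \<mu>"
    "\<And>n. ennreal (transport_cost p (\<pi> n)) < I n + ennreal (1 / real (Suc n))"
    by metis
  have "transport_cost p (\<pi> n) \<le> Wass p (\<mu>s n) \<mu> powr p + 1 / real (Suc n)" for n
    using \<pi>(2)[of n] unfolding I
    by (simp add: ennreal_plus[symmetric] ennreal_less_iff del: ennreal_plus)
  moreover have "(\<lambda>n. Wass p (\<mu>s n) \<mu> powr p + 1 / real (Suc n)) \<longlonglongrightarrow> 0"
    using tendsto_add[OF tendsto_powr'[OF lim tendsto_const[of p]] LIMSEQ_inverse_real_of_nat] p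
    by (simp add: Wass_def inverse_eq_divide)
  ultimately have "(\<lambda>n. transport_cost p (\<pi> n)) \<longlonglongrightarrow> 0"
    by (intro tendsto_sandwich[where f = "\<lambda>_. 0" and g = "\<lambda>n. transport_cost p (\<pi> n)"]) auto
  with \<pi>(1) show ?thesis by (intro that) auto
qed

definition bdd_lipschitz :: "('a::metric_space \<Rightarrow> real) \<Rightarrow> bool" where
  "bdd_lipschitz \<phi> \<longleftrightarrow> bounded (range \<phi>) \<and> (\<exists>L. L-lipschitz_on UNIV \<phi>)"

lemma bdd_lipschitz_measurable: "bdd_lipschitz \<phi> \<Longrightarrow> \<phi> \<in> borel_measurable borel"
  unfolding bdd_lipschitz_def
  by (auto intro: borel_measurable_continuous_onI lipschitz_on_continuous_on)

lemma le_add_powr: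
  fixes t :: real
  assumes "1 \<le> p" "0 < \<delta>" "0 \<le> t"
  shows "t \<le> \<delta> + \<delta> powr (1 - p) * t powr p"
proof (cases "t \<le> \<delta>")
  case False
  have "t = t powr (1 - p) * t powr p" using False assms by (simp add: powr_add[symmetric])
  also have "\<dots> \<le> \<delta> powr (1 - p) * t powr p"
    using False assms by (intro mult_right_mono powr_mono2') auto
  finally show ?thesis using assms by linarith
qed (use assms in \<open>auto intro: add_increasing2\<close>)

lemma lipschitz_coupling_bound:
  assumes p: "1 \<le> p" and \<mu>: "\<mu> \<in> Pp p" and \<nu>: "\<nu> \<in> Pp p" and \<pi>: "\<pi> \<in> couplings \<mu> \<nu>" and \<delta>: "0 < \<delta>"
    and \<phi>: "bounded (range \<phi>)" "L-lipschitz_on UNIV \<phi>"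
  shows "\<bar>(\<integral>x. \<phi> x \<partial>\<mu>) - (\<integral>x. \<phi> x \<partial>\<nu>)\<bar> \<le> L * (\<delta> + \<delta> powr (1 - p) * transport_cost p \<pi>)"
proof -
  interpret prob_space \<pi> by (rule couplings_D[OF \<pi>])
  have m\<phi>: "\<phi> \<in> borel_measurable borel"
    by (intro borel_measurable_continuous_onI lipschitz_on_continuous_on[OF \<phi>(2)])
  have int: "integrable \<pi> (\<lambda>z. \<phi> (fst z))" "integrable \<pi> (\<lambda>z. \<phi> (snd z))"
    using integrable_Prob_bounded[OF Pp_Prob m\<phi> \<phi>(1)] \<mu> \<nu>
    by (simp_all add: integrable_coupling[OF \<pi> m\<phi>])
  have intd: "integrable \<pi> (\<lambda>z. dist (fst z) (snd z) powr p)"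
    by (rule integrable_dist_powr_coupling[OF p \<mu> \<nu> \<pi>])
  have "\<bar>(\<integral>x. \<phi> x \<partial>\<mu>) - (\<integral>x. \<phi> x \<partial>\<nu>)\<bar> = \<bar>\<integral>z. \<phi> (fst z) - \<phi> (snd z) \<partial>\<pi>\<bar>"
    using int by (simp add: integral_coupling[OF \<pi> m\<phi>])
  also have "\<dots> \<le> (\<integral>z. \<bar>\<phi> (fst z) - \<phi> (snd z)\<bar> \<partial>\<pi>)" by (rule integral_abs_bound)
  also have "\<dots> \<le> (\<integral>z. L * (\<delta> + \<delta> powr (1 - p) * dist (fst z) (snd z) powr p) \<partial>\<pi>)"
  proof (rule integral_mono)
    fix z :: "'a \<times> 'a"
    have "\<bar>\<phi> (fst z) - \<phi> (snd z)\<bar> \<le> L * dist (fst z) (snd z)"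
      using lipschitz_onD[OF \<phi>(2), of "fst z" "snd z"] by (simp add: dist_real_def)
    also have "\<dots> \<le> L * (\<delta> + \<delta> powr (1 - p) * dist (fst z) (snd z) powr p)"
      using lipschitz_on_nonneg[OF \<phi>(2)] le_add_powr[OF p \<delta>] by (intro mult_left_mono) auto
    finally show "\<bar>\<phi> (fst z) - \<phi> (snd z)\<bar>
        \<le> L * (\<delta> + \<delta> powr (1 - p) * dist (fst z) (snd z) powr p)" .
  qed (use int intd in auto)
  also have "\<dots> = L * (\<delta> + \<delta> powr (1 - p) * transport_cost p \<pi>)"
    using intd by (simp add: prob_space transport_cost_def)
  finally show ?thesis .
qed

lemma continuous_map_integral:
  assumes p: "p = 0 \<or> 1 \<le> p" and \<phi>: "bdd_lipschitz \<phi>"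
  shows "continuous_map (TP p) euclideanreal (\<lambda>\<mu>. \<integral>x. \<phi> x \<partial>\<mu>)"
  unfolding continuous_map_TP_iff
proof (intro allI impI)
  fix \<mu>s :: "nat \<Rightarrow> 'a measure" and \<mu>
  assume \<mu>: "\<mu> \<in> Pp p" "range \<mu>s \<subseteq> Pp p" and conv: "convP p \<mu>s \<mu>"
  obtain L where L: "bounded (range \<phi>)" "L-lipschitz_on UNIV \<phi>"
    using \<phi> by (auto simp: bdd_lipschitz_def)
  show "(\<lambda>n. \<integral>x. \<phi> x \<partial>\<mu>s n) \<longlonglongrightarrow> (\<integral>x. \<phi> x \<partial>\<mu>)"
  proof (cases "p = 0")
    case True
    then show ?thesis using conv L lipschitz_on_continuous_on[OF L(2)] by (simp add: convP_def)
  next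
    case False
    then have p1: "1 \<le> p" and W: "(\<lambda>n. Wass p (\<mu>s n) \<mu>) \<longlonglongrightarrow> 0" using p conv by (auto simp: convP_def)
    have \<mu>s: "\<mu>s n \<in> Pp p" for n using \<mu>(2) by blast
    obtain \<pi> where \<pi>: "\<forall>n. \<pi> n \<in> couplings (\<mu>s n) \<mu>" "(\<lambda>n. transport_cost p (\<pi> n)) \<longlonglongrightarrow> 0"
      by (rule couplings_of_Wass_tendsto_0[OF p1 \<mu>s \<mu>(1) W])
    show ?thesis
    proof (rule tendstoI)
      fix e :: real assume "0 < e"
      define \<delta> where "\<delta> = e / (2 * (L + 1))"
      have \<delta>: "0 < \<delta>" "L * \<delta> < e"
        using \<open>0 < e\<close> lipschitz_on_nonneg[OF L(2)]
        by (auto simp: \<delta>_def field_simps intro: add_nonneg_pos)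
      have "(\<lambda>n. L * (\<delta> + \<delta> powr (1 - p) * transport_cost p (\<pi> n))) \<longlonglongrightarrow> L * (\<delta> + \<delta> powr (1 - p) * 0)"
        by (intro tendsto_intros \<pi>(2))
      then have "\<forall>\<^sub>F n in sequentially. L * (\<delta> + \<delta> powr (1 - p) * transport_cost p (\<pi> n)) < e"
        using \<delta>(2) by (intro order_tendstoD(2)) auto
      then show "\<forall>\<^sub>F n in sequentially. dist (\<integral>x. \<phi> x \<partial>\<mu>s n) (\<integral>x. \<phi> x \<partial>\<mu>) < e"
      proof eventually_elim
        case (elim n)
        then show ?case
          using lipschitz_coupling_bound[OF p1 \<mu>s \<mu>(1) spec[OF \<pi>(1)] \<delta>(1) L] unfolding dist_real_def
          by (rule le_less_trans[rotated])
      qed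
    qed
  qed
qed

section \<open>Measures with finite support\<close>

definition discr :: "'a::euclidean_space set \<Rightarrow> ('a \<Rightarrow> real) \<Rightarrow> 'a measure" where
  "discr X m = distr (point_measure X (\<lambda>x. ennreal (m x))) borel (\<lambda>x. x)"

lemma sets_discr [simp]: "sets (discr X m) = sets borel"
  and space_discr [simp]: "space (discr X m) = UNIV"
  by (simp_all add: discr_def)

lemma finite_sets_borel: "finite (X :: 'a::t1_space set) \<Longrightarrow> X \<in> sets borel"
  by (intro borel_closed finite_imp_closed)

lemma emeasure_discr:
  assumes "finite X" "A \<in> sets borel" "\<And>x. x \<in> X \<Longrightarrow> 0 \<le> m x"
  shows "emeasure (discr X m) A = ennreal (\<Sum>x\<in>X \<inter> A. m x)"
proof -
  have "emeasure (discr X m) A = emeasure (point_measure X (\<lambda>x. ennreal (m x))) (A \<inter> X)"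
    unfolding discr_def using assms(2) by (subst emeasure_distr) (auto simp: space_point_measure)
  also have "\<dots> = (\<Sum>x\<in>A \<inter> X. ennreal (m x))"
    using assms(1) by (intro emeasure_point_measure_finite) auto
  also have "\<dots> = ennreal (\<Sum>x\<in>A \<inter> X. m x)" using assms(3) by (intro sum_ennreal) auto
  finally show ?thesis by (simp only: Int_commute)
qed

lemma discr_cong: "(\<And>x. x \<in> X \<Longrightarrow> m x = m' x) \<Longrightarrow> discr X m = discr X m'"
  unfolding discr_def point_measure_def
  by (auto intro!: arg_cong[where f = "\<lambda>M. distr M borel (\<lambda>x. x)"] density_cong AE_I2)

lemma distr_discr:
  assumes X: "finite X" and Y: "finite Y" and g: "g \<in> borel_measurable borel" "g ` X \<subseteq> Y"
    and nonneg: "\<And>x. x \<in> X \<Longrightarrow> 0 \<le> P x" and m: "\<And>y. y \<in> Y \<Longrightarrow> m y = (\<Sum>x\<in>{x \<in> X. g x = y}. P x)"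
  shows "distr (discr X P) borel g = discr Y m"
proof (rule measure_eqI)
  fix A assume "A \<in> sets (distr (discr X P) borel g)"
  then have A: "A \<in> sets borel" and gA: "g -` A \<in> sets borel" using measurable_sets[OF g(1)] by auto
  have m0: "0 \<le> m y" if "y \<in> Y" for y unfolding m[OF that] using nonneg by (intro sum_nonneg) auto
  have "(\<Sum>x\<in>X \<inter> g -` A. P x) = (\<Sum>y\<in>Y \<inter> A. \<Sum>x\<in>{x \<in> X \<inter> g -` A. g x = y}. P x)"
    using X Y g(2) by (intro sum.group[symmetric]) auto
  also have "\<dots> = (\<Sum>y\<in>Y \<inter> A. m y)" using m by (intro sum.cong) (auto intro!: sum.cong)
  finally have "emeasure (discr X P) (g -` A) = emeasure (discr Y m) A"
    by (simp add: emeasure_discr[OF X gA] emeasure_discr[OF Y A] nonneg m0)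
  then show "emeasure (distr (discr X P) borel g) A = emeasure (discr Y m) A"
    using g(1) A by (subst emeasure_distr) (auto simp: measurable_def)
qed simp

lemma discr_extend:
  assumes "finite X" "Y \<subseteq> X" "\<And>x. x \<in> Y \<Longrightarrow> 0 \<le> m x"
  shows "discr X (\<lambda>x. if x \<in> Y then m x else 0) = discr Y m"
proof -
  have "finite Y" using assms by (blast intro: finite_subset)
  have "distr (discr Y m) borel (\<lambda>x. x) = discr X (\<lambda>x. if x \<in> Y then m x else 0)"
  proof (rule distr_discr)
    fix y
    have "{x \<in> Y. x = y} = (if y \<in> Y then {y} else {})" by auto
    then show "(if y \<in> Y then m y else 0) = (\<Sum>x\<in>{x \<in> Y. x = y}. m x)" by simp
  qed (use assms \<open>finite Y\<close> in auto)
  then show ?thesis by (simp add: distr_id2)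
qed

lemma prob_simplex_extend:
  assumes "finite X" "Y \<subseteq> X" "m \<in> prob_simplex Y"
  shows "(\<lambda>x. if x \<in> Y then m x else 0) \<in> prob_simplex X"
  using assms by (auto simp: prob_simplex_def sum.inter_restrict[symmetric] Int_absorb1)

lemma discr_Prob:
  assumes "finite X" "m \<in> prob_simplex X"
  shows "discr X m \<in> Prob"
proof -
  have "emeasure (discr X m) (space (discr X m)) = 1"
    using assms by (simp add: emeasure_discr prob_simplex_def)
  then show ?thesis unfolding Prob_def using prob_spaceI[of "discr X m"] by simp
qed

lemma integral_discr:
  fixes g :: "'a::euclidean_space \<Rightarrow> real"
  assumes "finite X" "g \<in> borel_measurable borel" "\<And>x. x \<in> X \<Longrightarrow> 0 \<le> m x"
  shows "(\<integral>x. g x \<partial>discr X m) = (\<Sum>x\<in>X. m x * g x)"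
  unfolding discr_def using assms
  by (subst integral_distr) (auto simp: lebesgue_integral_point_measure_finite)

lemma nn_integral_discr_less_top:
  assumes X: "finite X" and g: "(\<lambda>x. ennreal (g x)) \<in> borel_measurable borel"
  shows "(\<integral>\<^sup>+ x. ennreal (g x) \<partial>discr X m) < \<infinity>"
proof -
  have "(\<integral>\<^sup>+ x. ennreal (g x) \<partial>discr X m) = (\<Sum>x\<in>X. ennreal (m x) * ennreal (g x))"
    unfolding discr_def using assms
    by (subst nn_integral_distr) (auto simp: nn_integral_point_measure_finite)
  also have "\<dots> < \<infinity>" by (simp add: X ennreal_mult_less_top)
  finally show ?thesis .
qed

lemma integrable_discr:
  fixes g :: "'a::euclidean_space \<Rightarrow> real"
  assumes "finite X" "g \<in> borel_measurable borel"
  shows "integrable (discr X m) g"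
proof (rule integrableI_bounded)
  show "g \<in> borel_measurable (discr X m)" using assms(2) by (simp add: discr_def)
  show "(\<integral>\<^sup>+ x. ennreal (norm (g x)) \<partial>discr X m) < \<infinity>"
    using assms
    by (intro nn_integral_discr_less_top measurable_compose[OF _ measurable_ennreal]) auto
qed

lemma discr_Pp:
  assumes "finite X" "m \<in> prob_simplex X"
  shows "discr X m \<in> Pp p"
proof -
  have "(\<lambda>x::'a. ennreal (norm x powr p)) \<in> borel_measurable borel" by measurable
  then show ?thesis
    using nn_integral_discr_less_top[OF assms(1)] discr_Prob[OF assms] by (simp add: Pp_def)
qed

lemma discr_PX:
  assumes "finite X" "m \<in> prob_simplex X"
  shows "discr X m \<in> PX X"
proof -
  have "UNIV - X \<in> sets borel" using finite_sets_borel[OF assms(1)] by (intro sets.Diff) auto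
  then have "emeasure (discr X m) (UNIV - X) = 0"
    using assms by (simp add: emeasure_discr prob_simplex_def)
  then show ?thesis unfolding PX_def using discr_Prob[OF assms] by simp
qed

lemma Prob_finite_support:
  assumes X: "finite X" and \<mu>: "\<mu> \<in> Prob" "emeasure \<mu> (UNIV - X) = 0"
  obtains m where "m \<in> prob_simplex X" "\<mu> = discr X m"
proof -
  interpret prob_space \<mu> by (rule Prob_D[OF \<mu>(1)])
  define m where "m x = measure \<mu> {x}" for x
  note sets = Prob_D(2)[OF \<mu>(1)]
  note X' = finite_sets_borel[OF X]
  have eq: "emeasure \<mu> A = ennreal (\<Sum>x\<in>X \<inter> A. m x)" if A: "A \<in> sets borel" for A
  proof -
    have "emeasure \<mu> (A - X) \<le> emeasure \<mu> (UNIV - X)" using A X' sets by (intro emeasure_mono) auto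
    then have "emeasure \<mu> (A - X) = 0" using \<mu>(2) by simp
    moreover have "emeasure \<mu> A = emeasure \<mu> (A \<inter> X) + emeasure \<mu> (A - X)"
      using A X' sets plus_emeasure[of "A \<inter> X" \<mu> "A - X"]
      by (simp add: Int_Diff_Un Int_Diff_disjoint)
    moreover have "emeasure \<mu> (A \<inter> X) = (\<Sum>x\<in>A \<inter> X. emeasure \<mu> {x})"
      using X sets by (intro emeasure_eq_sum_singleton) auto
    moreover have "(\<Sum>x\<in>A \<inter> X. emeasure \<mu> {x}) = ennreal (\<Sum>x\<in>A \<inter> X. m x)"
      unfolding emeasure_eq_measure m_def by (rule sum_ennreal) simp
    ultimately show ?thesis by (simp only: Int_commute add_0_right)
  qed
  show thesis
  proof (rule that)
    have "ennreal (\<Sum>x\<in>X. m x) = 1" using eq[of UNIV] emeasure_space_1 Prob_D(3)[OF \<mu>(1)] by simp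
    then show "m \<in> prob_simplex X" by (simp add: prob_simplex_def ennreal_eq_1 m_def)
    show "\<mu> = discr X m"
      using sets by (intro measure_eqI) (auto simp: eq emeasure_discr[OF X] m_def)
  qed
qed

lemma compl_supp_null_sets:
  assumes \<mu>: "\<mu> \<in> Prob"
  shows "UNIV - supp \<mu> \<in> null_sets \<mu>"
proof -
  define \<F> where "\<F> = {ball x e |x e. 0 < e \<and> emeasure \<mu> (ball x e) = 0}"
  have "open S" if "S \<in> \<F>" for S using that unfolding \<F>_def by auto
  then obtain \<G> where \<G>: "\<G> \<subseteq> \<F>" "countable \<G>" "\<Union>\<G> = \<Union>\<F>" by (rule Lindelof)
  have "(\<Union>S\<in>\<G>. S) \<in> null_sets \<mu>"
  proof (rule null_sets_UN'[OF \<G>(2)])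
    fix S assume "S \<in> \<G>"
    then obtain x e where "S = ball x e" "emeasure \<mu> (ball x e) = 0"
      using \<G>(1) unfolding \<F>_def by blast
    then show "S \<in> null_sets \<mu>" using Prob_D(2)[OF \<mu>] by (intro null_setsI) simp_all
  qed
  moreover have "UNIV - supp \<mu> = \<Union>\<F>"
  proof (intro equalityI subsetI)
    fix x assume "x \<in> UNIV - supp \<mu>"
    then obtain e where "0 < e" "emeasure \<mu> (ball x e) = 0"
      unfolding supp_def by (auto simp: not_gr_zero)
    then show "x \<in> \<Union>\<F>" unfolding \<F>_def by (intro UnionI[of "ball x e"]) auto
  next
    fix y assume "y \<in> \<Union>\<F>"
    then obtain x e where y: "y \<in> ball x e" and null: "emeasure \<mu> (ball x e) = 0"
      unfolding \<F>_def by blast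
    from y obtain d where d: "0 < d" "ball y d \<subseteq> ball x e" using openE[OF open_ball] by blast
    have "emeasure \<mu> (ball y d) \<le> emeasure \<mu> (ball x e)"
      using d(2) Prob_D(2)[OF \<mu>] by (intro emeasure_mono) auto
    then show "y \<in> UNIV - supp \<mu>" using null d(1) unfolding supp_def by auto
  qed
  ultimately show ?thesis using \<G>(3) by simp
qed

lemma supp_discr_subset:
  assumes X: "finite X" and m: "m \<in> prob_simplex X"
  shows "supp (discr X m) \<subseteq> X"
proof (rule ccontr)
  assume "\<not> ?thesis"
  then obtain x where x: "x \<in> supp (discr X m)" "x \<in> - X" by blast
  have "open (- X)" using finite_imp_closed[OF X] by (simp add: open_Compl)
  then obtain e where e: "e > 0" "ball x e \<subseteq> - X" using x(2) by (rule openE)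
  then have "X \<inter> ball x e = {}" by blast
  then have "emeasure (discr X m) (ball x e) = 0"
    using X m by (simp add: emeasure_discr prob_simplex_def)
  then show False using x(1) e(1) by (auto simp: supp_def)
qed

lemma Dset_discr:
  assumes X: "finite X" and m: "m \<in> prob_simplex X" and \<mu>: "\<mu> \<in> Dset p (discr X m)"
  obtains m' where "m' \<in> prob_simplex X" "\<mu> = discr X m'"
proof -
  have P: "\<mu> \<in> Prob" and "supp \<mu> \<subseteq> X"
    using \<mu> supp_discr_subset[OF X m] by (auto simp: Dset_def Pp_def)
  then have "UNIV - X \<in> null_sets \<mu>"
    using finite_sets_borel[OF X] Prob_D(2)[OF P]
    by (intro null_sets_subset[OF compl_supp_null_sets[OF P]]) auto
  then have "emeasure \<mu> (UNIV - X) = 0" by (rule null_setsD1)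
  then show ?thesis using that by (rule Prob_finite_support[OF X P])
qed

text \<open>The common mass stays in place and the excess masses are coupled independently
  (if there is no excess, the quotient is 0 by convention).\<close>

definition excess_coupling :: "'a set \<Rightarrow> ('a \<Rightarrow> real) \<Rightarrow> ('a \<Rightarrow> real) \<Rightarrow> 'a \<times> 'a \<Rightarrow> real" where
  "excess_coupling X m m' = (\<lambda>(x, y). (if x = y then min (m x) (m' x) else 0) +
     (m x - min (m x) (m' x)) * (m' y - min (m y) (m' y)) / (\<Sum>z\<in>X. m z - min (m z) (m' z)))"

lemma excess_coupling_nonneg:
  assumes "m \<in> prob_simplex X" "m' \<in> prob_simplex X" "z \<in> X \<times> X"
  shows "0 \<le> excess_coupling X m m' z"
  using assms
  by (auto simp: excess_coupling_def prob_simplex_def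
      intro!: add_nonneg_nonneg divide_nonneg_nonneg mult_nonneg_nonneg sum_nonneg)

lemma excess_coupling_swap:
  assumes "m \<in> prob_simplex X" "m' \<in> prob_simplex X"
  shows "excess_coupling X m m' (x, y) = excess_coupling X m' m (y, x)"
proof -
  have "(\<Sum>z\<in>X. m z - min (m z) (m' z)) = (\<Sum>z\<in>X. m' z - min (m' z) (m z))"
    using assms by (simp add: sum_subtractf prob_simplex_def min.commute)
  then show ?thesis by (auto simp: excess_coupling_def min.commute mult.commute)
qed

lemma excess_coupling_marginal:
  assumes X: "finite X" and m: "m \<in> prob_simplex X" "m' \<in> prob_simplex X" and x: "x \<in> X"
  shows "(\<Sum>y\<in>X. excess_coupling X m m' (x, y)) = m x"
proof -
  define \<tau> where "\<tau> = (\<Sum>z\<in>X. m z - min (m z) (m' z))"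
  have \<tau>': "(\<Sum>z\<in>X. m' z - min (m z) (m' z)) = \<tau>"
    using m by (simp add: \<tau>_def sum_subtractf prob_simplex_def)
  have "m x - min (m x) (m' x) = 0" if "\<tau> = 0"
    using that X x unfolding \<tau>_def by (subst (asm) sum_nonneg_eq_0_iff) auto
  then have "(m x - min (m x) (m' x)) * \<tau> / \<tau> = m x - min (m x) (m' x)" by (cases "\<tau> = 0") auto
  moreover have "(\<Sum>y\<in>X. excess_coupling X m m' (x, y))
      = min (m x) (m' x) + (m x - min (m x) (m' x)) * \<tau> / \<tau>"
    unfolding excess_coupling_def \<tau>_def[symmetric] using X x
    by (simp add: sum.distrib sum_divide_distrib[symmetric] sum_distrib_left[symmetric] \<tau>')
  ultimately show ?thesis by simp
qed

lemma excess_coupling_in_couplings: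
  fixes X :: "'a::euclidean_space set"
  assumes X: "finite X" and m: "m \<in> prob_simplex X" "m' \<in> prob_simplex X"
  shows "discr (X \<times> X) (excess_coupling X m m') \<in> couplings (discr X m) (discr X m')"
proof -
  let ?P = "excess_coupling X m m'"
  have measurable: "fst \<in> borel_measurable (borel :: ('a \<times> 'a) measure)"
    "snd \<in> borel_measurable (borel :: ('a \<times> 'a) measure)"
    by (intro borel_measurable_continuous_onI continuous_intros)+
  have fst: "distr (discr (X \<times> X) ?P) borel fst = discr X m"
  proof (rule distr_discr)
    fix x assume x: "x \<in> X"
    then have "{z \<in> X \<times> X. fst z = x} = Pair x ` X" by auto
    then have "(\<Sum>z\<in>{z \<in> X \<times> X. fst z = x}. ?P z) = (\<Sum>y\<in>X. ?P (x, y))"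
      by (simp add: sum.reindex inj_on_def)
    then show "m x = (\<Sum>z\<in>{z \<in> X \<times> X. fst z = x}. ?P z)"
      using excess_coupling_marginal[OF X m x] by simp
  qed (use X measurable excess_coupling_nonneg[OF m] in auto)
  have snd: "distr (discr (X \<times> X) ?P) borel snd = discr X m'"
  proof (rule distr_discr)
    fix y assume y: "y \<in> X"
    then have "{z \<in> X \<times> X. snd z = y} = (\<lambda>x. (x, y)) ` X" by auto
    then have "(\<Sum>z\<in>{z \<in> X \<times> X. snd z = y}. ?P z) = (\<Sum>x\<in>X. ?P (x, y))"
      by (simp add: sum.reindex inj_on_def)
    then show "m' y = (\<Sum>z\<in>{z \<in> X \<times> X. snd z = y}. ?P z)"
      using excess_coupling_marginal[OF X m(2,1) y] by (simp add: excess_coupling_swap[OF m])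
  qed (use X measurable excess_coupling_nonneg[OF m] in auto)
  have "fst \<in> discr (X \<times> X) ?P \<rightarrow>\<^sub>M (borel :: 'a measure)"
    using measurable(1) by (simp add: discr_def)
  then have "prob_space (discr (X \<times> X) ?P)"
    using Prob_D(1)[OF discr_Prob[OF X m(1)]] unfolding fst[symmetric] by (rule prob_space_distrD)
  then show ?thesis unfolding couplings_def borel_prod using fst snd by simp
qed

lemma transport_cost_excess_coupling_le:
  fixes X :: "'a::euclidean_space set"
  assumes X: "finite X" and m: "m \<in> prob_simplex X" "m' \<in> prob_simplex X"
    and D: "\<And>x y. x \<in> X \<Longrightarrow> y \<in> X \<Longrightarrow> dist x y powr p \<le> D" "0 \<le> D"
  shows "transport_cost p (discr (X \<times> X) (excess_coupling X m m')) \<le> D * (\<Sum>x\<in>X. \<bar>m x - m' x\<bar>)"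
proof -
  define a where "a x = m x - min (m x) (m' x)" for x
  define b where "b x = m' x - min (m x) (m' x)" for x
  have nonneg: "0 \<le> a x" "0 \<le> b x" for x by (auto simp: a_def b_def)
  have sum_b: "(\<Sum>x\<in>X. b x) = (\<Sum>x\<in>X. a x)"
    using m by (simp add: a_def b_def sum_subtractf prob_simplex_def)
  have "(\<lambda>z::'a \<times> 'a. dist (fst z) (snd z) powr p) \<in> borel_measurable borel"
    unfolding borel_prod[symmetric] by (rule dist_powr_measurable)
  then have "transport_cost p (discr (X \<times> X) (excess_coupling X m m'))
      = (\<Sum>z\<in>X \<times> X. excess_coupling X m m' z * dist (fst z) (snd z) powr p)"
    unfolding transport_cost_def using X excess_coupling_nonneg[OF m] by (intro integral_discr) auto
  also have "\<dots> \<le> (\<Sum>z\<in>X \<times> X. D * (a (fst z) * b (snd z) / (\<Sum>x\<in>X. a x)))"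
  proof (rule sum_mono)
    fix z assume z: "z \<in> X \<times> X"
    have q: "0 \<le> a (fst z) * b (snd z) / (\<Sum>x\<in>X. a x)"
      using nonneg by (intro divide_nonneg_nonneg mult_nonneg_nonneg sum_nonneg)
    have "excess_coupling X m m' z * dist (fst z) (snd z) powr p
        = a (fst z) * b (snd z) / (\<Sum>x\<in>X. a x) * dist (fst z) (snd z) powr p"
      by (cases "fst z = snd z") (simp_all add: excess_coupling_def case_prod_beta a_def b_def)
    also have "\<dots> \<le> a (fst z) * b (snd z) / (\<Sum>x\<in>X. a x) * D"
      using z q by (intro mult_left_mono D) auto
    finally show "excess_coupling X m m' z * dist (fst z) (snd z) powr p
        \<le> D * (a (fst z) * b (snd z) / (\<Sum>x\<in>X. a x))"
      by (simp only: mult.commute)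
  qed
  also have "\<dots> = D * ((\<Sum>z\<in>X \<times> X. a (fst z) * b (snd z)) / (\<Sum>x\<in>X. a x))"
    unfolding sum_distrib_left[symmetric] sum_divide_distrib[symmetric] ..
  also have "(\<Sum>z\<in>X \<times> X. a (fst z) * b (snd z)) = (\<Sum>x\<in>X. a x) * (\<Sum>x\<in>X. b x)"
    by (simp add: sum_product sum.cartesian_product case_prod_beta)
  also have "D * ((\<Sum>x\<in>X. a x) * (\<Sum>x\<in>X. b x) / (\<Sum>x\<in>X. a x)) = D * (\<Sum>x\<in>X. a x)"
    unfolding sum_b by simp
  also have "\<dots> \<le> D * (\<Sum>x\<in>X. \<bar>m x - m' x\<bar>)"
    using D(2) by (intro mult_left_mono sum_mono) (auto simp: a_def)
  finally show ?thesis .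
qed

lemma convP_discr:
  assumes X: "finite X" and ms: "\<And>n. ms n \<in> prob_simplex X" and m: "m \<in> prob_simplex X"
    and p: "p = 0 \<or> 1 \<le> p"
    and lim: "\<And>x. x \<in> X \<Longrightarrow> (\<lambda>n. ms n x) \<longlonglongrightarrow> m x"
  shows "convP p (\<lambda>n. discr X (ms n)) (discr X m)"
proof (cases "p = 0")
  case True
  have "(\<lambda>n. \<integral>x. f x \<partial>discr X (ms n)) \<longlonglongrightarrow> (\<integral>x. f x \<partial>discr X m)" if "continuous_on UNIV f"
    for f :: "'a \<Rightarrow> real"
  proof -
    have "(\<integral>x. f x \<partial>discr X m) = (\<Sum>x\<in>X. m x * f x)" if "m \<in> prob_simplex X" for m
      using that \<open>continuous_on UNIV f\<close>
      by (intro integral_discr X borel_measurable_continuous_onI) (auto simp: prob_simplex_nonneg)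
    then show ?thesis using ms m lim by (auto intro!: tendsto_intros)
  qed
  then show ?thesis using True by (simp add: convP_def)
next
  case False
  then have p1: "1 \<le> p" using p by simp
  define D where "D = (\<Sum>z\<in>X \<times> X. dist (fst z) (snd z) powr p)"
  have D: "dist x y powr p \<le> D" if "x \<in> X" "y \<in> X" for x y
    unfolding D_def
    using X that member_le_sum[of "(x, y)" "X \<times> X" "\<lambda>z. dist (fst z) (snd z) powr p"] by auto
  have "0 \<le> D" unfolding D_def by (intro sum_nonneg) auto
  define \<pi> where "\<pi> n = discr (X \<times> X) (excess_coupling X (ms n) m)" for n
  have \<pi>: "\<pi> n \<in> couplings (discr X (ms n)) (discr X m)" for n
    unfolding \<pi>_def by (rule excess_coupling_in_couplings[OF X ms m])
  have "(\<lambda>n. D * (\<Sum>x\<in>X. \<bar>ms n x - m x\<bar>)) \<longlonglongrightarrow> D * (\<Sum>x\<in>X. \<bar>m x - m x\<bar>)" by (intro tendsto_intros lim)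
  then have "(\<lambda>n. D * (\<Sum>x\<in>X. \<bar>ms n x - m x\<bar>)) \<longlonglongrightarrow> 0" by simp
  then have "(\<lambda>n. transport_cost p (\<pi> n)) \<longlonglongrightarrow> 0"
  proof (rule Lim_null_comparison[rotated])
    have "transport_cost p (\<pi> n) \<le> D * (\<Sum>x\<in>X. \<bar>ms n x - m x\<bar>)" for n
      unfolding \<pi>_def by (rule transport_cost_excess_coupling_le[OF X ms m D \<open>0 \<le> D\<close>])
    then show "\<forall>\<^sub>F n in sequentially. norm (transport_cost p (\<pi> n)) \<le> D * (\<Sum>x\<in>X. \<bar>ms n x - m x\<bar>)"
      by simp
  qed
  then show ?thesis
    using Wass_tendsto_0[OF p1 discr_Pp[OF X ms] discr_Pp[OF X m] \<pi>] False by (simp add: convP_def)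
qed

lemma seq_cont_on_discr:
  assumes X: "finite X" and p: "p = 0 \<or> 1 \<le> p" and u: "continuous_map (TP p) euclideanreal u"
  shows "seq_cont_on X (prob_simplex X) (\<lambda>m. u (discr X m))"
  unfolding seq_cont_on_def
proof (intro allI impI)
  fix ms m assume "range ms \<subseteq> prob_simplex X" and m: "m \<in> prob_simplex X"
    and lim: "\<forall>x\<in>X. (\<lambda>n. ms n x) \<longlonglongrightarrow> m x"
  then have ms: "ms n \<in> prob_simplex X" for n by blast
  have "range (\<lambda>n. discr X (ms n)) \<subseteq> Pp p" using discr_Pp[OF X ms] by blast
  moreover have "convP p (\<lambda>n. discr X (ms n)) (discr X m)"
    using lim by (intro convP_discr X ms m p) auto
  ultimately show "(\<lambda>n. u (discr X (ms n))) \<longlonglongrightarrow> u (discr X m)"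
    using u discr_Pp[OF X m] unfolding continuous_map_TP_iff by blast
qed

lemma discr_open_nbhd:
  assumes X: "finite X" and p: "p = 0 \<or> 1 \<le> p" and m0: "m0 \<in> prob_simplex X"
    and U: "openin (TP p) U" "discr X m0 \<in> U"
  shows "\<exists>d>0. \<forall>m\<in>prob_simplex X. (\<forall>x\<in>X. \<bar>m x - m0 x\<bar> < d) \<longrightarrow> discr X m \<in> U"
proof (rule ccontr)
  assume "\<not> ?thesis"
  moreover have "0 < inverse (real (Suc n))" for n by simp
  ultimately have "\<exists>m\<in>prob_simplex X. (\<forall>x\<in>X. \<bar>m x - m0 x\<bar> < inverse (real (Suc n))) \<and> discr X m \<notin> U"
    for n by blast
  then obtain ms where ms: "\<And>n. ms n \<in> prob_simplex X"
    "\<And>n. \<forall>x\<in>X. \<bar>ms n x - m0 x\<bar> < inverse (real (Suc n))"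
      "\<And>n. discr X (ms n) \<notin> U" by metis
  have "(\<lambda>n. ms n x) \<longlonglongrightarrow> m0 x" if "x \<in> X" for x
  proof (rule LIM_zero_cancel, rule Lim_null_comparison[OF _ LIMSEQ_inverse_real_of_nat])
    show "\<forall>\<^sub>F n in sequentially. norm (ms n x - m0 x) \<le> inverse (real (Suc n))"
      using ms(2) that by (intro always_eventually allI) (simp add: less_imp_le)
  qed
  then have "convP p (\<lambda>n. discr X (ms n)) (discr X m0)" by (intro convP_discr[OF X ms(1) m0 p])
  moreover have "range (\<lambda>n. discr X (ms n)) \<subseteq> Pp p" using discr_Pp[OF X ms(1)] by blast
  ultimately have "\<forall>\<^sub>F n in sequentially. discr X (ms n) \<in> U" using U unfolding openin_TP by blast
  then show False using ms(3) by simp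
qed

definition finite_Prob :: "'a::euclidean_space measure set" where
  "finite_Prob = {discr X m |X m. finite X \<and> m \<in> prob_simplex X}"

lemma finite_Prob_Pp: "finite_Prob \<subseteq> Pp p"
  unfolding finite_Prob_def using discr_Pp by blast

lemma distr_simple_function_finite_Prob:
  fixes T :: "'a::euclidean_space \<Rightarrow> 'a"
  assumes \<mu>: "\<mu> \<in> Prob" and T: "simple_function \<mu> T"
  shows "distr \<mu> borel T \<in> finite_Prob"
proof -
  interpret prob_space \<mu> by (rule Prob_D[OF \<mu>])
  have measurable: "T \<in> \<mu> \<rightarrow>\<^sub>M borel" by (rule borel_measurable_simple_function[OF T])
  have X: "finite (range T)" using T Prob_D(3)[OF \<mu>] by (simp add: simple_function_def)
  have "distr \<mu> borel T \<in> Prob" unfolding Prob_def using prob_space_distr[OF measurable] by simp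
  moreover have "emeasure (distr \<mu> borel T) (UNIV - range T) = 0"
  proof -
    have "UNIV - range T \<in> sets borel" using finite_sets_borel[OF X] by (intro sets.Diff) auto
    then have "emeasure (distr \<mu> borel T) (UNIV - range T)
        = emeasure \<mu> (T -` (UNIV - range T) \<inter> space \<mu>)"
      by (rule emeasure_distr[OF measurable])
    also have "T -` (UNIV - range T) \<inter> space \<mu> = {}" by auto
    finally show ?thesis by simp
  qed
  ultimately obtain m where "m \<in> prob_simplex (range T)" "distr \<mu> borel T = discr (range T) m"
    by (rule Prob_finite_support[OF X])
  then show ?thesis unfolding finite_Prob_def using X by blast
qed

lemma weak_convergence_distr:
  assumes \<mu>: "\<mu> \<in> Prob" and T: "\<And>n. T n \<in> \<mu> \<rightarrow>\<^sub>M borel" "\<And>x. (\<lambda>n. T n x) \<longlonglongrightarrow> x"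
  shows "convP 0 (\<lambda>n. distr \<mu> borel (T n)) \<mu>"
  unfolding convP_def
proof (simp, intro allI impI, elim conjE)
  fix f :: "'a \<Rightarrow> real" assume f: "continuous_on UNIV f" "bounded (range f)"
  interpret prob_space \<mu> by (rule Prob_D[OF \<mu>])
  have measurable: "f \<in> borel_measurable borel" using f(1) by (rule borel_measurable_continuous_onI)
  obtain B where B: "\<And>x. norm (f x) \<le> B" using f(2) by (auto simp: bounded_iff)
  have "(\<lambda>n. \<integral>x. f (T n x) \<partial>\<mu>) \<longlonglongrightarrow> (\<integral>x. f x \<partial>\<mu>)"
  proof (rule integral_dominated_convergence[where w = "\<lambda>x. B"])
    show "AE x in \<mu>. (\<lambda>n. f (T n x)) \<longlonglongrightarrow> f x"
      using T(2) by (intro AE_I2 continuous_on_tendsto_compose[OF f(1)]) auto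
  qed (use B measurable measurable_Prob[OF \<mu>] measurable_compose[OF T(1) measurable] in auto)
  then show "(\<lambda>n. \<integral>x. f x \<partial>distr \<mu> borel (T n)) \<longlonglongrightarrow> (\<integral>x. f x \<partial>\<mu>)"
    by (simp add: integral_distr[OF T(1) measurable])
qed

lemma Wass_distr_tendsto_0:
  assumes p: "1 \<le> p" and \<mu>: "\<mu> \<in> Pp p"
    and T: "\<And>n. T n \<in> \<mu> \<rightarrow>\<^sub>M borel" "\<And>n. distr \<mu> borel (T n) \<in> Pp p"
    "\<And>x. (\<lambda>n. T n x) \<longlonglongrightarrow> x" "\<And>n x. norm (T n x) \<le> 2 * norm x"
  shows "(\<lambda>n. Wass p (distr \<mu> borel (T n)) \<mu>) \<longlonglongrightarrow> 0"
proof -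
  note P = Pp_Prob[OF \<mu>]
  interpret prob_space \<mu> by (rule Prob_D[OF P])
  define \<pi> where "\<pi> n = distr \<mu> (borel \<Otimes>\<^sub>M borel) (\<lambda>x. (T n x, x))" for n
  have id: "(\<lambda>x::'a. x) \<in> \<mu> \<rightarrow>\<^sub>M borel" unfolding measurable_Prob[OF P] by simp
  have pair: "(\<lambda>x. (T n x, x)) \<in> \<mu> \<rightarrow>\<^sub>M borel \<Otimes>\<^sub>M borel" for n
    using T(1) id by (intro measurable_Pair)
  have \<pi>: "\<pi> n \<in> couplings (distr \<mu> borel (T n)) \<mu>" for n
  proof -
    have "distr (\<pi> n) borel fst = distr \<mu> borel (T n)"
      unfolding \<pi>_def by (subst distr_distr[OF _ pair]) (auto simp: o_def)
    moreover have "distr (\<pi> n) borel snd = \<mu>"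
      unfolding \<pi>_def using distr_id2[OF Prob_D(2)[OF P, symmetric]]
      by (subst distr_distr[OF _ pair]) (auto simp: o_def)
    ultimately show ?thesis unfolding couplings_def \<pi>_def using prob_space_distr[OF pair] by simp
  qed
  have "(\<lambda>n. \<integral>x. dist (T n x) x powr p \<partial>\<mu>) \<longlonglongrightarrow> (\<integral>x. 0 \<partial>\<mu>)"
  proof (rule integral_dominated_convergence[where w = "\<lambda>x. 3 powr p * norm x powr p"])
    show "(\<lambda>x. dist (T n x) x powr p) \<in> borel_measurable \<mu>" for n
      using measurable_compose[OF pair dist_powr_measurable] by simp
    show "integrable \<mu> (\<lambda>x. 3 powr p * norm x powr p)" using integrable_norm_powr_Pp[OF \<mu>] p by simp
    show "AE x in \<mu>. (\<lambda>n. dist (T n x) x powr p) \<longlonglongrightarrow> 0"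
    proof (rule AE_I2)
      fix x
      have "(\<lambda>n. dist (T n x) x) \<longlonglongrightarrow> 0" using tendsto_dist[OF T(3)[of x] tendsto_const[of x]] by simp
      then show "(\<lambda>n. dist (T n x) x powr p) \<longlonglongrightarrow> 0"
        using tendsto_powr'[OF _ tendsto_const[of p]] p by fastforce
    qed
    show "AE x in \<mu>. norm (dist (T n x) x powr p) \<le> 3 powr p * norm x powr p" for n
    proof (rule AE_I2)
      fix x
      have "dist (T n x) x \<le> 3 * norm x"
        using T(4)[of n x] norm_triangle_ineq4[of "T n x" x] by (simp add: dist_norm)
      then have "dist (T n x) x powr p \<le> (3 * norm x) powr p" using p by (intro powr_mono2) auto
      then show "norm (dist (T n x) x powr p) \<le> 3 powr p * norm x powr p" by (simp add: powr_mult)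
    qed
  qed simp
  then have "(\<lambda>n. transport_cost p (\<pi> n)) \<longlonglongrightarrow> 0"
    by (simp add: transport_cost_def \<pi>_def integral_distr[OF pair dist_powr_measurable])
  then show ?thesis by (rule Wass_tendsto_0[OF p T(2) \<mu> \<pi>])
qed

lemma finite_Prob_dense:
  fixes \<mu> :: "'a::euclidean_space measure"
  assumes p: "p = 0 \<or> 1 \<le> p" and \<mu>: "\<mu> \<in> Pp p"
  obtains \<mu>s where "range \<mu>s \<subseteq> finite_Prob" "convP p \<mu>s \<mu>"
proof -
  note P = Pp_Prob[OF \<mu>]
  have "(\<lambda>x::'a. x) \<in> borel_measurable \<mu>" unfolding measurable_Prob[OF P] by simp
  then obtain T where T: "\<And>n. simple_function \<mu> (T n)" "\<And>x. (\<lambda>n. T n x) \<longlonglongrightarrow> x"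
    "\<And>n x. norm (T n x) \<le> 2 * norm x"
    using borel_measurable_implies_sequence_metric[of "\<lambda>x. x" \<mu> 0] Prob_D(3)[OF P] by auto
  have measurable: "T n \<in> \<mu> \<rightarrow>\<^sub>M borel" for n by (rule borel_measurable_simple_function[OF T(1)])
  have finite: "distr \<mu> borel (T n) \<in> finite_Prob" for n
    by (rule distr_simple_function_finite_Prob[OF P T(1)])
  have "convP p (\<lambda>n. distr \<mu> borel (T n)) \<mu>"
  proof (cases "p = 0")
    case True
    then show ?thesis using weak_convergence_distr[OF P measurable T(2)] by simp
  next
    case False
    then have "(\<lambda>n. Wass p (distr \<mu> borel (T n)) \<mu>) \<longlonglongrightarrow> 0"
      using p finite finite_Prob_Pp by (intro Wass_distr_tendsto_0 \<mu> measurable T) auto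
    then show ?thesis using False by (simp add: convP_def)
  qed
  then show ?thesis using finite by (intro that) auto
qed

lemma mixm_eq_bind:
  assumes \<mu>: "\<mu> \<in> Prob" and \<nu>: "\<nu> \<in> Prob" and t: "0 \<le> t" "t \<le> 1"
  shows "mixm t \<nu> \<mu> = measure_pmf (bernoulli_pmf t) \<bind> (\<lambda>b. if b then \<nu> else \<mu>)" (is "_ = ?B")
proof -
  have kernel: "(\<lambda>b. if b then \<nu> else \<mu>) \<in> measure_pmf (bernoulli_pmf t) \<rightarrow>\<^sub>M subprob_algebra borel"
    using Prob_D(1,2)[OF \<mu>] Prob_D(1,2)[OF \<nu>]
    by (auto simp: space_subprob_algebra prob_space_imp_subprob_space)
  have sets: "sets ?B = sets borel"
    by (rule sets_bind[OF _ measure_pmf.not_empty]) (use Prob_D(2) \<mu> \<nu> in auto)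
  have "emeasure ?B A = ennreal t * emeasure \<nu> A + ennreal (1 - t) * emeasure \<mu> A"
    if "A \<in> sets borel" for A
    using t by (subst emeasure_bind[OF measure_pmf.not_empty kernel that]) (simp add: mult.commute)
  then have "measure_of UNIV (sets borel) (emeasure ?B) = mixm t \<nu> \<mu>"
    unfolding mixm_def using sets.sigma_sets_eq[of "borel :: 'a measure"]
    by (intro measure_of_eq) simp_all
  then show ?thesis using measure_of_of_measure[of ?B] sets sets_eq_imp_space_eq[OF sets] by simp
qed

lemma integral_mixm:
  fixes g :: "'a::euclidean_space \<Rightarrow> real"
  assumes \<mu>: "\<mu> \<in> Prob" and \<nu>: "\<nu> \<in> Prob" and t: "0 \<le> t" "t \<le> 1"
    and g: "g \<in> borel_measurable borel" "bounded (range g)"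
  shows "(\<integral>x. g x \<partial>mixm t \<nu> \<mu>) = t * (\<integral>x. g x \<partial>\<nu>) + (1 - t) * (\<integral>x. g x \<partial>\<mu>)"
proof -
  obtain B where B: "\<And>x. \<bar>g x\<bar> \<le> B" using g(2) by (auto simp: bounded_iff)
  have "(\<integral>x. g x \<partial>mixm t \<nu> \<mu>) = (\<integral>b. (\<integral>x. g x \<partial>(if b then \<nu> else \<mu>)) \<partial>bernoulli_pmf t)"
    unfolding mixm_eq_bind[OF \<mu> \<nu> t]
  proof (rule integral_bind[where K = borel and B = B and B' = 1])
    show "(\<lambda>b. if b then \<nu> else \<mu>) \<in> measure_pmf (bernoulli_pmf t) \<rightarrow>\<^sub>M subprob_algebra borel"
      using Prob_D(1,2)[OF \<mu>] Prob_D(1,2)[OF \<nu>]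
      by (auto simp: space_subprob_algebra prob_space_imp_subprob_space)
    show "AE b in bernoulli_pmf t. emeasure (if b then \<nu> else \<mu>) (space (if b then \<nu> else \<mu>))
        \<le> ennreal 1"
      using prob_space.emeasure_space_1[OF Prob_D(1)[OF \<mu>]]
        prob_space.emeasure_space_1[OF Prob_D(1)[OF \<nu>]] by auto
  qed (use g B in \<open>auto simp: measure_pmf.finite_measure_axioms\<close>)
  then show ?thesis using t by simp
qed

section \<open>Cylindrical test functions\<close>

definition moments :: "'i set \<Rightarrow> ('i \<Rightarrow> 'a::euclidean_space \<Rightarrow> real) \<Rightarrow> 'a measure \<Rightarrow> 'i \<Rightarrow> real" where
  "moments X \<psi> \<mu> k = (if k \<in> X then \<integral>x. \<psi> k x \<partial>\<mu> else 0)"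

lemma continuous_map_moments:
  assumes p: "p = 0 \<or> 1 \<le> p" and \<psi>: "\<forall>k\<in>X. bdd_lipschitz (\<psi> k)"
  shows "continuous_map (TP p) euclidean (moments X \<psi>)"
  unfolding euclidean_product_topology[symmetric] continuous_map_componentwise_UNIV
proof
  fix k
  show "continuous_map (TP p) euclideanreal (\<lambda>\<mu>. moments X \<psi> \<mu> k)"
    using continuous_map_integral[OF p bspec[OF \<psi>]] by (cases "k \<in> X") (simp_all add: moments_def)
qed

lemma continuous_map_comp_moments:
  fixes g :: "('i \<Rightarrow> real) \<Rightarrow> real"
  assumes "p = 0 \<or> 1 \<le> p" "\<forall>k\<in>X. bdd_lipschitz (\<psi> k)" "continuous_on UNIV g"
  shows "continuous_map (TP p) euclideanreal (\<lambda>\<mu>. g (moments X \<psi> \<mu>))"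
  using continuous_map_compose[OF continuous_map_moments[OF assms(1,2)], where g = g] assms(3)
  by (simp add: o_def)

lemma bounded_comp_moments:
  fixes g :: "('i \<Rightarrow> real) \<Rightarrow> real"
  assumes \<psi>: "\<forall>k\<in>X. bdd_lipschitz (\<psi> k)" and g: "continuous_on UNIV g"
  shows "\<exists>C. \<forall>\<mu>\<in>Prob. \<bar>g (moments X \<psi> \<mu>)\<bar> \<le> C"
proof -
  have "\<forall>k\<in>X. \<exists>B. \<forall>x. \<bar>\<psi> k x\<bar> \<le> B" using \<psi> by (simp add: bdd_lipschitz_def bounded_iff)
  then obtain B where B: "\<And>k x. k \<in> X \<Longrightarrow> \<bar>\<psi> k x\<bar> \<le> B k" by metis
  define K where "K = PiE UNIV (\<lambda>k. if k \<in> X then {- B k..B k} else {0})"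
  have "compactin (product_topology (\<lambda>_. euclideanreal) UNIV) K"
    unfolding K_def compactin_PiE by simp
  then have "compact K" by (simp add: euclidean_product_topology)
  then have "bounded (g ` K)"
    by (intro compact_imp_bounded compact_continuous_image continuous_on_subset[OF g]) auto
  then obtain C where C: "\<And>a. a \<in> K \<Longrightarrow> \<bar>g a\<bar> \<le> C" by (auto simp: bounded_iff)
  have "moments X \<psi> \<mu> \<in> K" if \<mu>: "\<mu> \<in> Prob" for \<mu>
  proof -
    interpret prob_space \<mu> by (rule Prob_D[OF \<mu>])
    have "\<bar>\<integral>x. \<psi> k x \<partial>\<mu>\<bar> \<le> B k" if "k \<in> X" for k
    proof -
      have "integrable \<mu> (\<psi> k)"
        using bspec[OF \<psi> that]
        by (intro integrable_Prob_bounded[OF \<mu>] bdd_lipschitz_measurable)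
          (auto simp: bdd_lipschitz_def)
      then have "(\<integral>x. \<bar>\<psi> k x\<bar> \<partial>\<mu>) \<le> (\<integral>x. B k \<partial>\<mu>)" using B[OF that] by (intro integral_mono) auto
      then show ?thesis by (intro order_trans[OF integral_abs_bound]) (simp add: prob_space)
    qed
    then show ?thesis by (auto simp: K_def moments_def abs_le_iff minus_le_iff)
  qed
  then show ?thesis using C by blast
qed

lemma moments_mixm:
  assumes "\<forall>k\<in>X. bdd_lipschitz (\<psi> k)" "\<mu> \<in> Prob" "\<nu> \<in> Prob" "0 \<le> t" "t \<le> 1"
  shows "moments X \<psi> (mixm t \<nu> \<mu>) = (\<lambda>k. moments X \<psi> \<mu> k + t * (moments X \<psi> \<nu> k - moments X \<psi> \<mu> k))"
proof
  fix k
  have "k \<in> X \<Longrightarrow> \<psi> k \<in> borel_measurable borel" "k \<in> X \<Longrightarrow> bounded (range (\<psi> k))"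
    using assms(1) bdd_lipschitz_measurable by (auto simp: bdd_lipschitz_def)
  then show "moments X \<psi> (mixm t \<nu> \<mu>) k = moments X \<psi> \<mu> k + t * (moments X \<psi> \<nu> k - moments X \<psi> \<mu> k)"
    using integral_mixm[OF assms(2-5), of "\<psi> k"] by (simp add: moments_def algebra_simps)
qed

lemma lin_form_swap: "lin_form X (\<lambda>k. lin_form X (Q k) y) x
    = lin_form X (\<lambda>l. lin_form X (\<lambda>k. Q k l) x) y"
proof -
  have "lin_form X (\<lambda>k. lin_form X (Q k) y) x = (\<Sum>k\<in>X. \<Sum>l\<in>X. x k * (y l * Q k l))"
    by (simp add: lin_form_def sum_distrib_left)
  also have "\<dots> = (\<Sum>l\<in>X. \<Sum>k\<in>X. x k * (y l * Q k l))" by (rule sum.swap)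
  finally show ?thesis by (simp add: lin_form_def sum_distrib_left mult.left_commute)
qed

lemma sint_lin_form:
  assumes \<psi>: "\<forall>k\<in>X. bdd_lipschitz (\<psi> k)" and P: "\<mu> \<in> Prob" "\<nu> \<in> Prob"
  shows "sint \<mu> \<nu> (\<lambda>x. lin_form X f (\<lambda>k. \<psi> k x))
      = lin_form X f (\<lambda>k. moments X \<psi> \<nu> k - moments X \<psi> \<mu> k)"
proof -
  have "(\<integral>x. lin_form X f (\<lambda>k. \<psi> k x) \<partial>\<kappa>) = lin_form X f (moments X \<psi> \<kappa>)" if "\<kappa> \<in> Prob" for \<kappa>
  proof -
    have "integrable \<kappa> (\<psi> k)" if "k \<in> X" for k
      using bspec[OF \<psi> that]
      by (intro integrable_Prob_bounded \<open>\<kappa> \<in> Prob\<close> bdd_lipschitz_measurable)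
        (auto simp: bdd_lipschitz_def)
    then show ?thesis by (simp add: lin_form_def moments_def)
  qed
  then show ?thesis using P by (simp add: sint_def lin_form_def sum_subtractf left_diff_distrib)
qed

definition coord_C2 :: "'i set \<Rightarrow> (('i \<Rightarrow> real) \<Rightarrow> real) \<Rightarrow> ('i \<Rightarrow> ('i \<Rightarrow> real) \<Rightarrow> real) \<Rightarrow>
    ('i \<Rightarrow> 'i \<Rightarrow> ('i \<Rightarrow> real) \<Rightarrow> real) \<Rightarrow> bool" where
  "coord_C2 X \<Phi> \<Phi>1 \<Phi>2 \<longleftrightarrow>
     (\<forall>a d t. ((\<lambda>t. \<Phi> (\<lambda>i. a i + t * d i)) has_real_derivative
        lin_form X (\<lambda>k. \<Phi>1 k (\<lambda>i. a i + t * d i)) d) (at t)) \<and>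
     (\<forall>k\<in>X. \<forall>a d t. ((\<lambda>t. \<Phi>1 k (\<lambda>i. a i + t * d i)) has_real_derivative
        lin_form X (\<lambda>l. \<Phi>2 k l (\<lambda>i. a i + t * d i)) d) (at t)) \<and>
     (\<forall>k\<in>X. continuous_on UNIV (\<Phi>1 k)) \<and>
     (\<forall>k\<in>X. \<forall>l\<in>X. continuous_on UNIV (\<Phi>2 k l) \<and> \<Phi>2 k l = \<Phi>2 l k)"

definition cyl_deriv :: "'i set \<Rightarrow> ('i \<Rightarrow> 'a::euclidean_space \<Rightarrow> real) \<Rightarrow> ('i \<Rightarrow> ('i \<Rightarrow> real) \<Rightarrow> real) \<Rightarrow>
    'a \<Rightarrow> 'a measure \<Rightarrow> real" where
  "cyl_deriv X \<psi> \<Phi>1 x \<mu> = lin_form X (\<lambda>k. \<Phi>1 k (moments X \<psi> \<mu>)) (\<lambda>k. \<psi> k x)"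

definition cyl_deriv2 :: "'i set \<Rightarrow> ('i \<Rightarrow> 'a::euclidean_space \<Rightarrow> real) \<Rightarrow>
    ('i \<Rightarrow> 'i \<Rightarrow> ('i \<Rightarrow> real) \<Rightarrow> real) \<Rightarrow>
    'a \<Rightarrow> 'a \<Rightarrow> 'a measure \<Rightarrow> real" where
  "cyl_deriv2 X \<psi> \<Phi>2 x y \<mu> = lin_form X (\<lambda>k. lin_form X (\<lambda>l. \<Phi>2 k l (moments X \<psi> \<mu>)) (\<lambda>l. \<psi> l y))
      (\<lambda>k. \<psi> k x)"

lemma continuous_map_cyl_deriv:
  assumes X: "finite X" and q: "q = 0 \<or> 1 \<le> q" and \<psi>: "\<forall>k\<in>X. bdd_lipschitz (\<psi> k)"
    and \<Phi>: "coord_C2 X \<Phi> \<Phi>1 \<Phi>2"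
  shows "continuous_map (prod_topology euclidean (TP q)) euclideanreal
      (\<lambda>(x, \<mu>). cyl_deriv X \<psi> \<Phi>1 x \<mu>)"
    and "continuous_map (prod_topology (prod_topology euclidean euclidean) (TP q)) euclideanreal
      (\<lambda>((x, y), \<mu>). cyl_deriv2 X \<psi> \<Phi>2 x y \<mu>)"
proof -
  have "continuous_map euclidean euclideanreal (\<psi> k)" if "k \<in> X" for k
    using bspec[OF \<psi> that] lipschitz_on_continuous_on by (auto simp: bdd_lipschitz_def)
  note psi = continuous_map_compose[OF _ this, unfolded o_def]
  have "continuous_map (TP q) euclideanreal (\<lambda>\<mu>. \<Phi>1 k (moments X \<psi> \<mu>))" if "k \<in> X" for k
    using \<Phi> that by (intro continuous_map_comp_moments q \<psi>) (auto simp: coord_C2_def)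
  note deriv = continuous_map_compose[OF continuous_map_snd this, unfolded o_def]
  have "continuous_map (TP q) euclideanreal (\<lambda>\<mu>. \<Phi>2 k l (moments X \<psi> \<mu>))" if "k \<in> X" "l \<in> X" for k l
    using \<Phi> that by (intro continuous_map_comp_moments q \<psi>) (auto simp: coord_C2_def)
  note deriv2 = continuous_map_compose[OF continuous_map_snd this, unfolded o_def]
  show "continuous_map (prod_topology euclidean (TP q)) euclideanreal
      (\<lambda>(x, \<mu>). cyl_deriv X \<psi> \<Phi>1 x \<mu>)"
    unfolding cyl_deriv_def lin_form_def case_prod_beta
    by (intro continuous_map_sum X continuous_map_real_mult deriv psi continuous_map_fst)
  show "continuous_map (prod_topology (prod_topology euclidean euclidean) (TP q)) euclideanreal
      (\<lambda>((x, y), \<mu>). cyl_deriv2 X \<psi> \<Phi>2 x y \<mu>)"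
    unfolding cyl_deriv2_def lin_form_def case_prod_beta
    by (intro continuous_map_sum X continuous_map_real_mult deriv2 psi
      continuous_map_compose[OF continuous_map_fst, unfolded o_def]
        continuous_map_fst continuous_map_snd)
qed

lemma bounded_lin_form_family:
  assumes "finite X" "\<And>k. k \<in> X \<Longrightarrow> \<exists>C. \<forall>s\<in>S. \<bar>f s k\<bar> \<le> C" "\<And>k. k \<in> X \<Longrightarrow> \<exists>C. \<forall>s\<in>S. \<bar>g s k\<bar> \<le> C"
  shows "\<exists>C\<ge>0. \<forall>s\<in>S. \<bar>lin_form X (f s) (g s)\<bar> \<le> (C :: real)"
proof -
  obtain A where A: "\<And>k s. k \<in> X \<Longrightarrow> s \<in> S \<Longrightarrow> \<bar>f s k\<bar> \<le> A k" using assms(2) by metis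
  obtain B where B: "\<And>k s. k \<in> X \<Longrightarrow> s \<in> S \<Longrightarrow> \<bar>g s k\<bar> \<le> B k" using assms(3) by metis
  have "\<bar>lin_form X (f s) (g s)\<bar> \<le> (\<Sum>k\<in>X. \<bar>B k\<bar> * \<bar>A k\<bar>)" if "s \<in> S" for s
    unfolding lin_form_def
  proof (rule order_trans[OF sum_abs], rule sum_mono)
    fix k assume "k \<in> X"
    then show "\<bar>g s k * f s k\<bar> \<le> \<bar>B k\<bar> * \<bar>A k\<bar>"
      unfolding abs_mult using A[of k s] B[of k s] that by (intro mult_mono) auto
  qed
  then show ?thesis by (intro exI[of _ "\<Sum>k\<in>X. \<bar>B k\<bar> * \<bar>A k\<bar>"]) (auto intro: sum_nonneg)
qed

lemma bounded_cyl_deriv: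
  assumes X: "finite X" and \<psi>: "\<forall>k\<in>X. bdd_lipschitz (\<psi> k)" and \<Phi>: "coord_C2 X \<Phi> \<Phi>1 \<Phi>2"
  shows "\<exists>C\<ge>0. \<forall>\<mu>\<in>Prob. \<forall>x. \<bar>cyl_deriv X \<psi> \<Phi>1 x \<mu>\<bar> \<le> C"
    and "\<exists>C\<ge>0. \<forall>\<mu>\<in>Prob. \<forall>x y. \<bar>cyl_deriv2 X \<psi> \<Phi>2 x y \<mu>\<bar> \<le> C"
proof -
  have psi: "\<exists>C. \<forall>x. \<bar>\<psi> k x\<bar> \<le> C" if "k \<in> X" for k
    using bspec[OF \<psi> that] by (auto simp: bdd_lipschitz_def bounded_iff)
  have deriv: "\<exists>C. \<forall>\<mu>\<in>Prob. \<bar>\<Phi>1 k (moments X \<psi> \<mu>)\<bar> \<le> C" if "k \<in> X" for k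
    using \<Phi> that by (intro bounded_comp_moments \<psi>) (auto simp: coord_C2_def)
  have deriv2: "\<exists>C. \<forall>\<mu>\<in>Prob. \<bar>\<Phi>2 k l (moments X \<psi> \<mu>)\<bar> \<le> C" if "k \<in> X" "l \<in> X" for k l
    using \<Phi> that by (intro bounded_comp_moments \<psi>) (auto simp: coord_C2_def)
  have "\<exists>C\<ge>0. \<forall>s\<in>Prob \<times> UNIV. \<bar>cyl_deriv X \<psi> \<Phi>1 (snd s) (fst s)\<bar> \<le> C"
    unfolding cyl_deriv_def using psi deriv by (intro bounded_lin_form_family X) auto
  then show "\<exists>C\<ge>0. \<forall>\<mu>\<in>Prob. \<forall>x. \<bar>cyl_deriv X \<psi> \<Phi>1 x \<mu>\<bar> \<le> C" by auto
  have "\<exists>C. \<forall>s\<in>Prob \<times> UNIV. \<bar>lin_form X (\<lambda>l. \<Phi>2 k l (moments X \<psi> (fst s))) (\<lambda>l. \<psi> l (snd (snd s)))\<bar>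
      \<le> C" if "k \<in> X" for k
    using bounded_lin_form_family[of X "Prob \<times> UNIV" "\<lambda>s l. \<Phi>2 k l (moments X \<psi> (fst s))"
      "\<lambda>s l. \<psi> l (snd (snd s))"]
      X psi deriv2[OF that] by fastforce
  then have "\<exists>C\<ge>0. \<forall>s\<in>Prob \<times> UNIV. \<bar>cyl_deriv2 X \<psi> \<Phi>2 (fst (snd s)) (snd (snd s)) (fst s)\<bar> \<le> C"
    unfolding cyl_deriv2_def using psi by (intro bounded_lin_form_family X) auto
  then show "\<exists>C\<ge>0. \<forall>\<mu>\<in>Prob. \<forall>x y. \<bar>cyl_deriv2 X \<psi> \<Phi>2 x y \<mu>\<bar> \<le> C" by auto
qed

lemma integral_taylor:
  fixes \<phi> \<phi>1 \<phi>2 :: "real \<Rightarrow> real"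
  assumes \<phi>: "\<And>t. (\<phi> has_real_derivative \<phi>1 t) (at t)"
    and \<phi>1: "\<And>t. (\<phi>1 has_real_derivative \<phi>2 t) (at t)"
  shows "\<phi> 1 - \<phi> 0 = integral {0..1} \<phi>1"
    and "\<phi> 1 - \<phi> 0 - \<phi>1 0 = integral {0..1} (\<lambda>t. integral {0..t} \<phi>2)"
proof -
  have ftc: "(\<phi>1 has_integral \<phi> 1 - \<phi> 0) {0..1}"
    using \<phi> by (intro fundamental_theorem_of_calculus)
      (auto simp: has_real_derivative_iff_has_vector_derivative[symmetric] intro: DERIV_subset)
  then show "\<phi> 1 - \<phi> 0 = integral {0..1} \<phi>1" by (simp add: integral_unique)
  have "integral {0..t} \<phi>2 = \<phi>1 t - \<phi>1 0" if "t \<in> {0..1}" for t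
    using \<phi>1 that by (intro integral_unique fundamental_theorem_of_calculus)
      (auto simp: has_real_derivative_iff_has_vector_derivative[symmetric] intro: DERIV_subset)
  then have "integral {0..1} (\<lambda>t. integral {0..t} \<phi>2) = integral {0..1} (\<lambda>t. \<phi>1 t - \<phi>1 0)"
    by (intro integral_cong)
  also have "\<dots> = \<phi> 1 - \<phi> 0 - \<phi>1 0"
    using has_integral_diff[OF ftc has_integral_const_real[of "\<phi>1 0" 0 1]]
    by (intro integral_unique) simp
  finally show "\<phi> 1 - \<phi> 0 - \<phi>1 0 = integral {0..1} (\<lambda>t. integral {0..t} \<phi>2)" by simp
qed

lemma cyl_taylor:
  assumes \<psi>: "\<forall>k\<in>X. bdd_lipschitz (\<psi> k)" and \<Phi>: "coord_C2 X \<Phi> \<Phi>1 \<Phi>2" and P: "\<mu> \<in> Prob" "\<nu> \<in> Prob"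
  shows "\<Phi> (moments X \<psi> \<nu>) - \<Phi> (moments X \<psi> \<mu>)
      = integral {0..1} (\<lambda>t. sint \<mu> \<nu> (\<lambda>x. cyl_deriv X \<psi> \<Phi>1 x (mixm t \<nu> \<mu>)))"
    and "\<Phi> (moments X \<psi> \<nu>) - \<Phi> (moments X \<psi> \<mu>) - sint \<mu> \<nu> (\<lambda>x. cyl_deriv X \<psi> \<Phi>1 x \<mu>)
      = integral {0..1} (\<lambda>t. integral {0..t} (\<lambda>s.
          sint \<mu> \<nu> (\<lambda>x. sint \<mu> \<nu> (\<lambda>y. cyl_deriv2 X \<psi> \<Phi>2 x y (mixm s \<nu> \<mu>)))))"
proof -
  define a where "a = moments X \<psi> \<mu>"
  define d where "d k = moments X \<psi> \<nu> k - moments X \<psi> \<mu> k" for k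
  define \<gamma> where "\<gamma> t = (\<lambda>k. a k + t * d k)" for t
  have mix: "moments X \<psi> (mixm t \<nu> \<mu>) = \<gamma> t" if "t \<in> {0..1}" for t
    unfolding \<gamma>_def a_def d_def using that by (intro moments_mixm[OF \<psi> P]) auto
  have sint: "sint \<mu> \<nu> (\<lambda>x. lin_form X f (\<lambda>k. \<psi> k x)) = lin_form X f d" for f
    using sint_lin_form[where \<psi> = \<psi>, OF \<psi> P] by (simp add: d_def[abs_def])
  have deriv: "sint \<mu> \<nu> (\<lambda>x. cyl_deriv X \<psi> \<Phi>1 x (mixm t \<nu> \<mu>)) = lin_form X (\<lambda>k. \<Phi>1 k (\<gamma> t)) d"
    if "t \<in> {0..1}" for t
    unfolding cyl_deriv_def mix[OF that] by (rule sint)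
  have deriv2: "sint \<mu> \<nu> (\<lambda>x. sint \<mu> \<nu> (\<lambda>y. cyl_deriv2 X \<psi> \<Phi>2 x y (mixm t \<nu> \<mu>)))
      = quad_form X (\<lambda>k l. \<Phi>2 k l (\<gamma> t)) d"
    if "t \<in> {0..1}" for t
  proof -
    have "sint \<mu> \<nu> (\<lambda>y. cyl_deriv2 X \<psi> \<Phi>2 x y (mixm t \<nu> \<mu>))
        = lin_form X (\<lambda>k. lin_form X (\<lambda>l. \<Phi>2 k l (\<gamma> t)) d) (\<lambda>k. \<psi> k x)" for x
      unfolding cyl_deriv2_def mix[OF that] lin_form_swap[of X _ _ "\<lambda>k. \<psi> k x"] sint ..
    then show ?thesis by (simp add: sint quad_form_eq_lin_form)
  qed
  have "((\<lambda>t. \<Phi> (\<gamma> t)) has_real_derivative lin_form X (\<lambda>k. \<Phi>1 k (\<gamma> t)) d) (at t)" for t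
    using \<Phi> by (simp add: coord_C2_def \<gamma>_def)
  moreover have "((\<lambda>t. lin_form X (\<lambda>k. \<Phi>1 k (\<gamma> t)) d) has_real_derivative
      quad_form X (\<lambda>k l. \<Phi>2 k l (\<gamma> t)) d) (at t)" for t
    unfolding quad_form_eq_lin_form unfolding lin_form_def[of X _ d]
    using \<Phi> by (intro DERIV_sum DERIV_cmult) (simp add: coord_C2_def \<gamma>_def lin_form_def)
  ultimately have taylor: "\<Phi> (\<gamma> 1) - \<Phi> (\<gamma> 0) = integral {0..1} (\<lambda>t. lin_form X (\<lambda>k. \<Phi>1 k (\<gamma> t)) d)"
      "\<Phi> (\<gamma> 1) - \<Phi> (\<gamma> 0) - lin_form X (\<lambda>k. \<Phi>1 k (\<gamma> 0)) d
        = integral {0..1} (\<lambda>t. integral {0..t} (\<lambda>s. quad_form X (\<lambda>k l. \<Phi>2 k l (\<gamma> s)) d))"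
    by (rule integral_taylor)+
  have \<gamma>: "\<gamma> 0 = moments X \<psi> \<mu>" "\<gamma> 1 = moments X \<psi> \<nu>" by (auto simp: \<gamma>_def a_def d_def)
  show "\<Phi> (moments X \<psi> \<nu>) - \<Phi> (moments X \<psi> \<mu>)
      = integral {0..1} (\<lambda>t. sint \<mu> \<nu> (\<lambda>x. cyl_deriv X \<psi> \<Phi>1 x (mixm t \<nu> \<mu>)))"
    by (rule trans[OF taylor(1)[unfolded \<gamma>] integral_cong[OF deriv, symmetric]])
  have "sint \<mu> \<nu> (\<lambda>x. cyl_deriv X \<psi> \<Phi>1 x \<mu>) = lin_form X (\<lambda>k. \<Phi>1 k (\<gamma> 0)) d"
    unfolding cyl_deriv_def \<gamma> by (rule sint)
  moreover have "integral {0..1} (\<lambda>t. integral {0..t} (\<lambda>s.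
        sint \<mu> \<nu> (\<lambda>x. sint \<mu> \<nu> (\<lambda>y. cyl_deriv2 X \<psi> \<Phi>2 x y (mixm s \<nu> \<mu>)))))
      = integral {0..1} (\<lambda>t. integral {0..t} (\<lambda>s. quad_form X (\<lambda>k l. \<Phi>2 k l (\<gamma> s)) d))"
    by (intro integral_cong deriv2) auto
  ultimately show "\<Phi> (moments X \<psi> \<nu>) - \<Phi> (moments X \<psi> \<mu>) - sint \<mu> \<nu> (\<lambda>x. cyl_deriv X \<psi> \<Phi>1 x \<mu>)
      = integral {0..1} (\<lambda>t. integral {0..t} (\<lambda>s.
          sint \<mu> \<nu> (\<lambda>x. sint \<mu> \<nu> (\<lambda>y. cyl_deriv2 X \<psi> \<Phi>2 x y (mixm s \<nu> \<mu>)))))"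
    using taylor(2) by (simp add: \<gamma>)
qed

lemma C2_cylinder:
  fixes \<psi> :: "'i \<Rightarrow> 'a::euclidean_space \<Rightarrow> real"
  assumes X: "finite X" and q: "q = 0 \<or> 1 \<le> q" and \<psi>: "\<forall>k\<in>X. bdd_lipschitz (\<psi> k)"
    and \<Phi>: "coord_C2 X \<Phi> \<Phi>1 \<Phi>2"
  shows "C2 q (\<lambda>\<mu>. \<Phi> (moments X \<psi> \<mu>)) (cyl_deriv X \<psi> \<Phi>1) (cyl_deriv2 X \<psi> \<Phi>2)"
  unfolding C2_def
proof (intro conjI allI impI ballI)
  have "lin_form X (\<lambda>l. lin_form X (\<lambda>k. \<Phi>2 k l a) x) y
      = lin_form X (\<lambda>l. lin_form X (\<lambda>k. \<Phi>2 l k a) x) y" for a x y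
    using \<Phi> unfolding lin_form_def coord_C2_def
    by (intro sum.cong refl arg_cong2[where f = "(*)"]) auto
  then show "cyl_deriv2 X \<psi> \<Phi>2 x y \<mu> = cyl_deriv2 X \<psi> \<Phi>2 y x \<mu>" for x y \<mu>
    unfolding cyl_deriv2_def lin_form_swap[of X _ "\<lambda>k. \<psi> k y" "\<lambda>k. \<psi> k x"] .
  fix K :: "'a measure set" assume "compactin (TP q) K"
  then have K: "\<mu> \<in> Prob" if "\<mu> \<in> K" for \<mu> using that compactin_subset_topspace Pp_Prob by fastforce
  have pw: "0 \<le> pw x q" for x :: 'a by (simp add: pw_def)
  show "\<exists>C. \<forall>\<mu>\<in>K. \<forall>x. \<bar>cyl_deriv X \<psi> \<Phi>1 x \<mu>\<bar> \<le> C * (1 + pw x q)"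
  proof -
    have "\<exists>C\<ge>0. \<forall>\<mu>\<in>Prob. \<forall>x. \<bar>cyl_deriv X \<psi> \<Phi>1 x \<mu>\<bar> \<le> C" by (rule bounded_cyl_deriv(1)[OF X \<psi> \<Phi>])
    then obtain C where C: "0 \<le> C" "\<forall>\<mu>\<in>Prob. \<forall>x. \<bar>cyl_deriv X \<psi> \<Phi>1 x \<mu>\<bar> \<le> C" by blast
    moreover have "C \<le> C * (1 + pw x q)" for x :: 'a using C(1) pw[of x] by (simp add: distrib_left)
    ultimately show ?thesis using K by (intro exI[of _ C]) (blast intro: order_trans)
  qed
  show "\<exists>C. \<forall>\<mu>\<in>K. \<forall>x y. \<bar>cyl_deriv2 X \<psi> \<Phi>2 x y \<mu>\<bar> \<le> C * (1 + pw x q + pw y q)"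
  proof -
    have "\<exists>C\<ge>0. \<forall>\<mu>\<in>Prob. \<forall>x y. \<bar>cyl_deriv2 X \<psi> \<Phi>2 x y \<mu>\<bar> \<le> C"
      by (rule bounded_cyl_deriv(2)[OF X \<psi> \<Phi>])
    then obtain C where C: "0 \<le> C" "\<forall>\<mu>\<in>Prob. \<forall>x y. \<bar>cyl_deriv2 X \<psi> \<Phi>2 x y \<mu>\<bar> \<le> C" by blast
    moreover have "C \<le> C * (1 + pw x q + pw y q)" for x y :: 'a
      using C(1) pw[of x] pw[of y] by (simp add: distrib_left)
    ultimately show ?thesis using K by (intro exI[of _ C]) (blast intro: order_trans)
  qed
qed (rule continuous_map_cyl_deriv[OF X q \<psi> \<Phi>] cyl_taylor[OF \<psi> \<Phi> Pp_Prob Pp_Prob]; assumption)+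

lemma integral_product:
  fixes f g :: "'a \<Rightarrow> real"
  assumes M: "prob_space M" and f: "integrable M f" and g: "integrable M g"
  shows "integrable (M \<Otimes>\<^sub>M M) (\<lambda>(x, y). f x * g y)"
    "(\<integral>z. (case z of (x, y) \<Rightarrow> f x * g y) \<partial>(M \<Otimes>\<^sub>M M)) = (\<integral>x. f x \<partial>M) * (\<integral>x. g x \<partial>M)"
proof -
  interpret prob_space M by (rule M)
  interpret P: pair_sigma_finite M M ..
  show int: "integrable (M \<Otimes>\<^sub>M M) (\<lambda>(x, y). f x * g y)"
    using f g by (intro P.Fubini_integrable)
      (auto simp: abs_mult intro: borel_measurable_integrable)
  from P.integral_fst'[OF int] show "(\<integral>z. (case z of (x, y) \<Rightarrow> f x * g y) \<partial>(M \<Otimes>\<^sub>M M))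
      = (\<integral>x. f x \<partial>M) * (\<integral>x. g x \<partial>M)"
    by simp
qed

lemma Lop_cylinder:
  assumes \<mu>: "\<mu> \<in> Prob" and \<psi>: "\<forall>k\<in>X. bdd_lipschitz (\<psi> k)" and \<rho>: "integrable \<mu> \<rho>"
  shows "Lop (cyl_deriv2 X \<psi> \<Phi>2) \<mu> \<rho> = ereal (quad_form X (\<lambda>k l. \<Phi>2 k l (moments X \<psi> \<mu>))
    (\<lambda>k. \<integral>x. \<psi> k x * (\<rho> x - (\<integral>x. \<rho> x \<partial>\<mu>)) \<partial>\<mu>) / 2)"
proof -
  interpret prob_space \<mu> by (rule Prob_D[OF \<mu>])
  define m where "m = (\<integral>x. \<rho> x \<partial>\<mu>)"
  define f where "f k x = \<psi> k x * (\<rho> x - m)" for k x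
  define Q where "Q k l = \<Phi>2 k l (moments X \<psi> \<mu>)" for k l
  have f: "integrable \<mu> (f k)" if k: "k \<in> X" for k
  proof -
    obtain B where B: "\<And>x. \<bar>\<psi> k x\<bar> \<le> B"
      using bspec[OF \<psi> k] by (auto simp: bdd_lipschitz_def bounded_iff)
    have "\<psi> k \<in> borel_measurable \<mu>"
      unfolding measurable_Prob[OF \<mu>] by (rule bdd_lipschitz_measurable[OF bspec[OF \<psi> k]])
    then have "f k \<in> borel_measurable \<mu>" unfolding f_def using \<rho> by measurable
    moreover have "\<bar>\<psi> k x\<bar> * \<bar>\<rho> x - m\<bar> \<le> \<bar>B\<bar> * \<bar>\<rho> x - m\<bar>" for x
      using B[of x] by (intro mult_right_mono) auto
    then have "AE x in \<mu>. norm (f k x) \<le> norm (B * (\<rho> x - m))" by (simp add: f_def abs_mult)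
    moreover have "integrable \<mu> (\<lambda>x. B * (\<rho> x - m))" using \<rho> by simp
    ultimately show ?thesis by (rule Bochner_Integration.integrable_bound[rotated])
  qed
  have g: "(\<lambda>(x, y). cyl_deriv2 X \<psi> \<Phi>2 x y \<mu> * (\<rho> x - m) * (\<rho> y - m))
      = (\<lambda>z. \<Sum>k\<in>X. \<Sum>l\<in>X. Q k l * (case z of (x, y) \<Rightarrow> f k x * f l y))"
    by (auto simp: fun_eq_iff cyl_deriv2_def lin_form_def Q_def f_def sum_distrib_left
      sum_distrib_right intro!: sum.cong)
  note product = integral_product[OF prob_space_axioms f f]
  have "integrable (\<mu> \<Otimes>\<^sub>M \<mu>) (\<lambda>z. \<Sum>k\<in>X. \<Sum>l\<in>X. Q k l * (case z of (x, y) \<Rightarrow> f k x * f l y))"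
    by (intro Bochner_Integration.integrable_sum integrable_mult_right product(1))
  moreover have "(\<integral>z. (\<Sum>k\<in>X. \<Sum>l\<in>X. Q k l * (case z of (x, y) \<Rightarrow> f k x * f l y)) \<partial>(\<mu> \<Otimes>\<^sub>M \<mu>))
      = quad_form X Q (\<lambda>k. \<integral>x. f k x \<partial>\<mu>)"
    by (simp add: quad_form_def product Bochner_Integration.integral_sum mult.commute[of "Q _ _"])
  ultimately show ?thesis
    unfolding Lop_def Let_def m_def[symmetric] g using \<rho>
    by (simp add: Q_def[abs_def] f_def[abs_def])
qed

section \<open>Test functions touching at a finitely supported measure\<close>

definition rel_dev :: "'i set \<Rightarrow> ('i \<Rightarrow> real) \<Rightarrow> ('i \<Rightarrow> real) \<Rightarrow> 'i \<Rightarrow> real" where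
  "rel_dev X m0 m = (\<lambda>i. if i \<in> X then m i / m0 i - 1 else 0)"

lemma bdd_lipschitz_bump:
  assumes "0 < r"
  shows "bdd_lipschitz (\<lambda>x. a * max 0 (1 - dist k x / r) - b)"
proof -
  have "\<bar>a * max 0 (1 - dist k x / r) - b\<bar> \<le> \<bar>a\<bar> * 1 + \<bar>b\<bar>" for x
  proof -
    have "\<bar>a * max 0 (1 - dist k x / r)\<bar> \<le> \<bar>a\<bar> * 1"
      unfolding abs_mult using assms by (intro mult_left_mono) auto
    then show ?thesis by linarith
  qed
  then have "bounded (range (\<lambda>x. a * max 0 (1 - dist k x / r) - b))" by (auto simp: bounded_iff)
  moreover have "(\<bar>a\<bar> * (1 / r) + 0)-lipschitz_on UNIV (\<lambda>x. a * max 0 (1 - dist k x / r) - b)"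
  proof (intro lipschitz_on_diff lipschitz_on_cmult_real lipschitz_on_constant lipschitz_onI)
    fix x y
    have "\<bar>dist k x - dist k y\<bar> \<le> dist x y"
      using dist_triangle[of k x y] dist_triangle[of k y x] by (simp add: dist_commute)
    then have "\<bar>dist k x / r - dist k y / r\<bar> \<le> 1 / r * dist x y"
      using assms by (simp add: diff_divide_distrib[symmetric] abs_divide divide_right_mono)
    then show "dist (max 0 (1 - dist k x / r)) (max 0 (1 - dist k y / r)) \<le> 1 / r * dist x y"
      unfolding dist_real_def by linarith
  qed (use assms in simp)
  ultimately show ?thesis unfolding bdd_lipschitz_def by blast
qed

lemma rel_dev_moments:
  fixes X :: "'a::euclidean_space set"
  assumes X: "finite X"
  obtains \<psi> where "\<forall>k\<in>X. bdd_lipschitz (\<psi> k)"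
    "\<forall>k\<in>X. \<forall>j\<in>X. \<psi> k j = (if j = k then 1 / m0 k else 0) - 1"
    "\<forall>m\<in>prob_simplex X. moments X \<psi> (discr X m) = rel_dev X m0 m"
proof -
  have "\<exists>r>0. \<forall>x\<in>X. x \<noteq> k \<longrightarrow> r \<le> dist k x" for k using finite_set_avoid[OF X, of k] by blast
  then obtain r where r: "\<And>k. 0 < r k" "\<And>k x. x \<in> X \<Longrightarrow> x \<noteq> k \<Longrightarrow> r k \<le> dist k x" by metis
  define \<psi> where "\<psi> k x = 1 / m0 k * max 0 (1 - dist k x / r k) - 1" for k x
  have \<psi>: "bdd_lipschitz (\<psi> k)" for k unfolding \<psi>_def[abs_def] by (rule bdd_lipschitz_bump[OF r(1)])
  have dual: "\<psi> k j = (if j = k then 1 / m0 k else 0) - 1" if "j \<in> X" for k j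
    using r(2)[OF that, of k] r(1)[of k] by (auto simp: \<psi>_def max_def field_simps)
  have "moments X \<psi> (discr X m) k = rel_dev X m0 m k" if m: "m \<in> prob_simplex X" for m k
  proof (cases "k \<in> X")
    case True
    have "(\<integral>x. \<psi> k x \<partial>discr X m) = (\<Sum>j\<in>X. m j * \<psi> k j)"
      using prob_simplex_nonneg[OF m] by (intro integral_discr[OF X bdd_lipschitz_measurable[OF \<psi>]])
    also have "\<dots> = (\<Sum>j\<in>X. (if j = k then m j / m0 k else 0) - m j)"
      by (intro sum.cong refl) (simp add: dual right_diff_distrib)
    also have "\<dots> = m k / m0 k - 1" using X True prob_simplex_sum[OF m] by (simp add: sum_subtractf)
    finally show ?thesis using True by (simp add: moments_def rel_dev_def)
  qed (simp add: moments_def rel_dev_def)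
  then show ?thesis using \<psi> dual by (intro that) auto
qed

lemma TP_nbhd_of_discr:
  fixes X :: "'a::euclidean_space set"
  assumes X: "finite X" and p: "p = 0 \<or> 1 \<le> p" and m0: "m0 \<in> prob_simplex X" "\<And>i. i \<in> X \<Longrightarrow> 0 < m0 i"
    and d: "0 < d"
  obtains U where "openin (TP p) U" "discr X m0 \<in> U"
    "\<forall>m\<in>prob_simplex X. discr X m \<in> U \<longrightarrow> (\<forall>i\<in>X. \<bar>m i - m0 i\<bar> < d)"
proof -
  obtain \<psi> where \<psi>: "\<forall>k\<in>X. bdd_lipschitz (\<psi> k)"
      "\<forall>k\<in>X. \<forall>j\<in>X. \<psi> k j = (if j = k then 1 / m0 k else 0) - 1"
      "\<forall>m\<in>prob_simplex X. moments X \<psi> (discr X m) = rel_dev X m0 m"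
    by (rule rel_dev_moments[OF X])
  define U where "U = {\<mu> \<in> topspace (TP p). moments X \<psi> \<mu> \<in> (\<Inter>k\<in>X. (\<lambda>a. a k) -` {- d<..<d})}"
  have "open (\<Inter>k\<in>X. (\<lambda>a :: 'a \<Rightarrow> real. a k) -` {- d<..<d})"
    by (intro open_INT X ballI open_vimage continuous_on_product_coordinates) simp
  then have "openin (TP p) U"
    unfolding U_def
    by (intro openin_continuous_map_preimage[OF continuous_map_moments[OF p \<psi>(1)]]) simp
  moreover have "rel_dev X m0 m0 k = 0" for k using m0(2)[of k] by (force simp: rel_dev_def)
  then have "discr X m0 \<in> U" unfolding U_def using \<psi>(3) m0(1) discr_Pp[OF X m0(1)] d by simp
  moreover have "\<bar>m i - m0 i\<bar> < d" if "m \<in> prob_simplex X" "discr X m \<in> U" and i: "i \<in> X" for m i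
  proof -
    have "\<bar>m i / m0 i - 1\<bar> < d" using that \<psi>(3) by (auto simp: U_def rel_dev_def)
    moreover have "m i - m0 i = m0 i * (m i / m0 i - 1)"
      using m0(2)[OF i] by (simp add: right_diff_distrib)
    then have "\<bar>m i - m0 i\<bar> = m0 i * \<bar>m i / m0 i - 1\<bar>" using m0(2)[OF i] by (simp add: abs_mult)
    moreover have "m0 i * \<bar>m i / m0 i - 1\<bar> \<le> 1 * \<bar>m i / m0 i - 1\<bar>"
      using prob_simplex_le_1[OF X m0(1) i] by (intro mult_right_mono) auto
    ultimately show ?thesis by simp
  qed
  ultimately show ?thesis by (intro that) auto
qed

definition quartic :: "'i set \<Rightarrow> real \<Rightarrow> ('i \<Rightarrow> real) \<Rightarrow> ('i \<Rightarrow> 'i \<Rightarrow> real) \<Rightarrow> real \<Rightarrow> ('i \<Rightarrow> real) \<Rightarrow>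
    real" where
  "quartic X \<alpha> p Q K x = \<alpha> + lin_form X p x + quad_form X Q x / 2 + K * (\<Sum>k\<in>X. (x k) ^ 4)"

definition quartic_deriv :: "'i set \<Rightarrow> ('i \<Rightarrow> real) \<Rightarrow> ('i \<Rightarrow> 'i \<Rightarrow> real) \<Rightarrow> real \<Rightarrow> 'i \<Rightarrow> ('i \<Rightarrow> real) \<Rightarrow>
    real" where
  "quartic_deriv X p Q K k x = p k + lin_form X (Q k) x + 4 * K * (x k) ^ 3"

definition quartic_deriv2 :: "('i \<Rightarrow> 'i \<Rightarrow> real) \<Rightarrow> real \<Rightarrow> 'i \<Rightarrow> 'i \<Rightarrow> ('i \<Rightarrow> real) \<Rightarrow> real" where
  "quartic_deriv2 Q K k l x = Q k l + (if k = l then 12 * K * (x k)\<^sup>2 else 0)"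

lemma DERIV_lin_form: "((\<lambda>t. lin_form X p (\<lambda>i. a i + t * d i)) has_real_derivative
    lin_form X p d) (at t)"
  unfolding lin_form_def by (auto intro!: derivative_eq_intros sum.cong)

lemma DERIV_quad_form:
  assumes sym: "\<And>k l. k \<in> X \<Longrightarrow> l \<in> X \<Longrightarrow> Q k l = Q l k"
  shows "((\<lambda>t. quad_form X Q (\<lambda>i. a i + t * d i)) has_real_derivative
    2 * lin_form X (\<lambda>k. lin_form X (Q k) (\<lambda>i. a i + t * d i)) d) (at t)"
proof -
  define z where "z = (\<lambda>i. a i + t * d i)"
  have "((\<lambda>t. quad_form X Q (\<lambda>i. a i + t * d i)) has_real_derivative
      (\<Sum>k\<in>X. z k * lin_form X (Q k) d + d k * lin_form X (Q k) z)) (at t)"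
    unfolding quad_form_eq_lin_form unfolding lin_form_def[of X "\<lambda>k. lin_form X (Q k) _"] z_def
    by (auto intro!: derivative_eq_intros DERIV_lin_form sum.cong)
  moreover have "(\<Sum>k\<in>X. z k * lin_form X (Q k) d) = lin_form X (\<lambda>k. lin_form X (Q k) d) z"
    by (simp add: lin_form_def)
  moreover have "lin_form X (\<lambda>k. lin_form X (Q k) d) z = lin_form X (\<lambda>l. lin_form X (Q l) z) d"
    unfolding lin_form_swap[of X Q d z] using sym by (simp add: lin_form_def cong: sum.cong)
  moreover have "(\<Sum>k\<in>X. d k * lin_form X (Q k) z) = lin_form X (\<lambda>k. lin_form X (Q k) z) d"
    by (simp add: lin_form_def)
  ultimately show ?thesis by (simp add: sum.distrib z_def)
qed

lemma coord_C2_quartic: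
  assumes X: "finite X" and sym: "\<And>k l. k \<in> X \<Longrightarrow> l \<in> X \<Longrightarrow> Q k l = Q l k"
  shows "coord_C2 X (quartic X \<alpha> p Q K) (quartic_deriv X p Q K) (quartic_deriv2 Q K)"
  unfolding coord_C2_def
proof (intro conjI allI ballI)
  fix a d :: "'a \<Rightarrow> real" and t
  have "((\<lambda>t. \<Sum>k\<in>X. (a k + t * d k) ^ 4) has_real_derivative
      (\<Sum>k\<in>X. 4 * (a k + t * d k) ^ 3 * d k)) (at t)"
    by (auto intro!: derivative_eq_intros sum.cong)
  then have "((\<lambda>t. quartic X \<alpha> p Q K (\<lambda>i. a i + t * d i)) has_real_derivative
      0 + lin_form X p d + 2 * lin_form X (\<lambda>k. lin_form X (Q k) (\<lambda>i. a i + t * d i)) d / 2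
        + K * (\<Sum>k\<in>X. 4 * (a k + t * d k) ^ 3 * d k)) (at t)"
    unfolding quartic_def
    by (intro DERIV_add DERIV_const DERIV_lin_form DERIV_cdivide DERIV_quad_form sym DERIV_cmult)
  moreover have "lin_form X p d + lin_form X (\<lambda>k. lin_form X (Q k) (\<lambda>i. a i + t * d i)) d
      + K * (\<Sum>k\<in>X. 4 * (a k + t * d k) ^ 3 * d k)
      = lin_form X (\<lambda>k. quartic_deriv X p Q K k (\<lambda>i. a i + t * d i)) d"
    unfolding quartic_deriv_def lin_form_def[of X _ d] sum_distrib_left sum.distrib[symmetric]
    by (intro sum.cong refl) (simp add: algebra_simps)
  ultimately show "((\<lambda>t. quartic X \<alpha> p Q K (\<lambda>i. a i + t * d i)) has_real_derivative
      lin_form X (\<lambda>k. quartic_deriv X p Q K k (\<lambda>i. a i + t * d i)) d) (at t)" by simp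
  fix k assume k: "k \<in> X"
  have "((\<lambda>t. quartic_deriv X p Q K k (\<lambda>i. a i + t * d i)) has_real_derivative
      0 + lin_form X (Q k) d + 4 * K * (3 * (a k + t * d k)\<^sup>2 * d k)) (at t)"
    unfolding quartic_deriv_def
    by (intro DERIV_add DERIV_const DERIV_lin_form DERIV_cmult) (auto intro!: derivative_eq_intros)
  moreover have "lin_form X (Q k) d + 4 * K * (3 * (a k + t * d k)\<^sup>2 * d k)
      = lin_form X (\<lambda>l. quartic_deriv2 Q K k l (\<lambda>i. a i + t * d i)) d"
    using X k by (simp add: quartic_deriv2_def lin_form_def distrib_left sum.distrib
      if_distrib[of "\<lambda>y. _ * y"] cong: if_cong)
  ultimately show "((\<lambda>t. quartic_deriv X p Q K k (\<lambda>i. a i + t * d i)) has_real_derivative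
      lin_form X (\<lambda>l. quartic_deriv2 Q K k l (\<lambda>i. a i + t * d i)) d) (at t)" by simp
next
  fix k l assume kl: "k \<in> X" "l \<in> X"
  show "continuous_on UNIV (quartic_deriv X p Q K k)"
    unfolding quartic_deriv_def[abs_def] lin_form_def
    by (intro continuous_intros continuous_on_product_coordinates)
  show "continuous_on UNIV (quartic_deriv2 Q K k l)"
    unfolding quartic_deriv2_def[abs_def]
    by (cases "k = l") (auto intro!: continuous_intros continuous_on_product_coordinates)
  show "quartic_deriv2 Q K k l = quartic_deriv2 Q K l k"
    using sym[OF kl] by (auto simp: quartic_deriv2_def fun_eq_iff)
qed

definition sym_perturb :: "real \<Rightarrow> ('i \<Rightarrow> 'i \<Rightarrow> real) \<Rightarrow> 'i \<Rightarrow> 'i \<Rightarrow> real" where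
  "sym_perturb e P k l = (P k l + P l k) / 2 + 2 * e * (if k = l then 1 else 0)"

lemma quad_form_sym_perturb:
  assumes X: "finite X"
  shows "quad_form X (sym_perturb e P) x = quad_form X P x + 2 * e * (\<Sum>k\<in>X. (x k)\<^sup>2)"
proof -
  have "quad_form X (\<lambda>k l. P l k) x = quad_form X P x"
    unfolding quad_form_eq_lin_form lin_form_swap[of X P] ..
  then have "quad_form X (\<lambda>k l. 1 / 2 * P k l + 1 / 2 * P l k) x = quad_form X P x"
    unfolding quad_form_lincomb by simp
  moreover have "quad_form X (sym_perturb e P) x
      = 1 * quad_form X (\<lambda>k l. 1 / 2 * P k l + 1 / 2 * P l k) x
      + 2 * e * quad_form X (\<lambda>k l. if k = l then 1 else 0) x"
    unfolding quad_form_lincomb[symmetric] sym_perturb_def[abs_def]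
    by (simp add: add_divide_distrib)
  ultimately show ?thesis unfolding quad_form_diag[OF X] by (simp add: lin_form_def)
qed

lemma superjet_majorant_near:
  assumes X: "finite X" "X \<noteq> {}" and m0: "m0 \<in> prob_simplex X" "\<And>i. i \<in> X \<Longrightarrow> 0 < m0 i"
    and v: "seq_cont_on X (prob_simplex X) v" and jet: "simplex_superjet X v m0 p P" and e: "0 < e"
  obtains d where "0 < d" "\<forall>m\<in>prob_simplex X. l1_norm X (rel_dev X m0 m) < d \<longrightarrow>
    v m \<le> v m0 + lin_form X p (rel_dev X m0 m) + quad_form X (sym_perturb e P) (rel_dev X m0 m) / 2"
proof -
  define N where "N = real (card X)"
  have N: "0 < N" using X by (simp add: N_def card_gt_0_iff)
  obtain r where r: "r \<in> o[at_origin X](\<lambda>x. (l1_norm X x)\<^sup>2)"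
    and ev: "\<forall>\<^sub>F x in at_origin X. lin_form X m0 x = 0 \<longrightarrow>
        v (\<lambda>i. m0 i * (1 + x i)) \<le> v m0 + lin_form X p x + quad_form X P x / 2 + r x"
    using jet unfolding simplex_superjet_def by blast
  have "\<forall>\<^sub>F x in at_origin X. norm (r x) \<le> e / N * norm ((l1_norm X x)\<^sup>2)"
    using r e N by (intro landau_o.smallD) auto
  then have "\<forall>\<^sub>F x in at_origin X. (lin_form X m0 x = 0 \<longrightarrow>
        v (\<lambda>i. m0 i * (1 + x i)) \<le> v m0 + lin_form X p x + quad_form X P x / 2 + r x) \<and>
        norm (r x) \<le> e / N * norm ((l1_norm X x)\<^sup>2)"
    by (rule eventually_conj[OF ev])
  then obtain d where d: "0 < d" "\<And>x. l1_norm X x < d \<Longrightarrow> lin_form X m0 x = 0 \<Longrightarrow>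
      v (\<lambda>i. m0 i * (1 + x i)) \<le> v m0 + lin_form X p x + quad_form X P x / 2 + r x \<and>
      \<bar>r x\<bar> \<le> e / N * (l1_norm X x)\<^sup>2"
    unfolding eventually_at_origin by auto
  have "v m \<le> v m0 + lin_form X p (rel_dev X m0 m)
      + quad_form X (sym_perturb e P) (rel_dev X m0 m) / 2"
    if m: "m \<in> prob_simplex X" and small: "l1_norm X (rel_dev X m0 m) < d" for m
  proof -
    define x where "x = rel_dev X m0 m"
    have m_eq: "m0 i * (1 + x i) = m i" if "i \<in> X" for i
      using m0(2)[OF that] that by (simp add: x_def rel_dev_def)
    have "lin_form X m0 x = (\<Sum>i\<in>X. m0 i * (1 + x i)) - (\<Sum>i\<in>X. m0 i)"
      unfolding lin_form_def sum_subtractf[symmetric] by (simp add: algebra_simps)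
    then have "lin_form X m0 x = 0" using m m0(1) by (simp add: m_eq prob_simplex_sum)
    from d(2)[OF small[folded x_def] this] have "v (\<lambda>i. m0 i * (1 + x i))
        \<le> v m0 + lin_form X p x + quad_form X P x / 2 + r x"
      "r x \<le> e / N * (l1_norm X x)\<^sup>2" by auto
    moreover have "v m = v (\<lambda>i. m0 i * (1 + x i))"
      using m by (intro seq_cont_on_cong[OF v]) (auto simp: m_eq prob_simplex_def)
    moreover have "(l1_norm X x)\<^sup>2 \<le> (\<Sum>k\<in>X. \<bar>x k\<bar>\<^sup>2) * N"
      unfolding l1_norm_def N_def by (rule sum_squared_le_sum_of_squares)
    then have "e / N * (l1_norm X x)\<^sup>2 \<le> e / N * ((\<Sum>k\<in>X. (x k)\<^sup>2) * N)"
      using e N by (intro mult_left_mono) auto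
    ultimately show ?thesis
      using N by (simp add: quad_form_sym_perturb[OF X(1)] add_divide_distrib x_def)
  qed
  then show ?thesis using d(1) by (intro that) auto
qed

lemma quartic_sum_ge:
  assumes X: "finite X" "X \<noteq> {}" and d: "0 \<le> d" "d \<le> l1_norm X x"
  shows "(d / real (card X)) ^ 4 \<le> (\<Sum>k\<in>X. (x k) ^ 4)"
proof -
  have N: "0 < real (card X)" using X by (simp add: card_gt_0_iff)
  have "\<exists>k\<in>X. d / real (card X) \<le> \<bar>x k\<bar>"
  proof (rule ccontr)
    assume "\<not> ?thesis"
    then have "(\<Sum>k\<in>X. \<bar>x k\<bar>) < (\<Sum>k\<in>X. d / real (card X))"
      using X by (intro sum_strict_mono) (auto simp: not_le)
    then show False using d(2) N unfolding l1_norm_def by simp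
  qed
  then obtain k where k: "k \<in> X" "d / real (card X) \<le> \<bar>x k\<bar>" by blast
  have "(d / real (card X)) ^ 4 \<le> \<bar>x k\<bar> ^ 4" using k d(1) by (intro power_mono) auto
  also have "\<dots> = (x k) ^ 4" by simp
  also have "\<dots> \<le> (\<Sum>k\<in>X. (x k) ^ 4)" using X(1) k(1) by (intro member_le_sum) auto
  finally show ?thesis .
qed

lemma tendsto_rel_dev:
  assumes "\<And>i. i \<in> X \<Longrightarrow> 0 < m0 i" "\<forall>i\<in>X. (\<lambda>n. s n i) \<longlonglongrightarrow> l i"
  shows "(\<lambda>n. rel_dev X m0 (s n) i) \<longlonglongrightarrow> rel_dev X m0 l i"
  using assms(1)[of i] assms(2) by (cases "i \<in> X") (auto simp: rel_dev_def intro!: tendsto_intros)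

text \<open>The quartic term makes the quadratic majorant global, at no cost in the second derivative at
  the contact point.\<close>

lemma superjet_quartic_majorant:
  assumes X: "finite X" "X \<noteq> {}" and m0: "m0 \<in> prob_simplex X" "\<And>i. i \<in> X \<Longrightarrow> 0 < m0 i"
    and v: "seq_cont_on X (prob_simplex X) v" and jet: "simplex_superjet X v m0 p P" and e: "0 < e"
  obtains K where "\<forall>m\<in>prob_simplex X. v m \<le> quartic X (v m0) p (sym_perturb e P) K (rel_dev X m0 m)"
proof -
  define G where "G m = v m0 + lin_form X p (rel_dev X m0 m)
      + quad_form X (sym_perturb e P) (rel_dev X m0 m) / 2" for m
  obtain d where d: "0 < d" "\<forall>m\<in>prob_simplex X. l1_norm X (rel_dev X m0 m) < d \<longrightarrow> v m \<le> G m"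
    unfolding G_def by (rule superjet_majorant_near[OF X m0 v jet e])
  have "seq_cont_on X (prob_simplex X) G"
    unfolding seq_cont_on_def G_def lin_form_def quad_form_def
    by (intro allI impI tendsto_intros tendsto_rel_dev m0(2)) auto
  then obtain M where M: "\<And>m. m \<in> prob_simplex X \<Longrightarrow> \<bar>v m - G m\<bar> \<le> M"
    using seq_cont_on_bounded[OF seq_compact_on_simplex[OF X(1)] seq_cont_on_diff[OF v]] by blast
  have M0: "0 \<le> M" using M[OF m0(1)] by linarith
  have d4: "0 < (d / real (card X)) ^ 4" using d(1) X by (simp add: card_gt_0_iff)
  define K where "K = M / (d / real (card X)) ^ 4"
  have K0: "0 \<le> K" unfolding K_def using M0 d4 by (intro divide_nonneg_pos)
  have "v m \<le> quartic X (v m0) p (sym_perturb e P) K (rel_dev X m0 m)" if m: "m \<in> prob_simplex X"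
    for m
  proof -
    define S where "S = (\<Sum>k\<in>X. (rel_dev X m0 m k) ^ 4)"
    have "v m \<le> G m + K * S"
    proof (cases "l1_norm X (rel_dev X m0 m) < d")
      case True
      have "0 \<le> K * S" unfolding S_def using K0 by (intro mult_nonneg_nonneg sum_nonneg) auto
      then show ?thesis using True d(2) m by fastforce
    next
      case False
      then have "K * (d / real (card X)) ^ 4 \<le> K * S"
        unfolding S_def using K0 d(1) by (intro mult_left_mono quartic_sum_ge X) auto
      then show ?thesis using M[OF m] d4 by (simp add: K_def)
    qed
    then show ?thesis by (simp add: quartic_def G_def S_def)
  qed
  then show ?thesis by (intro that) auto
qed

lemma tendsto_centred_gen:
  assumes "\<forall>i\<in>X. (\<lambda>n. m n i) \<longlonglongrightarrow> l i" "\<forall>i\<in>X. \<forall>j\<in>X. (\<lambda>n. P n i j) \<longlonglongrightarrow> Q i j" "\<forall>i\<in>X. (\<lambda>n. \<rho> n i) \<longlonglongrightarrow> r i"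
  shows "(\<lambda>n. centred_gen X (m n) (P n) (\<rho> n)) \<longlonglongrightarrow> centred_gen X l Q r"
  unfolding centred_gen_def quad_form_def lin_form_def
  using assms by (intro tendsto_intros) auto

lemma centred_gen_uniformly_close:
  assumes X: "finite X" and m0: "m0 \<in> prob_simplex X"
    and P: "\<And>i j. i \<in> X \<Longrightarrow> j \<in> X \<Longrightarrow> seq_cont_on X (prob_simplex X) (\<lambda>m. P m i j)" and e: "0 < e"
  shows "\<exists>d>0. \<forall>m\<in>prob_simplex X. (\<forall>i\<in>X. \<bar>m i - m0 i\<bar> < d) \<longrightarrow>
    (\<forall>\<rho>. (\<forall>i\<in>X. \<bar>\<rho> i\<bar> \<le> B) \<longrightarrow> \<bar>centred_gen X m (P m) \<rho> - centred_gen X m0 (P m0) \<rho>\<bar> \<le> e)"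
proof (rule ccontr)
  assume not_close: "\<not> ?thesis"
  have "\<exists>m \<rho>. m \<in> prob_simplex X \<and> (\<forall>i\<in>X. \<bar>m i - m0 i\<bar> < inverse (real (Suc n))) \<and>
      (\<forall>i\<in>X. \<bar>\<rho> i\<bar> \<le> B) \<and>
      e < \<bar>centred_gen X m (P m) \<rho> - centred_gen X m0 (P m0) \<rho>\<bar>" for n
  proof -
    have "0 < inverse (real (Suc n))" by simp
    then show ?thesis using not_close unfolding not_le[symmetric] by blast
  qed
  then obtain m \<rho> where m: "\<And>n. m n \<in> prob_simplex X"
    "\<And>n. \<forall>i\<in>X. \<bar>m n i - m0 i\<bar> < inverse (real (Suc n))"
    and \<rho>: "\<And>n. \<forall>i\<in>X. \<bar>\<rho> n i\<bar> \<le> B" and far: "\<And>n. e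
        < \<bar>centred_gen X (m n) (P (m n)) (\<rho> n) - centred_gen X m0 (P m0) (\<rho> n)\<bar>"
    by metis
  have "bounded (range (\<lambda>n. \<rho> n i))" if "i \<in> X" for i using \<rho> that by (auto simp: bounded_iff)
  then obtain s r where s: "strict_mono s" and r: "\<And>i. i \<in> X \<Longrightarrow> (\<lambda>n. \<rho> (s n) i) \<longlonglongrightarrow> r i"
    using bounded_coords_convergent_subsequence[where s = \<rho>, OF X] by blast
  have lim: "(\<lambda>n. m (s n) i) \<longlonglongrightarrow> m0 i" if "i \<in> X" for i
  proof (rule LIM_zero_cancel, rule Lim_null_comparison)
    show "\<forall>\<^sub>F n in sequentially. norm (m (s n) i - m0 i) \<le> inverse (real (Suc (s n)))"
      using m(2) that by (auto intro!: always_eventually less_imp_le)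
    show "(\<lambda>n. inverse (real (Suc (s n)))) \<longlonglongrightarrow> 0"
      using LIMSEQ_subseq_LIMSEQ[OF LIMSEQ_inverse_real_of_nat s] by (simp add: o_def)
  qed
  have "(\<lambda>n. P (m (s n)) i j) \<longlonglongrightarrow> P m0 i j" if "i \<in> X" "j \<in> X" for i j
    by (rule seq_cont_onD[where s = "\<lambda>n. m (s n)", OF P[OF that] m(1) m0 lim])
  then have "(\<lambda>n. centred_gen X (m (s n)) (P (m (s n))) (\<rho> (s n))) \<longlonglongrightarrow> centred_gen X m0 (P m0) r"
    using lim r by (intro tendsto_centred_gen) auto
  moreover have "(\<lambda>n. centred_gen X m0 (P m0) (\<rho> (s n))) \<longlonglongrightarrow> centred_gen X m0 (P m0) r"
    using r by (intro tendsto_centred_gen) auto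
  ultimately have "(\<lambda>n. \<bar>centred_gen X (m (s n)) (P (m (s n))) (\<rho> (s n))
      - centred_gen X m0 (P m0) (\<rho> (s n))\<bar>)
      \<longlonglongrightarrow> \<bar>centred_gen X m0 (P m0) r - centred_gen X m0 (P m0) r\<bar>" by (intro tendsto_intros)
  then have "e \<le> \<bar>centred_gen X m0 (P m0) r - centred_gen X m0 (P m0) r\<bar>"
    by (rule LIMSEQ_le_const) (use far in \<open>auto intro: less_imp_le\<close>)
  then show False using e by simp
qed

definition simplex_hess :: "'i set \<Rightarrow> ('i \<Rightarrow> real) \<Rightarrow> ('i \<Rightarrow> 'i \<Rightarrow> ('i \<Rightarrow> real) \<Rightarrow> real) \<Rightarrow> ('i \<Rightarrow> real) \<Rightarrow>
    'i \<Rightarrow> 'i \<Rightarrow> real" where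
  "simplex_hess X m0 \<Phi>2 m k l = (1 + rel_dev X m0 m k) *
      (1 + rel_dev X m0 m l) * \<Phi>2 k l (rel_dev X m0 m)"

lemma Lop_cylinder_discr:
  fixes X :: "'a::euclidean_space set"
  assumes X: "finite X" and \<psi>: "\<forall>k\<in>X. bdd_lipschitz (\<psi> k)"
      "\<forall>k\<in>X. \<forall>j\<in>X. \<psi> k j = (if j = k then 1 / m0 k else 0) - 1"
      "moments X \<psi> (discr X m) = rel_dev X m0 m"
    and m: "m \<in> prob_simplex X" and \<rho>: "\<rho> \<in> borel_measurable borel"
  shows "Lop (cyl_deriv2 X \<psi> \<Phi>2) (discr X m) \<rho> = ereal (centred_gen X m (simplex_hess X m0 \<Phi>2 m) \<rho>)"
proof -
  define a where "a = lin_form X \<rho> m"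
  have a: "(\<integral>x. \<rho> x \<partial>discr X m) = a"
    using prob_simplex_nonneg[OF m]
    by (subst integral_discr[OF X \<rho>]) (auto simp: a_def lin_form_def)
  have moment: "(\<integral>x. \<psi> k x * (\<rho> x - a) \<partial>discr X m) = (1 + rel_dev X m0 m k) * (\<rho> k - a)"
    if k: "k \<in> X" for k
  proof -
    have "(\<integral>x. \<psi> k x * (\<rho> x - a) \<partial>discr X m) = (\<Sum>j\<in>X. m j * (\<psi> k j * (\<rho> j - a)))"
      using prob_simplex_nonneg[OF m] \<rho> bdd_lipschitz_measurable[OF bspec[OF \<psi>(1) k]]
      by (intro integral_discr X) auto
    also have "\<dots> = (\<Sum>j\<in>X. (if j = k then m j / m0 k * (\<rho> j - a) else 0) - (m j * \<rho> j - m j * a))"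
      using \<psi>(2) k by (intro sum.cong refl) (auto simp: left_diff_distrib right_diff_distrib)
    also have "\<dots> = m k / m0 k * (\<rho> k - a) - (lin_form X \<rho> m - a * (\<Sum>j\<in>X. m j))"
      using X k by (simp add: sum_subtractf lin_form_def sum_distrib_left mult.commute[of a])
    also have "\<dots> = (1 + rel_dev X m0 m k) * (\<rho> k - a)"
      using k by (simp add: prob_simplex_sum[OF m] a_def rel_dev_def)
    finally show ?thesis .
  qed
  have "quad_form X (\<lambda>k l. \<Phi>2 k l (rel_dev X m0 m)) (\<lambda>k. \<integral>x. \<psi> k x * (\<rho> x - a) \<partial>discr X m)
      = quad_form X (simplex_hess X m0 \<Phi>2 m) (\<lambda>k. \<rho> k - a)"
    unfolding quad_form_def by (intro sum.cong refl) (simp add: moment simplex_hess_def)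
  then show ?thesis
    using Lop_cylinder[OF discr_Prob[OF X m] \<psi>(1) integrable_discr[OF X \<rho>], of \<Phi>2]
    by (simp add: a \<psi>(3) centred_gen_def a_def)
qed

lemma centred_gen_sym_perturb_close:
  assumes X: "finite X" and m: "m \<in> prob_simplex X" and \<rho>: "\<forall>i\<in>X. \<bar>\<rho> i\<bar> \<le> B" and e: "0 \<le> e"
  shows "\<bar>centred_gen X m (sym_perturb e P) \<rho> - centred_gen X m P \<rho>\<bar>
      \<le> e * (real (card X) * (2 * B)\<^sup>2)"
proof -
  have "(\<rho> i - lin_form X \<rho> m)\<^sup>2 \<le> (2 * B)\<^sup>2" if "i \<in> X" for i
  proof -
    have "\<bar>\<rho> i - lin_form X \<rho> m\<bar> \<le> 2 * B"
      using \<rho> that abs_lin_form_simplex_le[of m X \<rho> B, OF m] by force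
    then show ?thesis using power_mono[of "\<bar>\<rho> i - lin_form X \<rho> m\<bar>" "2 * B" 2] by simp
  qed
  then have "(\<Sum>i\<in>X. (\<rho> i - lin_form X \<rho> m)\<^sup>2) \<le> real (card X) * (2 * B)\<^sup>2"
    by (intro sum_bounded_above)
  then have "e * (\<Sum>i\<in>X. (\<rho> i - lin_form X \<rho> m)\<^sup>2) \<le> e * (real (card X) * (2 * B)\<^sup>2)"
    using e by (intro mult_left_mono)
  moreover have "0 \<le> e * (\<Sum>i\<in>X. (\<rho> i - lin_form X \<rho> m)\<^sup>2)"
    using e by (intro mult_nonneg_nonneg sum_nonneg) auto
  ultimately show ?thesis
    by (simp add: centred_gen_def quad_form_sym_perturb[OF X] add_divide_distrib)
qed

lemma quartic_close_near_contact:
  assumes X: "finite X" and m0: "m0 \<in> prob_simplex X" "\<And>i. i \<in> X \<Longrightarrow> 0 < m0 i" and \<epsilon>: "0 < \<epsilon>"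
  obtains d where "0 < d" "\<forall>m\<in>prob_simplex X. (\<forall>i\<in>X. \<bar>m i - m0 i\<bar> < d) \<longrightarrow>
    \<bar>quartic X \<alpha> b Q K (rel_dev X m0 m) - \<alpha>\<bar> \<le> \<epsilon> \<and> (\<forall>\<rho>. (\<forall>i\<in>X. \<bar>\<rho> i\<bar> \<le> B) \<longrightarrow>
      \<bar>centred_gen X m (simplex_hess X m0 (quartic_deriv2 Q K) m) \<rho> - centred_gen X m0 Q \<rho>\<bar> \<le> \<epsilon>)"
proof -
  let ?\<Phi> = "\<lambda>m. quartic X \<alpha> b Q K (rel_dev X m0 m)"
    and ?R = "simplex_hess X m0 (quartic_deriv2 Q K)"
  have rel_dev_0: "rel_dev X m0 m0 = (\<lambda>_. 0)" using m0(2) by (force simp: rel_dev_def)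
  have at_m0: "?\<Phi> m0 = \<alpha>" "?R m0 = Q"
    by (simp_all add: rel_dev_0 quartic_def lin_form_def quad_form_def fun_eq_iff simplex_hess_def
      quartic_deriv2_def)
  have "seq_cont_on X (prob_simplex X) ?\<Phi>"
    unfolding seq_cont_on_def quartic_def lin_form_def quad_form_def
    by (intro allI impI tendsto_intros tendsto_rel_dev m0(2)) auto
  then obtain d1 where d1: "0 < d1"
    "\<And>m. m \<in> prob_simplex X \<Longrightarrow> (\<And>i. i \<in> X \<Longrightarrow> \<bar>m i - m0 i\<bar> < d1) \<Longrightarrow> \<bar>?\<Phi> m - ?\<Phi> m0\<bar> < \<epsilon>"
    using seq_cont_on_uniform[OF seq_compact_on_simplex[OF X] _ \<epsilon>] m0(1) by metis
  have "seq_cont_on X (prob_simplex X) (\<lambda>m. ?R m k l)" for k l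
    unfolding seq_cont_on_def simplex_hess_def quartic_deriv2_def
    by (cases "k = l") (auto intro!: tendsto_intros tendsto_rel_dev m0(2))
  then have "\<exists>d>0. \<forall>m\<in>prob_simplex X. (\<forall>i\<in>X. \<bar>m i - m0 i\<bar> < d) \<longrightarrow>
      (\<forall>\<rho>. (\<forall>i\<in>X. \<bar>\<rho> i\<bar> \<le> B) \<longrightarrow> \<bar>centred_gen X m (?R m) \<rho> - centred_gen X m0 (?R m0) \<rho>\<bar> \<le> \<epsilon>)"
    by (intro centred_gen_uniformly_close[OF X m0(1) _ \<epsilon>])
  then obtain d2 where d2: "0 < d2" "\<forall>m\<in>prob_simplex X. (\<forall>i\<in>X. \<bar>m i - m0 i\<bar> < d2) \<longrightarrow>
      (\<forall>\<rho>. (\<forall>i\<in>X. \<bar>\<rho> i\<bar> \<le> B) \<longrightarrow> \<bar>centred_gen X m (?R m) \<rho> - centred_gen X m0 Q \<rho>\<bar> \<le> \<epsilon>)"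
    unfolding at_m0(2) by blast
  show ?thesis
  proof (rule that[of "min d1 d2"], use d1(1) d2(1) in simp, intro ballI impI conjI)
    fix m assume m: "m \<in> prob_simplex X" and near: "\<forall>i\<in>X. \<bar>m i - m0 i\<bar> < min d1 d2"
    then show "\<bar>?\<Phi> m - \<alpha>\<bar> \<le> \<epsilon>" using d1(2)[OF m] unfolding at_m0(1) by (auto intro: less_imp_le)
    show "\<forall>\<rho>. (\<forall>i\<in>X. \<bar>\<rho> i\<bar> \<le> B) \<longrightarrow> \<bar>centred_gen X m (?R m) \<rho> - centred_gen X m0 Q \<rho>\<bar> \<le> \<epsilon>"
      using d2(2)[rule_format, OF m] near by simp
  qed
qed

lemma Lop_quartic_near:
  fixes X :: "'a::euclidean_space set"
  assumes X: "finite X" and \<psi>: "\<forall>k\<in>X. bdd_lipschitz (\<psi> k)"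
      "\<forall>k\<in>X. \<forall>j\<in>X. \<psi> k j = (if j = k then 1 / m0 k else 0) - 1"
      "moments X \<psi> (discr X m) = rel_dev X m0 m"
    and m: "m0 \<in> prob_simplex X" "m \<in> prob_simplex X"
    and \<rho>: "\<rho> \<in> borel_measurable borel" "\<forall>i\<in>X. \<bar>\<rho> i - \<rho> 0\<bar> \<le> B"
    and e: "0 \<le> e" "e * (real (card X) * (2 * B)\<^sup>2) \<le> \<epsilon> / 2"
    and close: "\<forall>\<rho>. (\<forall>i\<in>X. \<bar>\<rho> i\<bar> \<le> B) \<longrightarrow>
      \<bar>centred_gen X m (simplex_hess X m0 (quartic_deriv2 (sym_perturb e P) K) m) \<rho>
        - centred_gen X m0 (sym_perturb e P) \<rho>\<bar> \<le> \<epsilon> / 2"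
  shows "\<exists>y. Lop (cyl_deriv2 X \<psi> (quartic_deriv2 (sym_perturb e P) K)) (discr X m) \<rho> = ereal y \<and>
    \<bar>y - centred_gen X m0 P \<rho>\<bar> \<le> \<epsilon>"
proof -
  let ?y = "centred_gen X m (simplex_hess X m0 (quartic_deriv2 (sym_perturb e P) K) m) \<rho>"
  have "\<bar>?y - centred_gen X m0 (sym_perturb e P) \<rho>\<bar> \<le> \<epsilon> / 2"
    using spec[OF close, of "\<lambda>i. \<rho> i - \<rho> 0"] \<rho>(2)
    unfolding centred_gen_shift[OF m(1)] centred_gen_shift[OF m(2)] by blast
  moreover have "\<bar>centred_gen X m0 (sym_perturb e P) \<rho> - centred_gen X m0 P \<rho>\<bar>
      \<le> e * (real (card X) * (2 * B)\<^sup>2)"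
    using centred_gen_sym_perturb_close[OF X m(1) \<rho>(2) e(1)] unfolding centred_gen_shift[OF m(1)] .
  ultimately have "\<bar>?y - centred_gen X m0 P \<rho>\<bar> \<le> \<epsilon>" using e(2) by argo
  with Lop_cylinder_discr[OF X \<psi> m(2) \<rho>(1)] show ?thesis by blast
qed

lemma jet_test_function:
  fixes X :: "'a::euclidean_space set"
  assumes X: "finite X" "X \<noteq> {}" and m0: "m0 \<in> prob_simplex X" "\<And>i. i \<in> X \<Longrightarrow> 0 < m0 i"
    and p: "p = 0 \<or> 1 \<le> p" and q: "q = 0 \<or> 1 \<le> q"
    and v: "seq_cont_on X (prob_simplex X) v" and jet: "simplex_superjet X v m0 b P" and \<epsilon>: "0 < \<epsilon>"
  obtains f Df D2f U where "C2 q f Df D2f" "f (discr X m0) = v m0"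
    "\<forall>m\<in>prob_simplex X. v m \<le> f (discr X m)"
    "openin (TP p) U" "discr X m0 \<in> U"
    "\<forall>m\<in>prob_simplex X. discr X m \<in> U \<longrightarrow> \<bar>f (discr X m) - v m0\<bar> \<le> \<epsilon> \<and>
      (\<forall>\<rho>\<in>borel_measurable borel. (\<forall>i\<in>X. \<bar>\<rho> i - \<rho> 0\<bar> \<le> B) \<longrightarrow>
        (\<exists>y. Lop D2f (discr X m) \<rho> = ereal y \<and> \<bar>y - centred_gen X m0 P \<rho>\<bar> \<le> \<epsilon>))"
proof -
  define M where "M = real (card X) * (2 * B)\<^sup>2"
  define e where "e = \<epsilon> / (2 * (M + 1))"
  have "0 \<le> M" by (simp add: M_def)
  then have e: "0 < e" "e * M \<le> \<epsilon> / 2" using \<epsilon> by (auto simp: e_def field_simps)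
  obtain K where K: "\<forall>m\<in>prob_simplex X. v m
      \<le> quartic X (v m0) b (sym_perturb e P) K (rel_dev X m0 m)"
    by (rule superjet_quartic_majorant[OF X m0 v jet e(1)])
  obtain \<psi> where \<psi>: "\<forall>k\<in>X. bdd_lipschitz (\<psi> k)"
    "\<forall>k\<in>X. \<forall>j\<in>X. \<psi> k j = (if j = k then 1 / m0 k else 0) - 1"
      "\<forall>m\<in>prob_simplex X. moments X \<psi> (discr X m) = rel_dev X m0 m"
    by (rule rel_dev_moments[OF X(1)])
  let ?\<Phi> = "quartic X (v m0) b (sym_perturb e P) K" and ?\<Phi>2 = "quartic_deriv2 (sym_perturb e P) K"
  have "0 < \<epsilon> / 2" using \<epsilon> by simp
  obtain d where d: "0 < d" "\<forall>m\<in>prob_simplex X. (\<forall>i\<in>X. \<bar>m i - m0 i\<bar> < d) \<longrightarrow>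
      \<bar>?\<Phi> (rel_dev X m0 m) - v m0\<bar> \<le> \<epsilon> / 2 \<and>
      (\<forall>\<rho>. (\<forall>i\<in>X. \<bar>\<rho> i\<bar> \<le> B) \<longrightarrow>
        \<bar>centred_gen X m (simplex_hess X m0 ?\<Phi>2 m) \<rho> - centred_gen X m0 (sym_perturb e P) \<rho>\<bar>
        \<le> \<epsilon> / 2)"
    by (rule quartic_close_near_contact[OF X(1) m0 \<open>0 < \<epsilon> / 2\<close>])
  obtain U where U: "openin (TP p) U" "discr X m0 \<in> U"
      "\<forall>m\<in>prob_simplex X. discr X m \<in> U \<longrightarrow> (\<forall>i\<in>X. \<bar>m i - m0 i\<bar> < d)"
    by (rule TP_nbhd_of_discr[OF X(1) p m0 d(1)])
  show thesis
  proof (rule that[OF _ _ _ U(1,2)])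
    show "C2 q (\<lambda>\<mu>. ?\<Phi> (moments X \<psi> \<mu>))
        (cyl_deriv X \<psi> (quartic_deriv X b (sym_perturb e P) K)) (cyl_deriv2 X \<psi> ?\<Phi>2)"
      by (intro C2_cylinder X(1) q \<psi>(1) coord_C2_quartic) (auto simp: sym_perturb_def)
    have "rel_dev X m0 m0 = (\<lambda>_. 0)" using m0(2) by (force simp: rel_dev_def)
    then show "?\<Phi> (moments X \<psi> (discr X m0)) = v m0"
      using \<psi>(3) m0(1) by (simp add: quartic_def lin_form_def quad_form_def)
    show "\<forall>m\<in>prob_simplex X. v m \<le> ?\<Phi> (moments X \<psi> (discr X m))" using K \<psi>(3) by simp
    show "\<forall>m\<in>prob_simplex X. discr X m \<in> U \<longrightarrow> \<bar>?\<Phi> (moments X \<psi> (discr X m)) - v m0\<bar> \<le> \<epsilon> \<and>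
      (\<forall>\<rho>\<in>borel_measurable borel. (\<forall>i\<in>X. \<bar>\<rho> i - \<rho> 0\<bar> \<le> B) \<longrightarrow>
        (\<exists>y. Lop (cyl_deriv2 X \<psi> ?\<Phi>2) (discr X m) \<rho> = ereal y \<and> \<bar>y - centred_gen X m0 P \<rho>\<bar> \<le> \<epsilon>))"
    proof (intro ballI impI conjI)
      fix m assume m: "m \<in> prob_simplex X" "discr X m \<in> U"
      note close = d(2)[rule_format, OF m(1) U(3)[rule_format, OF m]]
      show "\<bar>?\<Phi> (moments X \<psi> (discr X m)) - v m0\<bar> \<le> \<epsilon>" using close \<psi>(3) m(1) \<epsilon> by simp
      fix \<rho> :: "'a \<Rightarrow> real" assume \<rho>: "\<rho> \<in> borel_measurable borel" "\<forall>i\<in>X. \<bar>\<rho> i - \<rho> 0\<bar> \<le> B"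
      show "\<exists>y. Lop (cyl_deriv2 X \<psi> ?\<Phi>2) (discr X m) \<rho> = ereal y \<and>
          \<bar>y - centred_gen X m0 P \<rho>\<bar> \<le> \<epsilon>"
        by (rule Lop_quartic_near[OF X(1) \<psi>(1,2) bspec[OF \<psi>(3) m(1)] m0(1) m(1) \<rho>
              less_imp_le[OF e(1)] e(2)[unfolded M_def] conjunct2[OF close]])
    qed
  qed
qed

section \<open>The comparison principle\<close>

lemma C2_uminus:
  assumes "C2 q f Df D2f"
  shows "C2 q (\<lambda>\<mu>. - f \<mu>) (\<lambda>x \<mu>. - Df x \<mu>) (\<lambda>x y \<mu>. - D2f x y \<mu>)"
  unfolding C2_def
proof (intro conjI)
  have sint_neg: "sint \<mu> \<nu> (\<lambda>x. - \<phi> x) = - sint \<mu> \<nu> \<phi>" for \<mu> \<nu> :: "'a measure" and \<phi>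
    by (simp add: sint_def)
  show "continuous_map (prod_topology euclidean (TP q)) euclideanreal (\<lambda>(x, \<mu>). - Df x \<mu>)"
    using conjunct1[OF assms[unfolded C2_def]] unfolding case_prod_beta
    by (rule continuous_map_minus)
  show "continuous_map (prod_topology (prod_topology euclidean euclidean) (TP q)) euclideanreal
      (\<lambda>((x, y), \<mu>). - D2f x y \<mu>)"
    using conjunct1[OF conjunct2[OF assms[unfolded C2_def]]] unfolding case_prod_beta
    by (rule continuous_map_minus)
  show "\<forall>\<mu>\<in>Pp q. \<forall>\<nu>\<in>Pp q.
      - f \<nu> - - f \<mu> = integral {0..1} (\<lambda>t. sint \<mu> \<nu> (\<lambda>x. - Df x (mixm t \<nu> \<mu>))) \<and>
      - f \<nu> - - f \<mu> - sint \<mu> \<nu> (\<lambda>x. - Df x \<mu>) =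
        integral {0..1} (\<lambda>t. integral {0..t} (\<lambda>s.
          sint \<mu> \<nu> (\<lambda>x. sint \<mu> \<nu> (\<lambda>y. - D2f x y (mixm s \<nu> \<mu>)))))"
  proof (intro ballI)
    fix \<mu> \<nu> :: "'a measure" assume "\<mu> \<in> Pp q" "\<nu> \<in> Pp q"
    then have "f \<nu> - f \<mu> = integral {0..1} (\<lambda>t. sint \<mu> \<nu> (\<lambda>x. Df x (mixm t \<nu> \<mu>)))"
      "f \<nu> - f \<mu> - sint \<mu> \<nu> (\<lambda>x. Df x \<mu>) =
        integral {0..1} (\<lambda>t. integral {0..t} (\<lambda>s.
          sint \<mu> \<nu> (\<lambda>x. sint \<mu> \<nu> (\<lambda>y. D2f x y (mixm s \<nu> \<mu>)))))"
      using assms unfolding C2_def by blast+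
    then show "- f \<nu> - - f \<mu> = integral {0..1} (\<lambda>t. sint \<mu> \<nu> (\<lambda>x. - Df x (mixm t \<nu> \<mu>))) \<and>
      - f \<nu> - - f \<mu> - sint \<mu> \<nu> (\<lambda>x. - Df x \<mu>) =
        integral {0..1} (\<lambda>t. integral {0..t} (\<lambda>s.
          sint \<mu> \<nu> (\<lambda>x. sint \<mu> \<nu> (\<lambda>y. - D2f x y (mixm s \<nu> \<mu>)))))"
      by (simp add: sint_neg)
  qed
qed (use assms in \<open>simp_all add: C2_def\<close>)

lemma Lop_uminus:
  assumes "Lop D2f \<mu> \<rho> = ereal y"
  shows "Lop (\<lambda>x y \<mu>. - D2f x y \<mu>) \<mu> \<rho> = ereal (- y)"
proof -
  define g where "g = (\<lambda>(x, y). D2f x y \<mu> * (\<rho> x - (\<integral>x. \<rho> x \<partial>\<mu>)) * (\<rho> y - (\<integral>x. \<rho> x \<partial>\<mu>)))"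
  have "(\<lambda>(x, y). - D2f x y \<mu> * (\<rho> x - (\<integral>x. \<rho> x \<partial>\<mu>)) * (\<rho> y - (\<integral>x. \<rho> x \<partial>\<mu>))) = (\<lambda>z. - g z)"
    by (auto simp: g_def)
  then show ?thesis
    using assms unfolding Lop_def Let_def g_def[symmetric] by (auto split: if_splits)
qed

lemma ulimsup_continuous:
  assumes u: "continuous_map (TP p) euclideanreal u" and \<mu>: "\<mu> \<in> D" "\<mu> \<in> Pp p"
  shows "ulimsup p D (\<lambda>\<mu>. ereal (u \<mu>)) \<mu> = ereal (u \<mu>)"
proof (rule antisym)
  show "ulimsup p D (\<lambda>\<mu>. ereal (u \<mu>)) \<mu> \<le> ereal (u \<mu>)"
  proof (rule ereal_le_epsilon2)
    fix e :: real assume e: "0 < e"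
    let ?U = "{\<nu> \<in> topspace (TP p). u \<nu> \<in> {..<u \<mu> + e}}"
    have U: "openin (TP p) ?U" using u by (rule openin_continuous_map_preimage) simp
    have "ulimsup p D (\<lambda>\<mu>. ereal (u \<mu>)) \<mu> \<le> (SUP \<nu>\<in>?U \<inter> D. ereal (u \<nu>))"
      unfolding ulimsup_def using U e \<mu> by (intro INF_lower) auto
    also have "\<dots> \<le> ereal (u \<mu>) + ereal e" by (intro SUP_least) auto
    finally show "ulimsup p D (\<lambda>\<mu>. ereal (u \<mu>)) \<mu> \<le> ereal (u \<mu>) + ereal e" .
  qed
  show "ereal (u \<mu>) \<le> ulimsup p D (\<lambda>\<mu>. ereal (u \<mu>)) \<mu>"
    unfolding ulimsup_def using \<mu>(1) by (intro INF_greatest SUP_upper) auto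
qed

lemma uliminf_eq_uminus_ulimsup: "uliminf p D g \<mu> = - ulimsup p D (\<lambda>\<nu>. - g \<nu>) \<mu>"
  by (simp add: uliminf_def ulimsup_def ereal_INF_uminus_eq ereal_SUP_uminus_eq)

lemma uliminf_le_0D:
  assumes "uliminf p D g \<mu> \<le> 0" "openin (TP p) U" "\<mu> \<in> U" "0 < \<tau>"
  obtains \<nu> where "\<nu> \<in> U \<inter> D" "g \<nu> < ereal \<tau>"
proof -
  have "(INF \<nu>\<in>U \<inter> D. g \<nu>) \<le> uliminf p D g \<mu>"
    unfolding uliminf_def using assms by (intro SUP_upper) auto
  also have "\<dots> < ereal \<tau>" using assms(1,4) by (auto intro: le_less_trans)
  finally show thesis using that unfolding INF_less_iff by blast
qed

lemma ulimsup_ge_0D: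
  assumes "0 \<le> ulimsup p D g \<mu>" "openin (TP p) U" "\<mu> \<in> U" "0 < \<tau>"
  obtains \<nu> where "\<nu> \<in> U \<inter> D" "ereal (- \<tau>) < g \<nu>"
proof -
  have "uliminf p D (\<lambda>\<nu>. - g \<nu>) \<mu> \<le> 0" using assms(1) by (simp add: uliminf_eq_uminus_ulimsup)
  then obtain \<nu> where "\<nu> \<in> U \<inter> D" "- g \<nu> < ereal \<tau>" by (rule uliminf_le_0D[OF _ assms(2-4)])
  then show thesis using that by (simp add: ereal_uminus_less_reorder)
qed

locale bounded_control =
  fixes p q \<beta> :: real and Hs :: "('a::euclidean_space \<Rightarrow> real) set"
    and c :: "'a measure \<Rightarrow> ('a \<Rightarrow> real) \<Rightarrow> ereal"
  assumes p: "p = 0 \<or> 1 \<le> p" and q: "q = 0 \<or> 1 \<le> q" and \<beta>: "0 < \<beta>"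
    and measurable: "\<rho> \<in> Hs \<Longrightarrow> \<rho> \<in> borel_measurable borel"
    and bounded: "bounded {\<rho> x - \<rho> 0 |\<rho>. \<rho> \<in> Hs}"
    and c_not_MInf: "\<mu> \<in> Pp p \<Longrightarrow> \<rho> \<in> Hs \<Longrightarrow> c \<mu> \<rho> \<noteq> -\<infinity>"
    and c_continuous: "finite X \<Longrightarrow> \<mu> \<in> PX X \<Longrightarrow> 0 < \<epsilon> \<Longrightarrow> \<exists>U. openin (TP p) U \<and> \<mu> \<in> U \<and>
      (\<forall>\<nu>\<in>U \<inter> PX X. \<forall>\<rho>\<in>Hs. ereal_close \<epsilon> (c \<nu> \<rho>) (c \<mu> \<rho>))"
begin

lemma uniform_bound:
  assumes X: "finite X"
  obtains B where "\<And>\<rho> i. \<rho> \<in> Hs \<Longrightarrow> i \<in> X \<Longrightarrow> \<bar>\<rho> i - \<rho> 0\<bar> \<le> B"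
proof -
  have "bounded (\<Union>x\<in>X. {\<rho> x - \<rho> 0 |\<rho>. \<rho> \<in> Hs})" using X bounded by (intro bounded_UN) auto
  then show thesis using that unfolding bounded_iff by fastforce
qed

lemma c_nbhd:
  assumes X: "finite X" and m0: "m0 \<in> prob_simplex X" and \<epsilon>: "0 < \<epsilon>"
  obtains U where "openin (TP p) U" "discr X m0 \<in> U" "\<forall>m\<in>prob_simplex X. discr X m \<in> U \<longrightarrow>
    (\<forall>\<rho>\<in>Hs. ereal_close \<epsilon> (c (discr X m) \<rho>) (c (discr X m0) \<rho>))"
  using c_continuous[OF X discr_PX[OF X m0] \<epsilon>] discr_PX[OF X] that by blast

lemma touching_measure:
  assumes X: "finite X" "X \<noteq> {}" and m: "m \<in> prob_simplex X" "\<And>i. i \<in> X \<Longrightarrow> 0 < m i"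
    and v: "continuous_map (TP p) euclideanreal v"
    and jet: "simplex_superjet X (\<lambda>m. v (discr X m)) m b P" and \<epsilon>: "0 < \<epsilon>"
  obtains f Df D2f U where "C2 q f Df D2f" "f (discr X m) = v (discr X m)"
    "\<forall>\<mu>\<in>Dset p (discr X m). v \<mu> \<le> f \<mu>"
    "openin (TP p) U" "discr X m \<in> U"
    "\<forall>\<nu>\<in>U \<inter> Dset p (discr X m). \<bar>f \<nu> - v (discr X m)\<bar> \<le> \<epsilon> \<and> (\<forall>\<rho>\<in>Hs.
      ereal_close \<epsilon> (c \<nu> \<rho>) (c (discr X m) \<rho>) \<and>
      (\<exists>y. Lop D2f \<nu> \<rho> = ereal y \<and> \<bar>y - centred_gen X m P \<rho>\<bar> \<le> \<epsilon>))"
proof -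
  obtain B where B: "\<And>\<rho> i. \<rho> \<in> Hs \<Longrightarrow> i \<in> X \<Longrightarrow> \<bar>\<rho> i - \<rho> 0\<bar> \<le> B" using uniform_bound[OF X(1)] by blast
  obtain f Df D2f U where f: "C2 q f Df D2f" "f (discr X m) = v (discr X m)"
    "\<forall>m\<in>prob_simplex X. v (discr X m) \<le> f (discr X m)"
    and U: "openin (TP p) U" "discr X m \<in> U" "\<forall>m'\<in>prob_simplex X. discr X m' \<in> U \<longrightarrow>
      \<bar>f (discr X m') - v (discr X m)\<bar> \<le> \<epsilon> \<and> (\<forall>\<rho>\<in>borel_measurable borel. (\<forall>i\<in>X. \<bar>\<rho> i - \<rho> 0\<bar> \<le> B) \<longrightarrow>
        (\<exists>y. Lop D2f (discr X m') \<rho> = ereal y \<and> \<bar>y - centred_gen X m P \<rho>\<bar> \<le> \<epsilon>))"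
    by (rule jet_test_function[OF X m p q seq_cont_on_discr[OF X(1) p v] jet \<epsilon>])
  obtain V where V: "openin (TP p) V" "discr X m \<in> V" "\<forall>m'\<in>prob_simplex X. discr X m' \<in> V \<longrightarrow>
      (\<forall>\<rho>\<in>Hs. ereal_close \<epsilon> (c (discr X m') \<rho>) (c (discr X m) \<rho>))"
    by (rule c_nbhd[OF X(1) m(1) \<epsilon>])
  show thesis
  proof (rule that[OF f(1,2) _ openin_Int[OF U(1) V(1)]])
    show "\<forall>\<mu>\<in>Dset p (discr X m). v \<mu> \<le> f \<mu>" using f(3) Dset_discr[OF X(1) m(1)] by metis
    show "discr X m \<in> U \<inter> V" using U(2) V(2) by blast
    show "\<forall>\<nu>\<in>U \<inter> V \<inter> Dset p (discr X m). \<bar>f \<nu> - v (discr X m)\<bar> \<le> \<epsilon> \<and> (\<forall>\<rho>\<in>Hs.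
      ereal_close \<epsilon> (c \<nu> \<rho>) (c (discr X m) \<rho>) \<and>
      (\<exists>y. Lop D2f \<nu> \<rho> = ereal y \<and> \<bar>y - centred_gen X m P \<rho>\<bar> \<le> \<epsilon>))"
    proof
      fix \<nu> assume \<nu>: "\<nu> \<in> U \<inter> V \<inter> Dset p (discr X m)"
      obtain m' where m': "m' \<in> prob_simplex X" "\<nu> = discr X m'"
        using Dset_discr[OF X(1) m(1), of \<nu> p] \<nu> by blast
      have "\<bar>f \<nu> - v (discr X m)\<bar> \<le> \<epsilon> \<and> (\<forall>\<rho>\<in>borel_measurable borel. (\<forall>i\<in>X. \<bar>\<rho> i - \<rho> 0\<bar> \<le> B) \<longrightarrow>
        (\<exists>y. Lop D2f \<nu> \<rho> = ereal y \<and> \<bar>y - centred_gen X m P \<rho>\<bar> \<le> \<epsilon>))" using U(3) m' \<nu> by blast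
      moreover have "\<forall>\<rho>\<in>Hs. ereal_close \<epsilon> (c \<nu> \<rho>) (c (discr X m) \<rho>)" using V(3) m' \<nu> by blast
      ultimately show "\<bar>f \<nu> - v (discr X m)\<bar> \<le> \<epsilon> \<and> (\<forall>\<rho>\<in>Hs.
        ereal_close \<epsilon> (c \<nu> \<rho>) (c (discr X m) \<rho>) \<and>
        (\<exists>y. Lop D2f \<nu> \<rho> = ereal y \<and> \<bar>y - centred_gen X m P \<rho>\<bar> \<le> \<epsilon>))"
        using B measurable by simp
    qed
  qed
qed

lemma Ham_ge:
  assumes "\<rho> \<in> Hs" "c \<nu> \<rho> \<le> ereal C" "Lop D2f \<nu> \<rho> = ereal y"
  shows "ereal (\<beta> * f \<nu> - C - y) \<le> Ham c Hs \<beta> f D2f \<nu>"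
proof -
  have "- ereal C \<le> - c \<nu> \<rho>" using assms(2) by (simp only: ereal_minus_le_minus)
  then have "ereal (\<beta> * f \<nu>) + (- ereal C - ereal y) \<le> ereal (\<beta> * f \<nu>) + (- c \<nu> \<rho> - Lop D2f \<nu> \<rho>)"
    unfolding assms(3) by (intro add_left_mono ereal_minus_mono) simp_all
  also have "\<dots> \<le> Ham c Hs \<beta> f D2f \<nu>"
    unfolding Ham_def using assms(1) by (intro add_left_mono SUP_upper)
  finally show ?thesis by (simp add: algebra_simps)
qed

lemma Ham_greaterD:
  assumes "ereal a < Ham c Hs \<beta> f D2f \<nu>"
  obtains \<rho> where "\<rho> \<in> Hs" "ereal (a - \<beta> * f \<nu>) < - c \<nu> \<rho> - Lop D2f \<nu> \<rho>"
proof -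
  have "ereal (a - \<beta> * f \<nu>) < (SUP \<rho>\<in>Hs. - c \<nu> \<rho> - Lop D2f \<nu> \<rho>)"
    using assms unfolding Ham_def by (cases "SUP \<rho>\<in>Hs. - c \<nu> \<rho> - Lop D2f \<nu> \<rho>") auto
  then show ?thesis using that unfolding less_SUP_iff by blast
qed

lemma simplex_subsolution_of_visc_sub:
  assumes X: "finite X" "X \<noteq> {}" and u: "continuous_map (TP p) euclideanreal u"
    and sub: "visc_sub p q c Hs \<beta> (\<lambda>\<mu>. ereal (u \<mu>))"
  shows "simplex_subsolution X Hs (\<lambda>\<rho> i. \<rho> i - \<rho> 0) (\<lambda>m. c (discr X m)) \<beta> (\<lambda>m. u (discr X m))"
  unfolding simplex_subsolution_def
proof (intro allI impI ballI)
  fix m b P \<rho> assume m: "m \<in> prob_simplex X" "\<forall>i\<in>X. 0 < m i"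
    and jet: "simplex_superjet X (\<lambda>m. u (discr X m)) m b P"
    and \<rho>: "\<rho> \<in> Hs"
  have pos: "0 < m i" if "i \<in> X" for i using m(2) that by blast
  have Pp: "discr X m \<in> Pp p" by (rule discr_Pp[OF X(1) m(1)])
  then have D: "discr X m \<in> Dset p (discr X m)" by (simp add: Dset_def)
  have approx: "\<beta> * u (discr X m) \<le> C + centred_gen X m P \<rho> + (\<beta> + 3) * \<epsilon>"
    if C: "c (discr X m) \<rho> = ereal C" and \<epsilon>: "0 < \<epsilon>" for C \<epsilon>
  proof -
    obtain f Df D2f U where f: "C2 q f Df D2f" "f (discr X m) = u (discr X m)"
      "\<forall>\<mu>\<in>Dset p (discr X m). u \<mu> \<le> f \<mu>"
      and U: "openin (TP p) U" "discr X m \<in> U"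
      "\<forall>\<nu>\<in>U \<inter> Dset p (discr X m). \<bar>f \<nu> - u (discr X m)\<bar> \<le> \<epsilon> \<and> (\<forall>\<rho>\<in>Hs.
        ereal_close \<epsilon> (c \<nu> \<rho>) (c (discr X m) \<rho>) \<and>
        (\<exists>y. Lop D2f \<nu> \<rho> = ereal y \<and> \<bar>y - centred_gen X m P \<rho>\<bar> \<le> \<epsilon>))"
      by (rule touching_measure[OF X m(1) pos u jet \<epsilon>])
    have "uliminf p (Dset p (discr X m)) (Ham c Hs \<beta> f D2f) (discr X m) \<le> 0"
      using sub Pp f ulimsup_continuous[OF u D Pp] unfolding visc_sub_def by auto
    then obtain \<nu> where \<nu>: "\<nu> \<in> U \<inter> Dset p (discr X m)" and Ham: "Ham c Hs \<beta> f D2f \<nu> < ereal \<epsilon>"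
      by (rule uliminf_le_0D[OF _ U(1,2) \<epsilon>])
    obtain y where y: "Lop D2f \<nu> \<rho> = ereal y" "\<bar>y - centred_gen X m P \<rho>\<bar> \<le> \<epsilon>"
      and close: "ereal_close \<epsilon> (c \<nu> \<rho>) (ereal C)" and f\<nu>: "\<bar>f \<nu> - u (discr X m)\<bar> \<le> \<epsilon>"
      using U(3) \<nu> \<rho> unfolding C[symmetric] by blast
    have "\<beta> * f \<nu> - (C + \<epsilon>) - y < \<epsilon>"
      using le_less_trans[OF Ham_ge[OF \<rho> ereal_close_bounds(2)[OF close \<epsilon>] y(1)] Ham] by simp
    moreover have "\<beta> * (u (discr X m) - \<epsilon>) \<le> \<beta> * f \<nu>" using f\<nu> \<beta> by (intro mult_left_mono) auto
    ultimately show ?thesis using y(2) by (simp add: algebra_simps)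
  qed
  show "ereal (\<beta> * u (discr X m)) \<le> c (discr X m) \<rho> + ereal (centred_gen X m P (\<lambda>i. \<rho> i - \<rho> 0))"
    unfolding centred_gen_shift[OF m(1)]
  proof (cases "c (discr X m) \<rho>")
    case (real C)
    have "\<beta> * u (discr X m) \<le> C + centred_gen X m P \<rho>"
    proof (rule field_le_epsilon)
      fix e :: real assume "0 < e"
      then show "\<beta> * u (discr X m) \<le> C + centred_gen X m P \<rho> + e"
        using approx[OF real, of "e / (\<beta> + 3)"] \<beta> by simp
    qed
    then show "ereal (\<beta> * u (discr X m)) \<le> c (discr X m) \<rho> + ereal (centred_gen X m P \<rho>)"
      by (simp add: real)
  qed (use c_not_MInf[OF Pp \<rho>] in auto)
qed

lemma visc_super_uminus:
  assumes w: "continuous_map (TP p) euclideanreal w"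
    and super: "visc_super p q c Hs \<beta> (\<lambda>\<mu>. ereal (w \<mu>))" and \<mu>: "\<mu> \<in> Pp p"
    and f: "C2 q f Df D2f" "f \<mu> = - w \<mu>" "\<forall>\<nu>\<in>Dset p \<mu>. - w \<nu> \<le> f \<nu>"
  shows "0 \<le> ulimsup p (Dset p \<mu>) (Ham c Hs \<beta> (\<lambda>\<mu>. - f \<mu>) (\<lambda>x y \<mu>. - D2f x y \<mu>)) \<mu>"
proof -
  have "\<mu> \<in> Dset p \<mu>" using \<mu> by (simp add: Dset_def)
  from ulimsup_continuous[OF continuous_map_minus[OF w] this \<mu>]
  have "ereal (- f \<mu>) = uliminf p (Dset p \<mu>) (\<lambda>\<nu>. ereal (w \<nu>)) \<mu>"
    using f(2) by (simp add: uliminf_eq_uminus_ulimsup)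
  moreover have "\<forall>\<nu>\<in>Dset p \<mu>. ereal (- f \<nu>) \<le> ereal (w \<nu>)" using f(3) by auto
  ultimately show ?thesis using super \<mu> C2_uminus[OF f(1)] unfolding visc_super_def by blast
qed

lemma simplex_supersolution_of_visc_super:
  assumes X: "finite X" "X \<noteq> {}" and w: "continuous_map (TP p) euclideanreal w"
    and super: "visc_super p q c Hs \<beta> (\<lambda>\<mu>. ereal (w \<mu>))"
  shows "simplex_supersolution X Hs (\<lambda>\<rho> i. \<rho> i - \<rho> 0) (\<lambda>m. c (discr X m)) \<beta> (\<lambda>m. w (discr X m))"
  unfolding simplex_supersolution_def
proof (intro allI impI)
  fix m b P and e :: real
  assume m: "m \<in> prob_simplex X" "\<forall>i\<in>X. 0 < m i"
    and jet: "simplex_superjet X (\<lambda>m. - w (discr X m)) m b P" and e: "0 < e"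
  define \<epsilon> where "\<epsilon> = e / (\<beta> + 3)"
  have \<epsilon>: "0 < \<epsilon>" "(\<beta> + 3) * \<epsilon> = e" using e \<beta> by (simp_all add: \<epsilon>_def)
  have pos: "0 < m i" if "i \<in> X" for i using m(2) that by blast
  have Pp: "discr X m \<in> Pp p" by (rule discr_Pp[OF X(1) m(1)])
  have neg: "continuous_map (TP p) euclideanreal (\<lambda>\<mu>. - w \<mu>)" using w by (rule continuous_map_minus)
  obtain f Df D2f U where f: "C2 q f Df D2f" "f (discr X m) = - w (discr X m)"
    "\<forall>\<mu>\<in>Dset p (discr X m). - w \<mu> \<le> f \<mu>"
    and U: "openin (TP p) U" "discr X m \<in> U"
    "\<forall>\<nu>\<in>U \<inter> Dset p (discr X m). \<bar>f \<nu> - - w (discr X m)\<bar> \<le> \<epsilon> \<and> (\<forall>\<rho>\<in>Hs.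
      ereal_close \<epsilon> (c \<nu> \<rho>) (c (discr X m) \<rho>) \<and>
      (\<exists>y. Lop D2f \<nu> \<rho> = ereal y \<and> \<bar>y - centred_gen X m P \<rho>\<bar> \<le> \<epsilon>))"
    by (rule touching_measure[OF X m(1) pos neg jet \<epsilon>(1)])
  define g where "g \<mu> = - f \<mu>" for \<mu>
  define D2g where "D2g x y \<mu> = - D2f x y \<mu>" for x y \<mu>
  have "0 \<le> ulimsup p (Dset p (discr X m)) (Ham c Hs \<beta> g D2g) (discr X m)"
    unfolding g_def[abs_def] D2g_def[abs_def] by (rule visc_super_uminus[OF w super Pp f])
  then obtain \<nu> where \<nu>: "\<nu> \<in> U \<inter> Dset p (discr X m)" and Ham: "ereal (- \<epsilon>) < Ham c Hs \<beta> g D2g \<nu>"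
    by (rule ulimsup_ge_0D[OF _ U(1,2) \<epsilon>(1)])
  obtain \<rho> where \<rho>: "\<rho> \<in> Hs" and less: "ereal (- \<epsilon> - \<beta> * g \<nu>) < - c \<nu> \<rho> - Lop D2g \<nu> \<rho>"
    by (rule Ham_greaterD[OF Ham])
  obtain y where y: "Lop D2f \<nu> \<rho> = ereal y" "\<bar>y - centred_gen X m P \<rho>\<bar> \<le> \<epsilon>"
    and close: "ereal_close \<epsilon> (c \<nu> \<rho>) (c (discr X m) \<rho>)" and f\<nu>: "\<bar>f \<nu> + w (discr X m)\<bar> \<le> \<epsilon>"
    using U(3) \<nu> \<rho> by auto
  have "Lop D2g \<nu> \<rho> = ereal (- y)" unfolding D2g_def[abs_def] by (rule Lop_uminus[OF y(1)])
  moreover have "c \<nu> \<rho> \<noteq> -\<infinity>" using \<nu> \<rho> by (intro c_not_MInf) (auto simp: Dset_def)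
  ultimately obtain C' where C': "c \<nu> \<rho> = ereal C'" "C' < \<epsilon> + \<beta> * g \<nu> + y"
    using less by (cases "c \<nu> \<rho>") auto
  then obtain C where C: "c (discr X m) \<rho> = ereal C"
    using ereal_close_real[OF close _ c_not_MInf[OF Pp \<rho>]] by auto
  have "C - \<epsilon> \<le> C'" using ereal_close_bounds(1)[OF close[unfolded C] \<epsilon>(1)] unfolding C' by simp
  moreover have "\<beta> * g \<nu> \<le> \<beta> * (w (discr X m) + \<epsilon>)"
    using f\<nu> \<beta> by (intro mult_left_mono) (auto simp: g_def)
  ultimately have "C - centred_gen X m P \<rho> \<le> \<beta> * w (discr X m) + (\<beta> + 3) * \<epsilon>"
    using C'(2) y(2) by (simp add: algebra_simps)
  then show "\<exists>\<rho>\<in>Hs. c (discr X m) \<rho> - ereal (centred_gen X m P (\<lambda>i. \<rho> i - \<rho> 0))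
      \<le> ereal (\<beta> * w (discr X m) + e)"
    using \<rho> by (intro bexI[of _ \<rho>]) (simp_all add: C \<epsilon>(2) centred_gen_shift[OF m(1)])
qed

lemma comparison_at_interior_maximum:
  assumes X: "finite X" "X \<noteq> {}" and m0: "m0 \<in> prob_simplex X" "\<And>i. i \<in> X \<Longrightarrow> 0 < m0 i"
    and u: "continuous_map (TP p) euclideanreal u" "visc_sub p q c Hs \<beta> (\<lambda>\<mu>. ereal (u \<mu>))"
    and w: "continuous_map (TP p) euclideanreal w" "visc_super p q c Hs \<beta> (\<lambda>\<mu>. ereal (w \<mu>))"
    and max: "\<And>m. m \<in> prob_simplex X \<Longrightarrow>
        u (discr X m) - w (discr X m) \<le> u (discr X m0) - w (discr X m0)"
  shows "u (discr X m0) \<le> w (discr X m0)"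
proof -
  obtain B where B: "\<And>\<rho> i. \<rho> \<in> Hs \<Longrightarrow> i \<in> X \<Longrightarrow> \<bar>\<rho> i - \<rho> 0\<bar> \<le> B" using uniform_bound[OF X(1)] by blast
  show ?thesis
  proof (rule simplex_comparison[OF X m0 seq_cont_on_discr[OF X(1) p u(1)]
      seq_cont_on_discr[OF X(1) p w(1)] max \<beta>
        simplex_subsolution_of_visc_sub[OF X u] simplex_supersolution_of_visc_super[OF X w]])
    show "c (discr X m0) \<rho> \<noteq> -\<infinity>" if "\<rho> \<in> Hs" for \<rho>
      by (rule c_not_MInf[OF discr_Pp[OF X(1) m0(1)] that])
    show "\<bar>\<rho> i - \<rho> 0\<bar> \<le> B" if "\<rho> \<in> Hs" "i \<in> X" for \<rho> i by (rule B[OF that])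
    fix e :: real assume "0 < e"
    then obtain U where U: "openin (TP p) U" "discr X m0 \<in> U" "\<forall>m\<in>prob_simplex X. discr X m \<in> U \<longrightarrow>
        (\<forall>\<rho>\<in>Hs. ereal_close e (c (discr X m) \<rho>) (c (discr X m0) \<rho>))"
      by (rule c_nbhd[OF X(1) m0(1)])
    then show "\<exists>d>0. \<forall>m\<in>prob_simplex X. (\<forall>i\<in>X. \<bar>m i - m0 i\<bar> < d) \<longrightarrow>
        (\<forall>\<rho>\<in>Hs. ereal_close e (c (discr X m) \<rho>) (c (discr X m0) \<rho>))"
      using discr_open_nbhd[OF X(1) p m0(1) U(1,2)] by blast
  qed
qed

lemma comparison_finite_Prob:
  assumes u: "continuous_map (TP p) euclideanreal u" "visc_sub p q c Hs \<beta> (\<lambda>\<mu>. ereal (u \<mu>))"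
    and w: "continuous_map (TP p) euclideanreal w" "visc_super p q c Hs \<beta> (\<lambda>\<mu>. ereal (w \<mu>))"
    and \<mu>: "\<mu> \<in> finite_Prob"
  shows "u \<mu> \<le> w \<mu>"
proof -
  obtain X m where X: "finite X" and m: "m \<in> prob_simplex X" "\<mu> = discr X m"
    using \<mu> by (auto simp: finite_Prob_def)
  obtain m0 where m0: "m0 \<in> prob_simplex X"
      and max: "\<And>m. m \<in> prob_simplex X \<Longrightarrow>
          u (discr X m) - w (discr X m) \<le> u (discr X m0) - w (discr X m0)"
    using seq_cont_on_attains_sup[OF seq_compact_on_simplex[OF X] _
      seq_cont_on_diff[OF seq_cont_on_discr[OF X p u(1)]
        seq_cont_on_discr[OF X p w(1)]]] m(1) by blast
  define Y where "Y = {x \<in> X. 0 < m0 x}"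
  have Y: "Y \<subseteq> X" "finite Y" using X by (auto simp: Y_def)
  have zero: "m0 x = 0" if "x \<in> X - Y" for x
    using that prob_simplex_nonneg[OF m0, of x] by (simp add: Y_def)
  have mass: "(\<Sum>x\<in>Y. m0 x) = 1"
    using sum.mono_neutral_right[OF X Y(1), of m0] zero m0 by (simp add: prob_simplex_def)
  then have "Y \<noteq> {}" by auto
  have m0Y: "m0 \<in> prob_simplex Y" "\<And>i. i \<in> Y \<Longrightarrow> 0 < m0 i"
    using mass by (auto simp: prob_simplex_def Y_def)
  have extend: "discr Y m' = discr X (\<lambda>x. if x \<in> Y then m' x else 0)" if "m' \<in> prob_simplex Y"
    for m'
    using discr_extend[OF X Y(1)] prob_simplex_nonneg[OF that] by simp
  have "discr Y m0 = discr X m0" unfolding extend[OF m0Y(1)] using zero by (intro discr_cong) auto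
  moreover have "u (discr Y m0) \<le> w (discr Y m0)"
  proof (rule comparison_at_interior_maximum[OF Y(2) \<open>Y \<noteq> {}\<close> m0Y u w])
    fix m' assume "m' \<in> prob_simplex Y"
    then show "u (discr Y m') - w (discr Y m') \<le> u (discr Y m0) - w (discr Y m0)"
      using max[OF prob_simplex_extend[OF X Y(1)]] \<open>discr Y m0 = discr X m0\<close> by (simp add: extend)
  qed
  ultimately show ?thesis using max[OF m(1)] m(2) by simp
qed

lemma comparison:
  assumes u: "continuous_map (TP p) euclideanreal u" "visc_sub p q c Hs \<beta> (\<lambda>\<mu>. ereal (u \<mu>))"
    and w: "continuous_map (TP p) euclideanreal w" "visc_super p q c Hs \<beta> (\<lambda>\<mu>. ereal (w \<mu>))"
    and \<mu>: "\<mu> \<in> Pp p"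
  shows "u \<mu> \<le> w \<mu>"
proof -
  obtain \<mu>s where \<mu>s: "range \<mu>s \<subseteq> finite_Prob" "convP p \<mu>s \<mu>" by (rule finite_Prob_dense[OF p \<mu>])
  have lim: "(\<lambda>n. v (\<mu>s n)) \<longlonglongrightarrow> v \<mu>" if "continuous_map (TP p) euclideanreal v" for v
    using that \<mu> \<mu>s finite_Prob_Pp unfolding continuous_map_TP_iff by blast
  have "u (\<mu>s n) \<le> w (\<mu>s n)" for n using comparison_finite_Prob[OF u w] \<mu>s(1) by blast
  then show ?thesis by (intro LIMSEQ_le[OF lim[OF u(1)] lim[OF w(1)]]) blast
qed

end

theorem theorem9p1:
  fixes p q \<beta> :: real
    and Hs :: "('a::euclidean_space \<Rightarrow> real) set"
    and TH :: "('a \<Rightarrow> real) topology"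
    and c :: "'a measure \<Rightarrow> ('a \<Rightarrow> real) \<Rightarrow> ereal"
    and u w :: "'a measure \<Rightarrow> real"
  assumes p: "p = 0 \<or> p \<ge> 1"
    and H_polish: "Polish TH" "topspace TH = Hs"
    and H_meas: "\<forall>\<rho>\<in>Hs. \<rho> \<in> borel_measurable borel"
    and c_meas: "(\<lambda>(\<mu>, \<rho>). c \<mu> \<rho>) \<in> borel_of (prod_topology (TP p) TH) \<rightarrow>\<^sub>M borel"
    and c_not_minf: "\<forall>\<mu>\<in>Pp p. \<forall>\<rho>\<in>Hs. c \<mu> \<rho> \<noteq> -\<infinity>"
    and beta: "\<beta> > 0"
    and cont_c: "\<forall>X. finite X \<longrightarrow> (\<forall>\<mu>\<in>PX X. \<forall>\<epsilon>>0. \<exists>U. openin (TP p) U \<and> \<mu> \<in> U \<and>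
                   (\<forall>\<nu>\<in>U \<inter> PX X. \<forall>\<rho>\<in>Hs. c \<nu> \<rho> = c \<mu> \<rho> \<or> \<bar>c \<nu> \<rho> - c \<mu> \<rho>\<bar> < ereal \<epsilon>))"
    and bdd_H: "\<forall>x. bounded {\<rho> x - \<rho> 0 | \<rho>. \<rho> \<in> Hs}"
    and q: "q = 0 \<or> (1 \<le> q \<and> q \<le> p)"
    and u_cont: "continuous_map (TP p) euclideanreal u"
    and w_cont: "continuous_map (TP p) euclideanreal w"
    and u_sub: "visc_sub p q c Hs \<beta> (\<lambda>\<mu>. ereal (u \<mu>))"
    and w_super: "visc_super p q c Hs \<beta> (\<lambda>\<mu>. ereal (w \<mu>))"
  shows "\<forall>\<mu>\<in>Pp p. u \<mu> \<le> w \<mu>"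
proof -
  interpret bounded_control p q \<beta> Hs c
  proof
    show "\<exists>U. openin (TP p) U \<and> \<mu> \<in> U \<and>
        (\<forall>\<nu>\<in>U \<inter> PX X. \<forall>\<rho>\<in>Hs. ereal_close \<epsilon> (c \<nu> \<rho>) (c \<mu> \<rho>))"
      if "finite X" "\<mu> \<in> PX X" "0 < \<epsilon>" for X \<mu> \<epsilon>
      unfolding ereal_close_def using cont_c that by blast
  qed (use p q beta H_meas bdd_H c_not_minf in auto)
  show ?thesis using comparison[OF u_cont u_sub w_cont w_super] by blast
qed

end
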